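(* Let $n\ge 1$ be an integer, $\sigma\ge 1$ and $0\le \sigma_1<\sigma/2<\sigma_2\le\sigma$ be real numbers. Assume that $$1<m\le 2\ \text{ if }\sigma_1=0,\qquad 1<m<\frac{2n}{n+4\sigma_1}\ \text{ if }\sigma_1>0,$$ and that the exponent $p>1$ satisfies one of the following: (i) $n\le 2\sigma$ and $\frac{2}{m}<p<\infty$; or (ii) $2\sigma<n<\frac{4\sigma}{2-m}$ and $\frac{2}{m}<p\le \frac{n}{n-2\sigma}$. Assume in addition that $$p<1+\frac{2m\sigma}{n-2m\sigma_1},$$ and let $(u_0,u_1)\in\mathcal{D}_\sigma^m$. Put $$\gamma_m:=1-\frac{n}{2m(\sigma-\sigma_1)}(p-1)+\frac{p\sigma_1}{\sigma-\sigma_1}.$$ Then there exists a constant $\varepsilon_0>0$ such that for any $\varepsilon\in(0,\varepsilon_0]$ the lifespan $T_m(\varepsilon)$ of the solution to the Cauchy problem $$\begin{cases} u_{tt}+(-\Delta)^\sigma u+(-\Delta)^{\sigma_1}u_t+(-\Delta)^{\sigma_2}u_t=|u|^p, & x\in\mathbb{R}^n,\ t>0,\\ u(0,x)=\varepsilon u_0(x),\quad u_t(0,x)=\varepsilon u_1(x), & x\in\mathbb{R}^n,\end{cases}$$ satisfies $$T_m(\varepsilon)\gtrsim \varepsilon^{-\frac{p-1}{\gamma_m}}.$$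
   Context: All functions are on $\mathbb{R}^n$; $H^a$ ($a\ge0$) is the $L^2$-based Bessel potential space on $\mathbb{R}^n$. The fractional Laplacian is $(-\Delta)^{a}\psi=\mathfrak{F}^{-1}(|\xi|^{2a}\mathfrak{F}(\psi)(\xi))$, with $\mathfrak{F}$ the Fourier transform in $x$. If $m=2$, the quantity $\frac{4\sigma}{2-m}$ is read as $+\infty$. The notation $g\gtrsim f$ means $f\le Cg$ for some constant $C>0$ (independent of $\varepsilon$). The data space is $\mathcal{D}_\sigma^m=(H^\sigma\cap L^m)\times(L^2\cap L^m)$ with norm $\|(\phi_0,\phi_1)\|_{\mathcal{D}_\sigma^m}=\|\phi_0\|_{H^\sigma}+\|\phi_0\|_{L^m}+\|\phi_1\|_{L^2}+\|\phi_1\|_{L^m}$. Solutions are understood via Duhamel's formula: $$u(t,x)=\varepsilon K_0(t,x)*_x u_0(x)+\varepsilon K_1(t,x)*_x u_1(x)+\int_0^t K_1(t-\tau,x)*_x|u(\tau,x)|^p\,d\tau,$$ where the kernels are defined by their Fourier transforms in $x$, $$\widehat{K_0}(t,\xi)=\frac{\lambda_1e^{\lambda_2t}-\lambda_2e^{\lambda_1t}}{\lambda_1-\lambda_2},\qquad \widehat{K_1}(t,\xi)=\frac{e^{\lambda_1t}-e^{\lambda_2t}}{\lambda_1-\lambda_2},$$ and $\lambda_{1,2}=\lambda_{1,2}(|\xi|)$ are the two (real or complex conjugate) roots $\lambda_{1,2}=\frac12\big(-|\xi|^{2\sigma_1}-|\xi|^{2\sigma_2}\pm\sqrt{(|\xi|^{2\sigma_1}+|\xi|^{2\sigma_2})^2-4|\xi|^{2\sigma}}\big)$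 (the quotients being understood as limits where $\lambda_1=\lambda_2$). The lifespan $T_m(\varepsilon)\in(0,\infty]$ is the maximal existence time of local solutions, i.e. the supremum of all $T>0$ for which a solution $u\in\mathcal{C}([0,T),H^\sigma)$ exists. *)

theory Defs
  imports "HOL-Analysis.Analysis"
begin

section \<open>Lebesgue spaces\<close>

text \<open>
  Functions on \<open>\<real>\<^sup>n\<close>, \<open>n = CARD('n)\<close>, are complex valued. Elements of \<open>L\<^sup>p\<close> are Borel
  representatives; nothing below depends on the choice of the representative.
\<close>

definition Lp_space :: "real \<Rightarrow> ('a::euclidean_space \<Rightarrow> complex) set" where
  "Lp_space p = {f \<in> borel_measurable lborel. integrable lborel (\<lambda>x. cmod (f x) powr p)}"

definition Lp_norm :: "real \<Rightarrow> ('a::euclidean_space \<Rightarrow> complex) \<Rightarrow> real" where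
  "Lp_norm p f = (\<integral>x. cmod (f x) powr p \<partial>lborel) powr (1 / p)"


section \<open>The Fourier transform on \<open>L\<^sup>2\<close>\<close>

definition fourier_L1 :: "((real ^ 'n) \<Rightarrow> complex) \<Rightarrow> (real ^ 'n) \<Rightarrow> complex" where
  "fourier_L1 f \<xi> =
     of_real ((2 * pi) powr (- real CARD('n) / 2)) * (\<integral>x. cis (- (x \<bullet> \<xi>)) * f x \<partial>lborel)"

definition inv_fourier_L1 :: "((real ^ 'n) \<Rightarrow> complex) \<Rightarrow> (real ^ 'n) \<Rightarrow> complex" where
  "inv_fourier_L1 g x =
     of_real ((2 * pi) powr (- real CARD('n) / 2)) * (\<integral>\<xi>. cis (x \<bullet> \<xi>) * g \<xi> \<partial>lborel)"

text \<open>
  Plancherel extension to \<open>L\<^sup>2\<close>: the limit in mean, as \<open>R \<rightarrow> \<infinity>\<close>, of the transforms of the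
  truncations of \<open>f\<close> to the balls of radius \<open>R\<close>, which lie in \<open>L\<^sup>1 \<inter> L\<^sup>2\<close>. The limit is unique
  up to null sets. Only meaningful for \<open>f \<in> L\<^sup>2\<close>.
\<close>

definition L2_extension ::
  "(((real ^ 'n) \<Rightarrow> complex) \<Rightarrow> (real ^ 'n) \<Rightarrow> complex) \<Rightarrow>
    ((real ^ 'n) \<Rightarrow> complex) \<Rightarrow> (real ^ 'n) \<Rightarrow> complex" where
  "L2_extension F f = (SOME g. g \<in> Lp_space 2 \<and>
     ((\<lambda>R. \<integral>\<^sup>+y. ennreal ((cmod (F (\<lambda>x. indicator (ball 0 R) x * f x) y - g y))\<^sup>2) \<partial>lborel)
        \<longlongrightarrow> 0) at_top)"

definition fourier :: "((real ^ 'n) \<Rightarrow> complex) \<Rightarrow> (real ^ 'n) \<Rightarrow> complex" where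
  "fourier = L2_extension fourier_L1"

definition inv_fourier :: "((real ^ 'n) \<Rightarrow> complex) \<Rightarrow> (real ^ 'n) \<Rightarrow> complex" where
  "inv_fourier = L2_extension inv_fourier_L1"


section \<open>Bessel potential spaces\<close>

definition bessel_weight :: "real \<Rightarrow> ((real ^ 'n) \<Rightarrow> complex) \<Rightarrow> (real ^ 'n) \<Rightarrow> complex" where
  "bessel_weight a f = (\<lambda>\<xi>. of_real ((1 + (norm \<xi>)\<^sup>2) powr (a / 2)) * fourier f \<xi>)"

definition H_space :: "real \<Rightarrow> ((real ^ 'n) \<Rightarrow> complex) set" where
  "H_space a = {f \<in> Lp_space 2. bessel_weight a f \<in> Lp_space 2}"

definition H_norm :: "real \<Rightarrow> ((real ^ 'n) \<Rightarrow> complex) \<Rightarrow> real" where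
  "H_norm a f = Lp_norm 2 (bessel_weight a f)"

definition H_continuous_on ::
  "real set \<Rightarrow> real \<Rightarrow> (real \<Rightarrow> (real ^ 'n) \<Rightarrow> complex) \<Rightarrow> bool" where
  "H_continuous_on I a u \<longleftrightarrow>
     (\<forall>t\<in>I. u t \<in> H_space a) \<and>
     (\<forall>t\<in>I. ((\<lambda>s. H_norm a (\<lambda>x. u s x - u t x)) \<longlongrightarrow> 0) (at t within I))"

definition data_space ::
  "real \<Rightarrow> real \<Rightarrow> (((real ^ 'n) \<Rightarrow> complex) \<times> ((real ^ 'n) \<Rightarrow> complex)) set" where
  "data_space \<sigma> m = (H_space \<sigma> \<inter> Lp_space m) \<times> (Lp_space 2 \<inter> Lp_space m)"


section \<open>The kernels\<close>

text \<open>
  The characteristic roots as functions of \<open>r = |\<xi>|\<close>. Isabelle has \<open>0 powr 0 = 0\<close>, so for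
  \<open>\<sigma>\<^sub>1 = 0\<close> the value at \<open>r = 0\<close> is off; this concerns a single frequency only.
\<close>

definition char_discr :: "real \<Rightarrow> real \<Rightarrow> real \<Rightarrow> real \<Rightarrow> real" where
  "char_discr \<sigma> \<sigma>1 \<sigma>2 r = (r powr (2 * \<sigma>1) + r powr (2 * \<sigma>2))\<^sup>2 - 4 * r powr (2 * \<sigma>)"

definition char_root1 :: "real \<Rightarrow> real \<Rightarrow> real \<Rightarrow> real \<Rightarrow> complex" where
  "char_root1 \<sigma> \<sigma>1 \<sigma>2 r =
     (- of_real (r powr (2 * \<sigma>1)) - of_real (r powr (2 * \<sigma>2))
        + csqrt (of_real (char_discr \<sigma> \<sigma>1 \<sigma>2 r))) / 2"

definition char_root2 :: "real \<Rightarrow> real \<Rightarrow> real \<Rightarrow> real \<Rightarrow> complex" where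
  "char_root2 \<sigma> \<sigma>1 \<sigma>2 r =
     (- of_real (r powr (2 * \<sigma>1)) - of_real (r powr (2 * \<sigma>2))
        - csqrt (of_real (char_discr \<sigma> \<sigma>1 \<sigma>2 r))) / 2"

text \<open>
  The quotients in the kernels; on the diagonal they are replaced by their limits, see
  \<open>K0_quot_limit\<close> and \<open>K1_quot_limit\<close>.
\<close>

definition K0_quot :: "complex \<Rightarrow> complex \<Rightarrow> real \<Rightarrow> complex" where
  "K0_quot l1 l2 t =
     (if l1 = l2 then (1 - l1 * of_real t) * exp (l1 * of_real t)
      else (l1 * exp (l2 * of_real t) - l2 * exp (l1 * of_real t)) / (l1 - l2))"

definition K1_quot :: "complex \<Rightarrow> complex \<Rightarrow> real \<Rightarrow> complex" where
  "K1_quot l1 l2 t =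
     (if l1 = l2 then of_real t * exp (l1 * of_real t)
      else (exp (l1 * of_real t) - exp (l2 * of_real t)) / (l1 - l2))"

lemma K1_quot_limit: "((\<lambda>z. K1_quot z l t) \<longlongrightarrow> K1_quot l l t) (at l)"
proof -
  have "((\<lambda>z. exp (z * of_real t)) has_field_derivative of_real t * exp (l * of_real t)) (at l)"
    by (auto intro!: derivative_eq_intros)
  hence "((\<lambda>z. (exp (z * of_real t) - exp (l * of_real t)) / (z - l))
            \<longlongrightarrow> of_real t * exp (l * of_real t)) (at l)"
    by (simp add: has_field_derivative_iff)
  moreover have "eventually (\<lambda>z. (exp (z * of_real t) - exp (l * of_real t)) / (z - l)
            = K1_quot z l t) (at l)"
    by (auto simp: eventually_at_filter K1_quot_def)
  ultimately show ?thesis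
    by (auto simp: K1_quot_def intro: Lim_transform_eventually)
qed

lemma K0_quot_limit: "((\<lambda>z. K0_quot z l t) \<longlongrightarrow> K0_quot l l t) (at l)"
proof -
  have "((\<lambda>z. exp (l * of_real t) - l * K1_quot z l t)
            \<longlongrightarrow> exp (l * of_real t) - l * K1_quot l l t) (at l)"
    by (intro tendsto_intros K1_quot_limit)
  moreover have "exp (l * of_real t) - l * K1_quot z l t = K0_quot z l t" for z
  proof (cases "z = l")
    case False
    define a b where "a = exp (l * of_real t)" and "b = exp (z * of_real t)"
    have "a - l * ((b - a) / (z - l)) = (a * (z - l) - l * (b - a)) / (z - l)"
      using False by (simp add: divide_simps)
    also have "\<dots> = (z * a - l * b) / (z - l)"
      by (simp add: algebra_simps)
    finally show ?thesis
      using False by (simp add: K0_quot_def K1_quot_def a_def b_def)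
  qed (simp add: K0_quot_def K1_quot_def algebra_simps)
  ultimately show ?thesis
    by simp
qed

definition K0_hat :: "real \<Rightarrow> real \<Rightarrow> real \<Rightarrow> real \<Rightarrow> (real ^ 'n) \<Rightarrow> complex" where
  "K0_hat \<sigma> \<sigma>1 \<sigma>2 t \<xi> =
     K0_quot (char_root1 \<sigma> \<sigma>1 \<sigma>2 (norm \<xi>)) (char_root2 \<sigma> \<sigma>1 \<sigma>2 (norm \<xi>)) t"

definition K1_hat :: "real \<Rightarrow> real \<Rightarrow> real \<Rightarrow> real \<Rightarrow> (real ^ 'n) \<Rightarrow> complex" where
  "K1_hat \<sigma> \<sigma>1 \<sigma>2 t \<xi> =
     K1_quot (char_root1 \<sigma> \<sigma>1 \<sigma>2 (norm \<xi>)) (char_root2 \<sigma> \<sigma>1 \<sigma>2 (norm \<xi>)) t"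

text \<open>
  The kernels themselves are in general only tempered distributions, given by their Fourier
  transforms, so that \<open>K *\<^sub>x f\<close> is the Fourier multiplier with symbol \<open>k\<close>.
\<close>

definition conv_kernel ::
  "((real ^ 'n) \<Rightarrow> complex) \<Rightarrow> ((real ^ 'n) \<Rightarrow> complex) \<Rightarrow> (real ^ 'n) \<Rightarrow> complex" where
  "conv_kernel k f = inv_fourier (\<lambda>\<xi>. k \<xi> * fourier f \<xi>)"


section \<open>Solutions and lifespan\<close>

text \<open>
  The integral over \<open>[a, b]\<close> of a function with values in \<open>L\<^sup>2\<close>: the definition of
  \<^const>\<open>has_integral\<close> on an interval, with the \<open>L\<^sup>2\<close> norm on functions in place of a type class
  norm. The integrand of Duhamel's formula is continuous in \<open>\<tau>\<close> with values in \<open>L\<^sup>2\<close>, so here it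
  coincides with the Riemann and the Bochner integral.
\<close>

definition L2_has_integral ::
  "(real \<Rightarrow> 'a::euclidean_space \<Rightarrow> complex) \<Rightarrow> ('a \<Rightarrow> complex) \<Rightarrow> real \<Rightarrow> real \<Rightarrow> bool" where
  "L2_has_integral v w a b \<longleftrightarrow>
     w \<in> Lp_space 2 \<and> (\<forall>\<tau>\<in>{a..b}. v \<tau> \<in> Lp_space 2) \<and>
     (\<forall>e>0. \<exists>\<gamma>. gauge \<gamma> \<and>
        (\<forall>\<D>. \<D> tagged_division_of {a..b} \<and> \<gamma> fine \<D> \<longrightarrow>
           Lp_norm 2 (\<lambda>x. (\<Sum>(\<tau>, k)\<in>\<D>. of_real (measure lborel k) * v \<tau> x) - w x) < e))"

definition abs_power :: "real \<Rightarrow> ('a \<Rightarrow> complex) \<Rightarrow> 'a \<Rightarrow> complex" where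
  "abs_power p f = (\<lambda>x. of_real (cmod (f x) powr p))"

text \<open>
  The condition \<open>|u(t)|\<^sup>p \<in> L\<^sup>2\<close> only ensures that the Fourier transform of the nonlinearity is
  meaningful. It follows from \<open>u(t) \<in> H\<^sup>\<sigma>\<close> by Sobolev embedding if \<open>p \<ge> 1\<close> and either
  \<open>n \<le> 2 \<sigma>\<close>, or \<open>n > 2 \<sigma>\<close> and \<open>p \<le> n / (n - 2 \<sigma>)\<close>.
\<close>

definition duhamel_solution ::
  "real \<Rightarrow> real \<Rightarrow> real \<Rightarrow> real \<Rightarrow> ((real ^ 'n) \<Rightarrow> complex) \<Rightarrow> ((real ^ 'n) \<Rightarrow> complex) \<Rightarrow>
    real \<Rightarrow> real \<Rightarrow> (real \<Rightarrow> (real ^ 'n) \<Rightarrow> complex) \<Rightarrow> bool" where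
  "duhamel_solution \<sigma> \<sigma>1 \<sigma>2 p u0 u1 \<epsilon> T u \<longleftrightarrow>
     H_continuous_on {0..<T} \<sigma> u \<and>
     (\<forall>t\<in>{0..<T}. abs_power p (u t) \<in> Lp_space 2) \<and>
     (\<forall>t\<in>{0..<T}. \<exists>w.
        L2_has_integral
          (\<lambda>\<tau>. conv_kernel (K1_hat \<sigma> \<sigma>1 \<sigma>2 (t - \<tau>)) (abs_power p (u \<tau>))) w 0 t \<and>
        (AE x in lborel. u t x =
            of_real \<epsilon> * conv_kernel (K0_hat \<sigma> \<sigma>1 \<sigma>2 t) u0 x
          + of_real \<epsilon> * conv_kernel (K1_hat \<sigma> \<sigma>1 \<sigma>2 t) u1 x
          + w x))"

definition lifespan ::
  "real \<Rightarrow> real \<Rightarrow> real \<Rightarrow> real \<Rightarrow> ((real ^ 'n) \<Rightarrow> complex) \<Rightarrow> ((real ^ 'n) \<Rightarrow> complex) \<Rightarrow>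
    real \<Rightarrow> ereal" where
  "lifespan \<sigma> \<sigma>1 \<sigma>2 p u0 u1 \<epsilon> =
     Sup {ereal T | T. T > 0 \<and> (\<exists>u. duhamel_solution \<sigma> \<sigma>1 \<sigma>2 p u0 u1 \<epsilon> T u)}"

end

theory Submission
  imports Defs "HOL-Probability.Probability"
begin

text \<open>
  Writing \<open>z t = (1 + t)\<^bsup>a\<^esup> W t \<F>(u t)\<close> with the weight \<open>W t \<xi> = 1 + (\<rho> t |\<xi>|)\<^bsup>\<sigma>\<^esup>\<close> at the
  diffusive length scale \<open>\<rho> t = (1 + t)\<^bsup>1/(2(\<sigma> - \<sigma>1))\<^esup>\<close> and \<open>a\<close> the \<open>L\<^sup>m\<close>-\<open>L\<^sup>2\<close> decay rate
  of the linear problem, Duhamel's formula becomes a fixed point equation for continuous functions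
  from \<open>[0, T]\<close> to \<open>L\<^sup>2\<close>. The linear part has norm at most \<open>L \<epsilon>\<close>. By Sobolev embedding at scale
  \<open>\<rho> t\<close>, \<open>|u|\<^bsup>p\<^esup>\<close> is in \<open>L\<^sup>m\<close> with norm of order \<open>(1 + t)\<^bsup>\<gamma> - 1\<^esup>\<close> on bounded sets of \<open>z\<close>, and
  better in \<open>L\<^sup>2\<close>; as \<open>\<gamma> > 0\<close>, the integral term has Lipschitz constant at most
  \<open>C (1 + T)\<^bsup>\<gamma>\<^esup> M\<^bsup>p - 1\<^esup>\<close> on the ball of radius \<open>M = 2 L \<epsilon>\<close>. Hence Banach's fixed point theorem applies as
  long as \<open>(1 + T)\<^bsup>\<gamma>\<^esup> \<epsilon>\<^bsup>p - 1\<^esup>\<close> is small.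
\<close>

section \<open>The Hilbert space of square integrable functions\<close>

text \<open>Each hypothesis closes one estimate. \<open>K1\<close> is of size |\<xi>|^(-2 \<sigma>1)
  at low frequencies, and the squared transform of an L^m function has mass of order at most R^(2
  \<kappa>), \<kappa> = n (1/m - 1/2), in the ball of radius R. The bound on m for \<sigma>1 > 0
  says 2 \<sigma>1 < \<kappa>, so the product is square integrable near 0. The bound n < 4 \<sigma>
  / (2 - m) keeps the rate a below 1, so that (1 + s)^(-a) integrates to a growing power of time.
  The lower bound p > 2/m makes p m > 2, the range in which Sobolev embedding puts |u|^p into L^m; p
  <= n / (n - 2 \<sigma>) admits all exponents up to 2 p; the last bound on p says \<gamma> > 0. The
  obstacle in the integral term is a mismatch of scales: the weight belongs to time t, the kernel to
  the elapsed time t - \<tau>. For old forcing the two scales are comparable. For recent forcing the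
  kernel gains \<sigma> derivatives at a rate \<theta> < 1 in time, applied to |u|^p in L^2, where
  it is smaller than in L^m. No constant depends on T; this is what turns the contraction into a
  lifespan bound.\<close>

lemma Lp_space_2_iff:
  "f \<in> Lp_space 2 \<longleftrightarrow> f \<in> borel_measurable lborel \<and> integrable lborel (\<lambda>x. (cmod (f x))\<^sup>2)"
  by (simp add: Lp_space_def)

lemma Lp_space_2_iff_nn:
  "f \<in> Lp_space 2 \<longleftrightarrow> f \<in> borel_measurable lborel \<and> (\<integral>\<^sup>+x. ennreal ((cmod (f x))\<^sup>2) \<partial>lborel) < \<infinity>"
  by (auto simp: Lp_space_2_iff integrable_iff_bounded)

lemma Lp_space_measurable [measurable_dest]: "f \<in> Lp_space p \<Longrightarrow> f \<in> borel_measurable lborel"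
  by (simp add: Lp_space_def)

lemma Lp_space_2_integrable: "f \<in> Lp_space 2 \<Longrightarrow> integrable lborel (\<lambda>x. (cmod (f x))\<^sup>2)"
  by (simp add: Lp_space_2_iff)

lemma cmod_add_sq_le: "(cmod (a + b))\<^sup>2 \<le> 2 * (cmod a)\<^sup>2 + 2 * (cmod b)\<^sup>2"
proof -
  have "(cmod (a + b))\<^sup>2 \<le> (cmod a + cmod b)\<^sup>2"
    by (intro power_mono norm_triangle_ineq) auto
  also have "\<dots> \<le> 2 * (cmod a)\<^sup>2 + 2 * (cmod b)\<^sup>2"
    using sum_squares_bound[of "cmod a" "cmod b"] by (simp add: power2_sum)
  finally show ?thesis .
qed

lemma Lp_space_2_zero: "(\<lambda>x. 0) \<in> Lp_space 2"
  by (simp add: Lp_space_2_iff)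

lemma Lp_space_2_add:
  assumes "f \<in> Lp_space 2" "g \<in> Lp_space 2"
  shows "(\<lambda>x. f x + g x) \<in> Lp_space 2"
proof -
  have [measurable]: "f \<in> borel_measurable lborel" "g \<in> borel_measurable lborel"
    using assms by (auto dest: Lp_space_measurable)
  have "integrable lborel (\<lambda>x. 2 * (cmod (f x))\<^sup>2 + 2 * (cmod (g x))\<^sup>2)"
    using assms by (auto simp: Lp_space_2_iff)
  hence "integrable lborel (\<lambda>x. (cmod (f x + g x))\<^sup>2)"
    by (rule Bochner_Integration.integrable_bound) (auto simp: cmod_add_sq_le)
  thus ?thesis by (simp add: Lp_space_2_iff)
qed

lemma Lp_space_2_mult:
  assumes f: "f \<in> Lp_space 2" and [measurable]: "k \<in> borel_measurable lborel"
    and C: "AE x in lborel. cmod (k x) \<le> C"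
  shows "(\<lambda>x. k x * f x) \<in> Lp_space 2"
proof -
  have [measurable]: "f \<in> borel_measurable lborel"
    using assms by (auto dest: Lp_space_measurable)
  have "integrable lborel (\<lambda>x. C\<^sup>2 * (cmod (f x))\<^sup>2)"
    using f by (auto simp: Lp_space_2_iff)
  hence "integrable lborel (\<lambda>x. (cmod (k x * f x))\<^sup>2)"
  proof (rule Bochner_Integration.integrable_bound)
    show "AE x in lborel. norm ((cmod (k x * f x))\<^sup>2) \<le> norm (C\<^sup>2 * (cmod (f x))\<^sup>2)"
      using C by eventually_elim (auto simp: norm_mult power_mult_distrib intro!: mult_right_mono power_mono)
  qed measurable
  thus ?thesis by (simp add: Lp_space_2_iff)
qed

lemma Lp_space_2_cmult: "f \<in> Lp_space 2 \<Longrightarrow> (\<lambda>x. c * f x) \<in> Lp_space 2"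
  by (rule Lp_space_2_mult[where C = "cmod c"]) auto

lemma Lp_space_2_scaleR: "f \<in> Lp_space 2 \<Longrightarrow> (\<lambda>x. c *\<^sub>R f x) \<in> Lp_space 2"
  using Lp_space_2_cmult[of f "of_real c"] by (simp add: scaleR_conv_of_real)

lemma Lp_space_2_uminus: "f \<in> Lp_space 2 \<Longrightarrow> (\<lambda>x. - f x) \<in> Lp_space 2"
  using Lp_space_2_cmult[of f "-1"] by simp

lemma Lp_space_2_diff: "f \<in> Lp_space 2 \<Longrightarrow> g \<in> Lp_space 2 \<Longrightarrow> (\<lambda>x. f x - g x) \<in> Lp_space 2"
  using Lp_space_2_add[of f "\<lambda>x. - g x"] Lp_space_2_uminus[of g] by simp

lemma Lp_space_2_inner:
  assumes "f \<in> Lp_space 2" "g \<in> Lp_space 2"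
  shows "integrable lborel (\<lambda>x. f x \<bullet> g x)"
proof -
  have [measurable]: "f \<in> borel_measurable lborel" "g \<in> borel_measurable lborel"
    using assms by (auto dest: Lp_space_measurable)
  have "integrable lborel (\<lambda>x. (cmod (f x))\<^sup>2 + (cmod (g x))\<^sup>2)"
    using assms by (auto simp: Lp_space_2_iff)
  thus ?thesis
  proof (rule Bochner_Integration.integrable_bound)
    have "\<bar>a \<bullet> b\<bar> \<le> (cmod a)\<^sup>2 + (cmod b)\<^sup>2" for a b :: complex
    proof -
      have "\<bar>a \<bullet> b\<bar> \<le> norm a * norm b"
        by (rule Cauchy_Schwarz_ineq2)
      also have "\<dots> \<le> (cmod a)\<^sup>2 + (cmod b)\<^sup>2"
        using sum_squares_bound[of "cmod a" "cmod b"] zero_le_power2[of "cmod a"] zero_le_power2[of "cmod b"]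
          mult_nonneg_nonneg[of "cmod a" "cmod b"] by linarith
      finally show ?thesis .
    qed
    thus "AE x in lborel. norm (f x \<bullet> g x) \<le> norm ((cmod (f x))\<^sup>2 + (cmod (g x))\<^sup>2)"
      by auto
  qed measurable
qed

text \<open>A partial equivalence relation: it is reflexive exactly on \<open>Lp_space 2\<close>, so
  the quotient both restricts to square integrable functions and identifies functions equal almost
  everywhere.\<close>

definition L2_eq :: "('a::euclidean_space \<Rightarrow> complex) \<Rightarrow> ('a \<Rightarrow> complex) \<Rightarrow> bool" where
  "L2_eq f g \<longleftrightarrow> f \<in> Lp_space 2 \<and> g \<in> Lp_space 2 \<and> (AE x in lborel. f x = g x)"

quotient_type (overloaded) 'a l2 = "'a::euclidean_space \<Rightarrow> complex" / partial: L2_eq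
proof (rule part_equivpI)
  show "\<exists>f :: 'a \<Rightarrow> complex. L2_eq f f"
    by (rule exI[of _ "\<lambda>_. 0"]) (simp add: L2_eq_def Lp_space_2_zero)
  show "symp (L2_eq :: ('a \<Rightarrow> complex) \<Rightarrow> _)"
    by (auto simp: symp_def L2_eq_def)
  show "transp (L2_eq :: ('a \<Rightarrow> complex) \<Rightarrow> _)"
    unfolding transp_def L2_eq_def by auto
qed

lemma l2_fun_in [simp, intro]: "rep_l2 v \<in> Lp_space 2"
  using Quotient3_rep_reflp[OF Quotient3_l2, of v] by (simp add: L2_eq_def)

lemma l2_fun_measurable [measurable]: "rep_l2 v \<in> borel_measurable lborel"
  using l2_fun_in[of v] by (rule Lp_space_measurable)

lemma rep_abs_l2:
  assumes "f \<in> Lp_space 2"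
  shows "AE x in lborel. rep_l2 (abs_l2 f) x = f x"
  using Quotient3_rep_abs[OF Quotient3_l2, of f] assms by (auto simp: L2_eq_def)

lemma abs_rep_l2 [simp]: "abs_l2 (rep_l2 v) = v"
  using Quotient3_abs_rep[OF Quotient3_l2] .

lemma abs_l2_eqI:
  assumes "f \<in> Lp_space 2" "g \<in> Lp_space 2" "AE x in lborel. f x = g x"
  shows "abs_l2 f = abs_l2 g"
  using assms Quotient3_rel[OF Quotient3_l2, of f g] by (auto simp: L2_eq_def)

lemma l2_eqI:
  assumes "AE x in lborel. rep_l2 v x = rep_l2 w x"
  shows "v = w"
  using abs_l2_eqI[OF l2_fun_in l2_fun_in assms] by simp

instantiation l2 :: (euclidean_space) real_vector
begin

lift_definition zero_l2 :: "'a l2" is "\<lambda>_. 0"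
  by (simp add: L2_eq_def Lp_space_2_zero)

lift_definition plus_l2 :: "'a l2 \<Rightarrow> 'a l2 \<Rightarrow> 'a l2" is "\<lambda>f g x. f x + g x"
  by (auto simp: L2_eq_def Lp_space_2_add)

lift_definition minus_l2 :: "'a l2 \<Rightarrow> 'a l2 \<Rightarrow> 'a l2" is "\<lambda>f g x. f x - g x"
  by (auto simp: L2_eq_def Lp_space_2_diff)

lift_definition uminus_l2 :: "'a l2 \<Rightarrow> 'a l2" is "\<lambda>f x. - f x"
  by (auto simp: L2_eq_def Lp_space_2_uminus)

lift_definition scaleR_l2 :: "real \<Rightarrow> 'a l2 \<Rightarrow> 'a l2" is "\<lambda>c f x. c *\<^sub>R f x"
  by (auto simp: L2_eq_def Lp_space_2_scaleR simp del: scaleR_conv_of_real)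

instance
proof
  fix u v w :: "'a l2" and a b r :: real
  show "u + v + w = u + (v + w)" "u + v = v + u" "0 + u = u" "- u + u = 0" "u - v = u + - v"
    by (transfer, auto simp: L2_eq_def Lp_space_2_add Lp_space_2_diff Lp_space_2_uminus Lp_space_2_zero algebra_simps)+
  show "a *\<^sub>R (u + v) = a *\<^sub>R u + a *\<^sub>R v" "(a + b) *\<^sub>R u = a *\<^sub>R u + b *\<^sub>R u"
      "a *\<^sub>R b *\<^sub>R u = (a * b) *\<^sub>R u" "1 *\<^sub>R u = u"
    by (transfer, auto simp: L2_eq_def Lp_space_2_add Lp_space_2_scaleR scaleR_add_left scaleR_add_right
        simp del: scaleR_conv_of_real)+
qed

end

text \<open>The complex numbers are treated as a plane, so this is the real part of the Hermitian
  product. It induces the same norm, and the real structure suffices since complex scalars act only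
  through symbols.\<close>

instantiation l2 :: (euclidean_space) real_inner
begin

lift_definition inner_l2 :: "'a l2 \<Rightarrow> 'a l2 \<Rightarrow> real" is "\<lambda>f g. \<integral>x. f x \<bullet> g x \<partial>lborel"
proof -
  fix f g f' g' :: "'a \<Rightarrow> complex"
  assume a: "L2_eq f f'" "L2_eq g g'"
  hence [measurable]: "f \<in> borel_measurable lborel" "g \<in> borel_measurable lborel"
    "f' \<in> borel_measurable lborel" "g' \<in> borel_measurable lborel"
    by (auto simp: L2_eq_def dest: Lp_space_measurable)
  show "(\<integral>x. f x \<bullet> g x \<partial>lborel) = (\<integral>x. f' x \<bullet> g' x \<partial>lborel)"
    using a by (intro integral_cong_AE) (auto simp: L2_eq_def)
qed

definition norm_l2 :: "'a l2 \<Rightarrow> real" where "norm_l2 v = sqrt (inner v v)"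
definition sgn_l2 :: "'a l2 \<Rightarrow> 'a l2" where "sgn_l2 v = v /\<^sub>R norm v"
definition dist_l2 :: "'a l2 \<Rightarrow> 'a l2 \<Rightarrow> real" where "dist_l2 v w = norm (v - w)"
definition uniformity_l2 :: "('a l2 \<times> 'a l2) filter" where
  "uniformity_l2 = (INF e\<in>{0<..}. principal {(x, y). dist x y < e})"
definition open_l2 :: "'a l2 set \<Rightarrow> bool" where
  "open_l2 U = (\<forall>x\<in>U. \<forall>\<^sub>F (x', y) in uniformity. x' = x \<longrightarrow> y \<in> U)"

instance
proof
  fix u v w :: "'a l2" and a b r :: real
  show "u \<bullet> v = v \<bullet> u"
    by transfer (simp add: inner_commute)
  show "(u + v) \<bullet> w = u \<bullet> w + v \<bullet> w"
    by transfer (simp add: inner_add_left L2_eq_def Lp_space_2_inner)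
  show "r *\<^sub>R u \<bullet> v = r * (u \<bullet> v)"
    by transfer (simp add: L2_eq_def Lp_space_2_inner del: scaleR_conv_of_real)
  show "0 \<le> u \<bullet> u"
    by transfer simp
  show "(u \<bullet> u = 0) = (u = 0)"
  proof transfer
    fix f :: "'a \<Rightarrow> complex"
    assume f: "L2_eq f f"
    hence i: "integrable lborel (\<lambda>x. f x \<bullet> f x)"
      by (simp add: L2_eq_def Lp_space_2_inner)
    show "((\<integral>x. f x \<bullet> f x \<partial>lborel) = 0) = L2_eq f (\<lambda>_. 0)"
      using f by (subst integral_nonneg_eq_0_iff_AE[OF i]) (auto simp: L2_eq_def Lp_space_2_zero)
  qed
qed (simp_all add: norm_l2_def sgn_l2_def dist_l2_def uniformity_l2_def open_l2_def)

end

section \<open>Passing between classes and representatives\<close>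

lemma rep_l2_zero: "AE x in lborel. rep_l2 0 x = 0"
  unfolding zero_l2_def by (simp add: rep_abs_l2 Lp_space_2_zero)

lemma rep_l2_add: "AE x in lborel. rep_l2 (v + w) x = rep_l2 v x + rep_l2 w x"
  using rep_abs_l2[OF Lp_space_2_add[OF l2_fun_in l2_fun_in], of v w]
  by (simp add: plus_l2_def)

lemma rep_l2_diff: "AE x in lborel. rep_l2 (v - w) x = rep_l2 v x - rep_l2 w x"
  using rep_abs_l2[OF Lp_space_2_diff[OF l2_fun_in l2_fun_in], of v w]
  by (simp add: minus_l2_def)

lemma rep_l2_scaleR: "AE x in lborel. rep_l2 (c *\<^sub>R v) x = c *\<^sub>R rep_l2 v x"
  using rep_abs_l2[OF Lp_space_2_scaleR[OF l2_fun_in], of c v]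
  by (simp add: scaleR_l2_def del: scaleR_conv_of_real)

lemma abs_l2_add: "f \<in> Lp_space 2 \<Longrightarrow> g \<in> Lp_space 2 \<Longrightarrow> abs_l2 (\<lambda>x. f x + g x) = abs_l2 f + abs_l2 g"
  by (simp add: plus_l2.abs_eq L2_eq_def)

lemma abs_l2_diff: "f \<in> Lp_space 2 \<Longrightarrow> g \<in> Lp_space 2 \<Longrightarrow> abs_l2 (\<lambda>x. f x - g x) = abs_l2 f - abs_l2 g"
  by (simp add: minus_l2.abs_eq L2_eq_def)

lemma abs_l2_scaleR: "f \<in> Lp_space 2 \<Longrightarrow> abs_l2 (\<lambda>x. c *\<^sub>R f x) = c *\<^sub>R abs_l2 f"
  by (simp add: scaleR_l2.abs_eq L2_eq_def del: scaleR_conv_of_real)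

lemma abs_l2_zero: "abs_l2 (\<lambda>x. 0) = 0"
  by (simp add: zero_l2_def)

lemma norm_l2_sq: "(norm v)\<^sup>2 = (\<integral>x. (cmod (rep_l2 v x))\<^sup>2 \<partial>lborel)"
  by (simp add: norm_l2_def inner_l2.rep_eq dot_square_norm)

lemma ennreal_norm_l2_sq: "ennreal ((norm v)\<^sup>2) = (\<integral>\<^sup>+x. ennreal ((cmod (rep_l2 v x))\<^sup>2) \<partial>lborel)"
  unfolding norm_l2_sq
  by (rule nn_integral_eq_integral[symmetric]) (auto intro: Lp_space_2_integrable)

lemma ennreal_norm_abs_l2_sq:
  assumes "f \<in> Lp_space 2"
  shows "ennreal ((norm (abs_l2 f))\<^sup>2) = (\<integral>\<^sup>+x. ennreal ((cmod (f x))\<^sup>2) \<partial>lborel)"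
  unfolding ennreal_norm_l2_sq
  by (rule nn_integral_cong_AE) (use rep_abs_l2[OF assms] in \<open>eventually_elim, simp\<close>)

lemma norm_abs_l2: "f \<in> Lp_space 2 \<Longrightarrow> norm (abs_l2 f) = Lp_norm 2 f"
proof -
  assume f: "f \<in> Lp_space 2"
  hence [measurable]: "f \<in> borel_measurable lborel" by (rule Lp_space_measurable)
  have "(norm (abs_l2 f))\<^sup>2 = (\<integral>x. (cmod (f x))\<^sup>2 \<partial>lborel)"
    unfolding norm_l2_sq
    by (rule integral_cong_AE) (use rep_abs_l2[OF f] in \<open>auto\<close>)
  moreover have "Lp_norm 2 f = sqrt (\<integral>x. (cmod (f x))\<^sup>2 \<partial>lborel)"
    by (simp add: Lp_norm_def powr_half_sqrt)
  ultimately show ?thesis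
    by (metis norm_ge_zero real_sqrt_unique)
qed

lemma norm_l2_leI:
  assumes "f \<in> Lp_space 2" "(\<integral>\<^sup>+x. ennreal ((cmod (f x))\<^sup>2) \<partial>lborel) \<le> ennreal (c\<^sup>2)" "c \<ge> 0"
  shows "norm (abs_l2 f) \<le> c"
proof -
  have "ennreal ((norm (abs_l2 f))\<^sup>2) \<le> ennreal (c\<^sup>2)"
    using assms by (simp add: ennreal_norm_abs_l2_sq)
  hence "(norm (abs_l2 f))\<^sup>2 \<le> c\<^sup>2" by simp
  thus ?thesis using assms(3) by (rule power2_le_imp_le)
qed

text \<open>Riesz-Fischer. The squared increments integrate to at most 4^(-k), so they remain
  summable after multiplication by 2^k; almost everywhere the weighted series is then finite and
  forces the increments themselves to be absolutely summable.\<close>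

lemma l2_fast_Cauchy_convergent:
  fixes v :: "nat \<Rightarrow> 'a::euclidean_space l2"
  assumes v: "\<And>j k. k \<le> j \<Longrightarrow> norm (v j - v k) \<le> (1/2) ^ k"
  shows "convergent v"
proof -
  define f where "f k = rep_l2 (v k)" for k
  have [measurable]: "f k \<in> borel_measurable lborel" for k
    by (simp add: f_def)
  have fd: "(\<integral>\<^sup>+x. ennreal ((cmod (f j x - f k x))\<^sup>2) \<partial>lborel) = ennreal ((norm (v j - v k))\<^sup>2)" for j k
    unfolding ennreal_norm_l2_sq
    by (rule nn_integral_cong_AE) (use rep_l2_diff[of "v j" "v k"] in \<open>eventually_elim, simp add: f_def\<close>)
  have "(\<integral>\<^sup>+x. (\<Sum>k. ennreal (2 ^ k * (cmod (f (Suc k) x - f k x))\<^sup>2)) \<partial>lborel)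
      = (\<Sum>k. \<integral>\<^sup>+x. ennreal (2 ^ k * (cmod (f (Suc k) x - f k x))\<^sup>2) \<partial>lborel)"
    by (intro nn_integral_suminf) measurable
  also have "\<dots> \<le> (\<Sum>k. ennreal ((1/2) ^ k))"
  proof (intro suminf_le summableI)
    fix k
    have "(\<integral>\<^sup>+x. ennreal (2 ^ k * (cmod (f (Suc k) x - f k x))\<^sup>2) \<partial>lborel)
        = ennreal (2 ^ k) * ennreal ((norm (v (Suc k) - v k))\<^sup>2)"
      unfolding fd[symmetric] by (subst nn_integral_cmult[symmetric]) (auto simp: ennreal_mult')
    also have "\<dots> \<le> ennreal (2 ^ k) * ennreal (((1/2) ^ k)\<^sup>2)"
      by (intro mult_left_mono ennreal_leI power_mono v) auto
    also have "\<dots> = ennreal ((1/2) ^ k)"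
      by (subst ennreal_mult''[symmetric]) (auto simp: power2_eq_square power_divide)
    finally show "(\<integral>\<^sup>+x. ennreal (2 ^ k * (cmod (f (Suc k) x - f k x))\<^sup>2) \<partial>lborel) \<le> ennreal ((1/2) ^ k)" .
  qed
  also have "\<dots> = ennreal (\<Sum>k. (1/2) ^ k)"
    by (rule suminf_ennreal2) (auto simp: summable_geometric)
  finally have fin: "(\<integral>\<^sup>+x. (\<Sum>k. ennreal (2 ^ k * (cmod (f (Suc k) x - f k x))\<^sup>2)) \<partial>lborel) \<noteq> \<infinity>"
    by (auto simp: top_unique)
  have "AE x in lborel. (\<Sum>k. ennreal (2 ^ k * (cmod (f (Suc k) x - f k x))\<^sup>2)) \<noteq> \<infinity>"
    by (rule nn_integral_PInf_AE[OF _ fin]) measurable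
  hence conv: "AE x in lborel. convergent (\<lambda>k. f k x)"
  proof eventually_elim
    case (elim x)
    define s where "s = (\<lambda>k. 2 ^ k * (cmod (f (Suc k) x - f k x))\<^sup>2)"
    have sm: "summable s"
      using elim by (intro summable_suminf_not_top) (auto simp: s_def)
    have "summable (\<lambda>k. s k + (1/2) ^ k)"
      by (intro summable_add sm summable_geometric) auto
    hence "summable (\<lambda>k. cmod (f (Suc k) x - f k x))"
    proof (rule summable_comparison_test[rotated], intro exI allI impI)
      fix k
      \<comment> \<open>The arithmetic-geometric inequality with weight \<open>2 ^ k\<close> turns
        the bound on squares into a bound on the increments.\<close>
      have "2 * (cmod (f (Suc k) x - f k x)) \<le> 2 ^ k * (cmod (f (Suc k) x - f k x))\<^sup>2 + (1/2)^k"
      proof -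
        have "0 \<le> 2 ^ k * (cmod (f (Suc k) x - f k x) - (1/2)^k)\<^sup>2"
          by simp
        also have "\<dots> = 2 ^ k * (cmod (f (Suc k) x - f k x))\<^sup>2 + (1/2)^k - 2 * (cmod (f (Suc k) x - f k x))"
          by (simp add: power2_eq_square field_simps)
        finally show ?thesis by simp
      qed
      thus "norm (cmod (f (Suc k) x - f k x)) \<le> s k + (1/2) ^ k"
        using norm_ge_zero[of "f (Suc k) x - f k x"] unfolding s_def real_norm_def abs_norm_cancel
        by linarith
    qed
    hence "summable (\<lambda>k. f (Suc k) x - f k x)"
      by (rule summable_norm_cancel)
    hence "convergent (\<lambda>n. f 0 x + (\<Sum>k<n. f (Suc k) x - f k x))"
      by (intro convergent_add convergent_const) (simp add: summable_iff_convergent)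
    moreover have "f 0 x + (\<Sum>k<n. f (Suc k) x - f k x) = f n x" for n
      using sum_lessThan_telescope[of "\<lambda>k. f k x" n] by simp
    ultimately show ?case by simp
  qed
  define g where "g x = lim (\<lambda>k. f k x)" for x
  have [measurable]: "g \<in> borel_measurable lborel"
    unfolding g_def by measurable
  have lim: "AE x in lborel. (\<lambda>k. f k x) \<longlonglongrightarrow> g x"
    using conv by eventually_elim (simp add: g_def convergent_LIMSEQ_iff)
  \<comment> \<open>Fatou's lemma carries the Cauchy estimate over to the pointwise limit; this
    gives both membership of the limit in L^2 and convergence in norm.\<close>
  have bound: "(\<integral>\<^sup>+x. ennreal ((cmod (g x - f k x))\<^sup>2) \<partial>lborel) \<le> ennreal (((1/2)^k)\<^sup>2)" for k
  proof -
    have "(\<integral>\<^sup>+x. ennreal ((cmod (g x - f k x))\<^sup>2) \<partial>lborel)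
       = (\<integral>\<^sup>+x. liminf (\<lambda>j. ennreal ((cmod (f j x - f k x))\<^sup>2)) \<partial>lborel)"
    proof (rule nn_integral_cong_AE, use lim in eventually_elim)
      case (elim x)
      have "(\<lambda>j. ennreal ((cmod (f j x - f k x))\<^sup>2)) \<longlonglongrightarrow> ennreal ((cmod (g x - f k x))\<^sup>2)"
        by (intro tendsto_intros elim)
      thus ?case by (simp add: lim_imp_Liminf del: tendsto_ennreal_iff)
    qed
    also have "\<dots> \<le> liminf (\<lambda>j. \<integral>\<^sup>+x. ennreal ((cmod (f j x - f k x))\<^sup>2) \<partial>lborel)"
      by (rule nn_integral_liminf) measurable
    also have "\<dots> \<le> ennreal (((1/2)^k)\<^sup>2)"
      unfolding fd
      by (intro Liminf_le) (auto intro!: eventually_sequentiallyI[of k] ennreal_leI power_mono v)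
    finally show ?thesis .
  qed
  have gd: "(\<lambda>x. g x - f k x) \<in> Lp_space 2" for k
    using bound[of k] by (auto simp: Lp_space_2_iff_nn intro: le_less_trans)
  have g: "g \<in> Lp_space 2"
    using Lp_space_2_add[OF gd[of 0], of "f 0"] by (simp add: f_def)
  have "norm (abs_l2 g - v k) \<le> (1/2) ^ k" for k
  proof -
    have "abs_l2 g - v k = abs_l2 (\<lambda>x. g x - f k x)"
      using g by (simp add: abs_l2_diff f_def)
    thus ?thesis
      using norm_l2_leI[OF gd bound] by simp
  qed
  moreover have "(\<lambda>k. (1/2::real) ^ k) \<longlonglongrightarrow> 0"
    by (intro LIMSEQ_power_zero) auto
  ultimately have "(\<lambda>k. abs_l2 g - v k) \<longlonglongrightarrow> 0"
    by (intro Lim_null_comparison[of "\<lambda>k. abs_l2 g - v k"]) auto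
  hence "v \<longlonglongrightarrow> abs_l2 g"
    using tendsto_diff[OF tendsto_const[of "abs_l2 g"], of "\<lambda>k. abs_l2 g - v k" 0] by simp
  thus ?thesis by (rule convergentI)
qed

instance l2 :: (euclidean_space) banach
proof
  fix X :: "nat \<Rightarrow> 'a l2"
  assume X: "Cauchy X"
  have "\<exists>N. \<forall>m\<ge>N. \<forall>n\<ge>N. norm (X m - X n) < (1/2) ^ k" for k :: nat
    using X[unfolded Cauchy_iff] by (auto simp del: power_divide)
  then obtain N where N: "\<And>k m n. m \<ge> N k \<Longrightarrow> n \<ge> N k \<Longrightarrow> norm (X m - X n) < (1/2) ^ k"
    by metis
  \<comment> \<open>The k-th index lies beyond the threshold for (1/2)^k, and the maximum with
    \<open>Suc rk\<close> makes the choice strictly increasing, hence a subsequence.\<close>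
  define r where "r = rec_nat (N 0) (\<lambda>k rk. max (Suc rk) (N (Suc k)))"
  have r0: "r 0 = N 0" and rS: "r (Suc k) = max (Suc (r k)) (N (Suc k))" for k
    by (simp_all add: r_def)
  have r: "strict_mono r"
    by (rule strict_monoI_Suc) (simp add: rS)
  have rN: "N k \<le> r k" for k
    by (cases k) (simp_all add: r0 rS)
  have "convergent (\<lambda>k. X (r k))"
  proof (rule l2_fast_Cauchy_convergent)
    fix j k :: nat assume "k \<le> j"
    hence "r k \<le> r j" using r by (simp add: strict_mono_less_eq)
    thus "norm (X (r j) - X (r k)) \<le> (1/2) ^ k"
      using rN[of k] by (intro less_imp_le[OF N]) auto
  qed
  then obtain L where "(X \<circ> r) \<longlonglongrightarrow> L"
    by (auto simp: convergent_def o_def)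
  thus "convergent X"
    using Cauchy_converges_subseq[OF X r] by (auto simp: convergent_def)
qed

section \<open>Multiplication operators\<close>

text \<open>Total by construction: the product determines a meaningful class only if it is square
  integrable again, which every use secures through \<open>bounded_symbol\<close>.\<close>

definition mul :: "('a::euclidean_space \<Rightarrow> complex) \<Rightarrow> 'a l2 \<Rightarrow> 'a l2" where
  "mul k v = abs_l2 (\<lambda>x. k x * rep_l2 v x)"

text \<open>The bound is only essential because the kernel estimates leave out the frequency
  0.\<close>

definition bounded_symbol :: "('a::euclidean_space \<Rightarrow> complex) \<Rightarrow> real \<Rightarrow> bool" where
  "bounded_symbol k C \<longleftrightarrow> k \<in> borel_measurable lborel \<and> (AE x in lborel. cmod (k x) \<le> C)"

lemma bounded_symbol_nonneg: "bounded_symbol k C \<Longrightarrow> C \<ge> 0"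
proof (rule ccontr)
  assume k: "bounded_symbol k C" and "\<not> C \<ge> 0"
  hence "AE x in lborel. cmod (k x) \<le> C" "C < 0" by (auto simp: bounded_symbol_def)
  have "AE x::'a in lborel. False"
    using \<open>AE x in lborel. cmod (k x) \<le> C\<close>
  proof eventually_elim
    case (elim x)
    thus False using \<open>C < 0\<close> norm_ge_zero[of "k x"] by linarith
  qed
  thus False by (simp add: AE_iff_null null_sets_def)
qed

lemma bounded_symbol_mono: "bounded_symbol k C \<Longrightarrow> C \<le> D \<Longrightarrow> bounded_symbol k D"
  by (auto simp: bounded_symbol_def elim!: eventually_mono)

lemma bounded_symbol_mult:
  assumes "bounded_symbol k C" "bounded_symbol l D"
  shows "bounded_symbol (\<lambda>x. k x * l x) (C * D)"
proof -
  have "AE x in lborel. cmod (k x) \<le> C" "AE x in lborel. cmod (l x) \<le> D"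
    using assms by (auto simp: bounded_symbol_def)
  hence "AE x in lborel. cmod (k x * l x) \<le> C * D"
    by eventually_elim (auto simp: norm_mult intro!: mult_mono bounded_symbol_nonneg[OF assms(1)])
  thus ?thesis
    using assms by (auto simp: bounded_symbol_def)
qed

lemma mul_in_Lp: "bounded_symbol k C \<Longrightarrow> (\<lambda>x. k x * rep_l2 v x) \<in> Lp_space 2"
  using Lp_space_2_mult[OF l2_fun_in] by (auto simp: bounded_symbol_def)

lemma rep_mul: "bounded_symbol k C \<Longrightarrow> AE x in lborel. rep_l2 (mul k v) x = k x * rep_l2 v x"
  unfolding mul_def by (rule rep_abs_l2) (rule mul_in_Lp)

lemma mul_abs_l2:
  assumes "bounded_symbol k C" "f \<in> Lp_space 2"
  shows "mul k (abs_l2 f) = abs_l2 (\<lambda>x. k x * f x)"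
  unfolding mul_def
proof (rule abs_l2_eqI)
  show "(\<lambda>x. k x * f x) \<in> Lp_space 2"
    using Lp_space_2_mult[OF assms(2)] assms(1) by (auto simp: bounded_symbol_def)
  show "AE x in lborel. k x * rep_l2 (abs_l2 f) x = k x * f x"
    using rep_abs_l2[OF assms(2)] by eventually_elim simp
qed (rule mul_in_Lp[OF assms(1)])

lemma ennreal_norm_mul_sq:
  assumes "bounded_symbol k C"
  shows "ennreal ((norm (mul k v))\<^sup>2) = (\<integral>\<^sup>+x. ennreal ((cmod (k x))\<^sup>2 * (cmod (rep_l2 v x))\<^sup>2) \<partial>lborel)"
  unfolding mul_def
  by (subst ennreal_norm_abs_l2_sq[OF mul_in_Lp[OF assms]]) (simp add: norm_mult power_mult_distrib)

lemma norm_mul_le: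
  assumes "bounded_symbol k C"
  shows "norm (mul k v) \<le> C * norm v"
proof -
  have C: "C \<ge> 0" using assms by (rule bounded_symbol_nonneg)
  have "(\<integral>\<^sup>+x. ennreal ((cmod (k x * rep_l2 v x))\<^sup>2) \<partial>lborel)
      \<le> (\<integral>\<^sup>+x. ennreal (C\<^sup>2) * ennreal ((cmod (rep_l2 v x))\<^sup>2) \<partial>lborel)"
  proof (rule nn_integral_mono_AE)
    have "AE x in lborel. cmod (k x) \<le> C"
      using assms by (auto simp: bounded_symbol_def)
    thus "AE x in lborel. ennreal ((cmod (k x * rep_l2 v x))\<^sup>2) \<le> ennreal (C\<^sup>2) * ennreal ((cmod (rep_l2 v x))\<^sup>2)"
      by eventually_elim
        (auto simp: norm_mult power_mult_distrib ennreal_mult'[symmetric] intro!: ennreal_leI mult_right_mono power_mono)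
  qed
  also have "\<dots> = ennreal ((C * norm v)\<^sup>2)"
    using C by (simp add: nn_integral_cmult ennreal_norm_l2_sq[symmetric] power_mult_distrib ennreal_mult')
  finally show ?thesis
    unfolding mul_def using C by (intro norm_l2_leI mul_in_Lp[OF assms]) auto
qed

lemma mul_add:
  assumes "bounded_symbol k C" shows "mul k (v + w) = mul k v + mul k w"
proof (rule l2_eqI)
  show "AE x in lborel. rep_l2 (mul k (v + w)) x = rep_l2 (mul k v + mul k w) x"
    using rep_mul[OF assms, of v] rep_mul[OF assms, of w] rep_mul[OF assms, of "v+w"]
      rep_l2_add[of v w] rep_l2_add[of "mul k v" "mul k w"]
    by eventually_elim (simp add: algebra_simps)
qed

lemma mul_scaleR:
  assumes "bounded_symbol k C" shows "mul k (c *\<^sub>R v) = c *\<^sub>R mul k v"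
proof (rule l2_eqI)
  show "AE x in lborel. rep_l2 (mul k (c *\<^sub>R v)) x = rep_l2 (c *\<^sub>R mul k v) x"
    using rep_mul[OF assms, of v] rep_mul[OF assms, of "c *\<^sub>R v"]
      rep_l2_scaleR[of c v] rep_l2_scaleR[of c "mul k v"]
    by eventually_elim simp
qed

lemma bounded_linear_mul: "bounded_symbol k C \<Longrightarrow> bounded_linear (mul k)"
  by (rule bounded_linear_intro[where K = C])
    (auto simp: mul_add mul_scaleR norm_mul_le mult.commute)

lemma mul_diff: "bounded_symbol k C \<Longrightarrow> mul k (v - w) = mul k v - mul k w"
  by (rule bounded_linear.linear[OF bounded_linear_mul, THEN linear_diff])

lemma mul_mul:
  assumes "bounded_symbol k C" "bounded_symbol l D"
  shows "mul k (mul l v) = mul (\<lambda>x. k x * l x) v"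
proof (rule l2_eqI)
  show "AE x in lborel. rep_l2 (mul k (mul l v)) x = rep_l2 (mul (\<lambda>x. k x * l x) v) x"
    using rep_mul[OF assms(1), of "mul l v"] rep_mul[OF assms(2), of v]
      rep_mul[OF bounded_symbol_mult[OF assms], of v]
    by eventually_elim simp
qed

lemma mul_symbol_add:
  assumes "bounded_symbol k C" "bounded_symbol l D"
  shows "mul (\<lambda>x. k x + l x) v = mul k v + mul l v"
proof -
  have "mul (\<lambda>x. k x + l x) v = abs_l2 (\<lambda>x. k x * rep_l2 v x + l x * rep_l2 v x)"
    by (simp add: mul_def algebra_simps)
  also have "\<dots> = mul k v + mul l v"
    unfolding mul_def by (rule abs_l2_add) (rule mul_in_Lp assms)+
  finally show ?thesis .
qed

lemma norm_mul_mono: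
  assumes "bounded_symbol k C" "bounded_symbol l D" "AE x in lborel. cmod (k x) \<le> cmod (l x)"
  shows "norm (mul k v) \<le> norm (mul l v)"
proof -
  have "(\<integral>\<^sup>+x. ennreal ((cmod (k x))\<^sup>2 * (cmod (rep_l2 v x))\<^sup>2) \<partial>lborel)
      \<le> (\<integral>\<^sup>+x. ennreal ((cmod (l x))\<^sup>2 * (cmod (rep_l2 v x))\<^sup>2) \<partial>lborel)"
    by (rule nn_integral_mono_AE) (use assms(3) in \<open>eventually_elim,
      auto intro!: ennreal_leI mult_right_mono power_mono\<close>)
  hence "(norm (mul k v))\<^sup>2 \<le> (norm (mul l v))\<^sup>2"
    by (simp flip: ennreal_norm_mul_sq[OF assms(1)] ennreal_norm_mul_sq[OF assms(2)])
  thus ?thesis by (rule power2_le_imp_le) simp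
qed

text \<open>Dominated convergence with majorant (2 C)^2 |v|^2. Pointwise convergence of uniformly
  bounded symbols gives strong convergence of the operators.\<close>

lemma mul_tendsto:
  fixes k :: "nat \<Rightarrow> 'a::euclidean_space \<Rightarrow> complex"
  assumes k: "\<And>n. bounded_symbol (k n) C" and l: "bounded_symbol l C"
    and lim: "AE x in lborel. (\<lambda>n. k n x) \<longlonglongrightarrow> l x"
  shows "(\<lambda>n. mul (k n) v) \<longlonglongrightarrow> mul l v"
proof -
  have C: "C \<ge> 0" using l by (rule bounded_symbol_nonneg)
  have [measurable]: "l \<in> borel_measurable lborel" "k n \<in> borel_measurable lborel" for n
    using k l by (auto simp: bounded_symbol_def)
  have sub: "bounded_symbol (\<lambda>x. k n x - l x) (2 * C)" for n
  proof -
    have "AE x in lborel. cmod (k n x) \<le> C" "AE x in lborel. cmod (l x) \<le> C"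
      using k l by (auto simp: bounded_symbol_def)
    hence "AE x in lborel. cmod (k n x - l x) \<le> 2 * C"
      by eventually_elim (metis norm_triangle_ineq4 add_mono order_trans mult_2)
    thus ?thesis by (auto simp: bounded_symbol_def)
  qed
  have "(\<lambda>n. \<integral>\<^sup>+x. ennreal ((cmod (k n x - l x))\<^sup>2 * (cmod (rep_l2 v x))\<^sup>2) \<partial>lborel)
      \<longlonglongrightarrow> (\<integral>\<^sup>+x. 0 \<partial>(lborel :: 'a measure))"
  proof (rule nn_integral_dominated_convergence[where w = "\<lambda>x. ennreal ((2*C)\<^sup>2 * (cmod (rep_l2 v x))\<^sup>2)"])
    fix n
    have "AE x in lborel. cmod (k n x - l x) \<le> 2 * C"
      using sub[of n] by (auto simp: bounded_symbol_def)
    thus "AE x in lborel. ennreal ((cmod (k n x - l x))\<^sup>2 * (cmod (rep_l2 v x))\<^sup>2)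
        \<le> ennreal ((2*C)\<^sup>2 * (cmod (rep_l2 v x))\<^sup>2)"
      by eventually_elim (intro ennreal_leI mult_right_mono power_mono, auto)
  next
    have "(\<integral>\<^sup>+x. ennreal ((2*C)\<^sup>2 * (cmod (rep_l2 v x))\<^sup>2) \<partial>lborel)
      = ennreal ((2*C)\<^sup>2) * ennreal ((norm v)\<^sup>2)"
      unfolding ennreal_norm_l2_sq by (subst nn_integral_cmult[symmetric]) (auto simp: ennreal_mult')
    thus "(\<integral>\<^sup>+x. ennreal ((2*C)\<^sup>2 * (cmod (rep_l2 v x))\<^sup>2) \<partial>lborel) < \<infinity>"
      by (simp add: ennreal_mult_less_top)
  next
    show "AE x in lborel. (\<lambda>n. ennreal ((cmod (k n x - l x))\<^sup>2 * (cmod (rep_l2 v x))\<^sup>2)) \<longlonglongrightarrow> 0"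
      using lim
    proof eventually_elim
      case (elim x)
      hence "(\<lambda>n. ennreal ((cmod (k n x - l x))\<^sup>2 * (cmod (rep_l2 v x))\<^sup>2))
          \<longlonglongrightarrow> ennreal ((cmod (l x - l x))\<^sup>2 * (cmod (rep_l2 v x))\<^sup>2)"
        by (intro tendsto_intros)
      thus ?case by simp
    qed
  qed auto
  hence "(\<lambda>n. ennreal ((norm (mul (\<lambda>x. k n x - l x) v))\<^sup>2)) \<longlonglongrightarrow> ennreal 0"
    by (simp add: ennreal_norm_mul_sq[OF sub])
  hence "(\<lambda>n. (norm (mul (\<lambda>x. k n x - l x) v))\<^sup>2) \<longlonglongrightarrow> 0"
    by (subst (asm) tendsto_ennreal_iff) auto
  hence "(\<lambda>n. sqrt ((norm (mul (\<lambda>x. k n x - l x) v))\<^sup>2)) \<longlonglongrightarrow> sqrt 0"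
    by (rule tendsto_real_sqrt)
  hence "(\<lambda>n. mul (\<lambda>x. k n x - l x) v) \<longlonglongrightarrow> 0"
    by (simp add: tendsto_norm_zero_iff)
  moreover have "mul (\<lambda>x. k n x - l x) v = mul (k n) v - mul l v" for n
    using mul_symbol_add[OF sub l, of n v] by simp
  ultimately show ?thesis
    by (simp add: LIM_zero_iff)
qed

text \<open>Symbols depending continuously on a parameter act strongly continuously, although in
  general not continuously in operator norm.\<close>

lemma continuous_on_mul:
  fixes k :: "'x::metric_space \<Rightarrow> 'a::euclidean_space \<Rightarrow> complex"
  assumes k: "\<And>s. s \<in> S \<Longrightarrow> bounded_symbol (k s) C"
    and cont: "AE x in lborel. continuous_on S (\<lambda>s. k s x)"
    and v: "continuous_on S v"
  shows "continuous_on S (\<lambda>s. mul (k s) (v s))"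
  unfolding continuous_on_sequentially
proof (intro allI ballI impI)
  fix X s assume X: "s \<in> S" "(\<forall>n. X n \<in> S) \<and> X \<longlonglongrightarrow> s"
  have kX: "bounded_symbol (k (X n)) C" for n using k X by auto
  have "AE x in lborel. (\<lambda>n. k (X n) x) \<longlonglongrightarrow> k s x"
    using cont by eventually_elim (use X in \<open>auto simp: continuous_on_sequentially o_def\<close>)
  hence 1: "(\<lambda>n. mul (k (X n)) (v s)) \<longlonglongrightarrow> mul (k s) (v s)"
    by (rule mul_tendsto[OF kX k[OF X(1)]])
  have "(\<lambda>n. v (X n)) \<longlonglongrightarrow> v s"
    using v X by (auto simp: continuous_on_sequentially o_def)
  hence "(\<lambda>n. C * norm (v (X n) - v s)) \<longlonglongrightarrow> C * norm (v s - v s)"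
    by (intro tendsto_intros)
  hence "(\<lambda>n. mul (k (X n)) (v (X n) - v s)) \<longlonglongrightarrow> 0"
    by (intro Lim_null_comparison[of "\<lambda>n. mul (k (X n)) (v (X n) - v s)" "\<lambda>n. C * norm (v (X n) - v s)"])
      (auto intro!: always_eventually norm_mul_le[OF kX])
  from tendsto_add[OF this 1] show "((\<lambda>s. mul (k s) (v s)) \<circ> X) \<longlonglongrightarrow> mul (k s) (v s)"
    by (simp add: o_def mul_diff[OF kX])
qed

section \<open>Gaussian integrals\<close>

lemma borel_measurable_cis [measurable]: "cis \<in> borel_measurable borel"
  by (intro borel_measurable_continuous_onI continuous_intros)

lemma borel_measurable_cnj [measurable]: "cnj \<in> borel_measurable borel"
  by (intro borel_measurable_continuous_onI continuous_intros)

lemma integrable_of_real_iff: "integrable M (\<lambda>x. complex_of_real (f x)) \<longleftrightarrow> integrable M f"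
  using integrable_Re[of M "\<lambda>x. complex_of_real (f x)"] by auto

lemma lborel_integral_affine:
  fixes f :: "'a::euclidean_space \<Rightarrow> 'b::{banach, second_countable_topology}"
  assumes c: "c \<noteq> 0" and [measurable]: "f \<in> borel_measurable lborel"
  shows "(\<integral>x. f x \<partial>lborel) = (\<bar>c\<bar> ^ DIM('a)) *\<^sub>R (\<integral>x. f (t + c *\<^sub>R x) \<partial>lborel)"
proof -
  have f: "f \<in> borel_measurable borel" using assms by simp
  show ?thesis
    by (subst lborel_affine[OF c, of t]) (use f in \<open>simp add: integral_density integral_distr\<close>)
qed

lemma lborel_nn_integral_affine:
  fixes f :: "'a::euclidean_space \<Rightarrow> ennreal"
  assumes c: "c \<noteq> 0" and [measurable]: "f \<in> borel_measurable lborel"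
  shows "(\<integral>\<^sup>+x. f x \<partial>lborel) = (\<bar>c\<bar> ^ DIM('a)) * (\<integral>\<^sup>+x. f (t + c *\<^sub>R x) \<partial>lborel)"
proof -
  have f: "f \<in> borel_measurable borel" using assms by simp
  show ?thesis
    by (subst lborel_affine[OF c, of t]) (use f in \<open>simp add: nn_integral_density nn_integral_distr nn_integral_cmult ennreal_power\<close>)
qed

definition gauss :: "'a::euclidean_space \<Rightarrow> real" where
  "gauss x = exp (- (norm x)\<^sup>2 / 2)"

lemma gauss_pos [simp]: "gauss x > 0" and gauss_nonneg [simp]: "gauss x \<ge> 0"
  and gauss_le_1: "gauss x \<le> 1"
  by (simp_all add: gauss_def)

lemma gauss_minus [simp]: "gauss (- x) = gauss x"
  by (simp add: gauss_def)

lemma gauss_measurable [measurable]: "gauss \<in> borel_measurable borel"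
  unfolding gauss_def by measurable

lemma gauss_prod: "gauss x = (\<Prod>b\<in>Basis. exp (- (x \<bullet> b)\<^sup>2 / 2))"
proof -
  have "- (norm x)\<^sup>2 / 2 = (\<Sum>b\<in>Basis. - (x \<bullet> b)\<^sup>2 / 2)"
    unfolding power2_norm_eq_inner euclidean_inner[of x x]
    by (simp add: power2_eq_square sum_negf sum_divide_distrib)
  thus ?thesis by (simp add: gauss_def exp_sum)
qed

text \<open>A rescaling of the characteristic function of the standard normal distribution.\<close>

lemma gauss_char_real:
  "has_bochner_integral lborel (\<lambda>x::real. cis (t * x) * of_real (exp (- x\<^sup>2 / 2)))
     (of_real (sqrt (2 * pi) * exp (- t\<^sup>2 / 2)))"
proof -
  have int: "integrable lborel (\<lambda>x::real. std_normal_density x *\<^sub>R iexp (t * x))"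
  proof -
    have "integrable lborel std_normal_density"
      using integrable_std_normal_moment_abs[of 0] by simp
    thus ?thesis
      by (rule Bochner_Integration.integrable_bound) (auto simp: norm_mult)
  qed
  have "(\<integral>x. std_normal_density x *\<^sub>R iexp (t * x) \<partial>lborel) = complex_of_real (exp (- (t^2) / 2))"
    using fun_cong[OF char_std_normal_distribution, of t] unfolding char_def
    by (subst (asm) integral_density) auto
  hence "has_bochner_integral lborel (\<lambda>x. std_normal_density x *\<^sub>R iexp (t * x)) (complex_of_real (exp (- (t^2) / 2)))"
    using int by (simp add: has_bochner_integral_iff)
  hence "has_bochner_integral lborel (\<lambda>x. of_real (sqrt (2 * pi)) * (std_normal_density x *\<^sub>R iexp (t * x)))
      (of_real (sqrt (2 * pi)) * complex_of_real (exp (- (t^2) / 2)))"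
    by (rule has_bochner_integral_mult_right) 
  moreover have "of_real (sqrt (2 * pi)) * (std_normal_density x *\<^sub>R iexp (t * x))
      = cis (t * x) * of_real (exp (- x\<^sup>2 / 2))" for x
    by (simp add: std_normal_density_def cis_conv_exp scaleR_conv_of_real)
  ultimately show ?thesis by simp
qed

lemma cis_sum: "cis (sum f A) = (\<Prod>a\<in>A. cis (f a))"
  by (induction A rule: infinite_finite_induct) (auto simp: cis_mult[symmetric])

text \<open>Reduces to dimension one: the character and the Gaussian are both products over
  \<open>Basis\<close>, and \<open>lborel\<close> is the image of a product measure.\<close>

lemma gauss_char:
  fixes z :: "'a::euclidean_space"
  shows "has_bochner_integral lborel (\<lambda>x. cis (z \<bullet> x) * of_real (gauss x))
    (of_real ((2 * pi) powr (DIM('a) / 2) * gauss z))"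
proof -
  interpret product_sigma_finite "\<lambda>_::'a. lborel :: real measure" ..
  define h where "h b x = cis ((z \<bullet> b) * x) * of_real (exp (- x\<^sup>2 / 2))" for b :: 'a and x :: real
  have h: "has_bochner_integral lborel (h b) (of_real (sqrt (2 * pi) * exp (- (z \<bullet> b)\<^sup>2 / 2)))" for b
    unfolding h_def by (rule gauss_char_real)
  have [measurable]: "h b \<in> borel_measurable borel" for b
    unfolding h_def by measurable
  have eq: "cis (z \<bullet> x) * of_real (gauss x) = (\<Prod>b\<in>Basis. h b (x \<bullet> b))" for x
    unfolding h_def prod.distrib gauss_prod euclidean_inner[of z x] cis_sum by simp
  have eq2: "(\<Prod>b\<in>Basis. h b ((\<Sum>b\<in>Basis. f b *\<^sub>R b) \<bullet> b)) = (\<Prod>b\<in>Basis. h b (f b))" for f :: "'a \<Rightarrow> real"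
    by (intro prod.cong) auto
  have "integrable (\<Pi>\<^sub>M b\<in>Basis. lborel) (\<lambda>f. \<Prod>b\<in>Basis. h b (f b))"
    using h by (intro product_integrable_prod) (auto simp: has_bochner_integral_iff)
  hence "integrable lborel (\<lambda>x::'a. \<Prod>b\<in>Basis. h b (x \<bullet> b))"
    unfolding lborel_eq[where 'a = 'a] by (subst integrable_distr_eq) (auto simp: eq2)
  moreover have "(\<integral>x. (\<Prod>b\<in>Basis. h b (x \<bullet> b)) \<partial>(lborel::'a measure)) = of_real ((2 * pi) powr (DIM('a) / 2) * gauss z)"
  proof -
    have "(\<integral>x. (\<Prod>b\<in>Basis. h b (x \<bullet> b)) \<partial>(lborel::'a measure)) = (\<integral>f. (\<Prod>b\<in>Basis. h b (f b)) \<partial>(\<Pi>\<^sub>M b\<in>Basis. lborel))"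
      unfolding lborel_eq[where 'a = 'a] by (subst integral_distr) (auto simp: eq2)
    also have "\<dots> = (\<Prod>b\<in>Basis. integral\<^sup>L lborel (h b))"
      using h by (intro product_integral_prod) (auto simp: has_bochner_integral_iff)
    also have "\<dots> = (\<Prod>b\<in>Basis. of_real (sqrt (2 * pi) * exp (- (z \<bullet> b)\<^sup>2 / 2)))"
      using h by (intro prod.cong) (auto simp: has_bochner_integral_iff)
    also have "\<dots> = of_real (sqrt (2 * pi) ^ DIM('a) * gauss z)"
      by (simp add: prod.distrib gauss_prod)
    also have "sqrt (2 * pi) ^ DIM('a) = (2 * pi) powr (DIM('a) / 2)"
      by (simp add: powr_half_sqrt[symmetric] powr_power)
    finally show ?thesis .
  qed
  ultimately show ?thesis
    unfolding eq by (simp add: has_bochner_integral_iff)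
qed

lemma gauss_integrable: "integrable lborel (gauss :: 'a::euclidean_space \<Rightarrow> real)"
proof -
  have "integrable lborel (\<lambda>x. cis ((0::'a) \<bullet> x) * of_real (gauss x))"
    using gauss_char[of "0::'a"] by (simp add: has_bochner_integral_iff)
  hence "integrable lborel (\<lambda>x::'a. complex_of_real (gauss x))" by simp
  thus ?thesis by (simp add: integrable_of_real_iff)
qed

text \<open>The heat kernel at time \<delta>^2 / 2, that is, the density of a centred normal vector
  with covariance \<delta>^2 times the identity. It has total mass 1.\<close>

definition gauss_kernel :: "real \<Rightarrow> 'a::euclidean_space \<Rightarrow> real" where
  "gauss_kernel \<delta> z = (2 * pi) powr (- DIM('a) / 2) * \<delta> powr (- DIM('a)) * gauss (z /\<^sub>R \<delta>)"

lemma gauss_kernel_nonneg [simp]: "gauss_kernel \<delta> z \<ge> 0"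
  by (simp add: gauss_kernel_def)

lemma gauss_kernel_minus [simp]: "gauss_kernel \<delta> (- z) = gauss_kernel \<delta> z"
  by (simp add: gauss_kernel_def)

lemma gauss_kernel_commute: "gauss_kernel \<delta> (x - y) = gauss_kernel \<delta> (y - x)"
  using gauss_kernel_minus[of \<delta> "x - y"] by simp

lemma gauss_kernel_measurable [measurable]: "gauss_kernel \<delta> \<in> borel_measurable borel"
  unfolding gauss_kernel_def by measurable

lemma gauss_integral: "(\<integral>x. gauss (x::'a::euclidean_space) \<partial>lborel) = (2 * pi) powr (DIM('a) / 2)"
proof -
  have "complex_of_real (\<integral>x. gauss (x::'a) \<partial>lborel) = of_real ((2 * pi) powr (DIM('a) / 2))"
    using gauss_char[of "0::'a"] by (simp add: has_bochner_integral_iff gauss_def[of 0])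
  thus ?thesis by (simp only: of_real_eq_iff)
qed

text \<open>The substitution x = y - \<delta> z moves the scale from the kernel into the argument of
  \<open>w\<close>, where the limit \<delta> -> 0 can be taken under a fixed integrable
  Gaussian.\<close>

lemma gauss_kernel_conv:
  fixes w :: "'a::euclidean_space \<Rightarrow> 'b::{banach, second_countable_topology}"
  assumes \<delta>: "\<delta> > 0" and [measurable]: "w \<in> borel_measurable lborel"
  shows "(\<integral>x. gauss_kernel \<delta> (y - x) *\<^sub>R w x \<partial>lborel)
    = (2 * pi) powr (- DIM('a) / 2) *\<^sub>R (\<integral>z. gauss z *\<^sub>R w (y - \<delta> *\<^sub>R z) \<partial>lborel)"
proof -
  have "(\<integral>x. gauss_kernel \<delta> (y - x) *\<^sub>R w x \<partial>lborel)
    = (\<bar>- \<delta>\<bar> ^ DIM('a)) *\<^sub>R (\<integral>z. gauss_kernel \<delta> (y - (y + (- \<delta>) *\<^sub>R z)) *\<^sub>R w (y + (- \<delta>) *\<^sub>R z) \<partial>lborel)"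
    by (rule lborel_integral_affine) (use \<delta> in auto)
  also have "\<dots> = (\<integral>z. (\<delta> ^ DIM('a)) *\<^sub>R (gauss_kernel \<delta> (\<delta> *\<^sub>R z) *\<^sub>R w (y - \<delta> *\<^sub>R z)) \<partial>lborel)"
    using \<delta> by (simp del: scaleR_scaleR)
  also have "\<dots> = (\<integral>z. (2 * pi) powr (- DIM('a) / 2) *\<^sub>R (gauss z *\<^sub>R w (y - \<delta> *\<^sub>R z)) \<partial>lborel)"
  proof (rule Bochner_Integration.integral_cong)
    fix z :: 'a
    have "\<delta> ^ DIM('a) * gauss_kernel \<delta> (\<delta> *\<^sub>R z) = (2 * pi) powr (- DIM('a) / 2) * gauss z"
      using \<delta> by (simp add: gauss_kernel_def powr_minus powr_realpow field_simps)
    thus "(\<delta> ^ DIM('a)) *\<^sub>R (gauss_kernel \<delta> (\<delta> *\<^sub>R z) *\<^sub>R w (y - \<delta> *\<^sub>R z))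
        = (2 * pi) powr (- DIM('a) / 2) *\<^sub>R (gauss z *\<^sub>R w (y - \<delta> *\<^sub>R z))"
      by simp
  qed simp
  finally show ?thesis by (simp only: integral_scaleR_right)
qed

lemma gauss_kernel_nn_integral:
  fixes y :: "'a::euclidean_space"
  assumes \<delta>: "\<delta> > 0"
  shows "(\<integral>\<^sup>+x. ennreal (gauss_kernel \<delta> (y - x)) \<partial>lborel) = 1"
proof -
  have "(\<integral>\<^sup>+x. ennreal (gauss_kernel \<delta> (y - x)) \<partial>lborel)
    = ennreal (\<bar>- \<delta>\<bar> ^ DIM('a)) * (\<integral>\<^sup>+z. ennreal (gauss_kernel \<delta> (y - (y + (- \<delta>) *\<^sub>R z))) \<partial>lborel)"
    using \<delta> by (subst lborel_nn_integral_affine[where c = "- \<delta>" and t = y]) (auto simp: ennreal_power)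
  also have "\<dots> = (\<integral>\<^sup>+z. ennreal (\<delta> ^ DIM('a) * gauss_kernel \<delta> (\<delta> *\<^sub>R z)) \<partial>(lborel::'a measure))"
    using \<delta> by (subst nn_integral_cmult[symmetric]) (auto simp: ennreal_mult'[symmetric])
  also have "\<dots> = (\<integral>\<^sup>+z. ennreal ((2 * pi) powr (- DIM('a) / 2) * gauss (z::'a)) \<partial>lborel)"
    using \<delta> by (simp add: gauss_kernel_def powr_minus powr_realpow field_simps)
  also have "\<dots> = ennreal (\<integral>z. (2 * pi) powr (- DIM('a) / 2) * gauss (z::'a) \<partial>lborel)"
    by (rule nn_integral_eq_integral) (auto intro: gauss_integrable)
  also have "\<dots> = 1"
    by (simp add: gauss_integral powr_add[symmetric])
  finally show ?thesis .
qed

lemma gauss_kernel_integrable: "\<delta> > 0 \<Longrightarrow> integrable lborel (\<lambda>x. gauss_kernel \<delta> (y - x))"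
  using gauss_kernel_nn_integral[of \<delta> y] by (subst integrable_iff_bounded) auto

text \<open>The constant is squared because the formula is applied to two successive transforms,
  each with its own factor (2 pi)^(-n/2).\<close>

lemma gauss_char_scaled:
  fixes z :: "'a::euclidean_space"
  assumes \<delta>: "\<delta> > 0"
  shows "((2 * pi) powr (- real DIM('a) / 2))\<^sup>2 * (\<integral>\<xi>. cis (z \<bullet> \<xi>) * of_real (gauss (\<delta> *\<^sub>R \<xi>)) \<partial>lborel)
     = of_real (gauss_kernel \<delta> z)"
proof -
  have "(\<integral>\<xi>. cis ((z /\<^sub>R \<delta>) \<bullet> \<xi>) * of_real (gauss \<xi>) \<partial>lborel)
     = (\<bar>\<delta>\<bar> ^ DIM('a)) *\<^sub>R (\<integral>\<xi>. cis ((z /\<^sub>R \<delta>) \<bullet> (0 + \<delta> *\<^sub>R \<xi>)) * of_real (gauss (0 + \<delta> *\<^sub>R \<xi>)) \<partial>lborel)"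
    by (rule lborel_integral_affine) (use \<delta> in \<open>auto\<close>)
  hence "of_real (\<delta> ^ DIM('a)) * (\<integral>\<xi>. cis (z \<bullet> \<xi>) * of_real (gauss (\<delta> *\<^sub>R \<xi>)) \<partial>lborel)
      = complex_of_real ((2 * pi) powr (DIM('a) / 2) * gauss (z /\<^sub>R \<delta>))"
    using gauss_char[of "z /\<^sub>R \<delta>"] \<delta>
    by (simp add: has_bochner_integral_iff scaleR_conv_of_real mult.assoc[symmetric])
  hence I: "(\<integral>\<xi>. cis (z \<bullet> \<xi>) * of_real (gauss (\<delta> *\<^sub>R \<xi>)) \<partial>lborel)
      = complex_of_real ((2 * pi) powr (DIM('a) / 2) * gauss (z /\<^sub>R \<delta>) / \<delta> ^ DIM('a))"
    using \<delta> by (simp add: field_simps)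
  have P: "((2 * pi) powr (- real DIM('a) / 2))\<^sup>2 * ((2 * pi) powr (DIM('a) / 2) * gauss (z /\<^sub>R \<delta>) / \<delta> ^ DIM('a))
      = gauss_kernel \<delta> z"
    using \<delta> by (simp add: gauss_kernel_def powr_minus powr_realpow power2_eq_square field_simps)
  show ?thesis unfolding I P[symmetric] by simp
qed

lemma gauss_scaled_integrable:
  assumes "\<delta> > 0" shows "integrable lborel (\<lambda>\<xi>::'a::euclidean_space. gauss (\<delta> *\<^sub>R \<xi>))"
proof -
  have "(\<integral>\<^sup>+x. ennreal (gauss (x::'a)) \<partial>lborel) < \<infinity>"
    using gauss_integrable[where 'a='a] by (simp add: integrable_iff_bounded)
  hence "(\<integral>\<^sup>+x. ennreal (gauss (\<delta> *\<^sub>R x::'a)) \<partial>lborel) < \<infinity>"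
    using assms by (subst (asm) lborel_nn_integral_affine[where c = "\<delta>" and t = 0])
      (auto simp: ennreal_mult_less_top ennreal_power)
  thus ?thesis by (subst integrable_iff_bounded) auto
qed

section \<open>The Fourier transform of integrable functions\<close>

text \<open>Both signs of the exponent are treated at once: \<open>s = -1\<close> is the Fourier transform
  and \<open>s = 1\<close> its inverse.\<close>

definition FT :: "real \<Rightarrow> ((real ^ 'n) \<Rightarrow> complex) \<Rightarrow> (real ^ 'n) \<Rightarrow> complex" where
  "FT s f \<xi> = of_real ((2 * pi) powr (- real CARD('n) / 2)) * (\<integral>x. cis (s * (x \<bullet> \<xi>)) * f x \<partial>lborel)"

lemma fourier_L1_FT: "fourier_L1 = FT (- 1)"
  by (simp add: fun_eq_iff fourier_L1_def FT_def)

lemma inv_fourier_L1_FT: "inv_fourier_L1 = FT 1"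
  by (simp add: fun_eq_iff inv_fourier_L1_def FT_def inner_commute)

lemma FT_measurable [measurable]:
  assumes [measurable]: "f \<in> borel_measurable lborel"
  shows "FT s f \<in> borel_measurable lborel"
proof -
  have [measurable]: "f \<in> borel_measurable borel" using assms by simp
  show ?thesis unfolding FT_def[abs_def] by measurable
qed

lemma cis_mult_integrable:
  fixes f :: "(real ^ 'n) \<Rightarrow> complex"
  assumes "integrable lborel f"
  shows "integrable lborel (\<lambda>x. cis (s * (x \<bullet> \<xi>)) * f x)"
proof -
  have [measurable]: "f \<in> borel_measurable borel"
    using borel_measurable_integrable[OF assms] by simp
  show ?thesis
    by (rule Bochner_Integration.integrable_bound[OF assms]) (auto simp: norm_mult)
qed

lemma FT_bound:
  fixes f :: "(real ^ 'n) \<Rightarrow> complex"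
  assumes "integrable lborel f"
  shows "cmod (FT s f \<xi>) \<le> (2 * pi) powr (- real CARD('n) / 2) * (\<integral>x. cmod (f x) \<partial>lborel)"
proof -
  have "cmod (\<integral>x. cis (s * (x \<bullet> \<xi>)) * f x \<partial>lborel) \<le> (\<integral>x. cmod (f x) \<partial>lborel)"
    using integral_norm_bound[of lborel "\<lambda>x. cis (s * (x \<bullet> \<xi>)) * f x"] by (simp add: norm_mult)
  thus ?thesis
    by (simp add: FT_def norm_mult mult_left_mono)
qed

lemma FT_add: "integrable lborel f \<Longrightarrow> integrable lborel g \<Longrightarrow> FT s (\<lambda>x. f x + g x) \<xi> = FT s f \<xi> + FT s g \<xi>"
  by (simp add: FT_def distrib_left cis_mult_integrable)

lemma FT_diff: "integrable lborel f \<Longrightarrow> integrable lborel g \<Longrightarrow> FT s (\<lambda>x. f x - g x) \<xi> = FT s f \<xi> - FT s g \<xi>"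
  by (simp add: FT_def right_diff_distrib cis_mult_integrable)

lemma FT_scaleR: "FT s (\<lambda>x. c *\<^sub>R f x) \<xi> = c *\<^sub>R FT s f \<xi>"
  by (simp add: FT_def scaleR_conv_of_real mult.left_commute)

lemma FT_cong_AE:
  assumes "AE x in lborel. f x = g x" "f \<in> borel_measurable lborel" "g \<in> borel_measurable lborel"
  shows "FT s f \<xi> = FT s g \<xi>"
proof -
  have [measurable]: "f \<in> borel_measurable borel" "g \<in> borel_measurable borel" using assms by auto
  have "(\<integral>x. cis (s * (x \<bullet> \<xi>)) * f x \<partial>lborel) = (\<integral>x. cis (s * (x \<bullet> \<xi>)) * g x \<partial>lborel)"
    by (rule integral_cong_AE) (use assms(1) in auto)
  thus ?thesis by (simp add: FT_def)
qed

lemma FT_gauss_integrable: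
  fixes f :: "(real ^ 'n) \<Rightarrow> complex"
  assumes "integrable lborel f" "\<delta> > 0"
  shows "integrable lborel (\<lambda>\<xi>. of_real (gauss (\<delta> *\<^sub>R \<xi>)) * FT s f \<xi>)"
proof -
  have [measurable]: "f \<in> borel_measurable lborel"
    using borel_measurable_integrable[OF assms(1)] .
  have [measurable]: "FT s f \<in> borel_measurable borel"
    using FT_measurable[of f s] by simp
  define K where "K = (2 * pi) powr (- real CARD('n) / 2) * (\<integral>x. cmod (f x) \<partial>lborel)"
  have K: "cmod (FT s f \<xi>) \<le> K" for \<xi>
    unfolding K_def by (rule FT_bound[OF assms(1)])
  have "integrable lborel (\<lambda>\<xi>::real^'n. gauss (\<delta> *\<^sub>R \<xi>) * K)"
    using gauss_scaled_integrable[OF assms(2), where 'a = "real^'n"] by (rule integrable_mult_left)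
  thus ?thesis
    by (rule Bochner_Integration.integrable_bound)
      (auto simp: norm_mult abs_mult intro!: mult_left_mono order_trans[OF K abs_ge_self])
qed

text \<open>The Gaussian factor makes the double integrand absolutely integrable. After Fubini the
  frequency integral is that of \<open>gauss_char_scaled\<close>, so the regularised double
  transform is a convolution with the heat kernel.\<close>

lemma FT_gauss_FT:
  fixes f :: "(real ^ 'n) \<Rightarrow> complex"
  assumes f: "integrable lborel f" and \<delta>: "\<delta> > 0" and s: "\<bar>s\<bar> = 1"
  shows "FT (- s) (\<lambda>\<xi>. of_real (gauss (\<delta> *\<^sub>R \<xi>)) * FT s f \<xi>) x
    = (\<integral>y. gauss_kernel \<delta> (x - y) *\<^sub>R f y \<partial>lborel)"
proof -
  have [measurable]: "f \<in> borel_measurable borel"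
    using borel_measurable_integrable[OF f] by simp
  define c :: complex where "c = of_real ((2 * pi) powr (- real CARD('n) / 2))"
  define g where "g \<xi> y = cis (- s * (\<xi> \<bullet> x)) * (of_real (gauss (\<delta> *\<^sub>R \<xi>)) * (cis (s * (y \<bullet> \<xi>)) * f y))" for \<xi> y :: "real^'n"
  have gm [measurable]: "case_prod g \<in> borel_measurable (lborel \<Otimes>\<^sub>M lborel)"
    unfolding g_def by measurable
  have gn: "cmod (g \<xi> y) = gauss (\<delta> *\<^sub>R \<xi>) * cmod (f y)" for \<xi> y
    by (simp add: g_def norm_mult)
  have gint: "integrable (lborel \<Otimes>\<^sub>M lborel) (case_prod g)"
  proof (rule lborel_pair.Fubini_integrable[OF gm])
    show "integrable lborel (\<lambda>\<xi>. \<integral>y. norm (case (\<xi>, y) of (\<xi>, y) \<Rightarrow> g \<xi> y) \<partial>lborel)"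
      using gauss_scaled_integrable[OF \<delta>, where 'a="real^'n"] by (simp add: gn)
    show "AE \<xi> in lborel. integrable lborel (\<lambda>y. case (\<xi>, y) of (\<xi>, y) \<Rightarrow> g \<xi> y)"
      unfolding g_def split_conv
      by (intro AE_I2 integrable_mult_right impI cis_mult_integrable f)
  qed
  have 1: "cis (- s * (\<xi> \<bullet> x)) * (of_real (gauss (\<delta> *\<^sub>R \<xi>)) * FT s f \<xi>) = c * (\<integral>y. g \<xi> y \<partial>lborel)" for \<xi>
    by (simp add: FT_def c_def g_def)
  have 2: "(\<integral>\<xi>. g \<xi> y \<partial>lborel) = f y * (\<integral>\<xi>. cis ((s *\<^sub>R (y - x)) \<bullet> \<xi>) * of_real (gauss (\<delta> *\<^sub>R \<xi>)) \<partial>lborel)" for y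
  proof -
    have "g \<xi> y = f y * (cis ((s *\<^sub>R (y - x)) \<bullet> \<xi>) * of_real (gauss (\<delta> *\<^sub>R \<xi>)))" for \<xi>
      by (simp add: g_def mult_ac cis_mult inner_diff_left inner_commute[of \<xi> x] right_diff_distrib)
    thus ?thesis by simp
  qed
  have sk: "gauss_kernel \<delta> (s *\<^sub>R (y - x)) = gauss_kernel \<delta> (x - y)" for y
  proof -
    have "s = 1 \<or> s = -1" using s by (auto simp: abs_if split: if_splits)
    thus ?thesis
    proof
      assume "s = 1" thus ?thesis by (simp add: gauss_kernel_commute)
    qed simp
  qed
  have c2: "c\<^sup>2 * (\<integral>\<xi>. cis (z \<bullet> \<xi>) * of_real (gauss (\<delta> *\<^sub>R \<xi>)) \<partial>lborel) = of_real (gauss_kernel \<delta> z)" for z :: "real^'n"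
    using gauss_char_scaled[OF \<delta>, of z] by (simp add: c_def)
  have "FT (- s) (\<lambda>\<xi>. of_real (gauss (\<delta> *\<^sub>R \<xi>)) * FT s f \<xi>) x = c * (\<integral>\<xi>. c * (\<integral>y. g \<xi> y \<partial>lborel) \<partial>lborel)"
    unfolding 1[symmetric] by (simp add: FT_def[of "-s"] c_def)
  also have "\<dots> = c\<^sup>2 * (\<integral>\<xi>. (\<integral>y. g \<xi> y \<partial>lborel) \<partial>lborel)"
    by (simp add: power2_eq_square)
  also have "(\<integral>\<xi>. (\<integral>y. g \<xi> y \<partial>lborel) \<partial>lborel) = (\<integral>y. (\<integral>\<xi>. g \<xi> y \<partial>lborel) \<partial>lborel)"
    using lborel_pair.Fubini_integral[OF gint] by simp
  also have "c\<^sup>2 * \<dots> = (\<integral>y. f y * (c\<^sup>2 * (\<integral>\<xi>. cis ((s *\<^sub>R (y - x)) \<bullet> \<xi>) * of_real (gauss (\<delta> *\<^sub>R \<xi>)) \<partial>lborel)) \<partial>lborel)"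
    unfolding 2 by (subst integral_mult_right_zero[symmetric]) (simp add: mult_ac)
  also have "\<dots> = (\<integral>y. gauss_kernel \<delta> (x - y) *\<^sub>R f y \<partial>lborel)"
    unfolding c2 sk by (simp add: scaleR_conv_of_real mult.commute)
  finally show ?thesis .
qed

text \<open>Pairing the regularised transform with the transform of \<open>f\<close> gives, by
  Fubini and \<open>FT_gauss_FT\<close>, the pairing of \<open>f\<close> with its convolution by the
  heat kernel.\<close>

lemma FT_L2_bound_gauss:
  fixes f :: "(real ^ 'n) \<Rightarrow> complex"
  assumes f: "integrable lborel f" "f \<in> Lp_space 2" and \<delta>: "\<delta> > 0" and s: "\<bar>s\<bar> = 1"
  shows "(\<integral>\<^sup>+\<xi>. ennreal (gauss (\<delta> *\<^sub>R \<xi>) * (cmod (FT s f \<xi>))\<^sup>2) \<partial>lborel)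
    \<le> (\<integral>\<^sup>+x. ennreal ((cmod (f x))\<^sup>2) \<partial>lborel)"
proof -
  have [measurable]: "f \<in> borel_measurable lborel" "f \<in> borel_measurable borel"
    using borel_measurable_integrable[OF f(1)] by simp_all
  have [measurable]: "FT s f \<in> borel_measurable borel"
    using FT_measurable[of f s] by simp
  define c :: complex where "c = of_real ((2 * pi) powr (- real CARD('n) / 2))"
  define e where "e \<xi> = of_real (gauss (\<delta> *\<^sub>R \<xi>)) * FT s f \<xi>" for \<xi>
  have e: "integrable lborel e"
    unfolding e_def by (rule FT_gauss_integrable[OF f(1) \<delta>])
  have [measurable]: "e \<in> borel_measurable borel"
    using borel_measurable_integrable[OF e] by simp
  define g where "g \<xi> x = e \<xi> * (c * (cis (- s * (x \<bullet> \<xi>)) * cnj (f x)))" for \<xi> x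
  have gm [measurable]: "case_prod g \<in> borel_measurable (lborel \<Otimes>\<^sub>M lborel)"
    unfolding g_def by measurable
  have fc: "integrable lborel (\<lambda>x. cnj (f x))" using f(1) by simp
  have gint: "integrable (lborel \<Otimes>\<^sub>M lborel) (case_prod g)"
  proof (rule lborel_pair.Fubini_integrable[OF gm])
    have "cmod (g \<xi> y) = cmod (e \<xi>) * (cmod c * cmod (f y))" for \<xi> y
      by (simp add: g_def norm_mult)
    thus "integrable lborel (\<lambda>\<xi>. \<integral>y. norm (case (\<xi>, y) of (\<xi>, y) \<Rightarrow> g \<xi> y) \<partial>lborel)"
      using e by simp
    show "AE \<xi> in lborel. integrable lborel (\<lambda>y. case (\<xi>, y) of (\<xi>, y) \<Rightarrow> g \<xi> y)"
      unfolding g_def split_conv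
      by (intro AE_I2 integrable_mult_right impI cis_mult_integrable fc)
  qed
  have cn: "cnj (FT s f \<xi>) = (\<integral>x. c * (cis (- s * (x \<bullet> \<xi>)) * cnj (f x)) \<partial>lborel)" for \<xi>
  proof -
    have "cnj (FT s f \<xi>) = c * (\<integral>x. cnj (cis (s * (x \<bullet> \<xi>)) * f x) \<partial>lborel)"
      unfolding FT_def complex_cnj_mult[of "of_real _"]
      by (subst Bochner_Integration.integral_cnj) (simp add: c_def)
    thus ?thesis by (simp add: cis_cnj)
  qed
  have g1: "(\<integral>x. g \<xi> x \<partial>lborel) = of_real (gauss (\<delta> *\<^sub>R \<xi>) * (cmod (FT s f \<xi>))\<^sup>2)" for \<xi>
  proof -
    have "(\<integral>x. g \<xi> x \<partial>lborel) = e \<xi> * cnj (FT s f \<xi>)"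
      unfolding g_def cn by simp
    thus ?thesis unfolding of_real_mult complex_norm_square e_def by (simp add: mult_ac)
  qed
  define h where "h x = (\<integral>y. gauss_kernel \<delta> (x - y) *\<^sub>R f y \<partial>lborel)" for x
  have g2: "(\<integral>\<xi>. g \<xi> x \<partial>lborel) = cnj (f x) * h x" for x
  proof -
    have "(\<integral>\<xi>. g \<xi> x \<partial>lborel) = cnj (f x) * (c * (\<integral>\<xi>. cis (- s * (\<xi> \<bullet> x)) * e \<xi> \<partial>lborel))"
      by (subst integral_mult_right_zero[symmetric])+ (simp add: g_def mult_ac inner_commute)
    also have "c * (\<integral>\<xi>. cis (- s * (\<xi> \<bullet> x)) * e \<xi> \<partial>lborel) = FT (- s) e x"
      by (simp add: FT_def c_def)
    also have "\<dots> = h x"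
      unfolding e_def h_def by (rule FT_gauss_FT[OF f(1) \<delta> s])
    finally show ?thesis .
  qed
  have int1: "integrable lborel (\<lambda>\<xi>. of_real (gauss (\<delta> *\<^sub>R \<xi>) * (cmod (FT s f \<xi>))\<^sup>2) :: complex)"
    using lborel_pair.integrable_fst'[OF gint] by (simp add: g1)
  hence int2: "integrable lborel (\<lambda>\<xi>. gauss (\<delta> *\<^sub>R \<xi>) * (cmod (FT s f \<xi>))\<^sup>2)"
    by (simp only: integrable_of_real_iff)
  have "of_real (\<integral>\<xi>. gauss (\<delta> *\<^sub>R \<xi>) * (cmod (FT s f \<xi>))\<^sup>2 \<partial>lborel) = (\<integral>\<xi>. (\<integral>x. g \<xi> x \<partial>lborel) \<partial>lborel)"
    unfolding g1 by (rule integral_complex_of_real[symmetric])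
  also have "\<dots> = (\<integral>x. cnj (f x) * h x \<partial>lborel)"
    using lborel_pair.Fubini_integral[OF gint] by (simp add: g2)
  finally have eq: "complex_of_real (\<integral>\<xi>. gauss (\<delta> *\<^sub>R \<xi>) * (cmod (FT s f \<xi>))\<^sup>2 \<partial>lborel) = (\<integral>x. cnj (f x) * h x \<partial>lborel)" .
  have "(\<integral>\<^sup>+\<xi>. ennreal (gauss (\<delta> *\<^sub>R \<xi>) * (cmod (FT s f \<xi>))\<^sup>2) \<partial>lborel)
      = ennreal (\<integral>\<xi>. gauss (\<delta> *\<^sub>R \<xi>) * (cmod (FT s f \<xi>))\<^sup>2 \<partial>lborel)"
    by (rule nn_integral_eq_integral[OF int2]) auto
  also have "\<dots> = ennreal (cmod (complex_of_real (\<integral>\<xi>. gauss (\<delta> *\<^sub>R \<xi>) * (cmod (FT s f \<xi>))\<^sup>2 \<partial>lborel)))"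
    by (subst norm_of_real, subst abs_of_nonneg) auto
  also have "\<dots> = ennreal (cmod (\<integral>x. cnj (f x) * h x \<partial>lborel))"
    unfolding eq ..
  also have "\<dots> \<le> (\<integral>\<^sup>+x. ennreal (cmod (cnj (f x) * h x)) \<partial>lborel)"
    by (rule integral_norm_bound_ennreal)
      (use lborel_pair.integrable_snd[OF gint] in \<open>simp add: g2\<close>)
  \<comment> \<open>A symmetric Young inequality: |f x| |f y| is at most half the sum of squares,
    and each half is integrated against a kernel of mass 1.\<close>
  also have "\<dots> \<le> (\<integral>\<^sup>+x. (\<integral>\<^sup>+y. (ennreal ((cmod (f x))\<^sup>2 / 2) + ennreal ((cmod (f y))\<^sup>2 / 2)) * ennreal (gauss_kernel \<delta> (x - y)) \<partial>lborel) \<partial>lborel)"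
  proof (rule nn_integral_mono)
    fix x
    have bd: "integrable lborel (\<lambda>y. gauss_kernel \<delta> (x - y) *\<^sub>R f y)"
    proof -
      have "gauss_kernel \<delta> z \<le> (2 * pi) powr (- real CARD('n) / 2) * \<delta> powr (- real CARD('n))" for z :: "real^'n"
        using mult_left_mono[OF gauss_le_1[of "z /\<^sub>R \<delta>"], of "(2 * pi) powr (- real CARD('n) / 2) * \<delta> powr (- real CARD('n))"]
        by (simp add: gauss_kernel_def)
      hence gk: "norm (gauss_kernel \<delta> (x - y) *\<^sub>R f y)
          \<le> norm (((2 * pi) powr (- real CARD('n) / 2) * \<delta> powr (- real CARD('n))) *\<^sub>R f y)" for y
        using mult_right_mono[of "gauss_kernel \<delta> (x - y)" "(2 * pi) powr (- real CARD('n) / 2) * \<delta> powr (- real CARD('n))" "cmod (f y)"]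
        by simp
      show ?thesis
        by (rule Bochner_Integration.integrable_bound[OF integrable_scaleR_right[OF f(1)] _ AE_I2[OF gk]])
          measurable
    qed
    have "ennreal (cmod (cnj (f x) * h x)) = ennreal (cmod (f x)) * ennreal (cmod (h x))"
      by (simp add: norm_mult ennreal_mult')
    also have "ennreal (cmod (h x)) \<le> (\<integral>\<^sup>+y. ennreal (cmod (gauss_kernel \<delta> (x - y) *\<^sub>R f y)) \<partial>lborel)"
      unfolding h_def by (rule integral_norm_bound_ennreal[OF bd])
    also have "ennreal (cmod (f x)) * \<dots> = (\<integral>\<^sup>+y. ennreal (cmod (f x) * cmod (f y) * gauss_kernel \<delta> (x - y)) \<partial>lborel)"
      by (subst nn_integral_cmult[symmetric]) (auto simp: ennreal_mult'[symmetric] mult_ac)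
    also have "\<dots> \<le> (\<integral>\<^sup>+y. (ennreal ((cmod (f x))\<^sup>2 / 2) + ennreal ((cmod (f y))\<^sup>2 / 2)) * ennreal (gauss_kernel \<delta> (x - y)) \<partial>lborel)"
    proof (rule nn_integral_mono)
      fix y
      have "cmod (f x) * cmod (f y) \<le> (cmod (f x))\<^sup>2 / 2 + (cmod (f y))\<^sup>2 / 2"
        using sum_squares_bound[of "cmod (f x)" "cmod (f y)"] by simp
      hence "cmod (f x) * cmod (f y) * gauss_kernel \<delta> (x - y) \<le> ((cmod (f x))\<^sup>2 / 2 + (cmod (f y))\<^sup>2 / 2) * gauss_kernel \<delta> (x - y)"
        by (intro mult_right_mono) auto
      hence "ennreal (cmod (f x) * cmod (f y) * gauss_kernel \<delta> (x - y))
         \<le> ennreal (((cmod (f x))\<^sup>2 / 2 + (cmod (f y))\<^sup>2 / 2) * gauss_kernel \<delta> (x - y))"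
        by (rule ennreal_leI)
      also have "\<dots> = (ennreal ((cmod (f x))\<^sup>2 / 2) + ennreal ((cmod (f y))\<^sup>2 / 2)) * ennreal (gauss_kernel \<delta> (x - y))"
        by (simp add: ennreal_mult' ennreal_plus)
      finally show "ennreal (cmod (f x) * cmod (f y) * gauss_kernel \<delta> (x - y))
         \<le> (ennreal ((cmod (f x))\<^sup>2 / 2) + ennreal ((cmod (f y))\<^sup>2 / 2)) * ennreal (gauss_kernel \<delta> (x - y))" .
    qed
    finally show "ennreal (cmod (cnj (f x) * h x)) \<le> (\<integral>\<^sup>+y. (ennreal ((cmod (f x))\<^sup>2 / 2) + ennreal ((cmod (f y))\<^sup>2 / 2)) * ennreal (gauss_kernel \<delta> (x - y)) \<partial>lborel)"
      by (simp add: mult_left_mono)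
  qed
  also have "\<dots> = (\<integral>\<^sup>+x. (\<integral>\<^sup>+y. ennreal ((cmod (f x))\<^sup>2 / 2) * ennreal (gauss_kernel \<delta> (x - y)) \<partial>lborel) \<partial>lborel)
     + (\<integral>\<^sup>+x. (\<integral>\<^sup>+y. ennreal ((cmod (f y))\<^sup>2 / 2) * ennreal (gauss_kernel \<delta> (x - y)) \<partial>lborel) \<partial>lborel)"
    by (subst nn_integral_add[symmetric], measurable) (simp add: nn_integral_add[symmetric] distrib_right)
  also have "(\<integral>\<^sup>+x. (\<integral>\<^sup>+y. ennreal ((cmod (f y))\<^sup>2 / 2) * ennreal (gauss_kernel \<delta> (x - y)) \<partial>lborel) \<partial>lborel)
      = (\<integral>\<^sup>+y. (\<integral>\<^sup>+x. ennreal ((cmod (f y))\<^sup>2 / 2) * ennreal (gauss_kernel \<delta> (y - x)) \<partial>lborel) \<partial>lborel)"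
    by (subst lborel_pair.Fubini') (auto simp: gauss_kernel_commute)
  also have "(\<integral>\<^sup>+x. (\<integral>\<^sup>+y. ennreal ((cmod (f x))\<^sup>2 / 2) * ennreal (gauss_kernel \<delta> (x - y)) \<partial>lborel) \<partial>lborel)
       + \<dots> = (\<integral>\<^sup>+x. ennreal ((cmod (f x))\<^sup>2 / 2) \<partial>lborel) + (\<integral>\<^sup>+x. ennreal ((cmod (f x))\<^sup>2 / 2) \<partial>lborel)"
    by (simp add: nn_integral_cmult gauss_kernel_nn_integral[OF \<delta>])
  also have "\<dots> = (\<integral>\<^sup>+x. ennreal ((cmod (f x))\<^sup>2) \<partial>lborel)"
    by (subst nn_integral_add[symmetric]) (auto simp: ennreal_plus[symmetric] simp del: ennreal_plus)
  finally show ?thesis .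
qed

text \<open>Fatou's lemma removes the Gaussian as \<delta> -> 0. Only a contraction is obtained
  here; equality of norms comes from inversion, in \<open>norm_fop\<close>.\<close>

lemma FT_L2_bound:
  fixes f :: "(real ^ 'n) \<Rightarrow> complex"
  assumes f: "integrable lborel f" "f \<in> Lp_space 2" and s: "\<bar>s\<bar> = 1"
  shows "(\<integral>\<^sup>+\<xi>. ennreal ((cmod (FT s f \<xi>))\<^sup>2) \<partial>lborel) \<le> (\<integral>\<^sup>+x. ennreal ((cmod (f x))\<^sup>2) \<partial>lborel)"
proof -
  have [measurable]: "f \<in> borel_measurable lborel"
    using borel_measurable_integrable[OF f(1)] by simp_all
  have [measurable]: "FT s f \<in> borel_measurable borel"
    using FT_measurable[of f s] by simp
  define \<delta> where "\<delta> k = 1 / real (Suc k)" for k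
  have \<delta>: "\<delta> k > 0" for k by (simp add: \<delta>_def)
  have \<delta>0: "\<delta> \<longlonglongrightarrow> 0" unfolding \<delta>_def by (rule LIMSEQ_Suc) (rule lim_1_over_n)
  have lim: "(\<lambda>k. ennreal (gauss (\<delta> k *\<^sub>R \<xi>) * (cmod (FT s f \<xi>))\<^sup>2)) \<longlonglongrightarrow> ennreal ((cmod (FT s f \<xi>))\<^sup>2)" for \<xi>
  proof -
    have "(\<lambda>k. gauss (\<delta> k *\<^sub>R \<xi>)) \<longlonglongrightarrow> exp (- (norm (0 *\<^sub>R \<xi>))\<^sup>2 / 2)"
      unfolding gauss_def by (intro tendsto_intros \<delta>0) auto
    hence "(\<lambda>k. gauss (\<delta> k *\<^sub>R \<xi>)) \<longlonglongrightarrow> 1" by simp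
    from tendsto_mult[OF this tendsto_const[of "(cmod (FT s f \<xi>))\<^sup>2"]] show ?thesis
      by (intro tendsto_ennrealI) simp
  qed
  have "(\<integral>\<^sup>+\<xi>. ennreal ((cmod (FT s f \<xi>))\<^sup>2) \<partial>lborel)
      = (\<integral>\<^sup>+\<xi>. liminf (\<lambda>k. ennreal (gauss (\<delta> k *\<^sub>R \<xi>) * (cmod (FT s f \<xi>))\<^sup>2)) \<partial>lborel)"
    by (rule nn_integral_cong) (rule lim_imp_Liminf[symmetric, OF _ lim], simp)
  also have "\<dots> \<le> liminf (\<lambda>k. \<integral>\<^sup>+\<xi>. ennreal (gauss (\<delta> k *\<^sub>R \<xi>) * (cmod (FT s f \<xi>))\<^sup>2) \<partial>lborel)"
    by (rule nn_integral_liminf) measurable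
  also have "\<dots> \<le> (\<integral>\<^sup>+x. ennreal ((cmod (f x))\<^sup>2) \<partial>lborel)"
    by (intro Liminf_le always_eventually allI FT_L2_bound_gauss f \<delta> s) simp
  finally show ?thesis .
qed

section \<open>The Fourier transform on the Hilbert space\<close>

lemma FT_in_Lp:
  fixes f :: "(real ^ 'n) \<Rightarrow> complex"
  assumes "integrable lborel f" "f \<in> Lp_space 2" "\<bar>s\<bar> = 1"
  shows "FT s f \<in> Lp_space 2"
  using FT_L2_bound[OF assms] assms(2) FT_measurable[of f s]
  by (auto simp: Lp_space_2_iff_nn)

lemma norm_FT_le:
  fixes f :: "(real ^ 'n) \<Rightarrow> complex"
  assumes "integrable lborel f" "f \<in> Lp_space 2" "\<bar>s\<bar> = 1"
  shows "norm (abs_l2 (FT s f)) \<le> norm (abs_l2 f)"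
  by (rule norm_l2_leI[OF FT_in_Lp[OF assms]])
    (use FT_L2_bound[OF assms] assms(2) in \<open>auto simp: ennreal_norm_abs_l2_sq\<close>)

lemma norm_FT_diff_le:
  fixes f g :: "(real ^ 'n) \<Rightarrow> complex"
  assumes f: "integrable lborel f" "f \<in> Lp_space 2" and g: "integrable lborel g" "g \<in> Lp_space 2"
    and s: "\<bar>s\<bar> = 1"
  shows "norm (abs_l2 (FT s f) - abs_l2 (FT s g)) \<le> norm (abs_l2 f - abs_l2 g)"
proof -
  have "abs_l2 (FT s f) - abs_l2 (FT s g) = abs_l2 (\<lambda>\<xi>. FT s f \<xi> - FT s g \<xi>)"
    by (rule abs_l2_diff[symmetric]) (rule FT_in_Lp f g s)+
  also have "\<dots> = abs_l2 (FT s (\<lambda>x. f x - g x))"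
    using FT_diff[OF f(1) g(1), of s] by (intro arg_cong[of _ _ abs_l2]) (simp add: fun_eq_iff)
  finally show ?thesis
    using norm_FT_le[of "\<lambda>x. f x - g x" s] f g s by (simp add: abs_l2_diff Lp_space_2_diff)
qed

section \<open>Extension of the transform from truncations to all of L^2\<close>

definition trunc :: "real \<Rightarrow> 'a::euclidean_space l2 \<Rightarrow> 'a \<Rightarrow> complex" where
  "trunc R v = (\<lambda>x. indicator (ball 0 R) x * rep_l2 v x)"

lemma bounded_symbol_indicator: "A \<in> sets borel \<Longrightarrow> bounded_symbol (indicator A) 1"
  by (auto simp: bounded_symbol_def indicator_def)

lemma trunc_in_Lp [simp]: "trunc R v \<in> Lp_space 2"
  unfolding trunc_def by (rule mul_in_Lp[OF bounded_symbol_indicator]) simp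

lemma abs_trunc: "abs_l2 (trunc R v) = mul (indicator (ball 0 R)) v"
  by (simp add: trunc_def mul_def)

lemma integrable_indicator_mult_L2:
  fixes f :: "'a::euclidean_space \<Rightarrow> complex"
  assumes f: "f \<in> Lp_space 2" and A: "A \<in> sets borel" "emeasure lborel A < \<infinity>"
  shows "integrable lborel (\<lambda>x. indicator A x * f x)"
proof -
  have [measurable]: "f \<in> borel_measurable lborel" "A \<in> sets lborel"
    using f A by (auto dest: Lp_space_measurable)
  have "integrable lborel (\<lambda>x. indicator A x + (cmod (f x))\<^sup>2 :: real)"
    using f A by (intro Bochner_Integration.integrable_add Lp_space_2_integrable) auto
  thus ?thesis
  proof (rule Bochner_Integration.integrable_bound)
    have "cmod (f x) \<le> 1 + (cmod (f x))\<^sup>2" for x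
      using sum_squares_bound[of 1 "cmod (f x)"] norm_ge_zero[of "f x"] unfolding power_one by linarith
    thus "AE x in lborel. norm (indicator A x * f x) \<le> norm (indicator A x + (cmod (f x))\<^sup>2 :: real)"
      by (auto simp: indicator_def)
  qed measurable
qed

lemma trunc_measurable [measurable]: "trunc R v \<in> borel_measurable lborel"
  by (rule Lp_space_measurable[OF trunc_in_Lp])

lemma indicator_in_Lp:
  fixes A :: "'a::euclidean_space set"
  assumes A: "A \<in> sets borel" "emeasure lborel A < \<infinity>"
  shows "(\<lambda>x. indicator A x * u) \<in> Lp_space 2"
proof -
  have [measurable]: "A \<in> sets lborel" using A by simp
  have "(\<integral>\<^sup>+x. ennreal ((cmod (indicator A x * u))\<^sup>2) \<partial>lborel) = (\<integral>\<^sup>+x. ennreal ((cmod u)\<^sup>2) * indicator A x \<partial>lborel)"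
    by (rule nn_integral_cong) (auto simp: indicator_def)
  also have "\<dots> < \<infinity>"
    using A by (simp add: nn_integral_cmult_indicator ennreal_mult_less_top)
  finally show ?thesis by (simp add: Lp_space_2_iff_nn)
qed

lemma emeasure_lborel_cbox_less_top: "emeasure lborel (cbox a b) < \<infinity>"
  by (rule emeasure_bounded_finite[OF bounded_cbox])

lemma integrable_indicator_cbox: "integrable lborel (indicator (cbox a b) :: 'a::euclidean_space \<Rightarrow> real)"
  using emeasure_lborel_cbox_less_top[of a b] by (intro integrable_real_indicator) auto

lemma trunc_integrable [simp]: "integrable lborel (trunc R v)"
  unfolding trunc_def by (rule integrable_indicator_mult_L2[OF l2_fun_in _ emeasure_lborel_ball_finite]) simp

lemma abs_trunc_tendsto:
  fixes v :: "'a::euclidean_space l2"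
  shows "((\<lambda>R. abs_l2 (trunc R v)) \<longlongrightarrow> v) at_top"
proof (rule tendsto_at_topI_sequentially)
  fix X :: "nat \<Rightarrow> real" assume X: "filterlim X at_top sequentially"
  have "(\<lambda>n. mul (indicator (ball 0 (X n))) v) \<longlonglongrightarrow> mul (\<lambda>_. 1) v"
  proof (rule mul_tendsto[where C = 1])
    have "(\<lambda>n. indicator (ball 0 (X n)) x :: complex) \<longlonglongrightarrow> 1" for x :: 'a
    proof (rule tendsto_eventually)
      have "\<forall>\<^sub>F n in sequentially. X n > norm x"
        using X by (simp add: filterlim_at_top_dense)
      thus "\<forall>\<^sub>F n in sequentially. indicator (ball 0 (X n)) x = (1::complex)"
        by eventually_elim (simp add: indicator_def)
    qed
    thus "AE x :: 'a in lborel. (\<lambda>n. indicator (ball 0 (X n)) x :: complex) \<longlonglongrightarrow> 1"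
      by (rule AE_I2)
    show "bounded_symbol (indicator (ball 0 (X n))) 1" for n
      by (rule bounded_symbol_indicator) simp
  qed (simp add: bounded_symbol_def)
  thus "(\<lambda>n. abs_l2 (trunc (X n) v)) \<longlonglongrightarrow> v"
    by (simp add: abs_trunc) (simp add: mul_def)
qed

definition ftr :: "real \<Rightarrow> real \<Rightarrow> (real ^ 'n) l2 \<Rightarrow> (real ^ 'n) l2" where
  "ftr s R v = abs_l2 (FT s (trunc R v))"

text \<open>A limit along integer radii suffices to define the operator; \<open>ftr_tendsto\<close>
  recovers the limit along all radii that \<open>L2_extension\<close> asks for.\<close>

definition fop :: "real \<Rightarrow> (real ^ 'n) l2 \<Rightarrow> (real ^ 'n) l2" where
  "fop s v = lim (\<lambda>k::nat. ftr s (real k) v)"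

context
  fixes s :: real
  assumes s: "\<bar>s\<bar> = 1"
begin

lemma ftr_seq_tendsto: "(\<lambda>k. ftr s (real k) v) \<longlonglongrightarrow> fop s v"
proof -
  have "(\<lambda>k::nat. abs_l2 (trunc (real k) v)) \<longlonglongrightarrow> v"
    using filterlim_compose[OF abs_trunc_tendsto filterlim_real_sequentially, of v] by simp
  hence "Cauchy (\<lambda>k::nat. abs_l2 (trunc (real k) v))"
    by (rule LIMSEQ_imp_Cauchy)
  hence "Cauchy (\<lambda>k. ftr s (real k) v)"
    unfolding Cauchy_iff ftr_def
    by (meson le_less_trans norm_FT_diff_le trunc_integrable trunc_in_Lp s)
  thus ?thesis
    by (simp add: fop_def Cauchy_convergent_iff convergent_LIMSEQ_iff)
qed

lemma norm_ftr_fop_le: "norm (ftr s R v - fop s v) \<le> norm (abs_l2 (trunc R v) - v)"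
proof (rule LIMSEQ_le)
  show "(\<lambda>k. norm (ftr s R v - ftr s (real k) v)) \<longlonglongrightarrow> norm (ftr s R v - fop s v)"
    by (intro tendsto_intros ftr_seq_tendsto)
  show "(\<lambda>k. norm (abs_l2 (trunc R v) - abs_l2 (trunc (real k) v))) \<longlonglongrightarrow> norm (abs_l2 (trunc R v) - v)"
    by (intro tendsto_intros filterlim_compose[OF abs_trunc_tendsto filterlim_real_sequentially])
  show "\<exists>N. \<forall>n\<ge>N. norm (ftr s R v - ftr s (real n) v) \<le> norm (abs_l2 (trunc R v) - abs_l2 (trunc (real n) v))"
    unfolding ftr_def by (intro exI allI impI norm_FT_diff_le trunc_integrable trunc_in_Lp s)
qed

lemma ftr_tendsto: "((\<lambda>R. ftr s R v) \<longlongrightarrow> fop s v) at_top"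
proof -
  have "((\<lambda>R. norm (abs_l2 (trunc R v) - v)) \<longlongrightarrow> norm (v - v)) at_top"
    by (intro tendsto_intros abs_trunc_tendsto)
  hence "((\<lambda>R. ftr s R v - fop s v) \<longlongrightarrow> 0) at_top"
    by (intro Lim_null_comparison[of "\<lambda>R. ftr s R v - fop s v" "\<lambda>R. norm (abs_l2 (trunc R v) - v)"]
        always_eventually allI norm_ftr_fop_le) simp
  thus ?thesis by (simp add: LIM_zero_iff)
qed

lemma fop_add: "fop s (v + w) = fop s v + fop s w"
proof (rule LIMSEQ_unique[OF ftr_seq_tendsto])
  have "ftr s R (v + w) = ftr s R v + ftr s R w" for R
  proof -
    have "AE x in lborel. trunc R (v + w) x = trunc R v x + trunc R w x"
      using rep_l2_add[of v w] by eventually_elim (simp add: trunc_def algebra_simps)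
    hence "FT s (trunc R (v + w)) \<xi> = FT s (\<lambda>x. trunc R v x + trunc R w x) \<xi>" for \<xi>
      by (rule FT_cong_AE) measurable
    hence "FT s (trunc R (v + w)) = (\<lambda>\<xi>. FT s (trunc R v) \<xi> + FT s (trunc R w) \<xi>)"
      by (simp add: fun_eq_iff FT_add)
    thus ?thesis
      by (simp add: ftr_def abs_l2_add FT_in_Lp s)
  qed
  thus "(\<lambda>k. ftr s (real k) (v + w)) \<longlonglongrightarrow> fop s v + fop s w"
    using tendsto_add[OF ftr_seq_tendsto ftr_seq_tendsto] by simp
qed

lemma fop_scaleR: "fop s (c *\<^sub>R v) = c *\<^sub>R fop s v"
proof (rule LIMSEQ_unique[OF ftr_seq_tendsto])
  have "ftr s R (c *\<^sub>R v) = c *\<^sub>R ftr s R v" for R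
  proof -
    have "AE x in lborel. trunc R (c *\<^sub>R v) x = c *\<^sub>R trunc R v x"
      using rep_l2_scaleR[of c v] by eventually_elim (simp add: trunc_def)
    hence "FT s (trunc R (c *\<^sub>R v)) \<xi> = FT s (\<lambda>x. c *\<^sub>R trunc R v x) \<xi>" for \<xi>
      by (rule FT_cong_AE) measurable
    hence "FT s (trunc R (c *\<^sub>R v)) = (\<lambda>\<xi>. c *\<^sub>R FT s (trunc R v) \<xi>)"
      by (simp add: fun_eq_iff FT_scaleR)
    thus ?thesis
      by (simp add: ftr_def abs_l2_scaleR FT_in_Lp s del: scaleR_conv_of_real)
  qed
  thus "(\<lambda>k. ftr s (real k) (c *\<^sub>R v)) \<longlonglongrightarrow> c *\<^sub>R fop s v"
    using tendsto_scaleR[OF tendsto_const ftr_seq_tendsto] by simp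
qed

lemma norm_fop_le: "norm (fop s v) \<le> norm v"
proof (rule LIMSEQ_le[OF tendsto_norm[OF ftr_seq_tendsto]])
  show "(\<lambda>k. norm (abs_l2 (trunc (real k) v))) \<longlonglongrightarrow> norm v"
    by (intro tendsto_norm filterlim_compose[OF abs_trunc_tendsto filterlim_real_sequentially])
  show "\<exists>N. \<forall>n\<ge>N. norm (ftr s (real n) v) \<le> norm (abs_l2 (trunc (real n) v))"
    unfolding ftr_def by (intro exI allI impI norm_FT_le trunc_integrable trunc_in_Lp s)
qed

lemma bounded_linear_fop: "bounded_linear (fop s)"
  by (rule bounded_linear_intro[where K = 1]) (auto simp: fop_add fop_scaleR norm_fop_le)

lemma fop_diff: "fop s (v - w) = fop s v - fop s w"
  by (rule linear_diff[OF bounded_linear.linear[OF bounded_linear_fop]])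

text \<open>Consistency on L^1 \<inter> L^2: the truncations converge in L^2 and the integral
  transform is a contraction there, so its values converge to the transform of \<open>f\<close>
  itself.\<close>

lemma fop_abs_l2:
  assumes f: "integrable lborel f" "f \<in> Lp_space 2"
  shows "fop s (abs_l2 f) = abs_l2 (FT s f)"
proof (rule LIMSEQ_unique[OF ftr_seq_tendsto])
  have "(\<lambda>k::nat. norm (abs_l2 (trunc (real k) (abs_l2 f)) - abs_l2 f)) \<longlonglongrightarrow> norm (abs_l2 f - abs_l2 f)"
    by (intro tendsto_intros filterlim_compose[OF abs_trunc_tendsto filterlim_real_sequentially])
  hence "(\<lambda>k::nat. ftr s (real k) (abs_l2 f) - abs_l2 (FT s f)) \<longlonglongrightarrow> 0"
    unfolding ftr_def
    by (intro Lim_null_comparison[of "\<lambda>k. abs_l2 (FT s (trunc (real k) (abs_l2 f))) - abs_l2 (FT s f)"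
          "\<lambda>k. norm (abs_l2 (trunc (real k) (abs_l2 f)) - abs_l2 f)"] always_eventually allI
        norm_FT_diff_le f s trunc_integrable trunc_in_Lp) simp
  thus "(\<lambda>k. ftr s (real k) (abs_l2 f)) \<longlonglongrightarrow> abs_l2 (FT s f)"
    by (simp add: LIM_zero_iff)
qed

end

text \<open>Orthogonality to boxes makes all box integrals vanish, and Lebesgue differentiation
  along shrinking cubes then gives 0 almost everywhere.\<close>

lemma l2_eq_0_boxI:
  fixes v :: "'a::euclidean_space l2"
  assumes v: "\<And>a b u. v \<bullet> abs_l2 (\<lambda>x. indicator (cbox a b) x * u) = 0"
  shows "v = 0"
proof -
  define D where "D = rep_l2 v"
  have D: "D \<in> Lp_space 2" by (simp add: D_def)
  hence [measurable]: "D \<in> borel_measurable lborel" by (rule Lp_space_measurable)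
  have int: "integrable lborel (\<lambda>x. indicator (cbox a b) x * D x)" for a b
    by (rule integrable_indicator_mult_L2[OF D _ emeasure_lborel_cbox_less_top]) simp
  have si: "set_integrable lborel (cbox a b) D" for a b
  proof -
    have "(\<lambda>x. indicator (cbox a b) x *\<^sub>R D x) = (\<lambda>x. indicator (cbox a b) x * D x)"
      by (auto simp: indicator_def)
    thus ?thesis using int[of a b] by (simp add: set_integrable_def)
  qed
  have zero: "(\<integral>x. indicator (cbox a b) x * D x \<partial>lborel) = 0" for a b
  proof -
    define I where "I = (\<integral>x. indicator (cbox a b) x * D x \<partial>lborel)"
    have ind: "(\<lambda>x. indicator (cbox a b) x * I) \<in> Lp_space 2"
      by (rule indicator_in_Lp[OF _ emeasure_lborel_cbox_less_top]) simp
    \<comment> \<open>The inner product is real, so a single direction \<open>u\<close> would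
      control only one component of the integral; the choice \<open>u = I\<close> yields |I|^2 =
      0.\<close>
    have "I \<bullet> I = (\<integral>x. (indicator (cbox a b) x * D x) \<bullet> I \<partial>lborel)"
      unfolding I_def[of ] by (subst integral_inner_left) (use int in auto)
    also have "\<dots> = (\<integral>x. D x \<bullet> (indicator (cbox a b) x * I) \<partial>lborel)"
      by (rule Bochner_Integration.integral_cong) (auto simp: indicator_def)
    also have "\<dots> = (\<integral>x. D x \<bullet> rep_l2 (abs_l2 (\<lambda>x. indicator (cbox a b) x * I)) x \<partial>lborel)"
      by (rule integral_cong_AE) (use rep_abs_l2[OF ind] in auto)
    also have "\<dots> = v \<bullet> abs_l2 (\<lambda>x. indicator (cbox a b) x * I)"
      by (simp add: inner_l2.rep_eq D_def)
    also have "\<dots> = 0" by (rule v)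
    finally show ?thesis unfolding I_def by simp
  qed
  have zero': "integral (cbox a b) D = 0" for a b
  proof -
    have "integral (cbox a b) D = (\<integral>x. indicator (cbox a b) x *\<^sub>R D x \<partial>lborel)"
      using set_borel_integral_eq_integral(2)[OF si, of a b] by (simp add: set_lebesgue_integral_def)
    also have "\<dots> = (\<integral>x. indicator (cbox a b) x * D x \<partial>lborel)"
      by (rule Bochner_Integration.integral_cong) (auto simp: indicator_def)
    finally show ?thesis using zero by simp
  qed
  obtain N where N: "negligible N"
    "\<And>x e. x \<notin> N \<Longrightarrow> 0 < e \<Longrightarrow> \<exists>d>0. \<forall>h. 0 < h \<and> h < d \<longrightarrow>
        norm (integral (cbox x (x + h *\<^sub>R One)) D /\<^sub>R h ^ DIM('a) - D x) < e"
    using integrable_ccontinuous_explicit[of D, OF set_borel_integral_eq_integral(1)[OF si]] by metis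
  have "{x. D x \<noteq> 0} \<subseteq> N"
  proof (rule subsetI, rule ccontr)
    fix x assume x: "x \<in> {x. D x \<noteq> 0}" "x \<notin> N"
    then obtain d where d: "d > 0" "\<forall>h. 0 < h \<and> h < d \<longrightarrow>
        norm (integral (cbox x (x + h *\<^sub>R One)) D /\<^sub>R h ^ DIM('a) - D x) < norm (D x)"
      using N(2)[of x "norm (D x)"] by (metis (mono_tags) zero_less_norm_iff mem_Collect_eq)
    thus False using spec[OF d(2), of "d/2"] by (simp add: zero')
  qed
  hence "negligible {x. D x \<noteq> 0}"
    using N(1) negligible_subset by blast
  moreover have "{x. D x \<noteq> 0} \<in> sets lborel"
    by measurable
  ultimately have "{x. D x \<noteq> 0} \<in> null_sets lborel"
    by (simp add: negligible_iff_null_sets null_sets_completion_iff)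
  hence "AE x in lborel. D x = 0"
    by (rule AE_I') auto
  from this rep_l2_zero have "AE x in lborel. rep_l2 v x = rep_l2 0 x"
    unfolding D_def by eventually_elim simp
  thus ?thesis by (rule l2_eqI)
qed

text \<open>Off the boundary the indicator is locally constant, so for each fixed \<open>z\<close>
  the integrand is eventually constant; the Gaussian dominates.\<close>

lemma gauss_conv_box_tendsto:
  fixes \<delta> :: "nat \<Rightarrow> real" and y :: "'a::euclidean_space"
  assumes \<delta>: "\<And>k. \<delta> k > 0" "\<delta> \<longlonglongrightarrow> 0" and y: "y \<notin> frontier (cbox a b)"
  shows "(\<lambda>k. \<integral>x. gauss_kernel (\<delta> k) (y - x) * indicator (cbox a b) x \<partial>lborel) \<longlonglongrightarrow> indicator (cbox a b) y"
proof -
  have "(\<lambda>k. \<integral>z. gauss z * indicator (cbox a b) (y - \<delta> k *\<^sub>R z) \<partial>lborel)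
      \<longlonglongrightarrow> (\<integral>z. gauss z * indicator (cbox a b) y \<partial>(lborel :: 'a measure))"
  proof (rule integral_dominated_convergence[where w = gauss])
    show "AE z in lborel. (\<lambda>k. gauss z * indicator (cbox a b) (y - \<delta> k *\<^sub>R z)) \<longlonglongrightarrow> gauss z * indicator (cbox a b) y"
    proof (rule AE_I2)
      fix z :: 'a
      have "(\<lambda>k. y - \<delta> k *\<^sub>R z) \<longlonglongrightarrow> y - 0 *\<^sub>R z"
        by (intro tendsto_intros \<delta>)
      hence t: "(\<lambda>k. y - \<delta> k *\<^sub>R z) \<longlonglongrightarrow> y" by simp
      have "\<forall>\<^sub>F k in sequentially. indicator (cbox a b) (y - \<delta> k *\<^sub>R z) = (indicator (cbox a b) y :: real)"
      proof (cases "y \<in> interior (cbox a b)")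
        case True
        have "\<forall>\<^sub>F k in sequentially. y - \<delta> k *\<^sub>R z \<in> interior (cbox a b)"
          by (rule topological_tendstoD[OF t open_interior True])
        thus ?thesis
          by eventually_elim (use True interior_subset[of "cbox a b"] in \<open>auto simp: indicator_def simp del: interior_cbox\<close>)
      next
        case False
        hence y': "y \<in> - cbox a b"
          using y by (auto simp: frontier_def closure_cbox)
        have "\<forall>\<^sub>F k in sequentially. y - \<delta> k *\<^sub>R z \<in> - cbox a b"
          by (rule topological_tendstoD[OF t _ y']) (simp add: closed_cbox open_Compl)
        thus ?thesis
          by eventually_elim (use y' in \<open>auto simp: indicator_def\<close>)
      qed
      thus "(\<lambda>k. gauss z * indicator (cbox a b) (y - \<delta> k *\<^sub>R z)) \<longlonglongrightarrow> gauss z * indicator (cbox a b) y"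
        by (intro tendsto_mult tendsto_const tendsto_eventually)
    qed
    show "AE z in lborel. norm (gauss z * indicator (cbox a b) (y - \<delta> k *\<^sub>R z)) \<le> gauss z" for k
      by (auto simp: indicator_def)
  qed (auto intro: gauss_integrable)
  hence "(\<lambda>k. (2 * pi) powr (- DIM('a) / 2) *\<^sub>R (\<integral>z. gauss z *\<^sub>R indicator (cbox a b) (y - \<delta> k *\<^sub>R z) \<partial>lborel))
      \<longlonglongrightarrow> (2 * pi) powr (- DIM('a) / 2) *\<^sub>R (\<integral>z. gauss z * indicator (cbox a b) y \<partial>(lborel :: 'a measure))"
    by (intro tendsto_intros) simp
  moreover have "(2 * pi) powr (- DIM('a) / 2) *\<^sub>R (\<integral>z. gauss z * indicator (cbox a b) y \<partial>(lborel :: 'a measure))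
      = indicator (cbox a b) y"
    by (simp add: gauss_integral mult.assoc[symmetric] powr_add[symmetric])
  moreover have "(\<integral>x. gauss_kernel (\<delta> k) (y - x) * indicator (cbox a b) x \<partial>lborel)
      = (2 * pi) powr (- DIM('a) / 2) *\<^sub>R (\<integral>z. gauss z *\<^sub>R indicator (cbox a b) (y - \<delta> k *\<^sub>R z) \<partial>lborel)" for k
    using gauss_kernel_conv[OF \<delta>(1), where w = "indicator (cbox a b) :: 'a \<Rightarrow> real" and y = y]
    by (simp only: real_scaleR_def) simp
  ultimately show ?thesis by (simp only:)
qed

text \<open>Fubini and the symmetry of the kernel move the mollification from \<open>f\<close> to
  the indicator, for which the pointwise limit is known.\<close>

lemma inner_gauss_conv_box:
  fixes f :: "'a::euclidean_space \<Rightarrow> complex"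
  assumes f: "integrable lborel f" and \<delta>: "\<delta> > 0"
  shows "(\<integral>x. (\<integral>y. gauss_kernel \<delta> (x - y) *\<^sub>R f y \<partial>lborel) \<bullet> (indicator (cbox a b) x * u) \<partial>lborel)
     = (\<integral>y. (f y \<bullet> u) * (\<integral>x. gauss_kernel \<delta> (y - x) * indicator (cbox a b) x \<partial>lborel) \<partial>lborel)"
proof -
  have [measurable]: "f \<in> borel_measurable borel"
    using borel_measurable_integrable[OF f] by simp
  define K where "K = (2 * pi) powr (- DIM('a) / 2) * \<delta> powr (- DIM('a))"
  have K: "gauss_kernel \<delta> z \<le> K" for z :: 'a
    using mult_left_mono[OF gauss_le_1[of "z /\<^sub>R \<delta>"], of K] by (simp add: gauss_kernel_def K_def)
  have K0: "K \<ge> 0" by (simp add: K_def)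
  define G where "G x y = gauss_kernel \<delta> (x - y) * (f y \<bullet> u) * indicator (cbox a b) x" for x y
  have [measurable]: "case_prod G \<in> borel_measurable (lborel \<Otimes>\<^sub>M lborel)"
    unfolding G_def by measurable
  have fu: "integrable lborel (\<lambda>y. f y \<bullet> u)" using f by simp
  have bnd: "integrable (lborel \<Otimes>\<^sub>M lborel) (\<lambda>(x, y). indicator (cbox a b) x * (K * (f y \<bullet> u)))"
  proof (rule lborel_pair.Fubini_integrable)
    show "integrable lborel (\<lambda>x. \<integral>y. norm (case (x, y) of (x, y) \<Rightarrow> indicator (cbox a b) x * (K * (f y \<bullet> u))) \<partial>lborel)"
      using integrable_indicator_cbox[of a b] by (simp add: abs_mult)
    show "AE x in lborel. integrable lborel (\<lambda>y. case (x, y) of (x, y) \<Rightarrow> indicator (cbox a b) x * (K * (f y \<bullet> u)))"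
      using fu by auto
  qed measurable
  have G: "integrable (lborel \<Otimes>\<^sub>M lborel) (case_prod G)"
  proof (rule Bochner_Integration.integrable_bound[OF bnd])
    have "norm (G x y) \<le> norm (indicator (cbox a b) x * (K * (f y \<bullet> u)))" for x y
      using mult_right_mono[OF K[of "x - y"], of "\<bar>f y \<bullet> u\<bar>"] K0
      by (auto simp: G_def abs_mult indicator_def)
    thus "AE z in lborel \<Otimes>\<^sub>M lborel. norm (case_prod G z) \<le> norm (case z of (x, y) \<Rightarrow> indicator (cbox a b) x * (K * (f y \<bullet> u)))"
      by auto
  qed measurable
  have gf: "integrable lborel (\<lambda>y. gauss_kernel \<delta> (x - y) *\<^sub>R f y)" for x
  proof (rule Bochner_Integration.integrable_bound[OF integrable_scaleR_right[OF f, of K]])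
    show "AE y in lborel. norm (gauss_kernel \<delta> (x - y) *\<^sub>R f y) \<le> norm (K *\<^sub>R f y)"
      using K K0 by (auto intro!: mult_right_mono)
  qed measurable
  have "(\<integral>y. gauss_kernel \<delta> (x - y) *\<^sub>R f y \<partial>lborel) \<bullet> (indicator (cbox a b) x * u) = (\<integral>y. G x y \<partial>lborel)" for x
  proof -
    have "(\<integral>y. gauss_kernel \<delta> (x - y) *\<^sub>R f y \<partial>lborel) \<bullet> (indicator (cbox a b) x * u)
      = (\<integral>y. (gauss_kernel \<delta> (x - y) *\<^sub>R f y) \<bullet> (indicator (cbox a b) x * u) \<partial>lborel)"
      by (rule integral_inner_left[symmetric]) (use gf in auto)
    also have "\<dots> = (\<integral>y. G x y \<partial>lborel)"
      by (rule Bochner_Integration.integral_cong) (auto simp: G_def indicator_def)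
    finally show ?thesis .
  qed
  moreover have "(f y \<bullet> u) * (\<integral>x. gauss_kernel \<delta> (y - x) * indicator (cbox a b) x \<partial>lborel) = (\<integral>x. G x y \<partial>lborel)" for y
    by (subst integral_mult_right_zero[symmetric]) (simp add: G_def gauss_kernel_commute[of \<delta> y] mult_ac)
  ultimately show ?thesis
    using lborel_pair.Fubini_integral[OF G] by simp
qed

text \<open>The mollified functions \<open>h k\<close> converge in norm to the double transform,
  since the Gaussian symbols converge strongly to 1. Their limit is identified with \<open>f\<close>
  only weakly, by testing against boxes, so norm convergence of the mollification to
  \<open>f\<close> need not be shown separately.\<close>

lemma fop_inverse_integrable:
  fixes f :: "(real ^ 'n) \<Rightarrow> complex"
  assumes f: "integrable lborel f" "f \<in> Lp_space 2" and s: "\<bar>s\<bar> = 1"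
  shows "fop (- s) (fop s (abs_l2 f)) = abs_l2 f"
proof -
  have [measurable]: "f \<in> borel_measurable borel" "f \<in> borel_measurable lborel"
    using borel_measurable_integrable[OF f(1)] by simp_all
  have s': "\<bar>- s\<bar> = 1" using s by simp
  define \<delta> where "\<delta> k = 1 / real (Suc k)" for k
  have \<delta>: "\<delta> k > 0" for k by (simp add: \<delta>_def)
  have \<delta>0: "\<delta> \<longlonglongrightarrow> 0" unfolding \<delta>_def by (rule LIMSEQ_Suc) (rule lim_1_over_n)
  define e where "e k = (\<lambda>\<xi>::real^'n. complex_of_real (gauss (\<delta> k *\<^sub>R \<xi>)))" for k
  have e: "bounded_symbol (e k) 1" for k
    by (auto simp: bounded_symbol_def e_def gauss_le_1)
  define h where "h k x = (\<integral>y. gauss_kernel (\<delta> k) (x - y) *\<^sub>R f y \<partial>lborel)" for k x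
  have FTf: "FT s f \<in> Lp_space 2" by (rule FT_in_Lp[OF f s])
  have egL: "(\<lambda>\<xi>. e k \<xi> * FT s f \<xi>) \<in> Lp_space 2" for k
    using Lp_space_2_mult[OF FTf] e by (auto simp: bounded_symbol_def)
  have egI: "integrable lborel (\<lambda>\<xi>. e k \<xi> * FT s f \<xi>)" for k
    unfolding e_def by (rule FT_gauss_integrable[OF f(1) \<delta>])
  have FTh: "FT (- s) (\<lambda>\<xi>. e k \<xi> * FT s f \<xi>) = h k" for k
    unfolding h_def e_def using FT_gauss_FT[OF f(1) \<delta> s, of k] by (simp add: fun_eq_iff)
  have hL: "h k \<in> Lp_space 2" for k
    using FT_in_Lp[OF egI egL s', of k] unfolding FTh .
  have fh: "fop (- s) (mul (e k) (fop s (abs_l2 f))) = abs_l2 (h k)" for k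
    unfolding fop_abs_l2[OF s f] mul_abs_l2[OF e FTf] fop_abs_l2[OF s' egI egL] FTh ..
  have "(\<lambda>k. mul (e k) (fop s (abs_l2 f))) \<longlonglongrightarrow> mul (\<lambda>_. 1) (fop s (abs_l2 f))"
  proof (rule mul_tendsto[OF e])
    show "AE \<xi> in lborel. (\<lambda>k. e k \<xi>) \<longlonglongrightarrow> 1"
    proof (rule AE_I2)
      fix \<xi> :: "real^'n"
      have "(\<lambda>k. gauss (\<delta> k *\<^sub>R \<xi>)) \<longlonglongrightarrow> exp (- (norm (0 *\<^sub>R \<xi>))\<^sup>2 / 2)"
        unfolding gauss_def by (intro tendsto_intros \<delta>0) auto
      from tendsto_of_real[OF this] show "(\<lambda>k. e k \<xi>) \<longlonglongrightarrow> 1" by (simp add: e_def)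
    qed
  qed (auto simp: bounded_symbol_def)
  hence "(\<lambda>k. mul (e k) (fop s (abs_l2 f))) \<longlonglongrightarrow> fop s (abs_l2 f)"
    by (simp add: mul_def)
  hence hlim: "(\<lambda>k. abs_l2 (h k)) \<longlonglongrightarrow> fop (- s) (fop s (abs_l2 f))"
    unfolding fh[symmetric] by (rule bounded_linear.tendsto[OF bounded_linear_fop[OF s']])
  have "fop (- s) (fop s (abs_l2 f)) - abs_l2 f = 0"
  proof (rule l2_eq_0_boxI)
    fix a b :: "real^'n" and u :: complex
    define w where "w = (\<lambda>x. indicator (cbox a b) x * u)"
    have wL: "w \<in> Lp_space 2"
      unfolding w_def by (rule indicator_in_Lp[OF _ emeasure_lborel_cbox_less_top]) simp
    have inn: "abs_l2 g \<bullet> abs_l2 w = (\<integral>x. g x \<bullet> w x \<partial>lborel)" if "g \<in> Lp_space 2" for g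
      using that wL by (intro inner_l2.abs_eq) (auto simp: L2_eq_def)
    have "(\<lambda>k. abs_l2 (h k) \<bullet> abs_l2 w) \<longlonglongrightarrow> fop (- s) (fop s (abs_l2 f)) \<bullet> abs_l2 w"
      by (intro tendsto_intros hlim)
    moreover have "(\<lambda>k. abs_l2 (h k) \<bullet> abs_l2 w) \<longlonglongrightarrow> abs_l2 f \<bullet> abs_l2 w"
    proof -
      have "abs_l2 (h k) \<bullet> abs_l2 w = (\<integral>y. (f y \<bullet> u) * (\<integral>x. gauss_kernel (\<delta> k) (y - x) * indicator (cbox a b) x \<partial>lborel) \<partial>lborel)" for k
        unfolding inn[OF hL] unfolding w_def h_def by (rule inner_gauss_conv_box[OF f(1) \<delta>])
      moreover have "(\<lambda>k. \<integral>y. (f y \<bullet> u) * (\<integral>x. gauss_kernel (\<delta> k) (y - x) * indicator (cbox a b) x \<partial>lborel) \<partial>lborel)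
         \<longlonglongrightarrow> (\<integral>y. (f y \<bullet> u) * indicator (cbox a b) y \<partial>lborel)"
      proof (rule integral_dominated_convergence[where w = "\<lambda>y. \<bar>f y \<bullet> u\<bar>"])
        \<comment> \<open>Pointwise convergence of the mollified indicator can fail on the boundary
          of the box, which is a null set.\<close>
        have "negligible (frontier (cbox a b))"
          by (simp add: negligible_convex_frontier)
        hence "frontier (cbox a b) \<in> null_sets lborel"
          by (simp add: negligible_iff_null_sets null_sets_completion_iff)
        hence "AE y in lborel. y \<notin> frontier (cbox a b)"
          by (rule AE_not_in)
        thus "AE y in lborel. (\<lambda>k. (f y \<bullet> u) * (\<integral>x. gauss_kernel (\<delta> k) (y - x) * indicator (cbox a b) x \<partial>lborel))
              \<longlonglongrightarrow> (f y \<bullet> u) * indicator (cbox a b) y"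
          by eventually_elim (intro tendsto_intros gauss_conv_box_tendsto \<delta> \<delta>0)
        fix k
        have "\<bar>\<integral>x. gauss_kernel (\<delta> k) (y - x) * indicator (cbox a b) x \<partial>lborel\<bar> \<le> 1" for y :: "real^'n"
        proof -
          have "(\<integral>x. gauss_kernel (\<delta> k) (y - x) * indicator (cbox a b) x \<partial>lborel) \<le> (\<integral>x. gauss_kernel (\<delta> k) (y - x) \<partial>lborel)"
            by (rule integral_mono_AE')
              (auto simp: indicator_def gauss_kernel_integrable[OF \<delta>])
          also have "\<dots> = 1"
            using gauss_kernel_nn_integral[OF \<delta>, of k y]
            by (subst integral_eq_nn_integral) auto
          finally show ?thesis
            by (subst abs_of_nonneg) auto
        qed
        from mult_left_mono[OF this, of "\<bar>f y \<bullet> u\<bar>" y for y]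
        show "AE y in lborel. norm ((f y \<bullet> u) * (\<integral>x. gauss_kernel (\<delta> k) (y - x) * indicator (cbox a b) x \<partial>lborel)) \<le> \<bar>f y \<bullet> u\<bar>"
          by (auto simp: abs_mult)
      qed (use f in auto)
      moreover have "(\<integral>y. (f y \<bullet> u) * indicator (cbox a b) y \<partial>lborel) = abs_l2 f \<bullet> abs_l2 w"
        unfolding inn[OF f(2)] unfolding w_def by (rule Bochner_Integration.integral_cong) (auto simp: indicator_def)
      ultimately show ?thesis by simp
    qed
    ultimately have "fop (- s) (fop s (abs_l2 f)) \<bullet> abs_l2 w = abs_l2 f \<bullet> abs_l2 w"
      by (rule LIMSEQ_unique)
    thus "(fop (- s) (fop s (abs_l2 f)) - abs_l2 f) \<bullet> abs_l2 (\<lambda>x. indicator (cbox a b) x * u) = 0"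
      by (simp add: inner_diff_left w_def)
  qed
  thus ?thesis by simp
qed

text \<open>Both sides are continuous, and truncations, which lie in L^1 \<inter> L^2, are
  dense.\<close>

theorem fop_inverse:
  assumes s: "\<bar>s\<bar> = 1"
  shows "fop (- s) (fop s v) = v"
proof (rule tendsto_unique[of at_top])
  have s': "\<bar>- s\<bar> = 1" using s by simp
  show "((\<lambda>R. fop (- s) (fop s (abs_l2 (trunc R v)))) \<longlongrightarrow> fop (- s) (fop s v)) at_top"
    by (intro bounded_linear.tendsto[OF bounded_linear_fop] abs_trunc_tendsto s s')
  show "((\<lambda>R. fop (- s) (fop s (abs_l2 (trunc R v)))) \<longlongrightarrow> v) at_top"
    using abs_trunc_tendsto[of v] by (simp add: fop_inverse_integrable[OF trunc_integrable trunc_in_Lp s])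
qed simp

text \<open>Plancherel's identity: two mutually inverse contractions are isometries.\<close>

lemma norm_fop [simp]:
  assumes s: "\<bar>s\<bar> = 1"
  shows "norm (fop s v) = norm v"
  using norm_fop_le[OF s, of v] norm_fop_le[of "-s" "fop s v"] s by (simp add: fop_inverse)

abbreviation fourier_l2 :: "(real ^ 'n) l2 \<Rightarrow> (real ^ 'n) l2" where
  "fourier_l2 \<equiv> fop (- 1)"

abbreviation inv_fourier_l2 :: "(real ^ 'n) l2 \<Rightarrow> (real ^ 'n) l2" where
  "inv_fourier_l2 \<equiv> fop 1"

lemma fourier_inv_fourier_l2 [simp]: "fourier_l2 (inv_fourier_l2 v) = v"
  using fop_inverse[of "1" v] by simp

text \<open>The condition under the choice operator holds exactly for the representatives of the
  class \<open>fop s (abs_l2 f)\<close>. Such representatives exist, so the chosen function is one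
  of them, whichever it is.\<close>

lemma L2_extension_FT:
  fixes f :: "(real ^ 'n) \<Rightarrow> complex"
  assumes f: "f \<in> Lp_space 2" and s: "\<bar>s\<bar> = 1"
  shows "L2_extension (FT s) f \<in> Lp_space 2 \<and> abs_l2 (L2_extension (FT s) f) = fop s (abs_l2 f)"
proof -
  have [measurable]: "f \<in> borel_measurable lborel" using f by (rule Lp_space_measurable)
  have [measurable]: "ball (0 :: real^'n) R \<in> sets borel" for R by simp
  have tr: "FT s (\<lambda>x. indicator (ball 0 R) x * f x) = FT s (trunc R (abs_l2 f))" for R
  proof
    fix \<xi>
    have "AE x in lborel. indicator (ball 0 R) x * f x = trunc R (abs_l2 f) x"
      using rep_abs_l2[OF f] by eventually_elim (simp add: trunc_def)
    thus "FT s (\<lambda>x. indicator (ball 0 R) x * f x) \<xi> = FT s (trunc R (abs_l2 f)) \<xi>"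
      by (rule FT_cong_AE) measurable
  qed
  have eq: "(\<integral>\<^sup>+y. ennreal ((cmod (FT s (\<lambda>x. indicator (ball 0 R) x * f x) y - g y))\<^sup>2) \<partial>lborel)
      = ennreal ((norm (ftr s R (abs_l2 f) - abs_l2 g))\<^sup>2)" if "g \<in> Lp_space 2" for g R
    unfolding tr ftr_def using that
    by (subst abs_l2_diff[symmetric]) (simp_all add: FT_in_Lp s ennreal_norm_abs_l2_sq Lp_space_2_diff)
  define P where "P g \<longleftrightarrow> g \<in> Lp_space 2 \<and> ((\<lambda>R. \<integral>\<^sup>+y. ennreal ((cmod (FT s (\<lambda>x. indicator (ball 0 R) x * f x) y - g y))\<^sup>2) \<partial>lborel)
        \<longlongrightarrow> 0) at_top" for g
  have P: "P g \<longleftrightarrow> g \<in> Lp_space 2 \<and> abs_l2 g = fop s (abs_l2 f)" for g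
  proof (cases "g \<in> Lp_space 2")
    case True
    have "P g \<longleftrightarrow> ((\<lambda>R. ennreal ((norm (ftr s R (abs_l2 f) - abs_l2 g))\<^sup>2)) \<longlongrightarrow> ennreal 0) at_top"
      using True by (simp add: P_def eq)
    also have "\<dots> \<longleftrightarrow> ((\<lambda>R. (norm (ftr s R (abs_l2 f) - abs_l2 g))\<^sup>2) \<longlongrightarrow> 0) at_top"
      by (rule tendsto_ennreal_iff) auto
    also have "\<dots> \<longleftrightarrow> ((\<lambda>R. ftr s R (abs_l2 f)) \<longlongrightarrow> abs_l2 g) at_top"
    proof
      assume "((\<lambda>R. (norm (ftr s R (abs_l2 f) - abs_l2 g))\<^sup>2) \<longlongrightarrow> 0) at_top"
      hence "((\<lambda>R. sqrt ((norm (ftr s R (abs_l2 f) - abs_l2 g))\<^sup>2)) \<longlongrightarrow> sqrt 0) at_top"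
        by (rule tendsto_real_sqrt)
      thus "((\<lambda>R. ftr s R (abs_l2 f)) \<longlongrightarrow> abs_l2 g) at_top"
        by (simp add: tendsto_norm_zero_iff LIM_zero_iff)
    next
      assume "((\<lambda>R. ftr s R (abs_l2 f)) \<longlongrightarrow> abs_l2 g) at_top"
      hence "((\<lambda>R. (norm (ftr s R (abs_l2 f) - abs_l2 g))\<^sup>2) \<longlongrightarrow> (norm (abs_l2 g - abs_l2 g))\<^sup>2) at_top"
        by (intro tendsto_intros)
      thus "((\<lambda>R. (norm (ftr s R (abs_l2 f) - abs_l2 g))\<^sup>2) \<longlongrightarrow> 0) at_top" by simp
    qed
    also have "\<dots> \<longleftrightarrow> abs_l2 g = fop s (abs_l2 f)"
      using ftr_tendsto[OF s, of "abs_l2 f"] tendsto_unique[of at_top "\<lambda>R. ftr s R (abs_l2 f)"]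
      by (metis trivial_limit_at_top_linorder)
    finally show ?thesis using True by simp
  qed (simp add: P_def)
  have "P (rep_l2 (fop s (abs_l2 f)))"
    unfolding P by simp
  hence "P (SOME g. P g)" by (rule someI[of P])
  hence "P (L2_extension (FT s) f)"
    unfolding L2_extension_def P_def .
  thus ?thesis unfolding P .
qed

lemma fourier_in_Lp: "f \<in> Lp_space 2 \<Longrightarrow> fourier f \<in> Lp_space 2"
  and abs_fourier: "f \<in> Lp_space 2 \<Longrightarrow> abs_l2 (fourier f) = fourier_l2 (abs_l2 f)"
  and inv_fourier_in_Lp: "f \<in> Lp_space 2 \<Longrightarrow> inv_fourier f \<in> Lp_space 2"
  and abs_inv_fourier: "f \<in> Lp_space 2 \<Longrightarrow> abs_l2 (inv_fourier f) = inv_fourier_l2 (abs_l2 f)"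
  using L2_extension_FT[of f "-1"] L2_extension_FT[of f 1]
  by (simp_all add: fourier_def inv_fourier_def fourier_L1_FT inv_fourier_L1_FT)

section \<open>Integrals over dyadic shells\<close>

lemma ennreal_le_suminf: "f (k::nat) \<le> (\<Sum>i. f i :: ennreal)"
  using sum_le_suminf[of f "{k}"] by (simp add: summableI)

lemma dyadic_inner:
  assumes "0 < t" "t \<le> 1"
  obtains k :: nat where "t \<le> 2 powr (- real k)" "2 powr (- real k - 1) \<le> t"
proof -
  obtain n where n: "(1/2::real) ^ n < t"
    using real_arch_pow_inv[of t "1/2"] assms by auto
  define k where "k = (LEAST k. (1/2::real) ^ Suc k < t)"
  have "(1/2::real) ^ Suc n < t"
    using n by (rule le_less_trans[rotated]) (rule power_decreasing, auto)
  hence k: "(1/2::real) ^ Suc k < t"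
    unfolding k_def by (rule LeastI)
  have "t \<le> (1/2::real) ^ k"
  proof (cases k)
    case (Suc j)
    have "\<not> (1/2::real) ^ Suc j < t"
      by (rule not_less_Least) (use Suc in \<open>simp add: k_def\<close>)
    thus ?thesis using Suc by simp
  qed (use assms in simp)
  moreover have "(1/2::real) ^ j = 2 powr (- real j)" for j
    by (simp add: powr_minus powr_realpow power_divide inverse_eq_divide)
  moreover have "2 powr (- real k - 1) = 2 powr (- real (Suc k))"
    by (rule arg_cong[of _ _ "\<lambda>x. 2 powr x"]) simp
  ultimately show ?thesis
    using k by (intro that[of k]) (auto simp del: of_nat_Suc power_Suc)
qed

lemma dyadic_outer:
  assumes "1 < (t::real)"
  obtains k :: nat where "2 powr real k \<le> t" "t \<le> 2 powr (real k + 1)"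
proof -
  define k where "k = nat \<lfloor>log 2 t\<rfloor>"
  have l: "log 2 t > 0" using assms by simp
  hence "real k \<le> log 2 t" "log 2 t \<le> real k + 1"
    unfolding k_def by linarith+
  hence "2 powr real k \<le> 2 powr log 2 t" "2 powr log 2 t \<le> 2 powr (real k + 1)"
    by (simp_all add: powr_mono)
  thus ?thesis using assms by (intro that[of k]) auto
qed

lemma suminf_ennreal_geometric:
  assumes "0 \<le> a" "0 \<le> x" "x < 1"
  shows "(\<Sum>k. ennreal (a * x ^ k)) = ennreal (a / (1 - x))"
  using assms by (subst suminf_ennreal2) (auto simp: summable_mult summable_geometric suminf_mult suminf_geometric)

text \<open>The growth of \<phi> over balls is all that is known about the density. It is used with
  \<phi> = 1, where d is the dimension, and with the squared transform of an L^m function, where d =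
  2 \<kappa>.\<close>

context
  fixes \<phi> :: "'a::euclidean_space \<Rightarrow> ennreal" and C d :: real
  assumes [measurable]: "\<phi> \<in> borel_measurable lborel" and C: "C \<ge> 0"
    and growth: "\<And>R. R > 0 \<Longrightarrow> (\<integral>\<^sup>+x. indicator (cball 0 R) x * \<phi> x \<partial>lborel) \<le> ennreal (C * R powr d)"
begin

lemma shell_sum_le:
  assumes a: "\<And>k. a k \<ge> 0" and r: "\<And>k. r k > 0" and x: "0 \<le> x" "x < 1" and b: "b \<ge> 0"
    and ar: "\<And>k::nat. a k * (C * r k powr d) \<le> b * x ^ k"
    and f: "\<And>x. f x \<le> (\<Sum>k. ennreal (a k) * indicator (cball 0 (r k)) x)"
  shows "(\<integral>\<^sup>+x. f x * \<phi> x \<partial>lborel) \<le> ennreal (b / (1 - x))"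
proof -
  have [measurable]: "cball (0::'a) R \<in> sets borel" for R by simp
  have "(\<integral>\<^sup>+x. f x * \<phi> x \<partial>lborel) \<le> (\<integral>\<^sup>+x. (\<Sum>k. ennreal (a k) * (indicator (cball 0 (r k)) x * \<phi> x)) \<partial>lborel)"
    using mult_right_mono[OF f] by (intro nn_integral_mono) (simp add: mult.assoc[symmetric])
  also have "\<dots> = (\<Sum>k. \<integral>\<^sup>+x. ennreal (a k) * (indicator (cball 0 (r k)) x * \<phi> x) \<partial>lborel)"
    by (rule nn_integral_suminf) measurable
  also have "\<dots> = (\<Sum>k. ennreal (a k) * (\<integral>\<^sup>+x. indicator (cball 0 (r k)) x * \<phi> x \<partial>lborel))"
    by (subst nn_integral_cmult) auto
  also have "\<dots> \<le> (\<Sum>k. ennreal (b * x ^ k))"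
  proof (intro suminf_le summableI)
    fix k
    have "ennreal (a k) * (\<integral>\<^sup>+x. indicator (cball 0 (r k)) x * \<phi> x \<partial>lborel) \<le> ennreal (a k) * ennreal (C * r k powr d)"
      by (intro mult_left_mono growth r) auto
    also have "\<dots> = ennreal (a k * (C * r k powr d))"
      using a by (simp add: ennreal_mult')
    also have "\<dots> \<le> ennreal (b * x ^ k)"
      by (intro ennreal_leI ar)
    finally show "ennreal (a k) * (\<integral>\<^sup>+x. indicator (cball 0 (r k)) x * \<phi> x \<partial>lborel) \<le> ennreal (b * x ^ k)" .
  qed
  also have "\<dots> = ennreal (b / (1 - x))"
    using b x by (rule suminf_ennreal_geometric)
  finally show ?thesis .
qed

text \<open>On the shell where |x| / X is between 2^(-k-1) and 2^(-k) the weight is at most 2^(s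
  (k+1)), against mass C (X 2^(-k))^d of the surrounding ball: a geometric series of ratio
  2^(s-d).\<close>

lemma shell_inner:
  assumes s: "0 \<le> s" "s < d" and X: "X > 0"
  shows "(\<integral>\<^sup>+x. (indicator (cball 0 X) x * ennreal ((norm x / X) powr (- s))) * \<phi> x \<partial>lborel)
    \<le> ennreal ((2 powr s * C * X powr d) / (1 - 2 powr (s - d)))"
proof (rule shell_sum_le)
  fix k :: nat
  show "2 powr (s * (real k + 1)) * (C * (X * 2 powr (- real k)) powr d) \<le> 2 powr s * C * X powr d * (2 powr (s - d)) ^ k"
  proof -
    have "2 powr (s * (real k + 1)) = 2 powr s * 2 powr (s * real k)"
      by (simp add: powr_add[symmetric] algebra_simps)
    moreover have "(X * 2 powr (- real k)) powr d = X powr d * 2 powr (- real k * d)"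
      using X by (simp add: powr_mult powr_powr)
    moreover have "(2 powr (s - d)) ^ k = 2 powr (s * real k) * 2 powr (- real k * d)"
      by (simp add: powr_power powr_add[symmetric] algebra_simps)
    ultimately show ?thesis by simp
  qed
next
  fix x :: 'a
  show "indicator (cball 0 X) x * ennreal ((norm x / X) powr (- s))
      \<le> (\<Sum>k. ennreal (2 powr (s * (real k + 1))) * indicator (cball 0 (X * 2 powr (- real k))) x)"
  proof (cases "x \<noteq> 0 \<and> norm x \<le> X")
    case True
    hence "0 < norm x / X" "norm x / X \<le> 1" using X by auto
    then obtain k :: nat where k: "norm x / X \<le> 2 powr (- real k)" "2 powr (- real k - 1) \<le> norm x / X"
      by (rule dyadic_inner)
    have "(norm x / X) powr (- s) \<le> (2 powr (- real k - 1)) powr (- s)"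
      using k s by (intro powr_mono2') auto
    also have "\<dots> = 2 powr (s * (real k + 1))"
      by (simp add: powr_powr algebra_simps)
    finally have "indicator (cball 0 X) x * ennreal ((norm x / X) powr (- s))
      \<le> ennreal (2 powr (s * (real k + 1))) * indicator (cball 0 (X * 2 powr (- real k))) x"
      using k(1) X True by (simp add: indicator_def field_simps ennreal_leI)
    also have "\<dots> \<le> (\<Sum>k. ennreal (2 powr (s * (real k + 1))) * indicator (cball 0 (X * 2 powr (- real k))) x)"
      by (rule ennreal_le_suminf)
    finally show ?thesis .
  qed (auto simp: indicator_def)
qed (use s C X in \<open>auto simp: powr_less_one\<close>)

text \<open>The mirror image of \<open>shell_inner\<close>: the outer shells have ratio 2^(d-s), and
  the factor 2^d comes from using the ball of radius X 2^(k+1) around the k-th shell.\<close>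

lemma shell_outer:
  assumes s: "d < s" "0 \<le> s" and X: "X > 0"
  shows "(\<integral>\<^sup>+x. (indicator (- cball 0 X) x * ennreal ((norm x / X) powr (- s))) * \<phi> x \<partial>lborel)
    \<le> ennreal ((2 powr d * C * X powr d) / (1 - 2 powr (d - s)))"
proof (rule shell_sum_le)
  fix k :: nat
  show "2 powr (- s * real k) * (C * (X * 2 powr (real k + 1)) powr d) \<le> 2 powr d * C * X powr d * (2 powr (d - s)) ^ k"
  proof -
    have "(X * 2 powr (real k + 1)) powr d = X powr d * (2 powr d * 2 powr (real k * d))"
      using X by (simp add: powr_mult powr_powr powr_add[symmetric] algebra_simps)
    moreover have "(2 powr (d - s)) ^ k = 2 powr (- s * real k) * 2 powr (real k * d)"
      by (simp add: powr_power powr_add[symmetric] algebra_simps)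
    ultimately show ?thesis by simp
  qed
next
  fix x :: 'a
  show "indicator (- cball 0 X) x * ennreal ((norm x / X) powr (- s))
      \<le> (\<Sum>k. ennreal (2 powr (- s * real k)) * indicator (cball 0 (X * 2 powr (real k + 1))) x)"
  proof (cases "norm x > X")
    case True
    hence "1 < norm x / X" using X by auto
    then obtain k :: nat where k: "2 powr real k \<le> norm x / X" "norm x / X \<le> 2 powr (real k + 1)"
      by (rule dyadic_outer)
    have "(norm x / X) powr (- s) \<le> (2 powr real k) powr (- s)"
      using k s by (intro powr_mono2') auto
    also have "\<dots> = 2 powr (- s * real k)"
      by (simp add: powr_powr algebra_simps)
    finally have "indicator (- cball 0 X) x * ennreal ((norm x / X) powr (- s))
      \<le> ennreal (2 powr (- s * real k)) * indicator (cball 0 (X * 2 powr (real k + 1))) x"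
      using k(2) X True by (simp add: indicator_def field_simps ennreal_leI)
    also have "\<dots> \<le> (\<Sum>k. ennreal (2 powr (- s * real k)) * indicator (cball 0 (X * 2 powr (real k + 1))) x)"
      by (rule ennreal_le_suminf)
    finally show ?thesis .
  qed (auto simp: indicator_def)
qed (use s C X in \<open>auto simp: powr_less_one\<close>)

end

lemma AE_lborel_neq_0: "AE x in lborel. x \<noteq> (0::'a::euclidean_space)"
  using AE_lborel_singleton[of "0::'a"] by simp

text \<open>The case \<open>s1 = 0\<close> is separate because \<open>d = 0\<close> is allowed there.\<close>

lemma shell_bound:
  assumes s1: "0 \<le> s1" "s1 < d \<or> s1 = 0" and s2: "d < s2" and d: "0 \<le> d"
  obtains K where "K > 0" "\<And>(\<phi> :: 'a::euclidean_space \<Rightarrow> ennreal) C X (k :: 'a \<Rightarrow> real).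
    \<phi> \<in> borel_measurable lborel \<Longrightarrow> C \<ge> 0 \<Longrightarrow> X > 0 \<Longrightarrow>
    (\<And>R. R > 0 \<Longrightarrow> (\<integral>\<^sup>+x. indicator (cball 0 R) x * \<phi> x \<partial>lborel) \<le> ennreal (C * R powr d)) \<Longrightarrow>
    (\<And>x. x \<noteq> 0 \<Longrightarrow> norm x \<le> X \<Longrightarrow> k x \<le> (norm x / X) powr (- s1)) \<Longrightarrow>
    (\<And>x. norm x > X \<Longrightarrow> k x \<le> (norm x / X) powr (- s2)) \<Longrightarrow>
    (\<integral>\<^sup>+x. ennreal (k x) * \<phi> x \<partial>lborel) \<le> ennreal (K * C * X powr d)"
proof -
  define K1 where "K1 = (if s1 < d then 2 powr s1 / (1 - 2 powr (s1 - d)) else 1)"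
  define K2 where "K2 = 2 powr d / (1 - 2 powr (d - s2))"
  have K1: "K1 > 0" by (auto simp: K1_def powr_less_one)
  have K2: "K2 > 0" using s2 by (auto simp: K2_def powr_less_one)
  show ?thesis
  proof (rule that[of "K1 + K2"])
    fix \<phi> :: "'a \<Rightarrow> ennreal" and C X and k :: "'a \<Rightarrow> real"
    assume [measurable]: "\<phi> \<in> borel_measurable lborel" and C: "C \<ge> 0" and X: "X > 0"
      and g: "\<And>R. R > 0 \<Longrightarrow> (\<integral>\<^sup>+x. indicator (cball 0 R) x * \<phi> x \<partial>lborel) \<le> ennreal (C * R powr d)"
      and k1: "\<And>x. x \<noteq> 0 \<Longrightarrow> norm x \<le> X \<Longrightarrow> k x \<le> (norm x / X) powr (- s1)"
      and k2: "\<And>x. norm x > X \<Longrightarrow> k x \<le> (norm x / X) powr (- s2)"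
    note g' = \<open>\<phi> \<in> borel_measurable lborel\<close> C g
    have [measurable]: "cball (0::'a) R \<in> sets borel" for R by simp
    have "(\<integral>\<^sup>+x. ennreal (k x) * \<phi> x \<partial>lborel)
      \<le> (\<integral>\<^sup>+x. (indicator (cball 0 X) x * ennreal ((norm x / X) powr (- s1))) * \<phi> x
            + (indicator (- cball 0 X) x * ennreal ((norm x / X) powr (- s2))) * \<phi> x \<partial>lborel)"
      by (rule nn_integral_mono_AE, use AE_lborel_neq_0 in eventually_elim)
        (auto simp: indicator_def intro!: mult_right_mono ennreal_leI k1 k2)
    also have "\<dots> = (\<integral>\<^sup>+x. (indicator (cball 0 X) x * ennreal ((norm x / X) powr (- s1))) * \<phi> x \<partial>lborel)
       + (\<integral>\<^sup>+x. (indicator (- cball 0 X) x * ennreal ((norm x / X) powr (- s2))) * \<phi> x \<partial>lborel)"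
      by (rule nn_integral_add) measurable
    also have "\<dots> \<le> ennreal (K1 * C * X powr d) + ennreal (K2 * C * X powr d)"
    proof (rule add_mono)
      show "(\<integral>\<^sup>+x. (indicator (cball 0 X) x * ennreal ((norm x / X) powr (- s1))) * \<phi> x \<partial>lborel) \<le> ennreal (K1 * C * X powr d)"
      proof (cases "s1 < d")
        case True
        thus ?thesis using shell_inner[OF g' s1(1) True X] by (simp add: K1_def)
      next
        case False
        hence s10: "s1 = 0" using s1 by auto
        have "(\<integral>\<^sup>+x. (indicator (cball 0 X) x * ennreal ((norm x / X) powr (- s1))) * \<phi> x \<partial>lborel)
          \<le> (\<integral>\<^sup>+x. indicator (cball 0 X) x * \<phi> x \<partial>lborel)"
          by (rule nn_integral_mono) (auto simp: indicator_def s10 powr_def)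
        also have "\<dots> \<le> ennreal (C * X powr d)" using X by (rule g)
        finally show ?thesis using False by (simp add: K1_def)
      qed
      show "(\<integral>\<^sup>+x. (indicator (- cball 0 X) x * ennreal ((norm x / X) powr (- s2))) * \<phi> x \<partial>lborel) \<le> ennreal (K2 * C * X powr d)"
        using shell_outer[OF g' s2 _ X] s2 d by (simp add: K2_def)
    qed
    also have "\<dots> = ennreal ((K1 + K2) * C * X powr d)"
      using K1 K2 C by (subst ennreal_plus[symmetric]) (auto simp: algebra_simps)
    finally show "(\<integral>\<^sup>+x. ennreal (k x) * \<phi> x \<partial>lborel) \<le> ennreal ((K1 + K2) * C * X powr d)" .
  qed (use K1 K2 in auto)
qed

lemma lebesgue_growth:
  "R > 0 \<Longrightarrow> (\<integral>\<^sup>+x. indicator (cball 0 R) x * 1 \<partial>(lborel :: 'a::euclidean_space measure))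
    \<le> ennreal (unit_ball_vol (DIM('a)) * R powr DIM('a))"
  by (simp add: emeasure_cball powr_realpow)

section \<open>Low frequencies of \<open>L\<^sup>m\<close> functions\<close>

text \<open>Stated with the nonnegative integral, so that finiteness and the size of the norm are
  one statement, invariant under changes on null sets.\<close>

definition Lm_bound :: "real \<Rightarrow> real \<Rightarrow> ('a::euclidean_space \<Rightarrow> complex) \<Rightarrow> bool" where
  "Lm_bound m B f \<longleftrightarrow> (\<integral>\<^sup>+x. ennreal (cmod (f x) powr m) \<partial>lborel) \<le> ennreal (B powr m)"

lemma Lm_bound_cong_AE:
  assumes "AE x in lborel. f x = g x"
  shows "Lm_bound m B f \<longleftrightarrow> Lm_bound m B g"
proof -
  have "(\<integral>\<^sup>+x. ennreal (cmod (f x) powr m) \<partial>lborel) = (\<integral>\<^sup>+x. ennreal (cmod (g x) powr m) \<partial>lborel)"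
    by (rule nn_integral_cong_AE) (use assms in \<open>eventually_elim, simp\<close>)
  thus ?thesis by (simp add: Lm_bound_def)
qed

text \<open>Splitting \<open>f\<close> at height \<open>B R\<^bsup>n/m\<^esup>\<close> into an \<open>L\<^sup>1\<close> and an \<open>L\<^sup>2\<close> part replaces the
  Hausdorff--Young inequality.\<close>

lemma low_frequency_bound:
  assumes m: "1 \<le> m" "m \<le> 2"
  obtains C where "C > 0" "\<And>(v :: (real ^ 'n) l2) B R. B > 0 \<Longrightarrow> R > 0 \<Longrightarrow> Lm_bound m B (rep_l2 v) \<Longrightarrow>
     (\<integral>\<^sup>+\<xi>. indicator (cball 0 R) \<xi> * ennreal ((cmod (rep_l2 (fourier_l2 v) \<xi>))\<^sup>2) \<partial>lborel)
       \<le> ennreal (C * B\<^sup>2 * R powr (2 * (real CARD('n) * (1 / m - 1 / 2))))"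
proof -
  define n where "n = real CARD('n)"
  define c where "c = (2 * pi) powr (- n / 2)"
  define V where "V = unit_ball_vol n"
  have V: "V > 0" by (simp add: V_def n_def)
  have c: "c > 0" by (simp add: c_def)
  show ?thesis
  proof (rule that[of "2 * (V * c\<^sup>2) + 2"])
    fix v :: "(real ^ 'n) l2" and B R :: real
    assume B: "B > 0" and R: "R > 0" and Lm: "Lm_bound m B (rep_l2 v)"
    define f where "f = rep_l2 v"
    have f: "f \<in> Lp_space 2" by (simp add: f_def)
    have [measurable]: "f \<in> borel_measurable lborel" "f \<in> borel_measurable borel"
      using f by (auto dest: Lp_space_measurable)
    have [measurable]: "cball (0::real^'n) R \<in> sets borel" by simp
    \<comment> \<open>At this height the two contributions (l^(1-m) B^m)^2 R^n and l^(2-m) B^m are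
      both equal to B^2 R^(2 \<kappa>).\<close>
    define l where "l = B * R powr (n / m)"
    have l: "l > 0" using B R by (simp add: l_def)
    define f1 where "f1 x = (if cmod (f x) > l then f x else 0)" for x
    define f2 where "f2 x = (if cmod (f x) > l then 0 else f x)" for x
    have [measurable]: "f1 \<in> borel_measurable lborel" "f2 \<in> borel_measurable lborel"
      unfolding f1_def f2_def by measurable
    have f1: "f1 \<in> Lp_space 2" and f2: "f2 \<in> Lp_space 2"
      unfolding Lp_space_2_iff
      by (auto intro!: Bochner_Integration.integrable_bound[OF Lp_space_2_integrable[OF f]] simp: f1_def f2_def)
    have Lmf: "(\<integral>\<^sup>+x. ennreal (cmod (f x) powr m) \<partial>lborel) \<le> ennreal (B powr m)"
      using Lm by (simp add: Lm_bound_def f_def)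
    have "(\<integral>\<^sup>+x. ennreal (cmod (f1 x)) \<partial>lborel) \<le> (\<integral>\<^sup>+x. ennreal (l powr (1 - m)) * ennreal (cmod (f x) powr m) \<partial>lborel)"
    proof (rule nn_integral_mono)
      fix x
      have "cmod (f x) \<le> l powr (1 - m) * cmod (f x) powr m" if "cmod (f x) > l"
      proof -
        have "cmod (f x) = cmod (f x) powr (1 - m) * cmod (f x) powr m"
          using that l by (simp add: powr_add[symmetric])
        also have "\<dots> \<le> l powr (1 - m) * cmod (f x) powr m"
          using that l m by (intro mult_right_mono powr_mono2') auto
        finally show ?thesis .
      qed
      thus "ennreal (cmod (f1 x)) \<le> ennreal (l powr (1 - m)) * ennreal (cmod (f x) powr m)"
        by (auto simp: f1_def ennreal_mult'[symmetric] ennreal_leI)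
    qed
    also have "\<dots> \<le> ennreal (l powr (1 - m)) * ennreal (B powr m)"
      using Lmf by (subst nn_integral_cmult) (auto intro!: mult_left_mono)
    also have "\<dots> = ennreal (l powr (1 - m) * B powr m)"
      by (simp add: ennreal_mult')
    finally have n1: "(\<integral>\<^sup>+x. ennreal (cmod (f1 x)) \<partial>lborel) \<le> ennreal (l powr (1 - m) * B powr m)" .
    have i1: "integrable lborel f1"
      using n1 by (auto simp: integrable_iff_bounded intro: le_less_trans)
    have n1': "(\<integral>x. cmod (f1 x) \<partial>lborel) \<le> l powr (1 - m) * B powr m"
      using n1 i1 by (subst (asm) nn_integral_eq_integral) auto
    have "(\<integral>\<^sup>+x. ennreal ((cmod (f2 x))\<^sup>2) \<partial>lborel) \<le> (\<integral>\<^sup>+x. ennreal (l powr (2 - m)) * ennreal (cmod (f x) powr m) \<partial>lborel)"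
    proof (rule nn_integral_mono)
      fix x
      have "(cmod (f x))\<^sup>2 \<le> l powr (2 - m) * cmod (f x) powr m" if "cmod (f x) \<le> l"
      proof (cases "f x = 0")
        case False
        have "(cmod (f x))\<^sup>2 = cmod (f x) powr (2 - m) * cmod (f x) powr m"
          using False by (simp add: powr_add[symmetric])
        also have "\<dots> \<le> l powr (2 - m) * cmod (f x) powr m"
          using that l m by (intro mult_right_mono powr_mono2) auto
        finally show ?thesis .
      qed simp
      thus "ennreal ((cmod (f2 x))\<^sup>2) \<le> ennreal (l powr (2 - m)) * ennreal (cmod (f x) powr m)"
        by (auto simp: f2_def ennreal_mult'[symmetric] ennreal_leI)
    qed
    also have "\<dots> \<le> ennreal (l powr (2 - m)) * ennreal (B powr m)"
      using Lmf by (subst nn_integral_cmult) (auto intro!: mult_left_mono)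
    also have "\<dots> = ennreal (l powr (2 - m) * B powr m)"
      by (simp add: ennreal_mult')
    finally have n2: "(\<integral>\<^sup>+x. ennreal ((cmod (f2 x))\<^sup>2) \<partial>lborel) \<le> ennreal (l powr (2 - m) * B powr m)" .
    have "v = abs_l2 (\<lambda>x. f1 x + f2 x)"
      by (subst abs_rep_l2[of v, symmetric]) (rule arg_cong[of _ _ abs_l2], auto simp: f1_def f2_def f_def)
    hence "v = abs_l2 f1 + abs_l2 f2"
      by (simp add: abs_l2_add f1 f2)
    \<comment> \<open>The integrable part has a bounded transform, paid for by the volume of the
      ball; the other part is transformed isometrically, without regard to the ball.\<close>
    hence Fv: "fourier_l2 v = abs_l2 (FT (-1) f1) + fourier_l2 (abs_l2 f2)"
      by (simp add: fop_add fop_abs_l2 i1 f1)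
    define g where "g = rep_l2 (fourier_l2 (abs_l2 f2))"
    have [measurable]: "g \<in> borel_measurable lborel" by (simp add: g_def)
    have "AE \<xi> in lborel. rep_l2 (fourier_l2 v) \<xi> = FT (-1) f1 \<xi> + g \<xi>"
      using rep_l2_add[of "abs_l2 (FT (-1) f1)" "fourier_l2 (abs_l2 f2)"] rep_abs_l2[OF FT_in_Lp[OF i1 f1, of "-1"]]
      unfolding Fv g_def by auto
    hence "(\<integral>\<^sup>+\<xi>. indicator (cball 0 R) \<xi> * ennreal ((cmod (rep_l2 (fourier_l2 v) \<xi>))\<^sup>2) \<partial>lborel)
      \<le> (\<integral>\<^sup>+\<xi>. ennreal (2 * (c * (l powr (1 - m) * B powr m))\<^sup>2) * indicator (cball 0 R) \<xi> + ennreal 2 * ennreal ((cmod (g \<xi>))\<^sup>2) \<partial>lborel)"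
    proof (intro nn_integral_mono_AE, eventually_elim)
      case (elim \<xi>)
      have "cmod (FT (-1) f1 \<xi>) \<le> c * (l powr (1 - m) * B powr m)"
      proof -
        have "cmod (FT (-1) f1 \<xi>) \<le> c * (\<integral>x. cmod (f1 x) \<partial>lborel)"
          using FT_bound[OF i1, of "-1" \<xi>] by (simp add: c_def n_def)
        also have "\<dots> \<le> c * (l powr (1 - m) * B powr m)"
          using n1' c by (intro mult_left_mono) auto
        finally show ?thesis .
      qed
      hence "(cmod (FT (-1) f1 \<xi>))\<^sup>2 \<le> (c * (l powr (1 - m) * B powr m))\<^sup>2"
        by (intro power_mono) auto
      hence "(cmod (rep_l2 (fourier_l2 v) \<xi>))\<^sup>2 \<le> 2 * (c * (l powr (1 - m) * B powr m))\<^sup>2 + 2 * (cmod (g \<xi>))\<^sup>2"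
        unfolding elim using cmod_add_sq_le[of "FT (-1) f1 \<xi>" "g \<xi>"] by linarith
      hence "ennreal ((cmod (rep_l2 (fourier_l2 v) \<xi>))\<^sup>2)
          \<le> ennreal (2 * (c * (l powr (1 - m) * B powr m))\<^sup>2 + 2 * (cmod (g \<xi>))\<^sup>2)"
        by (rule ennreal_leI)
      also have "\<dots> = ennreal (2 * (c * (l powr (1 - m) * B powr m))\<^sup>2) + ennreal 2 * ennreal ((cmod (g \<xi>))\<^sup>2)"
        by (subst ennreal_plus) (auto simp: ennreal_mult')
      finally show ?case by (auto simp: indicator_def)
    qed
    also have "\<dots> = ennreal (2 * (c * (l powr (1 - m) * B powr m))\<^sup>2) * emeasure lborel (cball (0::real^'n) R)
        + ennreal 2 * (\<integral>\<^sup>+\<xi>. ennreal ((cmod (g \<xi>))\<^sup>2) \<partial>lborel)"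
      by (simp add: nn_integral_add nn_integral_cmult nn_integral_cmult_indicator)
    also have "(\<integral>\<^sup>+\<xi>. ennreal ((cmod (g \<xi>))\<^sup>2) \<partial>lborel) = (\<integral>\<^sup>+x. ennreal ((cmod (f2 x))\<^sup>2) \<partial>lborel)"
      by (simp add: g_def ennreal_norm_l2_sq[symmetric] ennreal_norm_abs_l2_sq[symmetric] f2)
    also have "ennreal (2 * (c * (l powr (1 - m) * B powr m))\<^sup>2) * emeasure lborel (cball (0::real^'n) R) + ennreal 2 * \<dots>
        \<le> ennreal (2 * (c * (l powr (1 - m) * B powr m))\<^sup>2) * ennreal (V * R powr n) + ennreal 2 * ennreal (l powr (2 - m) * B powr m)"
      using R by (intro add_mono mult_left_mono n2) (simp_all add: emeasure_cball V_def n_def powr_realpow)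
    also have "\<dots> = ennreal (2 * (c * (l powr (1 - m) * B powr m))\<^sup>2 * (V * R powr n) + 2 * (l powr (2 - m) * B powr m))"
      using V by (subst ennreal_plus) (simp_all add: ennreal_mult')
    also have "2 * (c * (l powr (1 - m) * B powr m))\<^sup>2 * (V * R powr n) + 2 * (l powr (2 - m) * B powr m)
       = (2 * (V * c\<^sup>2) + 2) * B\<^sup>2 * R powr (2 * (n * (1 / m - 1 / 2)))"
    proof -
      have B2: "B\<^sup>2 = B powr 2" using B by simp
      have "n / m * (1 - m) = n / m - n" "n / m * (2 - m) = 2 * n / m - n"
        using m by (simp_all add: field_simps)
      note e = this
      have l1: "l powr (1 - m) = B powr (1 - m) * R powr (n / m - n)"
        unfolding l_def e(1)[symmetric] using B R by (simp add: powr_mult powr_powr)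
      have l2: "l powr (2 - m) = B powr (2 - m) * R powr (2 * n / m - n)"
        unfolding l_def e(2)[symmetric] using B R by (simp add: powr_mult powr_powr)
      have "(l powr (1 - m) * B powr m)\<^sup>2 * R powr n = B powr 2 * R powr (2 * (n * (1 / m - 1 / 2)))"
      proof -
        have "l powr (1 - m) * B powr m = B * R powr (n / m - n)"
          using B by (simp add: l1 powr_add[symmetric] mult_ac)
        hence "(l powr (1 - m) * B powr m)\<^sup>2 * R powr n = B\<^sup>2 * (R powr (n / m - n) * R powr (n / m - n) * R powr n)"
          by (simp add: power2_eq_square mult_ac)
        also have "R powr (n / m - n) * R powr (n / m - n) * R powr n = R powr (2 * (n * (1 / m - 1 / 2)))"
          by (simp add: powr_add[symmetric] algebra_simps)
        finally show ?thesis by (simp add: B2)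
      qed
      moreover have "l powr (2 - m) * B powr m = B powr 2 * R powr (2 * (n * (1 / m - 1 / 2)))"
        by (simp add: l2 mult_ac powr_add[symmetric]) (simp add: algebra_simps powr_add[symmetric])
      ultimately show ?thesis
        by (simp add: power_mult_distrib B2 algebra_simps)
    qed
    finally show "(\<integral>\<^sup>+\<xi>. indicator (cball 0 R) \<xi> * ennreal ((cmod (rep_l2 (fourier_l2 v) \<xi>))\<^sup>2) \<partial>lborel)
       \<le> ennreal ((2 * (V * c\<^sup>2) + 2) * B\<^sup>2 * R powr (2 * (real CARD('n) * (1 / m - 1 / 2))))"
      by (simp add: n_def)
  qed (use V c in \<open>auto intro!: add_nonneg_pos\<close>)
qed

section \<open>The Sobolev embedding\<close>

definition wt :: "real \<Rightarrow> real \<Rightarrow> 'a::euclidean_space \<Rightarrow> real" where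
  "wt \<sigma> \<rho> \<xi> = 1 + (\<rho> * norm \<xi>) powr \<sigma>"

lemma wt_ge_1 [simp]: "1 \<le> wt \<sigma> \<rho> \<xi>" and wt_pos [simp]: "0 < wt \<sigma> \<rho> \<xi>" and wt_nonneg [simp]: "0 \<le> wt \<sigma> \<rho> \<xi>"
  and wt_neq_0 [simp]: "wt \<sigma> \<rho> \<xi> \<noteq> 0"
proof -
  show *: "1 \<le> wt \<sigma> \<rho> \<xi>" by (simp add: wt_def)
  show "0 < wt \<sigma> \<rho> \<xi>" "0 \<le> wt \<sigma> \<rho> \<xi>" "wt \<sigma> \<rho> \<xi> \<noteq> 0" using * by linarith+
qed

lemma wt_measurable [measurable]: "wt \<sigma> \<rho> \<in> borel_measurable borel"
  unfolding wt_def by measurable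

lemma bounded_symbol_inverse_wt: "bounded_symbol (\<lambda>\<xi>. of_real (1 / wt \<sigma> \<rho> \<xi>)) 1"
  by (auto simp: bounded_symbol_def norm_divide divide_le_eq)

text \<open>Here \<open>\<beta> = 2 / (q - 2)\<close>, and the second alternative contains the critical exponent.\<close>

lemma wt_sublevel_integral:
  fixes n \<sigma> \<beta> :: real
  defines "n \<equiv> real DIM('a::euclidean_space)"
  assumes \<sigma>: "\<sigma> > 0" and \<beta>: "\<beta> > 0" and cond: "n < 2 * \<sigma> * (1 + \<beta>) \<or> (2 * \<sigma> < n \<and> n - 2 * \<sigma> = 2 * \<sigma> * \<beta>)"
  obtains K where "K > 0" "\<And>\<rho> \<theta>. \<rho> > 0 \<Longrightarrow> \<theta> > 0 \<Longrightarrow>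
    (\<integral>\<^sup>+\<xi>. indicator {\<xi>. wt \<sigma> \<rho> \<xi> powr \<beta> \<le> \<theta>} \<xi> * ennreal ((1 / wt \<sigma> \<rho> \<xi>)\<^sup>2) \<partial>(lborel :: 'a measure))
      \<le> ennreal (K * \<rho> powr (- n) * \<theta>\<^sup>2)"
proof -
  have n: "n > 0" by (simp add: n_def)
  define V where "V = unit_ball_vol n"
  have V: "V > 0" by (simp add: V_def n_def)
  have gr: "(\<integral>\<^sup>+x. indicator (cball 0 R) x * 1 \<partial>(lborel :: 'a measure)) \<le> ennreal (V * R powr n)" if "R > 0" for R
    using lebesgue_growth[OF that, where 'a = 'a] by (simp add: V_def n_def)
  show ?thesis
  proof (cases "n < 2 * \<sigma> * (1 + \<beta>)")
    case True
    obtain K where K: "K > 0" "\<And>(\<phi> :: 'a \<Rightarrow> ennreal) C X (k :: 'a \<Rightarrow> real).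
      \<phi> \<in> borel_measurable lborel \<Longrightarrow> C \<ge> 0 \<Longrightarrow> X > 0 \<Longrightarrow>
      (\<And>R. R > 0 \<Longrightarrow> (\<integral>\<^sup>+x. indicator (cball 0 R) x * \<phi> x \<partial>lborel) \<le> ennreal (C * R powr n)) \<Longrightarrow>
      (\<And>x. x \<noteq> 0 \<Longrightarrow> norm x \<le> X \<Longrightarrow> k x \<le> (norm x / X) powr (- 0)) \<Longrightarrow>
      (\<And>x. norm x > X \<Longrightarrow> k x \<le> (norm x / X) powr (- (2 * \<sigma> * (1 + \<beta>)))) \<Longrightarrow>
      (\<integral>\<^sup>+x. ennreal (k x) * \<phi> x \<partial>lborel) \<le> ennreal (K * C * X powr n)"
      by (rule shell_bound[of 0 n "2 * \<sigma> * (1 + \<beta>)", where 'a = 'a]) (use n True in auto)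
    show ?thesis
    proof (rule that[of "K * V"])
      fix \<rho> \<theta> :: real assume \<rho>: "\<rho> > 0" and \<theta>: "\<theta> > 0"
      \<comment> \<open>On the sublevel set, wt^(-2) = (wt^\<beta>)^2 wt^(-2-2\<beta>) is at most
        \<theta>^2 wt^(-2-2\<beta>). The last factor is integrable over the whole space exactly
        because n < 2 \<sigma> (1 + \<beta>).\<close>
      define k where "k \<xi> = wt \<sigma> \<rho> \<xi> powr (- 2 - 2 * \<beta>)" for \<xi> :: 'a
      have [measurable]: "k \<in> borel_measurable borel" unfolding k_def by measurable
      have "(\<integral>\<^sup>+\<xi>. indicator {\<xi>. wt \<sigma> \<rho> \<xi> powr \<beta> \<le> \<theta>} \<xi> * ennreal ((1 / wt \<sigma> \<rho> \<xi>)\<^sup>2) \<partial>(lborel :: 'a measure))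
        \<le> (\<integral>\<^sup>+\<xi>. ennreal (\<theta>\<^sup>2) * (ennreal (k \<xi>) * 1) \<partial>lborel)"
      proof (rule nn_integral_mono)
        fix \<xi> :: 'a
        have "(1 / wt \<sigma> \<rho> \<xi>)\<^sup>2 \<le> \<theta>\<^sup>2 * k \<xi>" if "wt \<sigma> \<rho> \<xi> powr \<beta> \<le> \<theta>"
        proof -
          have "(1 / wt \<sigma> \<rho> \<xi>)\<^sup>2 = wt \<sigma> \<rho> \<xi> powr (- 2)"
            by (simp add: powr_minus_divide power_divide)
          also have "\<dots> = (wt \<sigma> \<rho> \<xi> powr \<beta>)\<^sup>2 * k \<xi>"
            unfolding k_def power2_eq_square by (simp add: powr_add[symmetric])
          also have "\<dots> \<le> \<theta>\<^sup>2 * k \<xi>"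
            using that by (intro mult_right_mono power_mono) (auto simp: k_def)
          finally show ?thesis .
        qed
        thus "indicator {\<xi>. wt \<sigma> \<rho> \<xi> powr \<beta> \<le> \<theta>} \<xi> * ennreal ((1 / wt \<sigma> \<rho> \<xi>)\<^sup>2) \<le> ennreal (\<theta>\<^sup>2) * (ennreal (k \<xi>) * 1)"
          by (auto simp: indicator_def ennreal_mult'[symmetric] ennreal_leI)
      qed
      also have "\<dots> = ennreal (\<theta>\<^sup>2) * (\<integral>\<^sup>+\<xi>. ennreal (k \<xi>) * 1 \<partial>lborel)"
        by (rule nn_integral_cmult) measurable
      also have "(\<integral>\<^sup>+\<xi>. ennreal (k \<xi>) * 1 \<partial>lborel) \<le> ennreal (K * V * (1 / \<rho>) powr n)"
      proof (rule K(2)[OF _ _ _ gr])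
        fix \<xi> :: 'a
        show "\<xi> \<noteq> 0 \<Longrightarrow> norm \<xi> \<le> 1 / \<rho> \<Longrightarrow> k \<xi> \<le> (norm \<xi> / (1 / \<rho>)) powr - 0"
          using \<rho> powr_mono[of "- 2 - 2 * \<beta>" 0 "wt \<sigma> \<rho> \<xi>"] \<beta> by (simp add: k_def)
        assume x: "norm \<xi> > 1 / \<rho>"
        have pos: "\<rho> * norm \<xi> > 0" using x \<rho> by (smt (verit) divide_pos_pos mult_pos_pos)
        have "k \<xi> \<le> ((\<rho> * norm \<xi>) powr \<sigma>) powr (- 2 - 2 * \<beta>)"
          unfolding k_def using pos \<beta> by (intro powr_mono2') (auto simp: wt_def)
        also have "\<dots> = (norm \<xi> / (1 / \<rho>)) powr (- (2 * \<sigma> * (1 + \<beta>)))"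
          by (simp add: powr_powr algebra_simps)
        finally show "k \<xi> \<le> (norm \<xi> / (1 / \<rho>)) powr (- (2 * \<sigma> * (1 + \<beta>)))" .
      qed (use \<rho> V in auto)
      also have "ennreal (\<theta>\<^sup>2) * ennreal (K * V * (1 / \<rho>) powr n) = ennreal (K * V * \<rho> powr (- n) * \<theta>\<^sup>2)"
        using \<rho> by (subst ennreal_mult'[symmetric]) (auto simp: powr_minus powr_divide field_simps)
      finally show "(\<integral>\<^sup>+\<xi>. indicator {\<xi>. wt \<sigma> \<rho> \<xi> powr \<beta> \<le> \<theta>} \<xi> * ennreal ((1 / wt \<sigma> \<rho> \<xi>)\<^sup>2) \<partial>(lborel :: 'a measure))
          \<le> ennreal (K * V * \<rho> powr (- n) * \<theta>\<^sup>2)"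
        by (simp add: mult_left_mono)
    qed (use K V in auto)
  next
    case False
    hence crit: "2 * \<sigma> < n" "n - 2 * \<sigma> = 2 * \<sigma> * \<beta>" using cond by auto
    define K where "K = 2 powr (2 * \<sigma>) / (1 - 2 powr (2 * \<sigma> - n))"
    have K: "K > 0" using crit by (auto simp: K_def powr_less_one)
    show ?thesis
    proof (rule that[of "K * V"])
      fix \<rho> \<theta> :: real assume \<rho>: "\<rho> > 0" and \<theta>: "\<theta> > 0"
      \<comment> \<open>At the critical exponent the previous majorant fails to be integrable.
        Instead the sublevel set is confined to the ball of radius X, on which |\<xi>|^(-2\<sigma>)
        is integrable since 2 \<sigma> < n; the relation n - 2 \<sigma> = 2 \<sigma> \<beta> then
        yields exactly \<theta>^2.\<close>
      define X where "X = \<theta> powr (1 / (\<beta> * \<sigma>)) / \<rho>"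
      have X: "X > 0" using \<rho> \<theta> by (simp add: X_def)
      have "(\<integral>\<^sup>+\<xi>. indicator {\<xi>. wt \<sigma> \<rho> \<xi> powr \<beta> \<le> \<theta>} \<xi> * ennreal ((1 / wt \<sigma> \<rho> \<xi>)\<^sup>2) \<partial>(lborel :: 'a measure))
        \<le> (\<integral>\<^sup>+\<xi>. ennreal ((\<rho> * X) powr (- (2 * \<sigma>))) * ((indicator (cball 0 X) \<xi> * ennreal ((norm \<xi> / X) powr (- (2 * \<sigma>)))) * 1) \<partial>(lborel :: 'a measure))"
      proof (rule nn_integral_mono_AE, use AE_lborel_neq_0 in eventually_elim)
        case (elim \<xi>)
        have r: "\<rho> * norm \<xi> > 0" using elim \<rho> by simp
        have "(1 / wt \<sigma> \<rho> \<xi>)\<^sup>2 \<le> (\<rho> * X) powr (- (2 * \<sigma>)) * (norm \<xi> / X) powr (- (2 * \<sigma>)) \<and> norm \<xi> \<le> X"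
          if w: "wt \<sigma> \<rho> \<xi> powr \<beta> \<le> \<theta>"
        proof
          have "(1 / wt \<sigma> \<rho> \<xi>)\<^sup>2 = wt \<sigma> \<rho> \<xi> powr (- 2)"
            by (simp add: powr_minus_divide power_divide)
          also have "\<dots> \<le> ((\<rho> * norm \<xi>) powr \<sigma>) powr (- 2)"
            using r by (intro powr_mono2') (auto simp: wt_def)
          also have "\<dots> = (\<rho> * X * (norm \<xi> / X)) powr (- (2 * \<sigma>))"
            using X by (simp add: powr_powr mult_ac)
          also have "\<dots> = (\<rho> * X) powr (- (2 * \<sigma>)) * (norm \<xi> / X) powr (- (2 * \<sigma>))"
            by (rule powr_mult)
          finally show "(1 / wt \<sigma> \<rho> \<xi>)\<^sup>2 \<le> (\<rho> * X) powr (- (2 * \<sigma>)) * (norm \<xi> / X) powr (- (2 * \<sigma>))" .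
          have "((\<rho> * norm \<xi>) powr \<sigma>) powr \<beta> \<le> wt \<sigma> \<rho> \<xi> powr \<beta>"
            using r \<beta> by (intro powr_mono2) (auto simp: wt_def)
          hence "(\<rho> * norm \<xi>) powr (\<beta> * \<sigma>) \<le> \<theta>"
            using w by (simp add: powr_powr mult.commute)
          hence "((\<rho> * norm \<xi>) powr (\<beta> * \<sigma>)) powr (1 / (\<beta> * \<sigma>)) \<le> \<theta> powr (1 / (\<beta> * \<sigma>))"
            using \<beta> \<sigma> by (intro powr_mono2) auto
          hence "\<rho> * norm \<xi> \<le> \<theta> powr (1 / (\<beta> * \<sigma>))"
            using r \<beta> \<sigma> by (simp add: powr_powr)
          thus "norm \<xi> \<le> X" using \<rho> by (simp add: X_def field_simps)
        qed
        thus ?case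
          by (auto simp: indicator_def ennreal_mult'[symmetric] ennreal_leI)
      qed
      also have "\<dots> = ennreal ((\<rho> * X) powr (- (2 * \<sigma>))) * (\<integral>\<^sup>+\<xi>. (indicator (cball 0 X) \<xi> * ennreal ((norm \<xi> / X) powr (- (2 * \<sigma>)))) * 1 \<partial>(lborel :: 'a measure))"
      proof (rule nn_integral_cmult)
        have [measurable]: "cball (0::'a) X \<in> sets borel" by simp
        show "(\<lambda>\<xi>::'a. indicator (cball 0 X) \<xi> * ennreal ((norm \<xi> / X) powr - (2 * \<sigma>)) * 1) \<in> borel_measurable lborel"
          by measurable
      qed
      also have "\<dots> \<le> ennreal ((\<rho> * X) powr (- (2 * \<sigma>))) * ennreal (2 powr (2 * \<sigma>) * V * X powr n / (1 - 2 powr (2 * \<sigma> - n)))"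
        by (intro mult_left_mono shell_inner[OF _ _ gr]) (use V X \<sigma> crit in auto)
      also have "\<dots> = ennreal (K * V * \<rho> powr (- n) * \<theta>\<^sup>2)"
      proof -
        have "(\<rho> * X) powr (- (2 * \<sigma>)) * X powr n = \<rho> powr (- n) * (\<rho> * X) powr (n - 2 * \<sigma>)"
          using \<rho> X by (simp add: powr_mult powr_add powr_diff powr_minus field_simps)
        also have "(\<rho> * X) powr (n - 2 * \<sigma>) = \<theta>\<^sup>2"
          unfolding crit(2) using \<rho> \<theta> \<beta> \<sigma> by (simp add: X_def powr_powr)
        finally have "(\<rho> * X) powr (- (2 * \<sigma>)) * (2 powr (2 * \<sigma>) * V * X powr n / (1 - 2 powr (2 * \<sigma> - n))) = K * V * \<rho> powr (- n) * \<theta>\<^sup>2"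
          by (simp add: K_def field_simps)
        thus ?thesis by (subst ennreal_mult'[symmetric]) auto
      qed
      finally show "(\<integral>\<^sup>+\<xi>. indicator {\<xi>. wt \<sigma> \<rho> \<xi> powr \<beta> \<le> \<theta>} \<xi> * ennreal ((1 / wt \<sigma> \<rho> \<xi>)\<^sup>2) \<partial>(lborel :: 'a measure))
          \<le> ennreal (K * V * \<rho> powr (- n) * \<theta>\<^sup>2)" .
    qed (use K V in auto)
  qed
qed

section \<open>Integration over level sets\<close>

lemma nn_integral_powr_0:
  assumes r: "r > 0" and a: "a \<ge> 0"
  shows "(\<integral>\<^sup>+l. ennreal (r * l powr (r - 1)) * indicator {0..a} l \<partial>lborel) = ennreal (a powr r)"
proof -
  have "((\<lambda>l. l powr (r - 1)) has_integral (a powr (r - 1 + 1) / (r - 1 + 1))) {0..a}"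
    using r a by (intro has_integral_powr_from_0) auto
  hence "((\<lambda>l. r * l powr (r - 1)) has_integral (r * (a powr (r - 1 + 1) / (r - 1 + 1)))) {0..a}"
    by (rule has_integral_mult_right)
  hence "((\<lambda>l. r * l powr (r - 1)) has_integral (a powr r)) {0..a}"
    using r by simp
  from nn_integral_has_integral_lebesgue[OF _ this] r
  have "(\<integral>\<^sup>+l. ennreal (indicator {0..a} l * (r * l powr (r - 1))) \<partial>lborel) = ennreal (a powr r)"
    by simp
  moreover have "ennreal (indicator {0..a} l * (r * l powr (r - 1))) = ennreal (r * l powr (r - 1)) * indicator {0..a} l" for l
    by (auto simp: indicator_def)
  ultimately show ?thesis by simp
qed

lemma nn_integral_powr_lt:
  assumes r: "r > 0" and a: "a \<ge> 0"
  shows "(\<integral>\<^sup>+l. ennreal (r * l powr (r - 1)) * indicator {0<..<a} l \<partial>lborel) = ennreal (a powr r)"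
proof -
  have "AE l in lborel. l \<noteq> (0::real)" "AE l in lborel. l \<noteq> a"
    using AE_lborel_singleton[of 0] AE_lborel_singleton[of a] by simp_all
  hence "(\<integral>\<^sup>+l. ennreal (r * l powr (r - 1)) * indicator {0<..<a} l \<partial>lborel)
      = (\<integral>\<^sup>+l. ennreal (r * l powr (r - 1)) * indicator {0..a} l \<partial>lborel)"
    by (intro nn_integral_cong_AE, eventually_elim) (auto simp: indicator_def)
  thus ?thesis using nn_integral_powr_0[OF assms] by simp
qed

lemma layer_cake:
  fixes f :: "'a \<Rightarrow> real"
  assumes "sigma_finite_measure M" and [measurable]: "f \<in> borel_measurable M" and f: "\<And>x. f x \<ge> 0" and q: "q > 0"
  shows "(\<integral>\<^sup>+x. ennreal (f x powr q) \<partial>M)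
    = (\<integral>\<^sup>+l. ennreal (q * l powr (q - 1)) * indicator {0<..} l * emeasure M {x \<in> space M. l < f x} \<partial>lborel)"
proof -
  interpret pair_sigma_finite M lborel
    by (intro pair_sigma_finite.intro assms(1) sigma_finite_lborel)
  have "(\<integral>\<^sup>+x. ennreal (f x powr q) \<partial>M)
     = (\<integral>\<^sup>+x. (\<integral>\<^sup>+l. ennreal (q * l powr (q - 1)) * indicator {0<..<f x} l \<partial>lborel) \<partial>M)"
    by (simp add: nn_integral_powr_lt[OF q f])
  also have "\<dots> = (\<integral>\<^sup>+x. (\<integral>\<^sup>+l. ennreal (q * l powr (q - 1)) * (if 0 < l \<and> l < f x then 1 else 0) \<partial>lborel) \<partial>M)"
    by (intro nn_integral_cong) (auto simp: indicator_def)
  also have "\<dots> = (\<integral>\<^sup>+l. (\<integral>\<^sup>+x. ennreal (q * l powr (q - 1)) * (if 0 < l \<and> l < f x then 1 else 0) \<partial>M) \<partial>lborel)"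
    by (rule Fubini'[symmetric]) measurable
  also have "\<dots> = (\<integral>\<^sup>+l. ennreal (q * l powr (q - 1)) * indicator {0<..} l * emeasure M {x \<in> space M. l < f x} \<partial>lborel)"
  proof (rule nn_integral_cong)
    fix l :: real
    have "(\<integral>\<^sup>+x. ennreal (q * l powr (q - 1)) * (if 0 < l \<and> l < f x then 1 else 0) \<partial>M)
      = (\<integral>\<^sup>+x. ennreal (q * l powr (q - 1)) * indicator {0<..} l * indicator {x \<in> space M. l < f x} x \<partial>M)"
      by (rule nn_integral_cong) (auto simp: indicator_def)
    also have "\<dots> = ennreal (q * l powr (q - 1)) * indicator {0<..} l * emeasure M {x \<in> space M. l < f x}"
      by (rule nn_integral_cmult_indicator) measurable
    finally show "(\<integral>\<^sup>+x. ennreal (q * l powr (q - 1)) * (if 0 < l \<and> l < f x then 1 else 0) \<partial>M)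
       = ennreal (q * l powr (q - 1)) * indicator {0<..} l * emeasure M {x \<in> space M. l < f x}" .
  qed
  finally show ?thesis .
qed

lemma Chebyshev_l2:
  fixes v :: "'a::euclidean_space l2"
  assumes t: "t > 0"
  shows "emeasure lborel {x. t \<le> cmod (rep_l2 v x)} \<le> ennreal ((norm v)\<^sup>2 / t\<^sup>2)"
proof -
  have "emeasure lborel {x. t \<le> cmod (rep_l2 v x)} = (\<integral>\<^sup>+x. indicator {x. t \<le> cmod (rep_l2 v x)} x \<partial>lborel)"
    by (rule nn_integral_indicator[symmetric]) simp
  also have "\<dots> \<le> (\<integral>\<^sup>+x. ennreal (1 / t\<^sup>2) * ennreal ((cmod (rep_l2 v x))\<^sup>2) \<partial>lborel)"
  proof (rule nn_integral_mono)
    fix x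
    have "1 \<le> 1 / t\<^sup>2 * (cmod (rep_l2 v x))\<^sup>2" if "t \<le> cmod (rep_l2 v x)"
      using power_mono[OF that, of 2] t by (simp add: field_simps)
    hence "ennreal 1 \<le> ennreal (1 / t\<^sup>2 * (cmod (rep_l2 v x))\<^sup>2)" if "t \<le> cmod (rep_l2 v x)"
      using that by (intro ennreal_leI) auto
    thus "indicator {x. t \<le> cmod (rep_l2 v x)} x \<le> ennreal (1 / t\<^sup>2) * ennreal ((cmod (rep_l2 v x))\<^sup>2)"
      by (auto simp: indicator_def ennreal_mult'[symmetric])
  qed
  also have "\<dots> = ennreal (1 / t\<^sup>2) * ennreal ((norm v)\<^sup>2)"
    by (simp add: nn_integral_cmult ennreal_norm_l2_sq)
  also have "\<dots> = ennreal ((norm v)\<^sup>2 / t\<^sup>2)"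
    by (subst ennreal_mult'[symmetric]) auto
  finally show ?thesis .
qed

lemma ennreal_sq_leD:
  fixes x :: ennreal
  assumes "x\<^sup>2 \<le> ennreal (t\<^sup>2)" "t \<ge> 0"
  shows "x \<le> ennreal t"
proof (cases x)
  case (real r)
  hence "r\<^sup>2 \<le> t\<^sup>2" using assms by (simp add: ennreal_power)
  thus ?thesis using real assms by (auto intro!: ennreal_leI power2_le_imp_le)
next
  case top
  thus ?thesis using assms by (simp add: power2_eq_square ennreal_top_mult top_unique)
qed

text \<open>The proof of Chemin and Xu: a level set \<open>{|u| > l}\<close> is estimated by removing from \<open>u\<close>
  the frequencies that contribute at most \<open>l / 2\<close> in the supremum norm.\<close>

theorem sobolev_embedding:
  fixes n \<sigma> q :: real
  defines "n \<equiv> real CARD('n)"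
  assumes \<sigma>: "\<sigma> > 0" and q: "q > 2" and cond: "n \<le> 2 * \<sigma> \<or> q \<le> 2 * n / (n - 2 * \<sigma>)"
  obtains C where "C > 0" "\<And>\<rho> (z :: (real ^ 'n) l2) N. \<rho> > 0 \<Longrightarrow> norm z \<le> N \<Longrightarrow> N > 0 \<Longrightarrow>
    Lm_bound q (C * \<rho> powr (- n * (1/2 - 1/q)) * N) (rep_l2 (inv_fourier_l2 (mul (\<lambda>\<xi>. of_real (1 / wt \<sigma> \<rho> \<xi>)) z)))"
proof -
  \<comment> \<open>Chosen so that (w^\<beta>)^(q-2) = w^2, which cancels the weight in g = z / w at
    the end.\<close>
  define \<beta> where "\<beta> = 2 / (q - 2)"
  have \<beta>: "\<beta> > 0" using q by (simp add: \<beta>_def)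
  have n: "n > 0" by (simp add: n_def)
  have cond': "n < 2 * \<sigma> * (1 + \<beta>) \<or> (2 * \<sigma> < n \<and> n - 2 * \<sigma> = 2 * \<sigma> * \<beta>)"
  proof (cases "n \<le> 2 * \<sigma>")
    case True
    thus ?thesis using mult_pos_pos[OF \<sigma> \<beta>] by (simp add: algebra_simps)
  next
    case False
    hence "q * (n - 2 * \<sigma>) \<le> 2 * n" using cond by (simp add: field_simps)
    hence "(q - 2) * (n - 2 * \<sigma>) \<le> 4 * \<sigma>" by (simp add: algebra_simps)
    hence "n - 2 * \<sigma> \<le> 2 * \<sigma> * \<beta>" using q by (simp add: \<beta>_def field_simps)
    thus ?thesis using False by (auto simp: algebra_simps)
  qed
  obtain K where K: "K > 0" "\<And>\<rho> \<theta>. \<rho> > 0 \<Longrightarrow> \<theta> > 0 \<Longrightarrow>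
    (\<integral>\<^sup>+\<xi>. indicator {\<xi>. wt \<sigma> \<rho> \<xi> powr \<beta> \<le> \<theta>} \<xi> * ennreal ((1 / wt \<sigma> \<rho> \<xi>)\<^sup>2) \<partial>(lborel :: (real^'n) measure))
      \<le> ennreal (K * \<rho> powr (- n) * \<theta>\<^sup>2)"
    using wt_sublevel_integral[OF \<sigma> \<beta>, where 'a = "real^'n"] cond' by (auto simp: n_def)
  define c where "c = (2 * pi) powr (- n / 2)"
  have c: "c > 0" by (simp add: c_def)
  define c' where "c' = c * sqrt K"
  have c': "c' > 0" using c K by (simp add: c'_def)
  define C where "C = (4 * q / (q - 2) * (2 * c') powr (q - 2)) powr (1 / q)"
  have C: "C > 0" using q c' by (simp add: C_def)
  show ?thesis
  proof (rule that[OF C])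
    fix \<rho> :: real and z :: "(real ^ 'n) l2" and N assume \<rho>: "\<rho> > 0" and zN: "norm z \<le> N" and N: "N > 0"
    define w where "w = (wt \<sigma> \<rho> :: real^'n \<Rightarrow> real)"
    have w1: "1 \<le> w \<xi>" "0 < w \<xi>" "w \<xi> \<noteq> 0" "0 \<le> w \<xi>" for \<xi> by (simp_all add: w_def)
    have [measurable]: "w \<in> borel_measurable borel" by (simp add: w_def)
    define G where "G = mul (\<lambda>\<xi>. of_real (1 / w \<xi>)) z"
    define g where "g = rep_l2 G"
    have [measurable]: "g \<in> borel_measurable lborel" "g \<in> borel_measurable borel"
      using l2_fun_measurable[of G] by (simp_all add: g_def)
    have gz: "AE \<xi> in lborel. g \<xi> = of_real (1 / w \<xi>) * rep_l2 z \<xi>"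
      unfolding g_def G_def w_def by (rule rep_mul[OF bounded_symbol_inverse_wt])
    define u where "u = rep_l2 (inv_fourier_l2 G)"
    have [measurable]: "u \<in> borel_measurable lborel" by (simp add: u_def)
    \<comment> \<open>Calibrated so that Cauchy-Schwarz bounds the L^1 norm of \<open>g\<close> over
      \<open>E l\<close> by l / (2 c), that is, its inverse transform by l / 2.\<close>
    define a where "a = 2 * N * c' * \<rho> powr (- n / 2)"
    have a: "a > 0" using N c' \<rho> by (simp add: a_def)
    define E where "E l = {\<xi>. w \<xi> powr \<beta> \<le> l / a}" for l
    have E [measurable]: "E l \<in> sets borel" for l unfolding E_def by measurable
    have E': "- E l \<in> sets borel" for l using E[of l] by (simp add: borel_comp)
    have level: "emeasure lborel {x. l < cmod (u x)}
        \<le> ennreal (4 / l\<^sup>2) * (\<integral>\<^sup>+\<xi>. ennreal ((cmod (g \<xi>))\<^sup>2) * indicator (- E l) \<xi> \<partial>lborel)" if l: "l > 0" for l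
    proof -
      define g1 where "g1 = (\<lambda>\<xi>. indicator (E l) \<xi> * g \<xi>)"
      have g1L: "g1 \<in> Lp_space 2"
        unfolding g1_def g_def by (rule mul_in_Lp[OF bounded_symbol_indicator[OF E]])
      have "(\<integral>\<^sup>+\<xi>. ennreal (cmod (g1 \<xi>)) \<partial>lborel)
         = (\<integral>\<^sup>+\<xi>. (indicator (E l) \<xi> * ennreal (1 / w \<xi>)) * ennreal (cmod (rep_l2 z \<xi>)) \<partial>lborel)"
        by (rule nn_integral_cong_AE, use gz in eventually_elim)
          (use w1 in \<open>auto simp: g1_def indicator_def norm_mult norm_divide ennreal_mult'[symmetric] abs_of_pos\<close>)
      also have "\<dots>\<^sup>2 \<le> (\<integral>\<^sup>+\<xi>. (indicator (E l) \<xi> * ennreal (1 / w \<xi>))\<^sup>2 \<partial>lborel) * (\<integral>\<^sup>+\<xi>. (ennreal (cmod (rep_l2 z \<xi>)))\<^sup>2 \<partial>lborel)"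
        by (rule Cauchy_Schwarz_nn_integral) measurable
      also have "(\<integral>\<^sup>+\<xi>. (ennreal (cmod (rep_l2 z \<xi>)))\<^sup>2 \<partial>lborel) = ennreal ((norm z)\<^sup>2)"
        by (simp add: ennreal_norm_l2_sq ennreal_power)
      also have "(\<integral>\<^sup>+\<xi>. (indicator (E l) \<xi> * ennreal (1 / w \<xi>))\<^sup>2 \<partial>lborel)
          = (\<integral>\<^sup>+\<xi>. indicator {\<xi>. wt \<sigma> \<rho> \<xi> powr \<beta> \<le> l / a} \<xi> * ennreal ((1 / wt \<sigma> \<rho> \<xi>)\<^sup>2) \<partial>(lborel :: (real^'n) measure))"
        by (rule nn_integral_cong) (use w1 in \<open>auto simp: indicator_def E_def w_def ennreal_power less_imp_le\<close>)
      also have "\<dots> \<le> ennreal (K * \<rho> powr (- n) * (l / a)\<^sup>2)"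
        using \<rho> l a by (intro K) auto
      also have "ennreal (K * \<rho> powr (- n) * (l / a)\<^sup>2) * ennreal ((norm z)\<^sup>2) \<le> ennreal (K * \<rho> powr (- n) * (l / a)\<^sup>2) * ennreal (N\<^sup>2)"
        by (intro mult_left_mono ennreal_leI power_mono zN) auto
      also have "\<dots> = ennreal ((sqrt K * \<rho> powr (- n / 2) * (l / a) * N)\<^sup>2)"
      proof -
        have "(\<rho> powr (- n / 2))\<^sup>2 = \<rho> powr (- n)"
          by (simp add: power2_eq_square powr_add[symmetric])
        thus ?thesis using K(1) by (subst ennreal_mult'[symmetric]) (auto simp: power_mult_distrib power_divide)
      qed
      also have "sqrt K * \<rho> powr (- n / 2) * (l / a) * N = l / (2 * c)"
        using K c N \<rho> by (simp add: a_def c'_def)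
      finally have sq: "(\<integral>\<^sup>+\<xi>. ennreal (cmod (g1 \<xi>)) \<partial>lborel)\<^sup>2 \<le> ennreal ((l / (2 * c))\<^sup>2)"
        by (simp add: mult_right_mono)
      have n1: "(\<integral>\<^sup>+\<xi>. ennreal (cmod (g1 \<xi>)) \<partial>lborel) \<le> ennreal (l / (2 * c))"
        by (rule ennreal_sq_leD[OF sq]) (use l c in simp)
      have [measurable]: "g1 \<in> borel_measurable lborel" using g1L by (rule Lp_space_measurable)
      have i1: "integrable lborel g1"
        using n1 by (auto simp: integrable_iff_bounded intro: le_less_trans)
      have n1': "(\<integral>\<xi>. cmod (g1 \<xi>) \<partial>lborel) \<le> l / (2 * c)"
        using n1 i1 l c by (subst (asm) nn_integral_eq_integral) (auto simp: ennreal_le_iff)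
      define H where "H = mul (indicator (- E l)) G"
      have "G = abs_l2 g1 + H"
      proof -
        have "abs_l2 g1 + H = mul (\<lambda>\<xi>. indicator (E l) \<xi> + indicator (- E l) \<xi>) G"
          unfolding H_def g1_def g_def mul_def[of "indicator (E l)", symmetric]
          by (rule mul_symbol_add[symmetric, OF bounded_symbol_indicator[OF E] bounded_symbol_indicator[OF E']])
        also have "(\<lambda>\<xi>. indicator (E l) \<xi> + indicator (- E l) \<xi>) = (\<lambda>\<xi>::real^'n. 1 :: complex)"
          by (auto simp: indicator_def)
        also have "mul (\<lambda>\<xi>. 1) G = G" by (simp add: mul_def)
        finally show ?thesis by simp
      qed
      hence FG: "inv_fourier_l2 G = abs_l2 (FT 1 g1) + inv_fourier_l2 H"
        by (simp add: fop_add fop_abs_l2 i1 g1L)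
      define h where "h = rep_l2 (inv_fourier_l2 H)"
      have [measurable]: "h \<in> borel_measurable lborel" by (simp add: h_def)
      have ae: "AE x in lborel. u x = FT 1 g1 x + h x"
        unfolding u_def FG h_def
        using rep_l2_add[of "abs_l2 (FT 1 g1)" "inv_fourier_l2 H"] rep_abs_l2[OF FT_in_Lp[OF i1 g1L, of 1]] by auto
      have small: "cmod (FT 1 g1 x) \<le> l / 2" for x
      proof -
        have "cmod (FT 1 g1 x) \<le> c * (\<integral>\<xi>. cmod (g1 \<xi>) \<partial>lborel)"
          using FT_bound[OF i1, of 1 x] by (simp add: c_def n_def)
        also have "\<dots> \<le> c * (l / (2 * c))" using n1' c by (intro mult_left_mono) auto
        finally show ?thesis using c by simp
      qed
      have "emeasure lborel {x. l < cmod (u x)} \<le> emeasure lborel {x. l / 2 \<le> cmod (h x)}"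
      proof (rule emeasure_mono_AE)
        show "AE x in lborel. x \<in> {x. l < cmod (u x)} \<longrightarrow> x \<in> {x. l / 2 \<le> cmod (h x)}"
          using ae
        proof eventually_elim
          case (elim x)
          show ?case
            using norm_triangle_ineq[of "FT 1 g1 x" "h x"] small[of x] by (auto simp: elim)
        qed
      qed simp
      also have "\<dots> \<le> ennreal ((norm (inv_fourier_l2 H))\<^sup>2 / (l / 2)\<^sup>2)"
        unfolding h_def using l by (intro Chebyshev_l2) auto
      also have "\<dots> = ennreal (4 / l\<^sup>2) * ennreal ((norm H)\<^sup>2)"
        by (subst ennreal_mult'[symmetric]) (auto simp: power_divide field_simps)
      also have "ennreal ((norm H)\<^sup>2) = (\<integral>\<^sup>+\<xi>. ennreal ((cmod (g \<xi>))\<^sup>2) * indicator (- E l) \<xi> \<partial>lborel)"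
        unfolding H_def ennreal_norm_mul_sq[OF bounded_symbol_indicator[OF E']] g_def
        by (rule nn_integral_cong) (auto simp: indicator_def)
      finally show ?thesis .
    qed
    have "(\<integral>\<^sup>+x. ennreal (cmod (u x) powr q) \<partial>lborel)
      = (\<integral>\<^sup>+l. ennreal (q * l powr (q - 1)) * indicator {0<..} l * emeasure lborel {x \<in> space lborel. l < cmod (u x)} \<partial>lborel)"
      by (rule layer_cake) (use q in \<open>auto intro: sigma_finite_lborel\<close>)
    \<comment> \<open>The condition that \<xi> lies outside \<open>E l\<close> is rewritten as l < a
      w^\<beta>. After exchanging the integrals the level variable runs over (0, a w^\<beta>), which
      produces the power q - 2.\<close>
    also have "\<dots> \<le> (\<integral>\<^sup>+l. (\<integral>\<^sup>+\<xi>. ennreal (4 * q / (q - 2) * (cmod (g \<xi>))\<^sup>2) * (ennreal ((q - 2) * l powr (q - 2 - 1)) * (if 0 < l \<and> l < a * w \<xi> powr \<beta> then 1 else 0)) \<partial>lborel) \<partial>lborel)"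
    proof (rule nn_integral_mono)
      fix l :: real
      show "ennreal (q * l powr (q - 1)) * indicator {0<..} l * emeasure lborel {x \<in> space lborel. l < cmod (u x)}
        \<le> (\<integral>\<^sup>+\<xi>. ennreal (4 * q / (q - 2) * (cmod (g \<xi>))\<^sup>2) * (ennreal ((q - 2) * l powr (q - 2 - 1)) * (if 0 < l \<and> l < a * w \<xi> powr \<beta> then 1 else 0)) \<partial>lborel)"
      proof (cases "l > 0")
        case True
        have "ennreal (q * l powr (q - 1)) * indicator {0<..} l * emeasure lborel {x \<in> space lborel. l < cmod (u x)}
          \<le> ennreal (q * l powr (q - 1)) * (ennreal (4 / l\<^sup>2) * (\<integral>\<^sup>+\<xi>. ennreal ((cmod (g \<xi>))\<^sup>2) * indicator (- E l) \<xi> \<partial>lborel))"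
          using True by (auto intro!: mult_left_mono level)
        also have "\<dots> = ennreal (q * l powr (q - 1) * (4 / l\<^sup>2)) * (\<integral>\<^sup>+\<xi>. ennreal ((cmod (g \<xi>))\<^sup>2) * indicator (- E l) \<xi> \<partial>lborel)"
          using q by (subst mult.assoc[symmetric], subst ennreal_mult'[symmetric]) auto
        also have "q * l powr (q - 1) * (4 / l\<^sup>2) = 4 * q / (q - 2) * ((q - 2) * l powr (q - 2 - 1))"
        proof -
          have "l powr (q - 1) = l powr (q - 2 - 1) * l\<^sup>2"
            using True by (simp add: powr_add[symmetric] flip: powr_numeral)
          thus ?thesis using True q by simp
        qed
        also have "ennreal (4 * q / (q - 2) * ((q - 2) * l powr (q - 2 - 1))) * (\<integral>\<^sup>+\<xi>. ennreal ((cmod (g \<xi>))\<^sup>2) * indicator (- E l) \<xi> \<partial>lborel)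
          = (\<integral>\<^sup>+\<xi>. ennreal (4 * q / (q - 2) * ((q - 2) * l powr (q - 2 - 1))) * (ennreal ((cmod (g \<xi>))\<^sup>2) * indicator (- E l) \<xi>) \<partial>lborel)"
        proof (rule nn_integral_cmult[symmetric])
          have [measurable]: "- E l \<in> sets borel" by (rule E')
          show "(\<lambda>\<xi>. ennreal ((cmod (g \<xi>))\<^sup>2) * indicator (- E l) \<xi>) \<in> borel_measurable lborel"
            by measurable
        qed
        also have "\<dots> = (\<integral>\<^sup>+\<xi>. ennreal (4 * q / (q - 2) * (cmod (g \<xi>))\<^sup>2) * (ennreal ((q - 2) * l powr (q - 2 - 1)) * (if 0 < l \<and> l < a * w \<xi> powr \<beta> then 1 else 0)) \<partial>lborel)"
        proof (rule nn_integral_cong)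
          fix \<xi>
          show "ennreal (4 * q / (q - 2) * ((q - 2) * l powr (q - 2 - 1))) * (ennreal ((cmod (g \<xi>))\<^sup>2) * indicator (- E l) \<xi>)
            = ennreal (4 * q / (q - 2) * (cmod (g \<xi>))\<^sup>2) * (ennreal ((q - 2) * l powr (q - 2 - 1)) * (if 0 < l \<and> l < a * w \<xi> powr \<beta> then 1 else 0))"
            using True q a by (auto simp: indicator_def E_def field_simps ennreal_mult[symmetric])
        qed
        finally show ?thesis .
      qed simp
    qed
    also have "\<dots> = (\<integral>\<^sup>+\<xi>. (\<integral>\<^sup>+l. ennreal (4 * q / (q - 2) * (cmod (g \<xi>))\<^sup>2) * (ennreal ((q - 2) * l powr (q - 2 - 1)) * (if 0 < l \<and> l < a * w \<xi> powr \<beta> then 1 else 0)) \<partial>lborel) \<partial>lborel)"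
      by (rule lborel_pair.Fubini') measurable
    also have "\<dots> = (\<integral>\<^sup>+\<xi>. ennreal (4 * q / (q - 2) * (cmod (g \<xi>))\<^sup>2) * ennreal ((a * w \<xi> powr \<beta>) powr (q - 2)) \<partial>lborel)"
    proof (rule nn_integral_cong)
      fix \<xi>
      have "(\<integral>\<^sup>+l. ennreal (4 * q / (q - 2) * (cmod (g \<xi>))\<^sup>2) * (ennreal ((q - 2) * l powr (q - 2 - 1)) * (if 0 < l \<and> l < a * w \<xi> powr \<beta> then 1 else 0)) \<partial>lborel)
        = (\<integral>\<^sup>+l. ennreal (4 * q / (q - 2) * (cmod (g \<xi>))\<^sup>2) * (ennreal ((q - 2) * l powr (q - 2 - 1)) * indicator {0<..<a * w \<xi> powr \<beta>} l) \<partial>lborel)"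
        by (intro nn_integral_cong) (auto simp: indicator_def)
      also have "\<dots> = ennreal (4 * q / (q - 2) * (cmod (g \<xi>))\<^sup>2) * (\<integral>\<^sup>+l. (ennreal ((q - 2) * l powr (q - 2 - 1)) * indicator {0<..<a * w \<xi> powr \<beta>} l) \<partial>lborel)"
        by (rule nn_integral_cmult) measurable
      also have "(\<integral>\<^sup>+l. (ennreal ((q - 2) * l powr (q - 2 - 1)) * indicator {0<..<a * w \<xi> powr \<beta>} l) \<partial>lborel) = ennreal ((a * w \<xi> powr \<beta>) powr (q - 2))"
        using q a by (intro nn_integral_powr_lt) auto
      finally show "(\<integral>\<^sup>+l. ennreal (4 * q / (q - 2) * (cmod (g \<xi>))\<^sup>2) * (ennreal ((q - 2) * l powr (q - 2 - 1)) * (if 0 < l \<and> l < a * w \<xi> powr \<beta> then 1 else 0)) \<partial>lborel)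
        = ennreal (4 * q / (q - 2) * (cmod (g \<xi>))\<^sup>2) * ennreal ((a * w \<xi> powr \<beta>) powr (q - 2))" .
    qed
    also have "\<dots> = (\<integral>\<^sup>+\<xi>. ennreal (4 * q / (q - 2) * a powr (q - 2)) * ennreal ((cmod (rep_l2 z \<xi>))\<^sup>2) \<partial>lborel)"
    proof (rule nn_integral_cong_AE, use gz in eventually_elim)
      case (elim \<xi>)
      have "(w \<xi> powr \<beta>) powr (q - 2) = (w \<xi>)\<^sup>2"
      proof -
        have "\<beta> * (q - 2) = 2" using q by (simp add: \<beta>_def field_simps)
        thus ?thesis using w1[of \<xi>] by (simp only: powr_powr) simp
      qed
      hence "4 * q / (q - 2) * (cmod (g \<xi>))\<^sup>2 * (a * w \<xi> powr \<beta>) powr (q - 2) = 4 * q / (q - 2) * a powr (q - 2) * (cmod (rep_l2 z \<xi>))\<^sup>2"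
      proof -
        have "A * (Z / W) * (P * W) = A * P * Z" if "W \<noteq> 0" for A Z P W :: real
          using that by simp
        moreover have "(cmod (g \<xi>))\<^sup>2 = (cmod (rep_l2 z \<xi>))\<^sup>2 / (w \<xi>)\<^sup>2"
          using w1[of \<xi>] by (simp add: elim norm_mult norm_divide power_divide)
        moreover have "(a * w \<xi> powr \<beta>) powr (q - 2) = a powr (q - 2) * (w \<xi>)\<^sup>2"
          using \<open>(w \<xi> powr \<beta>) powr (q - 2) = (w \<xi>)\<^sup>2\<close> by (simp add: powr_mult)
        moreover have "(w \<xi>)\<^sup>2 \<noteq> 0" using w1[of \<xi>] by simp
        ultimately show ?thesis by metis
      qed
      thus ?case
        using q a by (subst (1 2) ennreal_mult[symmetric]) auto
    qed
    also have "\<dots> = ennreal (4 * q / (q - 2) * a powr (q - 2)) * ennreal ((norm z)\<^sup>2)"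
      by (simp add: nn_integral_cmult ennreal_norm_l2_sq)
    also have "\<dots> \<le> ennreal (4 * q / (q - 2) * a powr (q - 2)) * ennreal (N\<^sup>2)"
      by (intro mult_left_mono ennreal_leI power_mono zN) auto
    also have "\<dots> = ennreal ((C * \<rho> powr (- n * (1/2 - 1/q)) * N) powr q)"
    proof -
      have "a powr (q - 2) = (2 * c') powr (q - 2) * N powr (q - 2) * \<rho> powr (- n / 2 * (q - 2))"
        using N c' \<rho> by (simp add: a_def powr_mult powr_powr)
      moreover have "N powr (q - 2) * N\<^sup>2 = N powr q"
        using N by (simp add: powr_add[symmetric] flip: powr_numeral)
      moreover have "C powr q = 4 * q / (q - 2) * (2 * c') powr (q - 2)"
        using q c' by (simp add: C_def powr_powr)
      moreover have "(\<rho> powr (- n * (1/2 - 1/q))) powr q = \<rho> powr (- n / 2 * (q - 2))"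
      proof -
        have "- n * (1/2 - 1/q) * q = - n / 2 * (q - 2)" using q by (simp add: field_simps)
        thus ?thesis by (simp only: powr_powr)
      qed
      ultimately have "4 * q / (q - 2) * a powr (q - 2) * N\<^sup>2 = (C * \<rho> powr (- n * (1/2 - 1/q)) * N) powr q"
        using C N \<rho> by (simp add: powr_mult mult_ac)
      thus ?thesis using q by (subst ennreal_mult[symmetric]) auto
    qed
    finally show "Lm_bound q (C * \<rho> powr (- n * (1/2 - 1/q)) * N) (rep_l2 (inv_fourier_l2 (mul (\<lambda>\<xi>. of_real (1 / wt \<sigma> \<rho> \<xi>)) z)))"
      by (simp add: Lm_bound_def u_def G_def w_def)
  qed
qed

section \<open>The nonlinearity\<close>

lemma powr_diff_le:
  fixes a b p :: real
  assumes "0 \<le> a" "0 \<le> b" "1 \<le> p"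
  shows "\<bar>a powr p - b powr p\<bar> \<le> p * \<bar>a - b\<bar> * (max a b) powr (p - 1)"
proof -
  have main: "a powr p - b powr p \<le> p * (a - b) * a powr (p - 1)" if "0 \<le> b" "b < a" for a b :: real
  proof -
    have "continuous_on {b..a} (\<lambda>x. x powr p)"
      using that assms by (intro continuous_on_powr') (auto intro: continuous_intros)
    moreover have "(\<lambda>x. x powr p) differentiable (at x)" if "b < x" for x
      using that \<open>0 \<le> b\<close> has_real_derivative_powr[of x p] real_differentiable_def by fastforce
    ultimately obtain l z where z: "b < z" "z < a" "DERIV (\<lambda>x. x powr p) z :> l" "a powr p - b powr p = (a - b) * l"
      using MVT[of b a "\<lambda>x. x powr p"] \<open>b < a\<close> by blast
    have "l = p * z powr (p - 1)"
      using DERIV_unique[OF z(3) has_real_derivative_powr[of z p]] z that by auto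
    moreover have "z powr (p - 1) \<le> a powr (p - 1)"
      using z that assms by (intro powr_mono2) auto
    ultimately show ?thesis
      using z(4) that assms by (auto simp: mult_ac intro!: mult_left_mono)
  qed
  have mono: "x powr p \<le> y powr p" if "0 \<le> x" "x \<le> y" for x y :: real
    using that assms by (intro powr_mono2) auto
  consider "a < b" | "a = b" | "b < a" by linarith
  thus ?thesis
  proof cases
    case 1 thus ?thesis using main[of a b] mono[of a b] assms by (simp add: max_def)
  next
    case 3 thus ?thesis using main[of b a] mono[of b a] assms by (simp add: max_def)
  qed simp
qed

lemma abs_power_measurable [measurable]:
  "f \<in> borel_measurable M \<Longrightarrow> abs_power p f \<in> borel_measurable M"
  unfolding abs_power_def by measurable

lemma Lm_bound_abs_power:
  assumes "Lm_bound (p * r) X f" "X > 0"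
  shows "Lm_bound r (X powr p) (abs_power p f)"
  using assms by (simp add: Lm_bound_def abs_power_def powr_powr)

text \<open>Hoelder's inequality with exponents p and p / (p - 1), in the form of Young's inequality
  applied pointwise after dividing the difference by Y and the larger of the two moduli by X. All
  normalised integrals are then at most 1.\<close>

lemma Lm_bound_abs_power_diff:
  fixes f g :: "'a::euclidean_space \<Rightarrow> complex"
  assumes [measurable]: "f \<in> borel_measurable lborel" "g \<in> borel_measurable lborel"
    and p: "1 < p" and r: "0 < r" and X: "X > 0" and Y: "Y > 0"
    and f: "Lm_bound (p * r) X f" and g: "Lm_bound (p * r) X g" and fg: "Lm_bound (p * r) Y (\<lambda>x. f x - g x)"
  shows "Lm_bound r (2 powr (1 / r) * p * X powr (p - 1) * Y) (\<lambda>x. abs_power p f x - abs_power p g x)"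
proof -
  define s where "s = p * r"
  have s: "s > 0" using p r by (simp add: s_def)
  define c where "c = (p * X powr (p - 1) * Y) powr r"
  have c: "c \<ge> 0" by (simp add: c_def)
  have pt: "cmod (abs_power p f x - abs_power p g x) powr r
      \<le> c * ((1 / p) * (Y powr (- s) * cmod (f x - g x) powr s)
        + (1 - 1 / p) * (X powr (- s) * cmod (f x) powr s + X powr (- s) * cmod (g x) powr s))" (is "_ \<le> c * ?R") for x
  proof -
    define a b d where "a = cmod (f x)" and "b = cmod (g x)" and "d = cmod (f x - g x)"
    define h where "h = max a b"
    have nn: "a \<ge> 0" "b \<ge> 0" "d \<ge> 0" "h \<ge> 0" by (auto simp: a_def b_def d_def h_def le_max_iff_disj)
    have ab: "\<bar>a - b\<bar> \<le> d" unfolding a_def b_def d_def by (rule norm_triangle_ineq3)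
    have "cmod (abs_power p f x - abs_power p g x) = \<bar>a powr p - b powr p\<bar>"
      unfolding abs_power_def of_real_diff[symmetric] norm_of_real by (simp add: a_def b_def)
    also have "\<dots> \<le> p * \<bar>a - b\<bar> * h powr (p - 1)"
      unfolding h_def using nn p by (intro powr_diff_le) auto
    also have "\<dots> \<le> p * d * h powr (p - 1)"
      using ab p nn by (intro mult_right_mono mult_left_mono) auto
    also have "\<dots> = (p * X powr (p - 1) * Y) * ((d / Y) * (h / X) powr (p - 1))"
      using X Y nn by (simp add: powr_divide)
    finally have "cmod (abs_power p f x - abs_power p g x) powr r \<le> ((p * X powr (p - 1) * Y) * ((d / Y) * (h / X) powr (p - 1))) powr r"
      using r by (intro powr_mono2) auto
    also have "\<dots> = c * ((d / Y) powr r * (h / X) powr (r * (p - 1)))"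
      unfolding c_def powr_mult[of "p * X powr (p - 1) * Y"] powr_mult[of "d / Y"] powr_powr
      by (simp only: mult.commute[of "p - 1" r])
    also have "(d / Y) powr r * (h / X) powr (r * (p - 1))
        \<le> ((d / Y) powr r) powr p / p + ((h / X) powr (r * (p - 1))) powr (p / (p - 1)) / (p / (p - 1))"
      using p by (intro Youngs_inequality) (auto simp: field_simps)
    also have "\<dots> = (1 / p) * (d / Y) powr s + (1 - 1 / p) * (h / X) powr s"
    proof -
      have "r * (p - 1) * (p / (p - 1)) = s" "r * p = s" using p by (auto simp: s_def)
      moreover have "1 / (p / (p - 1)) = 1 - 1 / p" using p by (simp add: field_simps)
      ultimately show ?thesis unfolding powr_powr by (metis (no_types) divide_inverse mult.commute mult_1 inverse_eq_divide)
    qed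
    also have "\<dots> \<le> (1 / p) * (Y powr (- s) * d powr s) + (1 - 1 / p) * (X powr (- s) * a powr s + X powr (- s) * b powr s)"
    proof (intro add_mono mult_left_mono)
      show "(d / Y) powr s \<le> Y powr (- s) * d powr s"
        using Y nn by (simp add: powr_divide powr_minus field_simps)
      have "h powr s \<le> a powr s + b powr s"
        by (auto simp: h_def max_def)
      from mult_left_mono[OF this, of "X powr (- s)"] show "(h / X) powr s \<le> X powr (- s) * a powr s + X powr (- s) * b powr s"
        using X nn by (simp add: powr_divide powr_minus field_simps)
    qed (use p in auto)
    finally show ?thesis
      using c by (simp add: mult_left_mono a_def b_def d_def)
  qed
  have E: "ennreal (c * (u * x + v * (y + z))) = ennreal c * (ennreal u * ennreal x + ennreal v * (ennreal y + ennreal z))"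
    if "c \<ge> 0" "u \<ge> 0" "v \<ge> 0" "x \<ge> 0" "y \<ge> 0" "z \<ge> 0" for c u v x y z :: real
    using that by (simp add: ennreal_mult' ennreal_plus)
  have I: "(\<integral>\<^sup>+x. ennreal (Z powr (- s) * cmod (h x) powr s) \<partial>lborel) \<le> ennreal 1"
    if "Lm_bound (p * r) Z h" "Z > 0" and [measurable]: "h \<in> borel_measurable lborel" for Z and h :: "'a \<Rightarrow> complex"
  proof -
    have "(\<integral>\<^sup>+x. ennreal (Z powr (- s) * cmod (h x) powr s) \<partial>lborel) = ennreal (Z powr (- s)) * (\<integral>\<^sup>+x. ennreal (cmod (h x) powr s) \<partial>lborel)"
      by (subst nn_integral_cmult[symmetric]) (auto simp: ennreal_mult')
    also have "\<dots> \<le> ennreal (Z powr (- s)) * ennreal (Z powr s)"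
      using that(1) by (intro mult_left_mono) (auto simp: Lm_bound_def s_def)
    also have "\<dots> = ennreal 1"
      using that(2) by (subst ennreal_mult'[symmetric]) (auto simp: powr_add[symmetric])
    finally show ?thesis .
  qed
  have "(\<integral>\<^sup>+x. ennreal (cmod (abs_power p f x - abs_power p g x) powr r) \<partial>lborel)
    \<le> (\<integral>\<^sup>+x. ennreal c * (ennreal (1 / p) * ennreal (Y powr (- s) * cmod (f x - g x) powr s)
        + ennreal (1 - 1 / p) * (ennreal (X powr (- s) * cmod (f x) powr s) + ennreal (X powr (- s) * cmod (g x) powr s))) \<partial>lborel)"
  proof (rule nn_integral_mono)
    fix x
    have "ennreal (cmod (abs_power p f x - abs_power p g x) powr r)
      \<le> ennreal (c * ((1 / p) * (Y powr (- s) * cmod (f x - g x) powr s)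
        + (1 - 1 / p) * (X powr (- s) * cmod (f x) powr s + X powr (- s) * cmod (g x) powr s)))"
      by (intro ennreal_leI pt)
    also have "\<dots> = ennreal c * (ennreal (1 / p) * ennreal (Y powr (- s) * cmod (f x - g x) powr s)
        + ennreal (1 - 1 / p) * (ennreal (X powr (- s) * cmod (f x) powr s) + ennreal (X powr (- s) * cmod (g x) powr s)))"
      by (rule E) (use c p in auto)
    finally show "ennreal (cmod (abs_power p f x - abs_power p g x) powr r)
      \<le> ennreal c * (ennreal (1 / p) * ennreal (Y powr (- s) * cmod (f x - g x) powr s)
        + ennreal (1 - 1 / p) * (ennreal (X powr (- s) * cmod (f x) powr s) + ennreal (X powr (- s) * cmod (g x) powr s)))" .
  qed
  also have "\<dots> = ennreal c * (ennreal (1 / p) * (\<integral>\<^sup>+x. ennreal (Y powr (- s) * cmod (f x - g x) powr s) \<partial>lborel)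
        + ennreal (1 - 1 / p) * ((\<integral>\<^sup>+x. ennreal (X powr (- s) * cmod (f x) powr s) \<partial>lborel) + (\<integral>\<^sup>+x. ennreal (X powr (- s) * cmod (g x) powr s) \<partial>lborel)))"
    by (subst nn_integral_cmult, measurable) (simp add: nn_integral_add nn_integral_cmult)
  also have "\<dots> \<le> ennreal c * (ennreal (1 / p) * ennreal 1 + ennreal (1 - 1 / p) * (ennreal 1 + ennreal 1))"
    by (intro mult_left_mono add_mono I f g fg X Y) auto
  also have "\<dots> = ennreal (c * (1 / p * 1 + (1 - 1 / p) * (1 + 1)))"
    by (rule E[symmetric]) (use c p in auto)
  \<comment> \<open>The weights add up to 1/p + 2 (1 - 1/p) <= 2, since the power of the maximum was
    bounded by the sum of both powers. This 2 is the source of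
    \<open>2 powr (1 / r)\<close>.\<close>
  also have "\<dots> \<le> ennreal (c * 2)"
    using c p by (intro ennreal_leI mult_left_mono) (auto simp: field_simps)
  also have "c * 2 = (2 powr (1 / r) * p * X powr (p - 1) * Y) powr r"
    using r by (simp add: c_def powr_mult powr_powr mult_ac)
  finally show ?thesis by (simp add: Lm_bound_def)
qed

lemma Lm_bound_2:
  assumes [measurable]: "f \<in> borel_measurable lborel" and "Lm_bound 2 B f" "B \<ge> 0"
  shows "f \<in> Lp_space 2" "norm (abs_l2 f) \<le> B"
proof -
  have *: "(\<integral>\<^sup>+x. ennreal ((cmod (f x))\<^sup>2) \<partial>lborel) \<le> ennreal (B\<^sup>2)"
    using assms by (simp add: Lm_bound_def)
  show "f \<in> Lp_space 2"
    using * by (auto simp: Lp_space_2_iff_nn intro: le_less_trans)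
  thus "norm (abs_l2 f) \<le> B"
    using * assms(3) by (rule norm_l2_leI)
qed

section \<open>Pointwise estimates of the kernels\<close>

lemma mult_exp_minus_le: "0 < a \<Longrightarrow> t * exp (- (a * t)) \<le> (1 / a :: real)"
proof -
  assume a: "0 < a"
  have "a * t \<le> exp (a * t)" using exp_ge_add_one_self[of "a * t"] by linarith
  hence "a * t * exp (- (a * t)) \<le> exp (a * t) * exp (- (a * t))"
    by (intro mult_right_mono) auto
  hence "a * t * exp (- (a * t)) \<le> 1" by (simp add: exp_minus_inverse)
  thus ?thesis using a by (simp add: field_simps)
qed

lemma one_minus_exp_le: "1 - exp (- x) \<le> (x :: real)"
  using exp_ge_add_one_self[of "-x"] by linarith

lemma cmod_exp: "cmod (exp z) = exp (Re z)"
  by (simp add: norm_exp_eq_Re)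

text \<open>In terms of the damping \<open>A\<close> and the restoring coefficient \<open>B\<close>, the bounds hold in the
  overdamped, critical and oscillating regime alike.\<close>

lemma quot_bounds:
  fixes A B t :: real
  assumes A: "A > 0" and B: "B > 0" and BA: "B \<le> A\<^sup>2" and t: "t \<ge> 0"
  defines "l1 \<equiv> (- of_real A + csqrt (of_real (A\<^sup>2 - 4 * B))) / 2"
    and "l2 \<equiv> (- of_real A - csqrt (of_real (A\<^sup>2 - 4 * B))) / 2"
  shows "cmod (K1_quot l1 l2 t) \<le> t"
    and "cmod (K1_quot l1 l2 t) \<le> 8 / A * exp (- (B / A * t / 8))"
    and "cmod (K0_quot l1 l2 t) \<le> 9 * exp (- (B / A * t / 8))"
proof -
  define D where "D = sqrt \<bar>A\<^sup>2 - 4 * B\<bar>"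
  have D: "D \<ge> 0" "D\<^sup>2 = \<bar>A\<^sup>2 - 4 * B\<bar>" by (auto simp: D_def)
  have BA': "B / A \<le> A" using A BA by (simp add: field_simps power2_eq_square)
  define e where "e = exp (- (B / A * t / 8))"
  have e: "e > 0" by (simp add: e_def)
  have ex: "exp (- (a * t)) \<le> e" if "B / A / 8 \<le> a" for a
    using mult_right_mono[OF that t] by (simp add: e_def)
  \<comment> \<open>Half of the rate A / 4 absorbs the factor t at the cost 8 / A; the other half, A
    / 8, still dominates B / (8 A) because B <= A^2.\<close>
  have slow: "t * exp (- (a * t)) \<le> 8 / A * e" if "a \<ge> A / 4" for a
  proof -
    have "t * exp (- (a * t)) \<le> t * exp (- (A / 4 * t))"
      using mult_right_mono[OF that t] t by (intro mult_left_mono) auto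
    also have "\<dots> = (t * exp (- (A / 8 * t))) * exp (- (A / 8 * t))"
      by (simp add: mult_exp_exp mult.assoc)
    also have "\<dots> \<le> (1 / (A / 8)) * e"
      using A BA' t e by (intro mult_mono mult_exp_minus_le ex) auto
    finally show ?thesis by simp
  qed
  have main: "cmod (K1_quot l1 l2 t) \<le> t \<and> cmod (K1_quot l1 l2 t) \<le> 8 / A * e \<and> cmod (exp (l1 * of_real t)) \<le> e \<and> cmod l1 \<le> A"
  proof -
    consider "A\<^sup>2 - 4 * B > 0" | "A\<^sup>2 - 4 * B = 0" | "A\<^sup>2 - 4 * B < 0" by linarith
    thus ?thesis
    proof cases
      case 1
      have D0: "D > 0" using 1 by (simp add: D_def)
      have DD: "D\<^sup>2 = A\<^sup>2 - 4 * B" using 1 D by simp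
      have cs: "csqrt (of_real (A\<^sup>2 - 4 * B)) = of_real D"
        using 1 by (simp add: D_def csqrt_of_real_nonneg)
      have l: "l1 = of_real (- ((A - D) / 2))" "l2 = of_real (- ((A + D) / 2))"
        unfolding l1_def l2_def cs by (simp_all add: complex_eq_iff field_simps)
      have "l1 - l2 = of_real D" unfolding l by (simp add: complex_eq_iff field_simps)
      hence K: "K1_quot l1 l2 t = of_real ((exp (- ((A - D) / 2 * t)) - exp (- ((A + D) / 2 * t))) / D)"
      proof -
        assume d: "l1 - l2 = of_real D"
        hence "l1 \<noteq> l2" using D0 by auto
        hence "K1_quot l1 l2 t = (exp (l1 * of_real t) - exp (l2 * of_real t)) / of_real D"
          by (simp add: K1_quot_def d)
        moreover have "exp (of_real x * of_real t) = (of_real (exp (x * t)) :: complex)" for x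
          by (simp add: exp_of_real flip: of_real_mult)
        ultimately show ?thesis
          unfolding l by (simp only: of_real_diff[symmetric] of_real_divide[symmetric] minus_mult_left)
      qed
      have "exp (- ((A + D) / 2 * t)) = exp (- ((A - D) / 2 * t)) * exp (- (D * t))"
        by (simp add: mult_exp_exp field_simps)
      hence K': "cmod (K1_quot l1 l2 t) = exp (- ((A - D) / 2 * t)) * ((1 - exp (- (D * t))) / D)"
        unfolding K norm_of_real using D0 t by (subst abs_of_nonneg) (auto simp: field_simps)
      have DA: "D < A"
        using DD A B D0 by (intro power2_less_imp_less[of D A]) auto
      \<comment> \<open>The product of the roots is B and the faster rate is at most A, so the
        slower rate is at least B / A.\<close>
      have "(A - D) * (A + D) = 4 * B" using DD by (simp add: algebra_simps power2_eq_square)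
      hence "4 * B \<le> (A - D) * (2 * A)" using mult_left_mono[of "A + D" "2 * A" "A - D"] DA by auto
      hence AD: "B / A \<le> (A - D) / 2" using A by (simp add: field_simps)
      have q0: "0 \<le> (1 - exp (- (D * t))) / D" using D0 t by auto
      have qt: "(1 - exp (- (D * t))) / D \<le> t"
        using one_minus_exp_le[of "D * t"] D0 by (simp add: field_simps)
      have qD: "(1 - exp (- (D * t))) / D \<le> 1 / D"
        using D0 by (intro divide_right_mono) auto
      have e1: "exp (- ((A - D) / 2 * t)) \<le> 1" using DA t by simp
      have B8: "B / A / 8 \<le> (A - D) / 2"
      proof -
        have "y / 8 \<le> (A - D) / 2" if "y \<le> (A - D) / 2" "0 \<le> y" for y
          using that by linarith
        moreover have "0 \<le> B / A" using A B by simp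
        ultimately show ?thesis using AD by blast
      qed
      have e2: "exp (- ((A - D) / 2 * t)) \<le> e" by (rule ex[OF B8])
      have "cmod (K1_quot l1 l2 t) \<le> 1 * t"
        unfolding K' by (intro mult_mono e1 qt q0) auto
      moreover have "cmod (K1_quot l1 l2 t) \<le> 8 / A * e"
      \<comment> \<open>For well separated roots the divided difference is at most 1 / D. For nearly
        equal ones division by D is useless, but then the slower rate is at least A / 4 and
        \<open>slow\<close> applies.\<close>
      proof (cases "D \<ge> A / 2")
        case True
        have "cmod (K1_quot l1 l2 t) \<le> e * (1 / D)"
          unfolding K' using e by (intro mult_mono e2 qD q0) auto
        also have "\<dots> \<le> e * (8 / A)"
          using True A D0 e by (intro mult_left_mono) (auto simp: field_simps)
        finally show ?thesis by (simp add: mult.commute)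
      next
        case False
        have "cmod (K1_quot l1 l2 t) \<le> exp (- ((A - D) / 2 * t)) * t"
          unfolding K' by (intro mult_mono qt q0) auto
        also have "\<dots> \<le> 8 / A * e"
          using slow[of "(A - D) / 2"] False by (simp add: mult.commute)
        finally show ?thesis .
      qed
      moreover have "cmod (exp (l1 * of_real t)) \<le> e"
        using e2 unfolding cmod_exp l by simp
      moreover have "cmod l1 \<le> A"
        unfolding l norm_of_real using DA D0 A by simp
      ultimately show ?thesis by simp
    next
      case 2
      have l: "l1 = of_real (- (A / 2))" "l2 = of_real (- (A / 2))"
        unfolding l1_def l2_def 2 by simp_all
      have K: "cmod (K1_quot l1 l2 t) = t * exp (- (A / 2 * t))"
        unfolding K1_quot_def using t by (simp add: l norm_mult norm_exp_eq_Re)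
      have "t * exp (- (A / 2 * t)) \<le> t * 1" using A t by (intro mult_left_mono) auto
      moreover have "t * exp (- (A / 2 * t)) \<le> 8 / A * e" using A by (intro slow) auto
      moreover have "cmod (exp (l1 * of_real t)) \<le> e"
        using ex[of "A / 2"] BA' A unfolding cmod_exp l by simp
      moreover have "cmod l1 \<le> A"
        unfolding l norm_of_real using A by simp
      ultimately show ?thesis using K by simp
    next
      case 3
      have D0: "D > 0" using 3 by (simp add: D_def)
      have cs: "csqrt (of_real (A\<^sup>2 - 4 * B)) = \<i> * of_real D"
        using 3 by (simp add: D_def csqrt_of_real_nonpos)
      have l: "l1 = Complex (- (A / 2)) (D / 2)" "l2 = Complex (- (A / 2)) (- (D / 2))"
        unfolding l1_def l2_def cs by (simp_all add: complex_eq_iff field_simps)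
      have ne: "l1 \<noteq> l2" using D0 by (simp add: l)
      have l12: "l1 - l2 = \<i> * of_real D" by (simp add: l complex_eq_iff)
      have "exp (l1 * of_real t) - exp (l2 * of_real t) = of_real (exp (- (A / 2 * t))) * (2 * \<i> * of_real (sin (D / 2 * t)))"
        by (simp add: l complex_eq_iff Re_exp Im_exp)
      hence "K1_quot l1 l2 t = of_real (exp (- (A / 2 * t))) * (2 * \<i> * of_real (sin (D / 2 * t))) / (\<i> * of_real D)"
        using ne by (simp add: K1_quot_def l12)
      hence K: "cmod (K1_quot l1 l2 t) = exp (- (A / 2 * t)) * (2 * \<bar>sin (D / 2 * t)\<bar> / D)"
        using D0 by (simp add: norm_mult norm_divide)
      have "\<bar>sin (D / 2 * t)\<bar> \<le> D / 2 * t"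
        using abs_sin_x_le_abs_x[of "D / 2 * t"] D0 t by simp
      hence s: "2 * \<bar>sin (D / 2 * t)\<bar> / D \<le> t"
        using D0 by (simp add: field_simps)
      have K': "cmod (K1_quot l1 l2 t) \<le> exp (- (A / 2 * t)) * t"
        unfolding K by (intro mult_left_mono s) auto
      also have "\<dots> \<le> 1 * t" using A t by (intro mult_right_mono) auto
      finally have "cmod (K1_quot l1 l2 t) \<le> t" by simp
      moreover have "cmod (K1_quot l1 l2 t) \<le> 8 / A * e"
        using K' slow[of "A / 2"] A by (simp add: mult.commute)
      moreover have "cmod (exp (l1 * of_real t)) \<le> e"
        using ex[of "A / 2"] BA' A unfolding cmod_exp l by simp
      moreover have "cmod l1 \<le> A"
      proof -
        have "(cmod l1)\<^sup>2 = (A\<^sup>2 + D\<^sup>2) / 4" by (simp add: l cmod_power2 power_divide add_divide_distrib)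
        also have "\<dots> = B" using 3 D(2) by simp
        also have "\<dots> \<le> A\<^sup>2" by (rule BA)
        finally show ?thesis by (rule power2_le_imp_le) (use A in simp)
      qed
      ultimately show ?thesis by simp
    qed
  qed
  thus "cmod (K1_quot l1 l2 t) \<le> t" "cmod (K1_quot l1 l2 t) \<le> 8 / A * exp (- (B / A * t / 8))"
    by (simp_all add: e_def)
  have Q: "(a * w - b * v) / (a - b) = v - a * ((v - w) / (a - b))" if "a \<noteq> b" for a b v w :: complex
  proof -
    have "v - a * ((v - w) / (a - b)) = (v * (a - b) - a * (v - w)) / (a - b)"
      using that by (simp add: divide_simps)
    thus ?thesis by (simp add: algebra_simps)
  qed
  \<comment> \<open>This identity reduces \<open>K0_quot\<close> to \<open>K1_quot\<close>: since
    |l1| <= A, the factor 8 / A is cancelled, and 9 = 1 + 8.\<close>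
  have "K0_quot l1 l2 t = exp (l1 * of_real t) - l1 * K1_quot l1 l2 t"
  proof (cases "l1 = l2")
    case True
    thus ?thesis by (simp add: K0_quot_def K1_quot_def algebra_simps)
  next
    case False
    thus ?thesis unfolding K0_quot_def K1_quot_def by (simp only: if_False Q[OF False])
  qed
  hence "cmod (K0_quot l1 l2 t) \<le> cmod (exp (l1 * of_real t)) + cmod l1 * cmod (K1_quot l1 l2 t)"
    by (metis norm_triangle_ineq4 norm_mult)
  also have "\<dots> \<le> e + A * (8 / A * e)"
    using main A by (intro add_mono mult_mono) auto
  also have "\<dots> = 9 * e" using A by simp
  finally show "cmod (K0_quot l1 l2 t) \<le> 9 * exp (- (B / A * t / 8))" by (simp add: e_def)
qed

locale damping =
  fixes \<sigma> \<sigma>1 \<sigma>2 :: real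
  assumes \<sigma>_ge_1: "\<sigma> \<ge> 1" and \<sigma>1_nonneg: "0 \<le> \<sigma>1" and \<sigma>1_less: "\<sigma>1 < \<sigma> / 2" and \<sigma>2_greater: "\<sigma> / 2 < \<sigma>2" and \<sigma>2_le: "\<sigma>2 \<le> \<sigma>"
begin

abbreviation K0 :: "real \<Rightarrow> (real ^ 'n) \<Rightarrow> complex" where "K0 \<equiv> K0_hat \<sigma> \<sigma>1 \<sigma>2"
abbreviation K1 :: "real \<Rightarrow> (real ^ 'n) \<Rightarrow> complex" where "K1 \<equiv> K1_hat \<sigma> \<sigma>1 \<sigma>2"

text \<open>The order of the diffusive behaviour at low frequencies: restoring force over damping is
  |\<xi>|^(2\<sigma>) / |\<xi>|^(2\<sigma>1), hence frequencies of size (1 + t)^(-1/\<mu>) matter at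
  time t.\<close>

definition \<mu> :: real where "\<mu> = 2 * (\<sigma> - \<sigma>1)"

lemma \<mu>_pos: "\<mu> > 0" and \<sigma>_pos: "\<sigma> > 0"
  using \<sigma>_ge_1 \<sigma>1_less \<sigma>1_nonneg by (auto simp: \<mu>_def)

text \<open>An instance of \<open>quot_bounds\<close> with A the sum of the two damping symbols and
  B = |\<xi>|^(2\<sigma>). The \<sigma>1 term dominates A below frequency 1 and the \<sigma>2 term
  above it; this also yields B <= A^2, from 2 \<sigma>1 < \<sigma> and 2 \<sigma>2 > \<sigma>
  respectively.\<close>

lemma kernel_bounds:
  fixes \<xi> :: "real ^ 'n"
  assumes \<xi>: "\<xi> \<noteq> 0" and t: "t \<ge> 0"
  shows K1_le_time: "cmod (K1 t \<xi>) \<le> t"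
    and K1_low: "norm \<xi> \<le> 1 \<Longrightarrow> cmod (K1 t \<xi>) \<le> 9 * (norm \<xi> powr (- (2 * \<sigma>1)) * exp (- (t * norm \<xi> powr \<mu> / 16)))"
    and K1_high: "1 < norm \<xi> \<Longrightarrow> cmod (K1 t \<xi>) \<le> 9 * (norm \<xi> powr (- \<sigma>) * exp (- (t / 16)))"
    and K0_low: "norm \<xi> \<le> 1 \<Longrightarrow> cmod (K0 t \<xi>) \<le> 9 * exp (- (t * norm \<xi> powr \<mu> / 16))"
    and K0_high: "1 < norm \<xi> \<Longrightarrow> cmod (K0 t \<xi>) \<le> 9 * exp (- (t / 16))"
proof -
  define r where "r = norm \<xi>"
  have r: "r > 0" using \<xi> by (simp add: r_def)
  define A where "A = r powr (2 * \<sigma>1) + r powr (2 * \<sigma>2)"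
  define B where "B = r powr (2 * \<sigma>)"
  have A: "A > 0" and B: "B > 0" using r by (auto simp: A_def B_def add_pos_pos)
  have root: "char_root1 \<sigma> \<sigma>1 \<sigma>2 r = (- of_real A + csqrt (of_real (A\<^sup>2 - 4 * B))) / 2"
    "char_root2 \<sigma> \<sigma>1 \<sigma>2 r = (- of_real A - csqrt (of_real (A\<^sup>2 - 4 * B))) / 2"
    by (simp_all add: char_root1_def char_root2_def char_discr_def A_def B_def)
  have A1: "r powr (2 * \<sigma>1) \<le> A" and A2: "r powr (2 * \<sigma>2) \<le> A" by (simp_all add: A_def)
  have BA: "B \<le> A\<^sup>2"
  proof (cases "r \<le> 1")
    case True
    have "B \<le> r powr (4 * \<sigma>1)"
      unfolding B_def using True r \<sigma>1_less by (intro powr_mono') auto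
    also have "\<dots> = (r powr (2 * \<sigma>1))\<^sup>2" by (simp add: power2_eq_square powr_add[symmetric])
    also have "\<dots> \<le> A\<^sup>2" using A1 by (intro power_mono) auto
    finally show ?thesis .
  next
    case False
    have "B \<le> r powr (4 * \<sigma>2)"
      unfolding B_def using False r \<sigma>2_greater by (intro powr_mono) auto
    also have "\<dots> = (r powr (2 * \<sigma>2))\<^sup>2" by (simp add: power2_eq_square powr_add[symmetric])
    also have "\<dots> \<le> A\<^sup>2" using A2 by (intro power_mono) auto
    finally show ?thesis .
  qed
  note qb = quot_bounds[OF A B BA t, folded root]
  have K: "K1 t \<xi> = K1_quot (char_root1 \<sigma> \<sigma>1 \<sigma>2 r) (char_root2 \<sigma> \<sigma>1 \<sigma>2 r) t"
    "K0 t \<xi> = K0_quot (char_root1 \<sigma> \<sigma>1 \<sigma>2 r) (char_root2 \<sigma> \<sigma>1 \<sigma>2 r) t"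
    by (simp_all add: K1_hat_def K0_hat_def r_def)
  show "cmod (K1 t \<xi>) \<le> t" using qb(1) by (simp add: K)
  \<comment> \<open>The 16 is the 8 of \<open>quot_bounds\<close> times the factor 2 lost in
    bounding A by twice its dominant term.\<close>
  have low: "exp (- (B / A * t / 8)) \<le> exp (- (t * r powr \<mu> / 16))" if "r \<le> 1"
  proof -
    have "r powr (2 * \<sigma>2) \<le> r powr (2 * \<sigma>1)"
      using that r \<sigma>1_less \<sigma>2_greater by (intro powr_mono') auto
    hence "A \<le> 2 * r powr (2 * \<sigma>1)" by (simp add: A_def)
    hence "r powr \<mu> * A \<le> r powr \<mu> * (2 * r powr (2 * \<sigma>1))" by (intro mult_left_mono) auto
    also have "\<dots> = 2 * B" by (simp add: B_def \<mu>_def powr_add[symmetric] algebra_simps)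
    finally have "r powr \<mu> \<le> 2 * (B / A)" using A by (simp add: field_simps)
    from mult_right_mono[OF this t] show ?thesis by (simp add: mult_ac)
  qed
  have high: "exp (- (B / A * t / 8)) \<le> exp (- (t / 16))" if "1 < r"
  proof -
    have "r powr (2 * \<sigma>1) \<le> r powr (2 * \<sigma>)" "r powr (2 * \<sigma>2) \<le> r powr (2 * \<sigma>)"
      using that r \<sigma>1_less \<sigma>2_le \<sigma>_pos by (auto intro!: powr_mono)
    hence "A \<le> 2 * B" by (simp add: A_def B_def)
    hence "1 / 2 \<le> B / A" using A by (simp add: field_simps)
    hence "1 / 2 * t \<le> B / A * t" by (rule mult_right_mono[OF _ t])
    hence "1 / 2 * t / 8 \<le> B / A * t / 8" by (rule divide_right_mono) simp
    moreover have "t / 16 = 1 / 2 * t / 8" by simp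
    ultimately show ?thesis by (simp only: exp_le_cancel_iff neg_le_iff_le)
  qed
  show "cmod (K1 t \<xi>) \<le> 9 * (norm \<xi> powr (- (2 * \<sigma>1)) * exp (- (t * norm \<xi> powr \<mu> / 16)))" if "norm \<xi> \<le> 1"
  proof -
    have "1 / A \<le> r powr (- (2 * \<sigma>1))" using A1 r A by (simp add: powr_minus field_simps)
    hence "8 / A \<le> 9 * r powr (- (2 * \<sigma>1))" using powr_ge_zero[of r "- (2 * \<sigma>1)"] by linarith
    have "cmod (K1 t \<xi>) \<le> 8 / A * exp (- (B / A * t / 8))" using qb(2) by (simp add: K)
    also have "\<dots> \<le> (9 * r powr (- (2 * \<sigma>1))) * exp (- (t * r powr \<mu> / 16))"
      using that by (intro mult_mono low \<open>8 / A \<le> _\<close>) (auto simp: r_def)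
    finally show ?thesis by (simp add: r_def)
  qed
  show "cmod (K1 t \<xi>) \<le> 9 * (norm \<xi> powr (- \<sigma>) * exp (- (t / 16)))" if "1 < norm \<xi>"
  proof -
    \<comment> \<open>From the gain 2 \<sigma>2 only \<sigma> derivatives are kept, exactly as many
      as the weight asks for.\<close>
    have "r powr \<sigma> \<le> r powr (2 * \<sigma>2)" using that \<sigma>2_greater by (intro powr_mono) (auto simp: r_def)
    hence "r powr \<sigma> \<le> A" using A2 by linarith
    hence "1 / A \<le> r powr (- \<sigma>)" using r A by (simp add: powr_minus field_simps)
    hence "8 / A \<le> 9 * r powr (- \<sigma>)" using powr_ge_zero[of r "- \<sigma>"] by linarith
    have "cmod (K1 t \<xi>) \<le> 8 / A * exp (- (B / A * t / 8))" using qb(2) by (simp add: K)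
    also have "\<dots> \<le> (9 * r powr (- \<sigma>)) * exp (- (t / 16))"
      using that by (intro mult_mono high \<open>8 / A \<le> _\<close>) (auto simp: r_def)
    finally show ?thesis by (simp add: r_def)
  qed
  show "cmod (K0 t \<xi>) \<le> 9 * exp (- (t * norm \<xi> powr \<mu> / 16))" if "norm \<xi> \<le> 1"
    using order_trans[OF qb(3) mult_left_mono[OF low, of 9]] that unfolding K r_def by simp
  show "cmod (K0 t \<xi>) \<le> 9 * exp (- (t / 16))" if "1 < norm \<xi>"
    using order_trans[OF qb(3) mult_left_mono[OF high, of 9]] that unfolding K r_def by simp
qed

lemma K1_0 [simp]: "K1 0 \<xi> = 0"
  by (simp add: K1_hat_def K1_quot_def)

lemma continuous_K1: "continuous_on S (\<lambda>t. K1 t \<xi>)"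
  unfolding K1_hat_def K1_quot_def by (cases "char_root1 \<sigma> \<sigma>1 \<sigma>2 (norm \<xi>) = char_root2 \<sigma> \<sigma>1 \<sigma>2 (norm \<xi>)")
    (auto intro!: continuous_intros)

lemma continuous_K0: "continuous_on S (\<lambda>t. K0 t \<xi>)"
  unfolding K0_hat_def K0_quot_def by (cases "char_root1 \<sigma> \<sigma>1 \<sigma>2 (norm \<xi>) = char_root2 \<sigma> \<sigma>1 \<sigma>2 (norm \<xi>)")
    (auto intro!: continuous_intros)

text \<open>The principal root is discontinuous across the negative axis, so measurability is read
  off its explicit form on each half of the real line.\<close>

lemma csqrt_of_real_measurable [measurable]: "(\<lambda>x. csqrt (complex_of_real x)) \<in> borel_measurable borel"
proof -
  have "(\<lambda>x. csqrt (complex_of_real x)) = (\<lambda>x. if x \<ge> 0 then of_real (sqrt x) else \<i> * of_real (sqrt (- x)))"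
    by (auto simp: fun_eq_iff csqrt_of_real_nonneg csqrt_of_real_nonpos)
  thus ?thesis by simp
qed

lemma char_root_measurable [measurable]:
  "char_root1 \<sigma> \<sigma>1 \<sigma>2 \<in> borel_measurable borel" "char_root2 \<sigma> \<sigma>1 \<sigma>2 \<in> borel_measurable borel"
  unfolding char_root1_def char_root2_def char_discr_def by measurable

lemma kernel_measurable [measurable]:
  "K0 t \<in> borel_measurable borel" "K1 t \<in> borel_measurable borel"
  unfolding K0_hat_def[abs_def] K1_hat_def[abs_def] K0_quot_def K1_quot_def by measurable

end

section \<open>Multiplier estimates\<close>

text \<open>The inequality y <= exp y with y = c x / a, raised to the power a.\<close>

lemma powr_exp_bound:
  fixes a c :: real
  assumes "a \<ge> 0" "c > 0"
  obtains K where "K > 0" "\<And>x. x \<ge> 0 \<Longrightarrow> x powr a * exp (- (c * x)) \<le> K"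
proof (cases "a = 0")
  case True
  show ?thesis
    by (rule that[of 1]) (use True assms in \<open>auto simp: powr_def\<close>)
next
  case False
  hence a: "a > 0" using assms by simp
  show ?thesis
  proof (rule that[of "(a / c) powr a"])
    fix x :: real assume x: "x \<ge> 0"
    have "x = (a / c) * (c * x / a)" using a assms by simp
    hence "x powr a = (a / c) powr a * (c * x / a) powr a" by (metis powr_mult)
    also have "(c * x / a) powr a \<le> exp (c * x / a) powr a"
    proof (intro powr_mono2)
      show "c * x / a \<le> exp (c * x / a)"
        using exp_ge_add_one_self[of "c * x / a"] by linarith
    qed (use x a assms in auto)
    also have "exp (c * x / a) powr a = exp (c * x)" using a by (simp add: powr_def)
    finally have "x powr a * exp (- (c * x)) \<le> (a / c) powr a * exp (c * x) * exp (- (c * x))"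
      by (simp add: mult_left_mono mult_right_mono)
    thus "x powr a * exp (- (c * x)) \<le> (a / c) powr a" by (simp add: mult.assoc mult_exp_exp)
  qed (use a assms in auto)
qed

text \<open>In \<open>n_upper\<close> the alternative m = 2 encodes that 4 \<sigma> / (2 - m) is
  then read as infinite.\<close>

locale semilinear = damping \<sigma> \<sigma>1 \<sigma>2 for \<sigma> \<sigma>1 \<sigma>2 +
  fixes m p :: real and u0 u1 :: "(real ^ 'n) \<Rightarrow> complex"
  assumes m: "1 < m" "m \<le> 2"
    and m_upper: "\<sigma>1 > 0 \<Longrightarrow> m < 2 * real CARD('n) / (real CARD('n) + 4 * \<sigma>1)"
    and p: "p > 1" and mp: "2 / m < p"
    and p_Sobolev: "real CARD('n) \<le> 2 * \<sigma> \<or> p \<le> real CARD('n) / (real CARD('n) - 2 * \<sigma>)"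
    and n_upper: "real CARD('n) > 2 * \<sigma> \<Longrightarrow> m = 2 \<or> real CARD('n) < 4 * \<sigma> / (2 - m)"
    and p_upper: "p < 1 + 2 * m * \<sigma> / (real CARD('n) - 2 * m * \<sigma>1)"
    and data: "(u0, u1) \<in> data_space \<sigma> m"
begin

section \<open>Exponents and the conditions that control their signs\<close>

definition n :: real where "n = real CARD('n)"
text \<open>Growth exponent of the squared transform: an L^m function carries mass of order at most
  R^(2 \<kappa>) in the ball of radius R.\<close>

definition \<kappa> :: real where "\<kappa> = n * (1 / m - 1 / 2)"
definition a :: real where "a = (\<kappa> - 2 * \<sigma>1) / \<mu>"
text \<open>Rate in time at which \<open>K1\<close> decays once it has gained \<sigma>
  derivatives.\<close>

definition \<theta> :: real where "\<theta> = (\<sigma> - 2 * \<sigma>1) / \<mu>"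
text \<open>On bounded sets of the weighted unknown, |u|^p has L^m norm of order (1 +
  t)^(-\<delta>/\<mu>), so that \<gamma> - 1 = -\<delta>/\<mu>.\<close>

definition \<delta> :: real where "\<delta> = (p - 1) * n / m - 2 * p * \<sigma>1"
definition \<gamma> :: real where "\<gamma> = 1 - \<delta> / \<mu>"
definition \<rho> :: "real \<Rightarrow> real" where "\<rho> t = (1 + t) powr (1 / \<mu>)"

lemma n_pos: "n > 0" by (simp add: n_def)

lemma \<kappa>_nonneg: "\<kappa> \<ge> 0"
  using m n_pos by (auto simp: \<kappa>_def field_simps)

text \<open>For \<sigma>1 > 0 this is the upper bound on m rewritten. For \<sigma>1 = 0 there is no
  low frequency singularity, and \<kappa> may vanish (m = 2).\<close>

lemma \<kappa>_\<sigma>1: "2 * \<sigma>1 < \<kappa> \<or> \<sigma>1 = 0"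
proof (cases "\<sigma>1 = 0")
  case False
  hence s: "\<sigma>1 > 0" using \<sigma>1_nonneg by simp
  have "m * (n + 4 * \<sigma>1) < 2 * n"
    using m_upper[OF s] s n_pos by (simp add: n_def field_simps)
  hence "2 * \<sigma>1 < \<kappa>" using m by (simp add: \<kappa>_def field_simps)
  thus ?thesis by simp
qed simp

lemma \<kappa>_ge: "2 * \<sigma>1 \<le> \<kappa>" using \<kappa>_\<sigma>1 \<kappa>_nonneg by auto

lemma a_nonneg: "a \<ge> 0" using \<kappa>_ge \<mu>_pos by (simp add: a_def)

text \<open>Equivalent to \<kappa> < 2 \<sigma>. In high dimension this is the bound n < 4 \<sigma>
  / (2 - m); for n <= 2 \<sigma> it follows from \<kappa> < n / 2.\<close>

lemma a_less_1: "a < 1"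
proof -
  have "\<kappa> < 2 * \<sigma>"
  proof (cases "n \<le> 2 * \<sigma>")
    case True
    have "1 / m - 1 / 2 < 1 / 2" using m by (simp add: field_simps)
    hence "\<kappa> < n * (1 / 2)" unfolding \<kappa>_def using n_pos by (intro mult_strict_left_mono)
    thus ?thesis using True \<sigma>_pos by linarith
  next
    case False
    show ?thesis
    proof (cases "m = 2")
      case True thus ?thesis unfolding \<kappa>_def using \<sigma>_pos by simp
    next
      case F: False
      hence "n * (2 - m) < 4 * \<sigma>" using n_upper False m by (auto simp: n_def field_simps)
      moreover have "\<kappa> * (2 * m) = n * (2 - m)" using m by (simp add: \<kappa>_def field_simps)
      ultimately have "\<kappa> * (2 * m) < 4 * \<sigma>" by simp
      moreover have "\<kappa> * (2 * 1) \<le> \<kappa> * (2 * m)" using \<kappa>_nonneg m by (intro mult_left_mono) auto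
      ultimately show ?thesis by linarith
    qed
  qed
  thus ?thesis using \<mu>_pos by (simp add: a_def \<mu>_def field_simps)
qed

lemma \<theta>_pos: "\<theta> > 0" and \<theta>_less_1: "\<theta> < 1"
  using \<sigma>1_less \<sigma>_pos \<mu>_pos by (auto simp: \<theta>_def \<mu>_def field_simps)

lemma \<gamma>_pos: "\<gamma> > 0"
proof -
  \<comment> \<open>The upper bound on p has this difference as denominator, so its sign decides the
    direction of the inequality after clearing the fraction.\<close>
  have nm: "n - 2 * m * \<sigma>1 > 0"
  proof (cases "\<sigma>1 = 0")
    case False
    hence "2 * \<sigma>1 < n * (1 / m - 1 / 2)" using \<kappa>_\<sigma>1 by (simp add: \<kappa>_def)
    hence "2 * \<sigma>1 * m < n - n * m / 2" using m by (simp add: field_simps)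
    moreover have "n * m > 0" using n_pos m by simp
    ultimately show ?thesis by (simp add: mult_ac)
  qed (use n_pos in simp)
  have "(p - 1) * (n - 2 * m * \<sigma>1) < 2 * m * \<sigma>"
    using p_upper nm by (simp add: n_def field_simps)
  hence "(p - 1) * n - 2 * p * \<sigma>1 * m < 2 * (\<sigma> - \<sigma>1) * m" by (simp add: algebra_simps)
  hence "\<delta> < \<mu>" using m by (simp add: \<delta>_def \<mu>_def field_simps)
  thus ?thesis using \<mu>_pos by (simp add: \<gamma>_def)
qed

lemma \<rho>_ge_1: "t \<ge> 0 \<Longrightarrow> \<rho> t \<ge> 1"
  using \<mu>_pos by (simp add: \<rho>_def ge_one_powr_ge_zero)

lemma \<rho>_pos: "t \<ge> 0 \<Longrightarrow> \<rho> t > 0"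
  using \<rho>_ge_1[of t] by linarith

lemma \<rho>_powr: "\<rho> t powr x = (1 + t) powr (x / \<mu>)"
  by (simp add: \<rho>_def powr_powr)

lemma \<rho>_\<mu>: "t \<ge> 0 \<Longrightarrow> \<rho> t powr \<mu> = 1 + t"
  using \<mu>_pos by (simp add: \<rho>_powr)

text \<open>Replacing t by 1 + t costs only a constant at frequencies below 1 and lets the
  exponential act on the scaled variable \<open>\<rho> t * r\<close>, also for t near 0.\<close>

lemma exp_shift:
  assumes "t \<ge> 0" "0 \<le> r" "r \<le> 1"
  shows "exp (- (t * r powr \<mu> / 16)) \<le> exp (1 / 16) * exp (- (1 / 16 * (\<rho> t * r) powr \<mu>))"
proof -
  have "r powr \<mu> \<le> 1" using assms \<mu>_pos powr_mono2[of \<mu> r 1] by simp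
  moreover have "(\<rho> t * r) powr \<mu> = (1 + t) * r powr \<mu>" using assms by (simp add: powr_mult \<rho>_\<mu>)
  ultimately show ?thesis
    unfolding mult_exp_exp exp_le_cancel_iff by (simp add: algebra_simps)
qed

lemma exp_shift': "exp (- (t / 16 :: real)) = exp (1 / 16) * exp (- (1 / 16 * (1 + t)))"
  by (simp add: mult_exp_exp field_simps)

text \<open>Below frequency 1 the power |\<xi>|^(\<sigma> - 2\<sigma>1) equals x^\<theta> (1 +
  t)^(-\<theta>) for x = (1 + t) |\<xi>|^\<mu>, and the exponential absorbs x^\<theta>. Above it the
  kernel itself gains |\<xi>|^(-\<sigma>) and decays exponentially in time.\<close>

lemma K1_smoothing:
  obtains C where "C > 0" "\<And>t (\<xi> :: real^'n). t \<ge> 0 \<Longrightarrow> \<xi> \<noteq> 0 \<Longrightarrow> norm \<xi> powr \<sigma> * cmod (K1 t \<xi>) \<le> C * (1 + t) powr (- \<theta>)"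
proof -
  obtain K where K: "K > 0" "\<And>x. x \<ge> 0 \<Longrightarrow> x powr \<theta> * exp (- (1 / 16 * x)) \<le> K"
    using powr_exp_bound[of \<theta> "1/16"] \<theta>_pos by auto
  show ?thesis
  proof (rule that[of "9 * exp (1 / 16) * K"])
    fix t :: real and \<xi> :: "real^'n" assume t: "t \<ge> 0" and \<xi>: "\<xi> \<noteq> 0"
    define r where "r = norm \<xi>"
    have r: "r > 0" using \<xi> by (simp add: r_def)
    show "norm \<xi> powr \<sigma> * cmod (K1 t \<xi>) \<le> 9 * exp (1 / 16) * K * (1 + t) powr (- \<theta>)"
    proof (cases "r \<le> 1")
      case True
      define x where "x = (\<rho> t * r) powr \<mu>"
      have x: "x = (1 + t) * r powr \<mu>" using t by (simp add: x_def powr_mult \<rho>_\<mu>)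
      have "r powr \<sigma> * cmod (K1 t \<xi>) \<le> r powr \<sigma> * (9 * (r powr (- (2 * \<sigma>1)) * (exp (1 / 16) * exp (- (1 / 16 * x)))))"
      proof (rule mult_left_mono)
        have "cmod (K1 t \<xi>) \<le> 9 * (r powr (- (2 * \<sigma>1)) * exp (- (t * r powr \<mu> / 16)))"
          using K1_low[OF \<xi> t] True by (simp add: r_def)
        also have "\<dots> \<le> 9 * (r powr (- (2 * \<sigma>1)) * (exp (1 / 16) * exp (- (1 / 16 * x))))"
          using exp_shift[OF t _ True] r by (intro mult_left_mono) (auto simp: x_def)
        finally show "cmod (K1 t \<xi>) \<le> 9 * (r powr (- (2 * \<sigma>1)) * (exp (1 / 16) * exp (- (1 / 16 * x))))" .
      qed simp
      also have "\<dots> = 9 * exp (1 / 16) * (r powr (\<sigma> - 2 * \<sigma>1) * exp (- (1 / 16 * x)))"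
        using r by (simp add: powr_diff powr_minus field_simps)
      also have "r powr (\<sigma> - 2 * \<sigma>1) = x powr \<theta> * (1 + t) powr (- \<theta>)"
      proof -
        have "\<mu> * \<theta> = \<sigma> - 2 * \<sigma>1" using \<mu>_pos by (simp add: \<theta>_def)
        moreover have "(1 + t) powr \<theta> * (1 + t) powr (- \<theta>) = 1"
          unfolding powr_add[symmetric] using t by simp
        ultimately show ?thesis unfolding x powr_mult powr_powr by simp
      qed
      also have "9 * exp (1 / 16) * (x powr \<theta> * (1 + t) powr (- \<theta>) * exp (- (1 / 16 * x)))
          = 9 * exp (1 / 16) * (x powr \<theta> * exp (- (1 / 16 * x))) * (1 + t) powr (- \<theta>)"
        by simp
      also have "\<dots> \<le> 9 * exp (1 / 16) * K * (1 + t) powr (- \<theta>)"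
        by (intro mult_right_mono mult_left_mono K) (auto simp: x_def)
      finally show ?thesis by (simp add: r_def)
    next
      case False
      have "r powr \<sigma> * cmod (K1 t \<xi>) \<le> r powr \<sigma> * (9 * (r powr (- \<sigma>) * exp (- (t / 16))))"
        using K1_high[OF \<xi> t] False by (intro mult_left_mono) (auto simp: r_def)
      also have "\<dots> = 9 * exp (1 / 16) * ((1 + t) powr \<theta> * exp (- (1 / 16 * (1 + t)))) * (1 + t) powr (- \<theta>)"
        unfolding exp_shift' using r t by (simp add: powr_minus field_simps)
      also have "\<dots> \<le> 9 * exp (1 / 16) * K * (1 + t) powr (- \<theta>)"
        using t by (intro mult_right_mono mult_left_mono K) auto
      finally show ?thesis by (simp add: r_def)
    qed
  qed (use K in auto)
qed

abbreviation W :: "real \<Rightarrow> real^'n \<Rightarrow> real" where "W t \<equiv> wt \<sigma> (\<rho> t)"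

text \<open>Satisfied by \<open>K1 t\<close> and by the low frequency part of \<open>K0 t\<close>,
  so that one decay estimate covers both kinds of data and the forcing.\<close>

definition decaying :: "real \<Rightarrow> (real^'n \<Rightarrow> complex) \<Rightarrow> bool" where
  "decaying t k \<longleftrightarrow>
    (\<forall>\<xi>. \<xi> \<noteq> 0 \<longrightarrow> norm \<xi> \<le> 1 \<longrightarrow> cmod (k \<xi>) \<le> 9 * (norm \<xi> powr (- (2 * \<sigma>1)) * exp (- (t * norm \<xi> powr \<mu> / 16)))) \<and>
    (\<forall>\<xi>. 1 < norm \<xi> \<longrightarrow> cmod (k \<xi>) \<le> 9 * (norm \<xi> powr (- \<sigma>) * exp (- (t / 16))))"

lemma K1_decaying: "t \<ge> 0 \<Longrightarrow> decaying t (K1 t)"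
  unfolding decaying_def
proof (intro conjI allI impI)
  fix \<xi> :: "real^'n" assume t: "t \<ge> 0" and "1 < norm \<xi>"
  moreover from this have "\<xi> \<noteq> 0" by auto
  ultimately show "cmod (K1 t \<xi>) \<le> 9 * (norm \<xi> powr (- \<sigma>) * exp (- (t / 16)))"
    by (intro K1_high)
qed (rule K1_low)

text \<open>In the variable y = \<open>\<rho> t\<close> |\<xi>|, the weighted symbol on the unit
  ball is \<rho>^(2\<sigma>1) times a profile bounded by y^(-2\<sigma>1) near 0 and rapidly
  decreasing. Summing shells against growth R^(2\<kappa>) gives the square of \<rho>^(2\<sigma>1 -
  \<kappa>) = (1 + t)^(-a). Outside the ball exponential decay in time suffices, and only the L^2
  norm of \<open>f\<close> enters.\<close>

lemma multiplier_decay: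
  obtains C where "C > 0" "\<And>t k (f :: (real^'n) l2) B E. t \<ge> 0 \<Longrightarrow> B > 0 \<Longrightarrow>
    bounded_symbol (\<lambda>\<xi>. of_real (W t \<xi>) * k \<xi>) E \<Longrightarrow> decaying t k \<Longrightarrow>
    Lm_bound m B (rep_l2 f) \<Longrightarrow>
    norm (mul (\<lambda>\<xi>. of_real (W t \<xi>) * k \<xi>) (fourier_l2 f)) \<le> C * (1 + t) powr (- a) * (B + norm f)"
proof -
  \<comment> \<open>Of the exponential, y^(-s) is kept: \<sigma> pays for the weight, and the
    remaining y^(-\<kappa> - 1/2), squared, beats the growth 2 \<kappa> with margin 1.\<close>
  define s where "s = \<sigma> + \<kappa> + 1 / 2"
  have s: "s > 0" using \<sigma>_pos \<kappa>_nonneg by (simp add: s_def)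
  obtain K where K: "K > 0" "\<And>x. x \<ge> 0 \<Longrightarrow> x powr (s / \<mu>) * exp (- (1 / 16 * x)) \<le> K"
    using powr_exp_bound[of "s / \<mu>" "1/16"] s \<mu>_pos by auto
  \<comment> \<open>At high frequencies \<open>\<rho> t powr \<sigma>\<close> contributes the
    exponent \<sigma>/\<mu>, and a is the decay still to be produced.\<close>
  obtain K' where K': "K' > 0" "\<And>x. x \<ge> 0 \<Longrightarrow> x powr (\<sigma> / \<mu> + a) * exp (- (1 / 16 * x)) \<le> K'"
    using powr_exp_bound[of "\<sigma> / \<mu> + a" "1/16"] \<sigma>_pos \<mu>_pos a_nonneg by auto
  obtain C0 where C0: "C0 > 0" "\<And>(v :: (real ^ 'n) l2) B R. B > 0 \<Longrightarrow> R > 0 \<Longrightarrow> Lm_bound m B (rep_l2 v) \<Longrightarrow>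
     (\<integral>\<^sup>+\<xi>. indicator (cball 0 R) \<xi> * ennreal ((cmod (rep_l2 (fourier_l2 v) \<xi>))\<^sup>2) \<partial>lborel)
       \<le> ennreal (C0 * B\<^sup>2 * R powr (2 * (real CARD('n) * (1 / m - 1 / 2))))"
    using low_frequency_bound[of m, where 'n = 'n] m by (auto simp del: mult.assoc)
  obtain K2 where K2: "K2 > 0" "\<And>(\<phi> :: real^'n \<Rightarrow> ennreal) C X (k :: real^'n \<Rightarrow> real).
    \<phi> \<in> borel_measurable lborel \<Longrightarrow> C \<ge> 0 \<Longrightarrow> X > 0 \<Longrightarrow>
    (\<And>R. R > 0 \<Longrightarrow> (\<integral>\<^sup>+x. indicator (cball 0 R) x * \<phi> x \<partial>lborel) \<le> ennreal (C * R powr (2 * \<kappa>))) \<Longrightarrow>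
    (\<And>x. x \<noteq> 0 \<Longrightarrow> norm x \<le> X \<Longrightarrow> k x \<le> (norm x / X) powr (- (4 * \<sigma>1))) \<Longrightarrow>
    (\<And>x. norm x > X \<Longrightarrow> k x \<le> (norm x / X) powr (- (2 * \<kappa> + 1))) \<Longrightarrow>
    (\<integral>\<^sup>+x. ennreal (k x) * \<phi> x \<partial>lborel) \<le> ennreal (K2 * C * X powr (2 * \<kappa>))"
    by (rule shell_bound[of "4 * \<sigma>1" "2 * \<kappa>" "2 * \<kappa> + 1", where 'a = "real^'n"])
      (use \<kappa>_\<sigma>1 \<sigma>1_nonneg \<kappa>_nonneg in auto)
  define M where "M = 18 + 18 * exp (1 / 16) * K"
  have M: "M > 0" using K by (simp add: M_def add_pos_pos)
  define H where "H = 18 * exp (1 / 16) * K'"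
  have H: "H > 0" using K' by (simp add: H_def)
  define C where "C = sqrt (M\<^sup>2 * (K2 * C0) + H\<^sup>2)"
  have C2: "C\<^sup>2 = M\<^sup>2 * (K2 * C0) + H\<^sup>2" using K2 C0 by (simp add: C_def)
  have C: "C > 0" unfolding C_def using K2 C0 H by (intro real_sqrt_gt_zero add_nonneg_pos) auto
  show ?thesis
  proof (rule that[OF C])
    fix t k B E and f :: "(real^'n) l2"
    assume t: "t \<ge> 0" and B: "B > 0" and E: "bounded_symbol (\<lambda>\<xi>. of_real (W t \<xi>) * k \<xi>) E"
      and k: "decaying t k" and Lm: "Lm_bound m B (rep_l2 f)"
    have kl: "cmod (k \<xi>) \<le> 9 * (norm \<xi> powr (- (2 * \<sigma>1)) * exp (- (t * norm \<xi> powr \<mu> / 16)))" if "\<xi> \<noteq> 0" "norm \<xi> \<le> 1" for \<xi>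
      using k that by (auto simp: decaying_def)
    have kh: "cmod (k \<xi>) \<le> 9 * (norm \<xi> powr (- \<sigma>) * exp (- (t / 16)))" if "1 < norm \<xi>" for \<xi>
      using k that by (auto simp: decaying_def)
    define h where "h \<xi> = W t \<xi> * cmod (k \<xi>)" for \<xi>
    define w where "w = (\<lambda>\<xi>. of_real (W t \<xi>) * k \<xi>)"
    have h0: "h \<xi> \<ge> 0" for \<xi> by (simp add: h_def)
    have wh: "cmod (w \<xi>) = h \<xi>" for \<xi> by (simp add: w_def h_def norm_mult)
    have [measurable]: "w \<in> borel_measurable borel" using E by (simp add: bounded_symbol_def w_def)
    have [measurable]: "h \<in> borel_measurable borel"
      unfolding wh[symmetric, abs_def] by measurable
    define \<phi> where "\<phi> \<xi> = ennreal ((cmod (rep_l2 (fourier_l2 f) \<xi>))\<^sup>2)" for \<xi>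
    have [measurable]: "\<phi> \<in> borel_measurable lborel" unfolding \<phi>_def by measurable
    have \<rho>0: "\<rho> t > 0" and \<rho>1: "\<rho> t \<ge> 1" using \<rho>_pos[OF t] \<rho>_ge_1[OF t] .
    \<comment> \<open>The squared symbol cut off at frequency 1 and divided by its amplitude, so
      that it meets the normalised hypotheses of the shell estimate with X = 1 / \<rho>.\<close>
    define kk where "kk \<xi> = (if norm \<xi> \<le> 1 then (h \<xi> / (M * \<rho> t powr (2 * \<sigma>1)))\<^sup>2 else 0)" for \<xi>
    have [measurable]: "kk \<in> borel_measurable borel" unfolding kk_def by measurable
    have in_ball: "(\<integral>\<^sup>+\<xi>. ennreal (kk \<xi>) * \<phi> \<xi> \<partial>lborel) \<le> ennreal (K2 * (C0 * B\<^sup>2) * (1 / \<rho> t) powr (2 * \<kappa>))"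
    proof (rule K2(2))
      show "(\<integral>\<^sup>+x. indicator (cball 0 R) x * \<phi> x \<partial>lborel) \<le> ennreal (C0 * B\<^sup>2 * R powr (2 * \<kappa>))" if "R > 0" for R
        using C0(2)[OF B that Lm] by (simp add: \<phi>_def \<kappa>_def n_def)
    next
      fix \<xi> :: "real^'n" assume \<xi>: "\<xi> \<noteq> 0" "norm \<xi> \<le> 1 / \<rho> t"
      define y where "y = \<rho> t * norm \<xi>"
      have y: "y > 0" "y \<le> 1" using \<xi> \<rho>0 by (auto simp: y_def field_simps)
      have n1: "norm \<xi> \<le> 1" using \<xi>(2) \<rho>1 by (smt (verit) divide_le_eq_1_pos)
      have "W t \<xi> \<le> 2" using y \<sigma>_pos powr_mono2[of \<sigma> y 1] by (simp add: wt_def y_def)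
      moreover have "cmod (k \<xi>) \<le> 9 * (norm \<xi> powr (- (2 * \<sigma>1)) * 1)"
        by (rule order_trans[OF kl[OF \<xi>(1) n1]]) (use t in \<open>intro mult_left_mono; simp\<close>)
      ultimately have "h \<xi> \<le> 2 * (9 * (norm \<xi> powr (- (2 * \<sigma>1)) * 1))"
        unfolding h_def by (intro mult_mono) auto
      also have "\<dots> = 18 * (\<rho> t powr (2 * \<sigma>1) * y powr (- (2 * \<sigma>1)))"
        using \<rho>0 by (simp add: y_def powr_mult powr_minus field_simps)
      also have "\<dots> \<le> M * (\<rho> t powr (2 * \<sigma>1) * y powr (- (2 * \<sigma>1)))"
        using K by (intro mult_right_mono) (auto simp: M_def)
      finally have "h \<xi> / (M * \<rho> t powr (2 * \<sigma>1)) \<le> y powr (- (2 * \<sigma>1))"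
        using M \<rho>0 by (simp add: field_simps)
      hence "(h \<xi> / (M * \<rho> t powr (2 * \<sigma>1)))\<^sup>2 \<le> (y powr (- (2 * \<sigma>1)))\<^sup>2"
        using M h0 by (intro power_mono) auto
      also have "\<dots> = y powr (- (4 * \<sigma>1))" by (simp add: power2_eq_square powr_add[symmetric])
      finally show "kk \<xi> \<le> (norm \<xi> / (1 / \<rho> t)) powr (- (4 * \<sigma>1))"
        using n1 by (simp add: kk_def y_def mult.commute)
    next
      fix \<xi> :: "real^'n" assume \<xi>: "norm \<xi> > 1 / \<rho> t"
      define y where "y = \<rho> t * norm \<xi>"
      have y: "y > 1" using \<xi> \<rho>0 by (auto simp: y_def field_simps)
      show "kk \<xi> \<le> (norm \<xi> / (1 / \<rho> t)) powr (- (2 * \<kappa> + 1))"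
      proof (cases "norm \<xi> \<le> 1")
        case True
        have \<xi>0: "\<xi> \<noteq> 0" using y by (auto simp: y_def)
        have "W t \<xi> \<le> 2 * y powr \<sigma>"
          using y \<sigma>_pos ge_one_powr_ge_zero[of y \<sigma>] by (simp add: wt_def y_def)
        moreover have "cmod (k \<xi>) \<le> 9 * (norm \<xi> powr (- (2 * \<sigma>1)) * (exp (1 / 16) * exp (- (1 / 16 * y powr \<mu>))))"
          unfolding y_def by (rule order_trans[OF kl[OF \<xi>0 True]]) (intro mult_left_mono exp_shift t, use True in auto)
        ultimately have "h \<xi> \<le> 2 * y powr \<sigma> * (9 * (norm \<xi> powr (- (2 * \<sigma>1)) * (exp (1 / 16) * exp (- (1 / 16 * y powr \<mu>)))))"
          unfolding h_def by (intro mult_mono) auto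
        also have "norm \<xi> powr (- (2 * \<sigma>1)) = \<rho> t powr (2 * \<sigma>1) * y powr (- (2 * \<sigma>1))"
          using \<rho>0 by (simp add: y_def powr_mult powr_minus field_simps)
        also have "2 * y powr \<sigma> * (9 * (\<rho> t powr (2 * \<sigma>1) * y powr (- (2 * \<sigma>1)) * (exp (1 / 16) * exp (- (1 / 16 * y powr \<mu>)))))
            = (18 * exp (1 / 16)) * \<rho> t powr (2 * \<sigma>1) * (y powr \<sigma> * exp (- (1 / 16 * y powr \<mu>))) * y powr (- (2 * \<sigma>1))"
          by simp
        also have "\<dots> \<le> (18 * exp (1 / 16)) * \<rho> t powr (2 * \<sigma>1) * (K * y powr (- (\<kappa> + 1 / 2))) * 1"
        proof (rule mult_mono)
          have "y powr \<sigma> * exp (- (1 / 16 * y powr \<mu>)) = ((y powr \<mu>) powr (s / \<mu>) * exp (- (1 / 16 * y powr \<mu>))) * y powr (- (\<kappa> + 1 / 2))"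
          proof -
            have "(y powr \<mu>) powr (s / \<mu>) = y powr s" using \<mu>_pos by (simp add: powr_powr)
            moreover have "y powr \<sigma> = y powr s * y powr (- (\<kappa> + 1 / 2))"
              unfolding powr_add[symmetric] by (simp add: s_def)
            ultimately show ?thesis by simp
          qed
          also have "\<dots> \<le> K * y powr (- (\<kappa> + 1 / 2))"
            by (intro mult_right_mono K) auto
          finally have "y powr \<sigma> * exp (- (1 / 16 * y powr \<mu>)) \<le> K * y powr (- (\<kappa> + 1 / 2))" .
          thus "18 * exp (1 / 16) * \<rho> t powr (2 * \<sigma>1) * (y powr \<sigma> * exp (- (1 / 16 * y powr \<mu>)))
              \<le> 18 * exp (1 / 16) * \<rho> t powr (2 * \<sigma>1) * (K * y powr (- (\<kappa> + 1 / 2)))"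
            by (rule mult_left_mono) simp
          show "y powr (- (2 * \<sigma>1)) \<le> 1" using y \<sigma>1_nonneg powr_mono[of "- (2 * \<sigma>1)" 0 y] by simp
        qed (use K in auto)
        also have "\<dots> = (18 * exp (1 / 16) * K) * (\<rho> t powr (2 * \<sigma>1) * y powr (- (\<kappa> + 1 / 2)))" by simp
        also have "\<dots> \<le> M * (\<rho> t powr (2 * \<sigma>1) * y powr (- (\<kappa> + 1 / 2)))"
          by (intro mult_right_mono) (auto simp: M_def)
        finally have "h \<xi> / (M * \<rho> t powr (2 * \<sigma>1)) \<le> y powr (- (\<kappa> + 1 / 2))"
          using M \<rho>0 by (simp add: field_simps)
        hence "(h \<xi> / (M * \<rho> t powr (2 * \<sigma>1)))\<^sup>2 \<le> (y powr (- (\<kappa> + 1 / 2)))\<^sup>2"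
          using M h0 by (intro power_mono) auto
        also have "\<dots> = y powr (- (2 * \<kappa> + 1))" by (simp add: power2_eq_square powr_add[symmetric])
        finally show ?thesis using True by (simp add: kk_def y_def mult.commute)
      qed (simp add: kk_def)
    qed (use C0 \<rho>0 in auto)
    have high: "h \<xi> \<le> H * (1 + t) powr (- a)" if "1 < norm \<xi>" for \<xi> :: "real^'n"
    proof -
      have "\<rho> t * norm \<xi> \<ge> 1" using \<rho>1 that by (smt (verit) mult_le_cancel_left1 mult_less_cancel_left1)
      hence "W t \<xi> \<le> 2 * (\<rho> t powr \<sigma> * norm \<xi> powr \<sigma>)"
        using \<sigma>_pos ge_one_powr_ge_zero[of "\<rho> t * norm \<xi>" \<sigma>] unfolding wt_def powr_mult by linarith
      hence "h \<xi> \<le> 2 * (\<rho> t powr \<sigma> * norm \<xi> powr \<sigma>) * (9 * (norm \<xi> powr (- \<sigma>) * exp (- (t / 16))))"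
        unfolding h_def by (intro mult_mono kh that) auto
      also have "\<dots> = 18 * exp (1 / 16) * ((1 + t) powr (\<sigma> / \<mu> + a) * exp (- (1 / 16 * (1 + t)))) * (1 + t) powr (- a)"
      proof -
        have "norm \<xi> powr \<sigma> * norm \<xi> powr (- \<sigma>) = 1" using that by (auto simp: powr_add[symmetric])
        moreover have "(1 + t) powr (\<sigma> / \<mu> + a) * (1 + t) powr (- a) = \<rho> t powr \<sigma>"
          by (simp add: powr_add[symmetric] \<rho>_powr)
        moreover have "2 * (X * Y) * (9 * (Z * (e1 * e2))) = 18 * e1 * (P * e2) * Q" if "Y * Z = 1" "P * Q = X"
          for X Y Z P Q e1 e2 :: real
          using that by algebra
        ultimately show ?thesis unfolding exp_shift' by blast
      qed
      also have "\<dots> \<le> 18 * exp (1 / 16) * K' * (1 + t) powr (- a)"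
        using t by (intro mult_right_mono mult_left_mono K') auto
      finally show ?thesis by (simp add: H_def)
    qed
    have "ennreal ((norm (mul w (fourier_l2 f)))\<^sup>2) = (\<integral>\<^sup>+\<xi>. ennreal ((h \<xi>)\<^sup>2 * (cmod (rep_l2 (fourier_l2 f) \<xi>))\<^sup>2) \<partial>lborel)"
      using ennreal_norm_mul_sq[OF E[folded w_def], of "fourier_l2 f"] unfolding wh .
    also have "\<dots> = (\<integral>\<^sup>+\<xi>. ennreal ((h \<xi>)\<^sup>2) * \<phi> \<xi> \<partial>lborel)"
      by (simp add: \<phi>_def ennreal_mult')
    also have "\<dots> \<le> (\<integral>\<^sup>+\<xi>. ennreal ((M * \<rho> t powr (2 * \<sigma>1))\<^sup>2) * (ennreal (kk \<xi>) * \<phi> \<xi>) + ennreal ((H * (1 + t) powr (- a))\<^sup>2) * \<phi> \<xi> \<partial>lborel)"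
    proof (rule nn_integral_mono)
      fix \<xi> :: "real^'n"
      show "ennreal ((h \<xi>)\<^sup>2) * \<phi> \<xi> \<le> ennreal ((M * \<rho> t powr (2 * \<sigma>1))\<^sup>2) * (ennreal (kk \<xi>) * \<phi> \<xi>) + ennreal ((H * (1 + t) powr (- a))\<^sup>2) * \<phi> \<xi>"
      proof (cases "norm \<xi> \<le> 1")
        case True
        have "(h \<xi>)\<^sup>2 = (M * \<rho> t powr (2 * \<sigma>1))\<^sup>2 * kk \<xi>"
          using True M \<rho>0 by (simp add: kk_def power_divide)
        hence "ennreal ((h \<xi>)\<^sup>2) * \<phi> \<xi> = ennreal ((M * \<rho> t powr (2 * \<sigma>1))\<^sup>2) * (ennreal (kk \<xi>) * \<phi> \<xi>)"
          by (simp add: ennreal_mult' mult.assoc)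
        thus ?thesis by simp
      next
        case False
        hence "(h \<xi>)\<^sup>2 \<le> (H * (1 + t) powr (- a))\<^sup>2" using high h0 by (intro power_mono) auto
        thus ?thesis by (intro add_increasing mult_right_mono ennreal_leI) auto
      qed
    qed
    also have "\<dots> = ennreal ((M * \<rho> t powr (2 * \<sigma>1))\<^sup>2) * (\<integral>\<^sup>+\<xi>. ennreal (kk \<xi>) * \<phi> \<xi> \<partial>lborel) + ennreal ((H * (1 + t) powr (- a))\<^sup>2) * (\<integral>\<^sup>+\<xi>. \<phi> \<xi> \<partial>lborel)"
      by (simp add: nn_integral_add nn_integral_cmult)
    also have "(\<integral>\<^sup>+\<xi>. \<phi> \<xi> \<partial>lborel) = ennreal ((norm f)\<^sup>2)"
      by (simp add: \<phi>_def ennreal_norm_l2_sq[symmetric])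
    also have "ennreal ((M * \<rho> t powr (2 * \<sigma>1))\<^sup>2) * (\<integral>\<^sup>+\<xi>. ennreal (kk \<xi>) * \<phi> \<xi> \<partial>lborel) + ennreal ((H * (1 + t) powr (- a))\<^sup>2) * ennreal ((norm f)\<^sup>2)
      \<le> ennreal ((M * \<rho> t powr (2 * \<sigma>1))\<^sup>2) * ennreal (K2 * (C0 * B\<^sup>2) * (1 / \<rho> t) powr (2 * \<kappa>)) + ennreal ((H * (1 + t) powr (- a))\<^sup>2) * ennreal ((norm f)\<^sup>2)"
      by (intro add_mono mult_left_mono in_ball) auto
    also have "\<dots> = ennreal ((M * \<rho> t powr (2 * \<sigma>1))\<^sup>2 * (K2 * (C0 * B\<^sup>2) * (1 / \<rho> t) powr (2 * \<kappa>)) + (H * (1 + t) powr (- a))\<^sup>2 * (norm f)\<^sup>2)"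
      using K2 C0 by (subst ennreal_plus) (auto simp: ennreal_mult')
    finally have "(norm (mul w (fourier_l2 f)))\<^sup>2 \<le> (M * \<rho> t powr (2 * \<sigma>1))\<^sup>2 * (K2 * (C0 * B\<^sup>2) * (1 / \<rho> t) powr (2 * \<kappa>)) + (H * (1 + t) powr (- a))\<^sup>2 * (norm f)\<^sup>2"
      using K2 C0 by (subst (asm) ennreal_le_iff) auto
    also have "(M * \<rho> t powr (2 * \<sigma>1))\<^sup>2 * (K2 * (C0 * B\<^sup>2) * (1 / \<rho> t) powr (2 * \<kappa>)) = M\<^sup>2 * (K2 * C0) * ((1 + t) powr (- a))\<^sup>2 * B\<^sup>2"
    proof -
      have "(\<rho> t powr (2 * \<sigma>1))\<^sup>2 * (1 / \<rho> t) powr (2 * \<kappa>) = \<rho> t powr (4 * \<sigma>1 - 2 * \<kappa>)"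
        using \<rho>0 by (simp add: power2_eq_square powr_add[symmetric] powr_divide powr_diff)
      also have "\<dots> = ((1 + t) powr (- a))\<^sup>2"
      proof -
        have "(4 * \<sigma>1 - 2 * \<kappa>) / \<mu> = - a + - a"
          by (simp add: a_def add_divide_distrib[symmetric] diff_divide_distrib[symmetric])
        thus ?thesis by (simp only: \<rho>_powr power2_eq_square powr_add[symmetric])
      qed
      finally show ?thesis by (simp add: power_mult_distrib mult_ac)
    qed
    also have "M\<^sup>2 * (K2 * C0) * ((1 + t) powr (- a))\<^sup>2 * B\<^sup>2 + (H * (1 + t) powr (- a))\<^sup>2 * (norm f)\<^sup>2
       \<le> M\<^sup>2 * (K2 * C0) * ((1 + t) powr (- a))\<^sup>2 * (B + norm f)\<^sup>2 + (H * (1 + t) powr (- a))\<^sup>2 * (B + norm f)\<^sup>2"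
      using B K2 C0 by (intro add_mono mult_left_mono power_mono) auto
    also have "\<dots> = (C * (1 + t) powr (- a) * (B + norm f))\<^sup>2"
      by (simp only: power_mult_distrib C2) (simp add: algebra_simps)
    finally show "norm (mul (\<lambda>\<xi>. of_real (W t \<xi>) * k \<xi>) (fourier_l2 f)) \<le> C * (1 + t) powr (- a) * (B + norm f)"
      unfolding w_def using C B by (rule_tac power2_le_imp_le) auto
  qed
qed

end

lemma mul_symbol_scale:
  assumes "bounded_symbol k C"
  shows "mul (\<lambda>x. of_real c * k x) v = c *\<^sub>R mul k v"
proof -
  have "mul (\<lambda>x. of_real c * k x) v = abs_l2 (\<lambda>x. c *\<^sub>R (k x * rep_l2 v x))"
    by (simp add: mul_def scaleR_conv_of_real mult.assoc)
  also have "\<dots> = c *\<^sub>R mul k v"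
    unfolding mul_def by (rule abs_l2_scaleR[OF mul_in_Lp[OF assms]])
  finally show ?thesis .
qed

lemma Lm_bound_mono:
  assumes "Lm_bound m B f" "0 \<le> B" "B \<le> B'" "m \<ge> 0"
  shows "Lm_bound m B' f"
  using assms(1) unfolding Lm_bound_def
  by (rule order_trans) (use assms in \<open>auto intro!: ennreal_leI powr_mono2\<close>)

lemma Lp_space_Lm_bound:
  assumes "f \<in> Lp_space m" "m > 0"
  obtains B where "B > 0" "Lm_bound m B f"
proof (rule that)
  define I where "I = (\<integral>x. cmod (f x) powr m \<partial>lborel)"
  have I: "I \<ge> 0" by (simp add: I_def)
  show "(I + 1) powr (1 / m) > 0" using I by simp
  have "(\<integral>\<^sup>+x. ennreal (cmod (f x) powr m) \<partial>lborel) = ennreal I"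
    unfolding I_def using assms by (intro nn_integral_eq_integral) (auto simp: Lp_space_def)
  thus "Lm_bound m ((I + 1) powr (1 / m)) f"
    using I assms by (auto simp: Lm_bound_def powr_powr intro!: ennreal_leI)
qed

section \<open>The Duhamel kernel with the weight of the later time\<close>

context semilinear
begin

lemma W_K1_bound:
  obtains C where "C > 0" "\<And>s t. 0 \<le> s \<Longrightarrow> 0 \<le> t \<Longrightarrow>
    bounded_symbol (\<lambda>\<xi> :: real^'n. of_real ((\<rho> t * norm \<xi>) powr \<sigma>) * K1 s \<xi>) (C * (1 + t) powr (\<sigma> / \<mu>) * (1 + s) powr (- \<theta>))"
proof -
  obtain C where C: "C > 0" "\<And>t (\<xi> :: real^'n). t \<ge> 0 \<Longrightarrow> \<xi> \<noteq> 0 \<Longrightarrow> norm \<xi> powr \<sigma> * cmod (K1 t \<xi>) \<le> C * (1 + t) powr (- \<theta>)"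
  proof -
    show thesis by (rule K1_smoothing[OF that])
  qed
  show ?thesis
  proof (rule that[OF C(1)])
    fix s t :: real assume s: "0 \<le> s" and t: "0 \<le> t"
    have "AE \<xi> in lborel. cmod (of_real ((\<rho> t * norm (\<xi> :: real^'n)) powr \<sigma>) * K1 s \<xi>) \<le> C * (1 + t) powr (\<sigma> / \<mu>) * (1 + s) powr (- \<theta>)"
      using AE_lborel_neq_0
    proof eventually_elim
      case (elim \<xi>)
      have "cmod (of_real ((\<rho> t * norm \<xi>) powr \<sigma>) * K1 s \<xi>) = \<rho> t powr \<sigma> * (norm \<xi> powr \<sigma> * cmod (K1 s \<xi>))"
        by (simp add: norm_mult powr_mult)
      also have "\<dots> \<le> \<rho> t powr \<sigma> * (C * (1 + s) powr (- \<theta>))"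
        by (intro mult_left_mono C(2)[OF s elim]) simp
      finally show ?case by (simp add: \<rho>_powr mult_ac)
    qed
    thus "bounded_symbol (\<lambda>\<xi>. of_real ((\<rho> t * norm (\<xi> :: real^'n)) powr \<sigma>) * K1 s \<xi>) (C * (1 + t) powr (\<sigma> / \<mu>) * (1 + s) powr (- \<theta>))"
      by (simp add: bounded_symbol_def)
  qed
qed

lemma K1_symbol: "0 \<le> s \<Longrightarrow> bounded_symbol (K1 s :: real^'n \<Rightarrow> complex) s"
  unfolding bounded_symbol_def
  by (intro conjI) (simp, use AE_lborel_neq_0 in eventually_elim, rule K1_le_time)

lemma W_K1_symbol:
  obtains C where "C > 0" "\<And>s t. 0 \<le> s \<Longrightarrow> 0 \<le> t \<Longrightarrow>
    bounded_symbol (\<lambda>\<xi>. of_real (W t \<xi>) * K1 s \<xi>) (s + C * (1 + t) powr (\<sigma> / \<mu>) * (1 + s) powr (- \<theta>))"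
proof -
  obtain C where C: "C > 0" "\<And>s t. 0 \<le> s \<Longrightarrow> 0 \<le> t \<Longrightarrow>
    bounded_symbol (\<lambda>\<xi> :: real^'n. of_real ((\<rho> t * norm \<xi>) powr \<sigma>) * K1 s \<xi>) (C * (1 + t) powr (\<sigma> / \<mu>) * (1 + s) powr (- \<theta>))"
  proof -
    show thesis by (rule W_K1_bound[OF that])
  qed
  show ?thesis
  proof (rule that[OF C(1)])
    fix s t :: real assume s: "0 \<le> s" and t: "0 \<le> t"
    have "AE \<xi> in lborel. cmod (K1 s (\<xi> :: real^'n)) \<le> s"
        "AE \<xi> in lborel. cmod (of_real ((\<rho> t * norm (\<xi> :: real^'n)) powr \<sigma>) * K1 s \<xi>) \<le> C * (1 + t) powr (\<sigma> / \<mu>) * (1 + s) powr (- \<theta>)"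
      using K1_symbol[OF s] C(2)[OF s t] by (auto simp: bounded_symbol_def)
    hence "AE \<xi> in lborel. cmod (of_real (W t \<xi>) * K1 s \<xi>) \<le> s + C * (1 + t) powr (\<sigma> / \<mu>) * (1 + s) powr (- \<theta>)"
    proof eventually_elim
      case (elim \<xi>)
      have "of_real (W t \<xi>) * K1 s \<xi> = K1 s \<xi> + of_real ((\<rho> t * norm \<xi>) powr \<sigma>) * K1 s \<xi>"
        by (simp add: wt_def algebra_simps)
      thus ?case
        using order_trans[OF norm_triangle_ineq add_mono[OF elim]] by (simp only:)
    qed
    thus "bounded_symbol (\<lambda>\<xi>. of_real (W t \<xi>) * K1 s \<xi>) (s + C * (1 + t) powr (\<sigma> / \<mu>) * (1 + s) powr (- \<theta>))"
      by (simp add: bounded_symbol_def)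
  qed
qed

text \<open>If t <= 2 s, then W at time t is at most a constant times W at time s, and the decay
  estimate at time s applies. In general W is split as 1 plus a pure power: the first part again
  decays, while the second is absorbed by the smoothing of the kernel on L^2.\<close>

lemma duhamel_kernel_bounds:
  obtains C where "C > 0"
    "\<And>s t B (f :: (real^'n) l2). 0 \<le> s \<Longrightarrow> s \<le> t \<Longrightarrow> t \<le> 2 * s \<Longrightarrow> B > 0 \<Longrightarrow> Lm_bound m B (rep_l2 f) \<Longrightarrow>
      norm (mul (\<lambda>\<xi>. of_real (W t \<xi>) * K1 s \<xi>) (fourier_l2 f)) \<le> C * (1 + t) powr (- a) * (B + norm f)"
    "\<And>s t B (f :: (real^'n) l2). 0 \<le> s \<Longrightarrow> s \<le> t \<Longrightarrow> B > 0 \<Longrightarrow> Lm_bound m B (rep_l2 f) \<Longrightarrow>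
      norm (mul (\<lambda>\<xi>. of_real (W t \<xi>) * K1 s \<xi>) (fourier_l2 f))
        \<le> C * ((1 + s) powr (- a) * (B + norm f) + (1 + t) powr (\<sigma> / \<mu>) * (1 + s) powr (- \<theta>) * norm f)"
proof -
  obtain C1 where C1: "C1 > 0" "\<And>t k (f :: (real^'n) l2) B E. t \<ge> 0 \<Longrightarrow> B > 0 \<Longrightarrow>
    bounded_symbol (\<lambda>\<xi>. of_real (W t \<xi>) * k \<xi>) E \<Longrightarrow> decaying t k \<Longrightarrow>
    Lm_bound m B (rep_l2 f) \<Longrightarrow>
    norm (mul (\<lambda>\<xi>. of_real (W t \<xi>) * k \<xi>) (fourier_l2 f)) \<le> C1 * (1 + t) powr (- a) * (B + norm f)"
  proof -
    show thesis by (rule multiplier_decay[OF that])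
  qed
  obtain C2 where C2: "C2 > 0" "\<And>s t. 0 \<le> s \<Longrightarrow> 0 \<le> t \<Longrightarrow>
    bounded_symbol (\<lambda>\<xi> :: real^'n. of_real ((\<rho> t * norm \<xi>) powr \<sigma>) * K1 s \<xi>) (C2 * (1 + t) powr (\<sigma> / \<mu>) * (1 + s) powr (- \<theta>))"
  proof -
    show thesis by (rule W_K1_bound[OF that])
  qed
  obtain C3 where C3: "\<And>s t. 0 \<le> s \<Longrightarrow> 0 \<le> t \<Longrightarrow>
    bounded_symbol (\<lambda>\<xi>. of_real (W t \<xi>) * K1 s \<xi>) (s + C3 * (1 + t) powr (\<sigma> / \<mu>) * (1 + s) powr (- \<theta>))"
  proof -
    show thesis by (rule W_K1_symbol[OF that])
  qed
  have diag: "norm (mul (\<lambda>\<xi>. of_real (W s \<xi>) * K1 s \<xi>) (fourier_l2 f)) \<le> C1 * (1 + s) powr (- a) * (B + norm f)"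
    if "0 \<le> s" "B > 0" "Lm_bound m B (rep_l2 f)" for s B and f :: "(real^'n) l2"
    by (rule C1(2)[OF that(1,2) C3[OF that(1) that(1)] K1_decaying[OF that(1)] that(3)])
  \<comment> \<open>From 1 + t <= 2 (1 + s), raised to the power \<sigma>/\<mu>, which compares the
    scales at the times t and s.\<close>
  define c where "c = 2 powr (\<sigma> / \<mu>)"
  have c: "c \<ge> 1" unfolding c_def using \<sigma>_pos \<mu>_pos by (intro ge_one_powr_ge_zero) auto
  define C where "C = c * C1 * 2 powr a + C1 + C2"
  have Cp: "c * C1 * 2 powr a \<ge> 0" using C1 c by simp
  show ?thesis
  proof (rule that[of C])
    show "C > 0" using Cp C1 C2 by (simp add: C_def)
  next
    fix s t B :: real and f :: "(real^'n) l2"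
    assume s: "0 \<le> s" "s \<le> t" "t \<le> 2 * s" and B: "B > 0" and Lm: "Lm_bound m B (rep_l2 f)"
    have t: "0 \<le> t" using s by simp
    have ineq: "1 + t \<le> 2 * (1 + s)" using s by simp
    have \<rho>: "\<rho> t powr \<sigma> \<le> c * \<rho> s powr \<sigma>"
    proof -
      have "\<rho> t powr \<sigma> \<le> (2 * (1 + s)) powr (\<sigma> / \<mu>)"
        unfolding \<rho>_powr using ineq t \<sigma>_pos \<mu>_pos by (intro powr_mono2) auto
      thus ?thesis unfolding powr_mult \<rho>_powr c_def .
    qed
    have "norm (mul (\<lambda>\<xi>. of_real (W t \<xi>) * K1 s \<xi>) (fourier_l2 f)) \<le> norm (mul (\<lambda>\<xi>. of_real c * (of_real (W s \<xi>) * K1 s \<xi>)) (fourier_l2 f))"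
    proof (rule norm_mul_mono[OF C3[OF s(1) t]])
      have "bounded_symbol (\<lambda>\<xi>::real^'n. of_real c) c" using c by (simp add: bounded_symbol_def)
      thus "bounded_symbol (\<lambda>\<xi>. of_real c * (of_real (W s \<xi>) * K1 s \<xi>)) (c * (s + C3 * (1 + s) powr (\<sigma> / \<mu>) * (1 + s) powr (- \<theta>)))"
        by (rule bounded_symbol_mult[OF _ C3[OF s(1) s(1)]])
      have "W t \<xi> \<le> c * W s \<xi>" for \<xi> :: "real^'n"
        using mult_right_mono[OF \<rho>, of "norm \<xi> powr \<sigma>"] c by (simp add: wt_def powr_mult algebra_simps)
      thus "AE \<xi> in lborel. cmod (of_real (W t \<xi>) * K1 s \<xi>) \<le> cmod (of_real c * (of_real (W s \<xi>) * K1 s \<xi>))"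
        using c by (auto simp: norm_mult mult.assoc[symmetric] intro!: mult_right_mono)
    qed
    also have "\<dots> = c * norm (mul (\<lambda>\<xi>. of_real (W s \<xi>) * K1 s \<xi>) (fourier_l2 f))"
      using c by (simp add: mul_symbol_scale[OF C3[OF s(1) s(1)]])
    also have "\<dots> \<le> c * (C1 * (1 + s) powr (- a) * (B + norm f))"
      using c by (intro mult_left_mono diag s B Lm) auto
    also have "\<dots> \<le> c * (C1 * (2 powr a * (1 + t) powr (- a)) * (B + norm f))"
    proof -
      have "(1 + s) powr (- a) \<le> ((1 + t) / 2) powr (- a)"
        using ineq t a_nonneg by (intro powr_mono2') auto
      also have "\<dots> = 2 powr a * (1 + t) powr (- a)"
        by (simp add: powr_divide powr_minus field_simps)
      finally show ?thesis using C1 c B by (intro mult_left_mono mult_right_mono) auto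
    qed
    also have "\<dots> = (c * C1 * 2 powr a) * ((1 + t) powr (- a) * (B + norm f))" by simp
    also have "\<dots> \<le> C * ((1 + t) powr (- a) * (B + norm f))"
      using C1 C2 B by (intro mult_right_mono) (auto simp: C_def)
    finally show "norm (mul (\<lambda>\<xi>. of_real (W t \<xi>) * K1 s \<xi>) (fourier_l2 f)) \<le> C * (1 + t) powr (- a) * (B + norm f)"
      by (simp add: mult.assoc)
  next
    fix s t B :: real and f :: "(real^'n) l2"
    assume s: "0 \<le> s" "s \<le> t" and B: "B > 0" and Lm: "Lm_bound m B (rep_l2 f)"
    have t: "0 \<le> t" using s by simp
    have "(\<lambda>\<xi>. of_real (W t \<xi>) * K1 s \<xi>) = (\<lambda>\<xi>. K1 s \<xi> + of_real ((\<rho> t * norm \<xi>) powr \<sigma>) * K1 s \<xi>)"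
      by (simp add: fun_eq_iff wt_def algebra_simps)
    hence "norm (mul (\<lambda>\<xi>. of_real (W t \<xi>) * K1 s \<xi>) (fourier_l2 f))
      \<le> norm (mul (K1 s) (fourier_l2 f)) + norm (mul (\<lambda>\<xi>. of_real ((\<rho> t * norm \<xi>) powr \<sigma>) * K1 s \<xi>) (fourier_l2 f))"
      by (simp add: mul_symbol_add[OF K1_symbol[OF s(1)] C2(2)[OF s(1) t]] norm_triangle_ineq)
    also have "norm (mul (K1 s) (fourier_l2 f)) \<le> norm (mul (\<lambda>\<xi>. of_real (W s \<xi>) * K1 s \<xi>) (fourier_l2 f))"
    proof (rule norm_mul_mono[OF K1_symbol[OF s(1)] C3[OF s(1) s(1)]])
      have "cmod (K1 s \<xi>) * 1 \<le> cmod (K1 s \<xi>) * W s \<xi>" for \<xi> :: "real^'n"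
        by (intro mult_left_mono) auto
      thus "AE \<xi> in lborel. cmod (K1 s \<xi>) \<le> cmod (of_real (W s \<xi>) * K1 s \<xi>)"
        by (auto simp: norm_mult mult.commute)
    qed
    also have "\<dots> \<le> C1 * (1 + s) powr (- a) * (B + norm f)"
      by (rule diag[OF s(1) B Lm])
    also have "norm (mul (\<lambda>\<xi>. of_real ((\<rho> t * norm \<xi>) powr \<sigma>) * K1 s \<xi>) (fourier_l2 f)) \<le> C2 * (1 + t) powr (\<sigma> / \<mu>) * (1 + s) powr (- \<theta>) * norm f"
      using norm_mul_le[OF C2(2)[OF s(1) t], of "fourier_l2 f"] by simp
    also have "C1 * (1 + s) powr (- a) * (B + norm f) + C2 * (1 + t) powr (\<sigma> / \<mu>) * (1 + s) powr (- \<theta>) * norm f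
      \<le> C * ((1 + s) powr (- a) * (B + norm f)) + C * ((1 + t) powr (\<sigma> / \<mu>) * (1 + s) powr (- \<theta>) * norm f)"
      using Cp C1 C2 B unfolding mult.assoc by (intro add_mono mult_right_mono) (auto simp: C_def)
    finally show "norm (mul (\<lambda>\<xi>. of_real (W t \<xi>) * K1 s \<xi>) (fourier_l2 f))
        \<le> C * ((1 + s) powr (- a) * (B + norm f) + (1 + t) powr (\<sigma> / \<mu>) * (1 + s) powr (- \<theta>) * norm f)"
      by (simp add: distrib_left)
  qed
qed

section \<open>The linear evolution of the data\<close>

definition bw :: "real^'n \<Rightarrow> real" where "bw \<xi> = (1 + (norm \<xi>)\<^sup>2) powr (\<sigma> / 2)"

lemma bw_measurable [measurable]: "bw \<in> borel_measurable borel"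
  unfolding bw_def by measurable

lemma bw_ge: "1 \<le> bw \<xi>" "norm \<xi> powr \<sigma> \<le> bw \<xi>"
proof -
  show "1 \<le> bw \<xi>" unfolding bw_def using \<sigma>_pos by (intro ge_one_powr_ge_zero) auto
  have "norm \<xi> powr \<sigma> = ((norm \<xi>)\<^sup>2) powr (\<sigma> / 2)"
    by (cases "\<xi> = 0") (simp_all add: powr_powr flip: powr_numeral)
  also have "\<dots> \<le> bw \<xi>" unfolding bw_def using \<sigma>_pos by (intro powr_mono2) auto
  finally show "norm \<xi> powr \<sigma> \<le> bw \<xi>" .
qed

lemma bw_pos [simp]: "bw \<xi> > 0" "bw \<xi> \<noteq> 0"
  using bw_ge(1)[of \<xi>] by auto

lemma bounded_symbol_inverse_bw: "bounded_symbol (\<lambda>\<xi>. of_real (1 / bw \<xi>)) 1"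
  by (auto simp: bounded_symbol_def norm_divide abs_of_pos bw_ge)

lemma u0_H: "u0 \<in> H_space \<sigma>" and u0_m: "u0 \<in> Lp_space m" and u1_2: "u1 \<in> Lp_space 2" and u1_m: "u1 \<in> Lp_space m"
  using data by (auto simp: data_space_def)

lemma u0_2: "u0 \<in> Lp_space 2"
  using u0_H by (simp add: H_space_def)

definition z0 :: "(real^'n) l2" where "z0 = abs_l2 (bessel_weight \<sigma> u0)"

lemma fourier_u0: "fourier_l2 (abs_l2 u0) = mul (\<lambda>\<xi>. of_real (1 / bw \<xi>)) z0"
proof -
  have b: "bessel_weight \<sigma> u0 \<in> Lp_space 2" using u0_H by (simp add: H_space_def)
  have "mul (\<lambda>\<xi>. of_real (1 / bw \<xi>)) z0 = abs_l2 (\<lambda>\<xi>. of_real (1 / bw \<xi>) * bessel_weight \<sigma> u0 \<xi>)"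
    unfolding z0_def by (rule mul_abs_l2[OF bounded_symbol_inverse_bw b])
  also have "(\<lambda>\<xi>. of_real (1 / bw \<xi>) * bessel_weight \<sigma> u0 \<xi>) = fourier u0"
    using bw_pos(2) by (simp add: fun_eq_iff bessel_weight_def bw_def)
  also have "abs_l2 (fourier u0) = fourier_l2 (abs_l2 u0)"
    by (rule abs_fourier[OF u0_2])
  finally show ?thesis by simp
qed

text \<open>The bound on \<open>K0\<close> at high frequencies contains no decay in |\<xi>|, so
  nothing there compensates the growth of W. The regularity of \<open>u0\<close> does: the symbol
  acts on the Bessel weighted transform \<open>z0\<close> and carries the inverse weight.\<close>

definition K0b :: "real \<Rightarrow> real^'n \<Rightarrow> complex" where
  "K0b t \<xi> = of_real (W t \<xi>) * K0 t \<xi> * of_real (1 / bw \<xi>)"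

lemma K0b_measurable [measurable]: "K0b t \<in> borel_measurable borel"
  unfolding K0b_def by measurable

lemma W_bw_bound: "t \<ge> 0 \<Longrightarrow> W t \<xi> / bw \<xi> \<le> 2 * (1 + t) powr (\<sigma> / \<mu>)"
proof -
  assume t: "t \<ge> 0"
  have "1 \<le> (1 + t) powr (\<sigma> / \<mu>)" using t \<sigma>_pos \<mu>_pos by (intro ge_one_powr_ge_zero) auto
  hence "W t \<xi> \<le> (1 + t) powr (\<sigma> / \<mu>) * bw \<xi> + (1 + t) powr (\<sigma> / \<mu>) * bw \<xi>"
    unfolding wt_def powr_mult \<rho>_powr using bw_ge[of \<xi>] mult_mono[of 1 "(1 + t) powr (\<sigma> / \<mu>)" 1 "bw \<xi>"]
    by (intro add_mono mult_left_mono) auto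
  thus ?thesis by (simp add: field_simps)
qed

lemma K0b_pointwise: "t \<ge> 0 \<Longrightarrow> cmod (K0b t \<xi>) \<le> 2 * (1 + t) powr (\<sigma> / \<mu>) * cmod (K0 t \<xi>)"
  using mult_right_mono[OF W_bw_bound[of t \<xi>], of "cmod (K0 t \<xi>)"]
  by (simp add: K0b_def norm_mult norm_divide abs_of_pos)

lemma K0_symbol: "0 \<le> t \<Longrightarrow> bounded_symbol (K0 t :: real^'n \<Rightarrow> complex) 9"
proof -
  assume t: "t \<ge> 0"
  have "AE \<xi> in lborel. cmod (K0 t (\<xi> :: real^'n)) \<le> 9"
    using AE_lborel_neq_0
  proof eventually_elim
    case (elim \<xi>)
    have e: "9 * exp (- (t * norm \<xi> powr \<mu> / 16)) \<le> 9" "9 * exp (- (t / 16)) \<le> 9" using t by auto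
    thus ?case
      using order_trans[OF K0_low[OF elim t] e(1)] order_trans[OF K0_high[OF elim t] e(2)]
      by (cases "norm \<xi> \<le> 1") auto
  qed
  thus ?thesis by (simp add: bounded_symbol_def)
qed

lemma K0b_symbol: "t \<ge> 0 \<Longrightarrow> bounded_symbol (K0b t) (18 * (1 + t) powr (\<sigma> / \<mu>))"
proof -
  assume t: "t \<ge> 0"
  have "AE \<xi> in lborel. cmod (K0 t (\<xi> :: real^'n)) \<le> 9"
    using K0_symbol[OF t] by (simp add: bounded_symbol_def)
  hence "AE \<xi> in lborel. cmod (K0b t \<xi>) \<le> 18 * (1 + t) powr (\<sigma> / \<mu>)"
  proof eventually_elim
    case (elim \<xi>)
    have "2 * (1 + t) powr (\<sigma> / \<mu>) * cmod (K0 t \<xi>) \<le> 2 * (1 + t) powr (\<sigma> / \<mu>) * 9"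
      by (intro mult_left_mono elim) auto
    from order_trans[OF K0b_pointwise[OF t] this] show ?case by simp
  qed
  thus ?thesis by (simp add: bounded_symbol_def)
qed

text \<open>The solution of the linear problem for the data \<open>(u0, u1)\<close>, on the Fourier side and with
  the weight \<^term>\<open>W t\<close>.\<close>

definition lin :: "real \<Rightarrow> (real^'n) l2" where
  "lin t = mul (K0b t) z0 + mul (\<lambda>\<xi>. of_real (W t \<xi>) * K1 t \<xi>) (fourier_l2 (abs_l2 u1))"

text \<open>The contribution of \<open>u0\<close> is split at frequency 1: below it the L^m bound of
  \<open>u0\<close> gives the rate a, above it the symbol decays exponentially in time and acts on
  \<open>z0\<close>.\<close>

lemma lin_bound:
  obtains C where "C > 0" "\<And>t. t \<ge> 0 \<Longrightarrow> norm (lin t) \<le> C * (1 + t) powr (- a)"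
proof -
  obtain C1 where C1: "C1 > 0" "\<And>t k (f :: (real^'n) l2) B E. t \<ge> 0 \<Longrightarrow> B > 0 \<Longrightarrow>
    bounded_symbol (\<lambda>\<xi>. of_real (W t \<xi>) * k \<xi>) E \<Longrightarrow> decaying t k \<Longrightarrow>
    Lm_bound m B (rep_l2 f) \<Longrightarrow>
    norm (mul (\<lambda>\<xi>. of_real (W t \<xi>) * k \<xi>) (fourier_l2 f)) \<le> C1 * (1 + t) powr (- a) * (B + norm f)"
  proof -
    show thesis by (rule multiplier_decay[OF that])
  qed
  obtain C3 where C3: "\<And>s t. 0 \<le> s \<Longrightarrow> 0 \<le> t \<Longrightarrow>
    bounded_symbol (\<lambda>\<xi>. of_real (W t \<xi>) * K1 s \<xi>) (s + C3 * (1 + t) powr (\<sigma> / \<mu>) * (1 + s) powr (- \<theta>))"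
  proof -
    show thesis by (rule W_K1_symbol[OF that])
  qed
  obtain K' where K': "K' > 0" "\<And>x. x \<ge> 0 \<Longrightarrow> x powr (\<sigma> / \<mu> + a) * exp (- (1 / 16 * x)) \<le> K'"
    using powr_exp_bound[of "\<sigma> / \<mu> + a" "1/16"] \<sigma>_pos \<mu>_pos a_nonneg by auto
  obtain B0 where B0: "B0 > 0" "Lm_bound m B0 u0" using Lp_space_Lm_bound[OF u0_m] m by auto
  obtain B1 where B1: "B1 > 0" "Lm_bound m B1 u1" using Lp_space_Lm_bound[OF u1_m] m by auto
  have Lm0: "Lm_bound m B0 (rep_l2 (abs_l2 u0))" using B0 Lm_bound_cong_AE[OF rep_abs_l2[OF u0_2]] by blast
  have Lm1: "Lm_bound m B1 (rep_l2 (abs_l2 u1))" using B1 Lm_bound_cong_AE[OF rep_abs_l2[OF u1_2]] by blast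
  define C where "C = C1 * (B0 + norm (abs_l2 u0)) + 18 * exp (1 / 16) * K' * norm z0 + C1 * (B1 + norm (abs_l2 u1))"
  show ?thesis
  proof (rule that[of C])
    have "C1 * (B0 + norm (abs_l2 u0)) > 0" "C1 * (B1 + norm (abs_l2 u1)) > 0"
      using C1 B0 B1 by (auto intro!: mult_pos_pos add_pos_nonneg)
    moreover have "18 * exp (1 / 16) * K' * norm z0 \<ge> 0" using K' by simp
    ultimately show "C > 0" unfolding C_def by linarith
    fix t :: real assume t: "t \<ge> 0"
    define k where "k \<xi> = indicator (cball 0 1) \<xi> * K0 t \<xi>" for \<xi> :: "real^'n"
    define h where "h \<xi> = indicator (- cball 0 1) \<xi> * K0b t \<xi>" for \<xi>
    have [measurable]: "cball (0::real^'n) 1 \<in> sets borel" "- cball (0::real^'n) 1 \<in> sets borel" by simp_all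
    have hsym: "bounded_symbol h (18 * exp (1 / 16) * K' * (1 + t) powr (- a))"
    proof -
      have "AE \<xi> in lborel. cmod (h \<xi>) \<le> 18 * exp (1 / 16) * K' * (1 + t) powr (- a)"
        using AE_lborel_neq_0
      proof eventually_elim
        case (elim \<xi>)
        show ?case
        proof (cases "norm \<xi> \<le> 1")
          case False
          have "cmod (h \<xi>) \<le> 2 * (1 + t) powr (\<sigma> / \<mu>) * cmod (K0 t \<xi>)"
            using False K0b_pointwise[OF t, of \<xi>] by (simp add: h_def)
          also have "\<dots> \<le> 2 * (1 + t) powr (\<sigma> / \<mu>) * (9 * exp (- (t / 16)))"
            using False by (intro mult_left_mono K0_high[OF elim t]) auto
          also have "(1 + t) powr (\<sigma> / \<mu>) = (1 + t) powr (\<sigma> / \<mu> + a) * (1 + t) powr (- a)"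
            by (simp add: powr_add[symmetric])
          also have "2 * ((1 + t) powr (\<sigma> / \<mu> + a) * (1 + t) powr (- a)) * (9 * exp (- (t / 16)))
             = 18 * exp (1 / 16) * ((1 + t) powr (\<sigma> / \<mu> + a) * exp (- (1 / 16 * (1 + t)))) * (1 + t) powr (- a)"
            unfolding exp_shift' by simp
          also have "\<dots> \<le> 18 * exp (1 / 16) * K' * (1 + t) powr (- a)"
            using t by (intro mult_right_mono mult_left_mono K') auto
          finally show ?thesis .
        qed (use K' in \<open>simp add: h_def\<close>)
      qed
      moreover have "h \<in> borel_measurable borel" unfolding h_def by measurable
      ultimately show ?thesis by (simp add: bounded_symbol_def)
    qed
    have ksym: "bounded_symbol (\<lambda>\<xi>. of_real (W t \<xi>) * k \<xi>) (9 * (1 + \<rho> t powr \<sigma>))"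
    proof -
      have "AE \<xi> in lborel. cmod (of_real (W t \<xi>) * k \<xi>) \<le> 9 * (1 + \<rho> t powr \<sigma>)"
        using AE_lborel_neq_0
      proof eventually_elim
        case (elim \<xi>)
        show ?case
        proof (cases "norm \<xi> \<le> 1")
          case True
          have "norm \<xi> powr \<sigma> \<le> 1" using True \<sigma>_pos powr_mono2[of \<sigma> "norm \<xi>" 1] by simp
          hence "W t \<xi> \<le> 1 + \<rho> t powr \<sigma>" by (simp add: wt_def powr_mult mult_left_le)
          moreover have "cmod (K0 t \<xi>) \<le> 9"
            using K0_low[OF elim t True] t by (smt (verit) divide_nonneg_nonneg exp_le_one_iff mult_nonneg_nonneg powr_ge_zero)
          ultimately have "W t \<xi> * cmod (K0 t \<xi>) \<le> (1 + \<rho> t powr \<sigma>) * 9"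
            by (intro mult_mono) (auto intro: add_nonneg_nonneg)
          thus ?thesis using True by (simp add: k_def norm_mult)
        qed (simp add: k_def add_nonneg_nonneg)
      qed
      moreover have "k \<in> borel_measurable borel" unfolding k_def by measurable
      ultimately show ?thesis by (simp add: bounded_symbol_def)
    qed
    have split: "mul (K0b t) z0 = mul (\<lambda>\<xi>. of_real (W t \<xi>) * k \<xi>) (fourier_l2 (abs_l2 u0)) + mul h z0"
    proof -
      have s2: "bounded_symbol (\<lambda>\<xi>. of_real (W t \<xi>) * k \<xi> * of_real (1 / bw \<xi>)) (9 * (1 + \<rho> t powr \<sigma>) * 1)"
        by (rule bounded_symbol_mult[OF ksym bounded_symbol_inverse_bw])
      have "K0b t = (\<lambda>\<xi>. of_real (W t \<xi>) * k \<xi> * of_real (1 / bw \<xi>) + h \<xi>)"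
        by (auto simp: fun_eq_iff K0b_def k_def h_def indicator_def)
      thus ?thesis
        by (simp only: mul_symbol_add[OF s2 hsym] fourier_u0 mul_mul[OF ksym bounded_symbol_inverse_bw])
    qed
    have 1: "norm (mul (\<lambda>\<xi>. of_real (W t \<xi>) * k \<xi>) (fourier_l2 (abs_l2 u0))) \<le> C1 * (1 + t) powr (- a) * (B0 + norm (abs_l2 u0))"
    proof (rule C1(2)[OF t B0(1) ksym _ Lm0])
      have "cmod (k \<xi>) \<le> 9 * (norm \<xi> powr (- (2 * \<sigma>1)) * exp (- (t * norm \<xi> powr \<mu> / 16)))" if "\<xi> \<noteq> 0" "norm \<xi> \<le> 1" for \<xi>
      proof -
        \<comment> \<open>\<open>K0\<close> is not singular at low frequencies; on the unit ball it
          satisfies the weaker bound with the factor |\<xi>|^(-2\<sigma>1) as well.\<close>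
        have "1 \<le> norm \<xi> powr (- (2 * \<sigma>1))"
          using that \<sigma>1_nonneg powr_mono'[of "- (2 * \<sigma>1)" 0 "norm \<xi>"] by simp
        hence "1 * exp (- (t * norm \<xi> powr \<mu> / 16)) \<le> norm \<xi> powr (- (2 * \<sigma>1)) * exp (- (t * norm \<xi> powr \<mu> / 16))"
          by (intro mult_right_mono) auto
        hence "9 * exp (- (t * norm \<xi> powr \<mu> / 16)) \<le> 9 * (norm \<xi> powr (- (2 * \<sigma>1)) * exp (- (t * norm \<xi> powr \<mu> / 16)))"
          by simp
        from order_trans[OF K0_low[OF that(1) t that(2)] this] show ?thesis using that by (simp add: k_def)
      qed
      thus "decaying t k" by (auto simp: decaying_def k_def)
    qed
    have 2: "norm (mul (\<lambda>\<xi>. of_real (W t \<xi>) * K1 t \<xi>) (fourier_l2 (abs_l2 u1))) \<le> C1 * (1 + t) powr (- a) * (B1 + norm (abs_l2 u1))"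
      by (rule C1(2)[OF t B1(1) C3[OF t t] K1_decaying[OF t] Lm1])
    have 3: "norm (mul h z0) \<le> 18 * exp (1 / 16) * K' * (1 + t) powr (- a) * norm z0"
      by (rule norm_mul_le[OF hsym])
    have "norm (lin t) \<le> norm (mul (\<lambda>\<xi>. of_real (W t \<xi>) * k \<xi>) (fourier_l2 (abs_l2 u0))) + norm (mul h z0)
        + norm (mul (\<lambda>\<xi>. of_real (W t \<xi>) * K1 t \<xi>) (fourier_l2 (abs_l2 u1)))"
      unfolding lin_def split by (intro norm_triangle_mono norm_triangle_ineq order_refl)
    also have "\<dots> \<le> C * (1 + t) powr (- a)"
      using 1 2 3 by (simp add: C_def algebra_simps)
    finally show "norm (lin t) \<le> C * (1 + t) powr (- a)" .
  qed
qed

lemma continuous_W: "continuous_on {0..} (\<lambda>t. W t \<xi>)"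
proof -
  have "continuous_on {0..} \<rho>"
    unfolding \<rho>_def by (intro continuous_intros) auto
  hence "continuous_on {0..} (\<lambda>t. \<rho> t * norm \<xi>)"
    by (rule continuous_on_mult_right)
  hence "continuous_on {0..} (\<lambda>t. (\<rho> t * norm \<xi>) powr \<sigma>)"
    by (rule continuous_on_powr'[OF _ continuous_on_const]) (use \<rho>_pos \<sigma>_pos in \<open>auto simp: less_imp_le\<close>)
  thus ?thesis unfolding wt_def by (rule continuous_on_add[OF continuous_on_const])
qed

lemma W_K1_uniform_symbol:
  obtains E where "\<And>s t. s \<in> {0..T} \<Longrightarrow> t \<in> {0..T} \<Longrightarrow> bounded_symbol (\<lambda>\<xi>. of_real (W t \<xi>) * K1 s \<xi>) E"
proof -
  obtain C where C: "C > 0" "\<And>s t. 0 \<le> s \<Longrightarrow> 0 \<le> t \<Longrightarrow>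
    bounded_symbol (\<lambda>\<xi>. of_real (W t \<xi>) * K1 s \<xi>) (s + C * (1 + t) powr (\<sigma> / \<mu>) * (1 + s) powr (- \<theta>))"
  proof -
    show thesis by (rule W_K1_symbol[OF that])
  qed
  show ?thesis
  proof (rule that[of "T + C * (1 + T) powr (\<sigma> / \<mu>) * 1"])
    fix s t assume st: "s \<in> {0..T}" "t \<in> {0..T}"
    have "s + C * (1 + t) powr (\<sigma> / \<mu>) * (1 + s) powr (- \<theta>) \<le> T + C * (1 + T) powr (\<sigma> / \<mu>) * 1"
    proof (intro add_mono mult_mono)
      show "(1 + s) powr (- \<theta>) \<le> 1" using st \<theta>_pos powr_mono[of "-\<theta>" 0 "1 + s"] by simp
      show "(1 + t) powr (\<sigma> / \<mu>) \<le> (1 + T) powr (\<sigma> / \<mu>)" using st \<sigma>_pos \<mu>_pos by (intro powr_mono2) auto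
    qed (use st C in auto)
    thus "bounded_symbol (\<lambda>\<xi>. of_real (W t \<xi>) * K1 s \<xi>) (T + C * (1 + T) powr (\<sigma> / \<mu>) * 1)"
      using C(2)[of s t] st by (auto intro: bounded_symbol_mono)
  qed
qed

lemma continuous_lin: "continuous_on {0..T} lin"
  unfolding lin_def
proof (intro continuous_on_add)
  have sub: "{0..T} \<subseteq> {0..}" by auto
  show "continuous_on {0..T} (\<lambda>t. mul (K0b t) z0)"
  proof (rule continuous_on_mul)
    show "bounded_symbol (K0b t) (18 * (1 + T) powr (\<sigma> / \<mu>))" if "t \<in> {0..T}" for t
      using that \<sigma>_pos \<mu>_pos by (intro bounded_symbol_mono[OF K0b_symbol] mult_left_mono powr_mono2) auto
    show "AE \<xi> in lborel. continuous_on {0..T} (\<lambda>t. K0b t \<xi>)"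
      unfolding K0b_def
      by (intro AE_I2 continuous_intros continuous_K0 continuous_on_subset[OF continuous_W sub])
  qed (rule continuous_on_const)
  obtain E where E: "\<And>s t. s \<in> {0..T} \<Longrightarrow> t \<in> {0..T} \<Longrightarrow> bounded_symbol (\<lambda>\<xi>. of_real (W t \<xi>) * K1 s \<xi>) E"
  proof -
    show thesis by (rule W_K1_uniform_symbol[OF that])
  qed
  show "continuous_on {0..T} (\<lambda>t. mul (\<lambda>\<xi>. of_real (W t \<xi>) * K1 t \<xi>) (fourier_l2 (abs_l2 u1)))"
  proof (rule continuous_on_mul)
    show "AE \<xi> in lborel. continuous_on {0..T} (\<lambda>t. of_real (W t \<xi>) * K1 t \<xi>)"
      by (intro AE_I2 continuous_intros continuous_K1 continuous_on_subset[OF continuous_W sub])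
  qed (auto intro: E)
qed

subsection \<open>The nonlinear term\<close>

text \<open>The unknown is \<open>z t = (1 + t)\<^bsup>a\<^esup> W t \<F>(u t)\<close>, so that its \<open>L\<^sup>2\<close> norm is the
  time-weighted Sobolev norm of \<open>u t\<close>.\<close>

definition sol :: "real \<Rightarrow> (real^'n) l2 \<Rightarrow> (real^'n) l2" where
  "sol t z = inv_fourier_l2 (mul (\<lambda>\<xi>. of_real (1 / W t \<xi>)) ((1 + t) powr (- a) *\<^sub>R z))"

definition nl :: "real \<Rightarrow> (real^'n) l2 \<Rightarrow> (real^'n) l2" where
  "nl t z = abs_l2 (abs_power p (rep_l2 (sol t z)))"

lemma sol_diff: "sol t (z - z') = sol t z - sol t z'"
  by (simp only: sol_def scaleR_diff_right mul_diff[OF bounded_symbol_inverse_wt] fop_diff[OF abs_one])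

text \<open>The exponent in time collects \<rho>^(-n (1/2 - 1/q)) from the embedding at scale \<rho>
  and (1 + t)^(-a) from the weight. The restriction q <= 2 p keeps q in the Sobolev range by the
  upper bound on p.\<close>

lemma sol_Lq:
  assumes q: "q > 2" "q \<le> 2 * p"
  obtains C where "C > 0" "\<And>t z N. t \<ge> 0 \<Longrightarrow> norm z \<le> N \<Longrightarrow> N > 0 \<Longrightarrow>
    Lm_bound q (C * (1 + t) powr (- ((n * (1/2 - 1/q) + \<kappa> - 2 * \<sigma>1) / \<mu>)) * N) (rep_l2 (sol t z))"
proof -
  have cond: "real CARD('n) \<le> 2 * \<sigma> \<or> q \<le> 2 * real CARD('n) / (real CARD('n) - 2 * \<sigma>)"
  proof (cases "real CARD('n) \<le> 2 * \<sigma>")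
    case False
    hence "p \<le> real CARD('n) / (real CARD('n) - 2 * \<sigma>)" using p_Sobolev by simp
    hence "2 * p \<le> 2 * real CARD('n) / (real CARD('n) - 2 * \<sigma>)" by simp
    thus ?thesis using q by linarith
  qed simp
  obtain C where C: "C > 0" "\<And>\<rho> (z :: (real ^ 'n) l2) N. \<rho> > 0 \<Longrightarrow> norm z \<le> N \<Longrightarrow> N > 0 \<Longrightarrow>
    Lm_bound q (C * \<rho> powr (- real CARD('n) * (1/2 - 1/q)) * N) (rep_l2 (inv_fourier_l2 (mul (\<lambda>\<xi>. of_real (1 / wt \<sigma> \<rho> \<xi>)) z)))"
    using sobolev_embedding[OF \<sigma>_pos q(1), where 'n = 'n] cond by blast
  show ?thesis
  proof (rule that[OF C(1)])
    fix t N :: real and z :: "(real^'n) l2" assume t: "t \<ge> 0" and z: "norm z \<le> N" and N: "N > 0"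
    have "norm ((1 + t) powr (- a) *\<^sub>R z) \<le> (1 + t) powr (- a) * N"
      using z by (simp add: mult_left_mono)
    moreover have "(1 + t) powr (- a) * N > 0" using t N by simp
    ultimately have "Lm_bound q (C * \<rho> t powr (- real CARD('n) * (1/2 - 1/q)) * ((1 + t) powr (- a) * N)) (rep_l2 (sol t z))"
      unfolding sol_def by (intro C(2) \<rho>_pos t)
    also have "C * \<rho> t powr (- real CARD('n) * (1/2 - 1/q)) * ((1 + t) powr (- a) * N)
      = C * (\<rho> t powr (- real CARD('n) * (1/2 - 1/q)) * (1 + t) powr (- a)) * N" by simp
    also have "\<rho> t powr (- real CARD('n) * (1/2 - 1/q)) * (1 + t) powr (- a) = (1 + t) powr (- ((n * (1/2 - 1/q) + \<kappa> - 2 * \<sigma>1) / \<mu>))"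
      unfolding \<rho>_powr powr_add[symmetric]
      by (rule arg_cong[of _ _ "\<lambda>x. (1 + t) powr x"]) (use \<mu>_pos in \<open>simp add: n_def a_def field_simps\<close>)
    finally show "Lm_bound q (C * (1 + t) powr (- ((n * (1/2 - 1/q) + \<kappa> - 2 * \<sigma>1) / \<mu>)) * N) (rep_l2 (sol t z))" .
  qed
qed

text \<open>\<open>sol_Lq\<close> at q = p r, raised to the power p: each of the p factors
  contributes the same rate, hence e / \<mu> in total. Linearity of \<open>sol\<close> makes the
  difference of solutions an instance of the same bound.\<close>

lemma nl_Lr:
  assumes r: "r > 0" "p * r > 2" "r \<le> 2"
  defines "e \<equiv> p * (n / 2 + \<kappa> - 2 * \<sigma>1) - n / r"
  obtains C where "C > 0" "\<And>t z z' M d. t \<ge> 0 \<Longrightarrow> M > 0 \<Longrightarrow> d > 0 \<Longrightarrow> norm z \<le> M \<Longrightarrow> norm z' \<le> M \<Longrightarrow> norm (z - z') \<le> d \<Longrightarrow>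
    Lm_bound r (C * (1 + t) powr (- (e / \<mu>)) * (M powr (p - 1) * d))
      (\<lambda>x. abs_power p (rep_l2 (sol t z)) x - abs_power p (rep_l2 (sol t z')) x)"
    "\<And>t z M. t \<ge> 0 \<Longrightarrow> M > 0 \<Longrightarrow> norm z \<le> M \<Longrightarrow>
    Lm_bound r (C * (1 + t) powr (- (e / \<mu>)) * (M powr (p - 1) * M)) (abs_power p (rep_l2 (sol t z)))"
proof -
  have "p * r \<le> 2 * p" using r p by simp
  then obtain C where C: "C > 0" "\<And>t z N. t \<ge> 0 \<Longrightarrow> norm z \<le> N \<Longrightarrow> N > 0 \<Longrightarrow>
    Lm_bound (p * r) (C * (1 + t) powr (- ((n * (1/2 - 1/(p * r)) + \<kappa> - 2 * \<sigma>1) / \<mu>)) * N) (rep_l2 (sol t z))"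
    using sol_Lq[OF r(2)] by blast
  define e' where "e' = (n * (1/2 - 1/(p * r)) + \<kappa> - 2 * \<sigma>1) / \<mu>"
  have e': "p * e' = e / \<mu>"
    using p r \<mu>_pos by (simp add: e'_def e_def field_simps)
  have pw: "(C * (1 + t) powr (- e') * M) powr (p - 1) * (C * (1 + t) powr (- e') * d)
      = C powr p * (1 + t) powr (- (e / \<mu>)) * (M powr (p - 1) * d)" if "t \<ge> 0" for t M d :: real
  proof -
    have "C powr p = C powr (p - 1) * C" using C(1) powr_add[of C "p - 1" 1] by simp
    moreover have "(1 + t) powr (- (e / \<mu>)) = ((1 + t) powr (- e')) powr (p - 1) * (1 + t) powr (- e')"
      unfolding powr_powr powr_add[symmetric] e'[symmetric]
      by (rule arg_cong[of _ _ "\<lambda>x. (1 + t) powr x"]) (simp add: algebra_simps)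
    ultimately show ?thesis by (simp add: powr_mult)
  qed
  \<comment> \<open>At least 1, so that the constant of the difference estimate also serves for the
    single power.\<close>
  define K where "K = 2 powr (1 / r) * p"
  have K: "K \<ge> 1" unfolding K_def using p r ge_one_powr_ge_zero[of 2 "1 / r"] mult_mono[of 1 "2 powr (1 / r)" 1 p] by simp
  show ?thesis
  proof (rule that[of "K * C powr p"])
    show "K * C powr p > 0" using K C by simp
  next
    fix t M d :: real and z z' assume t: "t \<ge> 0" and M: "M > 0" and d: "d > 0"
      and z: "norm (z :: (real^'n) l2) \<le> M" "norm (z' :: (real^'n) l2) \<le> M" "norm (z - z') \<le> d"
    define X where "X = C * (1 + t) powr (- e') * M"
    define Y where "Y = C * (1 + t) powr (- e') * d"
    have XY: "X > 0" "Y > 0" using C t M d by (auto simp: X_def Y_def)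
    have "Lm_bound (p * r) Y (rep_l2 (sol t (z - z')))"
      unfolding Y_def e'_def by (rule C(2)[OF t z(3) d])
    hence fg: "Lm_bound (p * r) Y (\<lambda>x. rep_l2 (sol t z) x - rep_l2 (sol t z') x)"
      unfolding sol_diff by (simp add: Lm_bound_cong_AE[OF rep_l2_diff])
    have "Lm_bound r (2 powr (1 / r) * p * X powr (p - 1) * Y) (\<lambda>x. abs_power p (rep_l2 (sol t z)) x - abs_power p (rep_l2 (sol t z')) x)"
      by (rule Lm_bound_abs_power_diff[OF _ _ p r(1) XY _ _ fg]) (use C(2)[OF t _ M] z in \<open>auto simp: X_def e'_def\<close>)
    also have "2 powr (1 / r) * p * X powr (p - 1) * Y = K * (X powr (p - 1) * Y)" by (simp add: K_def)
    also have "\<dots> = K * C powr p * (1 + t) powr (- (e / \<mu>)) * (M powr (p - 1) * d)"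
      unfolding X_def Y_def pw[OF t] by simp
    finally show "Lm_bound r (K * C powr p * (1 + t) powr (- (e / \<mu>)) * (M powr (p - 1) * d))
      (\<lambda>x. abs_power p (rep_l2 (sol t z)) x - abs_power p (rep_l2 (sol t z')) x)" .
  next
    fix t M :: real and z assume t: "t \<ge> 0" and M: "M > 0" and z: "norm (z :: (real^'n) l2) \<le> M"
    define X where "X = C * (1 + t) powr (- e') * M"
    have X: "X > 0" using C t M by (auto simp: X_def)
    have "Lm_bound r (X powr p) (abs_power p (rep_l2 (sol t z)))"
      by (rule Lm_bound_abs_power[OF _ X]) (use C(2)[OF t z M] in \<open>simp add: X_def e'_def\<close>)
    moreover have "X powr p = X powr (p - 1) * X" using X powr_add[of X "p - 1" 1] by simp
    hence eq: "X powr p = C powr p * (1 + t) powr (- (e / \<mu>)) * (M powr (p - 1) * M)"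
      unfolding X_def pw[OF t] .
    have "1 * X powr p \<le> K * X powr p" by (rule mult_right_mono[OF K powr_ge_zero])
    hence "X powr p \<le> K * C powr p * (1 + t) powr (- (e / \<mu>)) * (M powr (p - 1) * M)"
      unfolding mult_1 eq by (simp only: mult.assoc)
    moreover have "0 \<le> X powr p" by simp
    ultimately show "Lm_bound r (K * C powr p * (1 + t) powr (- (e / \<mu>)) * (M powr (p - 1) * M)) (abs_power p (rep_l2 (sol t z)))"
      using r by (meson Lm_bound_mono less_imp_le)
  qed
qed

lemma nl_in_Lp: "t \<ge> 0 \<Longrightarrow> abs_power p (rep_l2 (sol t z)) \<in> Lp_space 2"
proof -
  assume t: "t \<ge> 0"
  have r: "2 > (0::real)" "p * 2 > 2" "2 \<le> (2::real)" using p by auto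
  obtain C where C: "C > 0" "\<And>t z M. t \<ge> 0 \<Longrightarrow> M > 0 \<Longrightarrow> norm z \<le> M \<Longrightarrow>
    Lm_bound 2 (C * (1 + t) powr (- ((p * (n / 2 + \<kappa> - 2 * \<sigma>1) - n / 2) / \<mu>)) * (M powr (p - 1) * M)) (abs_power p (rep_l2 (sol t z)))"
  proof -
    show thesis by (rule nl_Lr[OF r that])
  qed
  show ?thesis
    by (rule Lm_bound_2(1)[OF _ C(2)[OF t, of "norm z + 1" z]]) (use C t in \<open>auto intro!: add_nonneg_pos\<close>)
qed

text \<open>The cases r = m and r = 2 of \<open>nl_Lr\<close>. They require p m > 2, which is p >
  2/m, and p > 1. Between the two, the L^2 norm decays faster by the exponent
  \<kappa>/\<mu>.\<close>

lemma nl_bounds: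
  obtains C where "C > 0"
    "\<And>t z z' M d. t \<ge> 0 \<Longrightarrow> M > 0 \<Longrightarrow> d > 0 \<Longrightarrow> norm z \<le> M \<Longrightarrow> norm z' \<le> M \<Longrightarrow> norm (z - z') \<le> d \<Longrightarrow>
      Lm_bound m (C * (1 + t) powr (- (\<delta> / \<mu>)) * (M powr (p - 1) * d)) (rep_l2 (nl t z - nl t z'))"
    "\<And>t z z' M d. t \<ge> 0 \<Longrightarrow> M > 0 \<Longrightarrow> d > 0 \<Longrightarrow> norm z \<le> M \<Longrightarrow> norm z' \<le> M \<Longrightarrow> norm (z - z') \<le> d \<Longrightarrow>
      norm (nl t z - nl t z') \<le> C * (1 + t) powr (- ((\<delta> + \<kappa>) / \<mu>)) * (M powr (p - 1) * d)"
proof -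
  have e1: "p * (n / 2 + \<kappa> - 2 * \<sigma>1) - n / m = \<delta>"
    using m by (simp add: \<kappa>_def \<delta>_def field_simps)
  have e2: "p * (n / 2 + \<kappa> - 2 * \<sigma>1) - n / 2 = \<delta> + \<kappa>"
    using m by (simp add: \<kappa>_def \<delta>_def field_simps)
  have pm: "m > 0" "p * m > 2" "m \<le> 2" using mp m by (simp_all add: field_simps)
  obtain C1 where C1: "C1 > 0" "\<And>t z z' M d. t \<ge> 0 \<Longrightarrow> M > 0 \<Longrightarrow> d > 0 \<Longrightarrow> norm z \<le> M \<Longrightarrow> norm z' \<le> M \<Longrightarrow> norm (z - z') \<le> d \<Longrightarrow>
    Lm_bound m (C1 * (1 + t) powr (- (\<delta> / \<mu>)) * (M powr (p - 1) * d))
      (\<lambda>x. abs_power p (rep_l2 (sol t z)) x - abs_power p (rep_l2 (sol t z')) x)"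
  proof -
    show thesis by (rule nl_Lr[OF pm, unfolded e1, OF that])
  qed
  obtain C2 where C2: "C2 > 0" "\<And>t z z' M d. t \<ge> 0 \<Longrightarrow> M > 0 \<Longrightarrow> d > 0 \<Longrightarrow> norm z \<le> M \<Longrightarrow> norm z' \<le> M \<Longrightarrow> norm (z - z') \<le> d \<Longrightarrow>
    Lm_bound 2 (C2 * (1 + t) powr (- ((\<delta> + \<kappa>) / \<mu>)) * (M powr (p - 1) * d))
      (\<lambda>x. abs_power p (rep_l2 (sol t z)) x - abs_power p (rep_l2 (sol t z')) x)"
  proof -
    have "2 > (0::real)" "p * 2 > 2" "2 \<le> (2::real)" using p by auto
    thus thesis by (rule nl_Lr[of 2, unfolded e2, OF _ _ _ that])
  qed
  have eq: "nl t z - nl t z' = abs_l2 (\<lambda>x. abs_power p (rep_l2 (sol t z)) x - abs_power p (rep_l2 (sol t z')) x)" if "t \<ge> 0" for t z z'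
    unfolding nl_def by (rule abs_l2_diff[symmetric]) (rule nl_in_Lp[OF that])+
  show ?thesis
  proof (rule that[of "C1 + C2"])
    fix t M d :: real and z z' assume t: "t \<ge> 0" and M: "M > 0" and d: "d > 0"
      and z: "norm (z :: (real^'n) l2) \<le> M" "norm (z' :: (real^'n) l2) \<le> M" "norm (z - z') \<le> d"
    have "Lm_bound m (C1 * (1 + t) powr (- (\<delta> / \<mu>)) * (M powr (p - 1) * d)) (rep_l2 (nl t z - nl t z'))"
      unfolding eq[OF t] using C1(2)[OF t M d z]
      by (subst Lm_bound_cong_AE[OF rep_abs_l2[OF Lp_space_2_diff[OF nl_in_Lp[OF t] nl_in_Lp[OF t]]]])
    thus "Lm_bound m ((C1 + C2) * (1 + t) powr (- (\<delta> / \<mu>)) * (M powr (p - 1) * d)) (rep_l2 (nl t z - nl t z'))"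
      by (rule Lm_bound_mono) (use C1 C2 d m in \<open>auto intro!: mult_right_mono\<close>)
    have "norm (nl t z - nl t z') \<le> C2 * (1 + t) powr (- ((\<delta> + \<kappa>) / \<mu>)) * (M powr (p - 1) * d)"
      unfolding eq[OF t] by (rule Lm_bound_2(2)[OF _ C2(2)[OF t M d z]]) (use C2 d in auto)
    also have "\<dots> \<le> (C1 + C2) * (1 + t) powr (- ((\<delta> + \<kappa>) / \<mu>)) * (M powr (p - 1) * d)"
      using C1 C2 d by (intro mult_right_mono) auto
    finally show "norm (nl t z - nl t z') \<le> (C1 + C2) * (1 + t) powr (- ((\<delta> + \<kappa>) / \<mu>)) * (M powr (p - 1) * d)" .
  qed (use C1 C2 in auto)
qed

lemma nl_0: "nl t 0 = 0"
proof -
  have "sol t 0 = 0" using sol_diff[of t 0 0] by simp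
  moreover have "abs_l2 (abs_power p (rep_l2 (0 :: (real^'n) l2))) = abs_l2 (\<lambda>x. 0)"
  proof (rule abs_l2_eqI[OF _ Lp_space_2_zero])
    show ae: "AE x in lborel. abs_power p (rep_l2 (0 :: (real^'n) l2)) x = 0"
      using rep_l2_zero by eventually_elim (simp add: abs_power_def)
    show "abs_power p (rep_l2 (0 :: (real^'n) l2)) \<in> Lp_space 2"
    proof -
      have "(\<integral>\<^sup>+x. ennreal ((cmod (abs_power p (rep_l2 (0 :: (real^'n) l2)) x))\<^sup>2) \<partial>lborel) = (\<integral>\<^sup>+x. 0 \<partial>(lborel :: (real^'n) measure))"
        by (rule nn_integral_cong_AE) (use ae in \<open>eventually_elim, simp\<close>)
      thus ?thesis by (simp add: Lp_space_2_iff_nn)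
    qed
  qed
  ultimately show ?thesis by (simp add: nl_def abs_l2_zero)
qed

end

section \<open>The Duhamel operator\<close>

lemma has_integral_powr_shift:
  fixes g t :: real
  assumes g: "g > 0" and t: "t \<ge> 0"
  shows "((\<lambda>\<tau>. (1 + \<tau>) powr (g - 1)) has_integral (((1 + t) powr g - 1) / g)) {0..t}"
proof -
  have "((\<lambda>\<tau>. (1 + \<tau>) powr (g - 1)) has_integral ((1 + t) powr g / g - (1 + 0) powr g / g)) {0..t}"
  proof (rule fundamental_theorem_of_calculus[OF t])
    fix \<tau> assume "\<tau> \<in> {0..t}"
    hence "((\<lambda>\<tau>. (1 + \<tau>) powr g / g) has_real_derivative (1 + \<tau>) powr (g - 1)) (at \<tau> within {0..t})"
      using g by (auto intro!: derivative_eq_intros)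
    thus "((\<lambda>\<tau>. (1 + \<tau>) powr g / g) has_vector_derivative (1 + \<tau>) powr (g - 1)) (at \<tau> within {0..t})"
      by (simp add: has_real_derivative_iff_has_vector_derivative)
  qed
  thus ?thesis by (simp add: diff_divide_distrib)
qed

lemma has_integral_powr_reflect:
  fixes x t :: real
  assumes x: "x < 1" and t: "t \<ge> 0"
  shows "((\<lambda>\<tau>. (1 + (t - \<tau>)) powr (- x)) has_integral (((1 + t) powr (1 - x) - 1) / (1 - x))) {0..t}"
proof -
  have "((\<lambda>\<tau>. (1 + (t - \<tau>)) powr (- x)) has_integral (- ((1 + (t - t)) powr (1 - x) / (1 - x)) - (- ((1 + (t - 0)) powr (1 - x) / (1 - x))))) {0..t}"
  proof (rule fundamental_theorem_of_calculus[OF t])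
    fix \<tau> assume "\<tau> \<in> {0..t}"
    hence \<tau>: "1 + (t - \<tau>) > 0" by simp
    have "((\<lambda>\<tau>. (1 + (t - \<tau>)) powr (1 - x)) has_real_derivative ((1 - x) * (1 + (t - \<tau>)) powr (1 - x - 1)) * (0 + (0 - 1))) (at \<tau> within {0..t})"
      by (rule DERIV_chain2[of "\<lambda>z. z powr (1 - x)"], rule has_real_derivative_powr[OF \<tau>])
        (intro DERIV_add DERIV_diff DERIV_const DERIV_ident)
    from DERIV_minus[OF DERIV_cdivide[OF this, of "1 - x"]]
    have "((\<lambda>\<tau>. - ((1 + (t - \<tau>)) powr (1 - x) / (1 - x))) has_real_derivative (1 + (t - \<tau>)) powr (- x)) (at \<tau> within {0..t})"
      using x by simp
    thus "((\<lambda>\<tau>. - ((1 + (t - \<tau>)) powr (1 - x) / (1 - x))) has_vector_derivative (1 + (t - \<tau>)) powr (- x)) (at \<tau> within {0..t})"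
      by (simp add: has_real_derivative_iff_has_vector_derivative)
  qed
  thus ?thesis by (simp add: diff_divide_distrib)
qed

context semilinear
begin

text \<open>Since \<rho> t >= 1, changing the weight from time t to time 0 is a contraction.
  Continuity of the nonlinear term in time thereby reduces to continuity of \<open>nl 0\<close> and
  strong continuity of symbols.\<close>

lemma sol_shift:
  assumes t: "t \<ge> 0"
  shows "sol t z = sol 0 (mul (\<lambda>\<xi>. of_real (W 0 \<xi> / W t \<xi>)) ((1 + t) powr (- a) *\<^sub>R z))"
    and "bounded_symbol (\<lambda>\<xi>. of_real (W 0 \<xi> / W t \<xi>)) 1"
proof -
  have \<rho>0: "\<rho> 0 = 1" by (simp add: \<rho>_def)
  have "W 0 \<xi> \<le> W t \<xi>" for \<xi> :: "real^'n"
  proof -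
    have "1 * norm \<xi> \<le> \<rho> t * norm \<xi>" by (rule mult_right_mono[OF \<rho>_ge_1[OF t]]) simp
    thus ?thesis using \<sigma>_pos by (auto simp: wt_def \<rho>0 intro!: powr_mono2)
  qed
  thus s: "bounded_symbol (\<lambda>\<xi>. of_real (W 0 \<xi> / W t \<xi>)) 1"
    by (auto simp: bounded_symbol_def norm_divide abs_of_pos)
  show "sol t z = sol 0 (mul (\<lambda>\<xi>. of_real (W 0 \<xi> / W t \<xi>)) ((1 + t) powr (- a) *\<^sub>R z))"
    by (simp add: sol_def mul_mul[OF bounded_symbol_inverse_wt s, simplified])
qed

lemma isCont_nl_0: "isCont (nl 0) z"
proof -
  obtain C where C: "C > 0"
    "\<And>t z z' M d. t \<ge> 0 \<Longrightarrow> M > 0 \<Longrightarrow> d > 0 \<Longrightarrow> norm z \<le> M \<Longrightarrow> norm z' \<le> M \<Longrightarrow> norm (z - z') \<le> d \<Longrightarrow>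
      Lm_bound m (C * (1 + t) powr (- (\<delta> / \<mu>)) * (M powr (p - 1) * d)) (rep_l2 (nl t z - nl t z'))"
    "\<And>t z z' M d. t \<ge> 0 \<Longrightarrow> M > 0 \<Longrightarrow> d > 0 \<Longrightarrow> norm z \<le> M \<Longrightarrow> norm z' \<le> M \<Longrightarrow> norm (z - z') \<le> d \<Longrightarrow>
      norm (nl t z - nl t z') \<le> C * (1 + t) powr (- ((\<delta> + \<kappa>) / \<mu>)) * (M powr (p - 1) * d)"
  proof -
    show thesis by (rule nl_bounds[OF that])
  qed
  define M where "M = norm z + 1"
  have M: "M > 0" by (simp add: M_def add_nonneg_pos)
  have "\<forall>\<^sub>F z' in at z. norm (z' - z) < 1"
    by (auto simp: eventually_at dist_norm intro!: exI[of _ 1])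
  hence "\<forall>\<^sub>F z' in at z. norm (nl 0 z' - nl 0 z) \<le> C * M powr (p - 1) * norm (z' - z)"
  proof eventually_elim
    case (elim z')
    show ?case
    proof (cases "z' = z")
      case False
      have "norm z' \<le> norm (z' - z) + norm z" using norm_triangle_ineq[of "z' - z" z] by simp
      hence "norm z' \<le> M" using elim by (simp add: M_def)
      thus ?thesis
        using C(3)[of 0 M "norm (z' - z)" z' z] M False by (simp add: M_def mult.assoc)
    qed simp
  qed
  moreover have "((\<lambda>z'. C * M powr (p - 1) * norm (z' - z)) \<longlongrightarrow> C * M powr (p - 1) * norm (z - z)) (at z)"
    by (intro tendsto_intros)
  ultimately have "((\<lambda>z'. nl 0 z' - nl 0 z) \<longlongrightarrow> 0) (at z)"
    by (intro Lim_null_comparison[of "\<lambda>z'. nl 0 z' - nl 0 z" "\<lambda>z'. C * M powr (p - 1) * norm (z' - z)"]) auto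
  thus ?thesis by (simp add: isCont_def LIM_zero_iff)
qed

lemma continuous_scaled:
  assumes "continuous_on {0..T} z"
  shows "continuous_on {0..T} (\<lambda>t. (1 + t) powr x *\<^sub>R (z t :: (real^'n) l2))"
proof -
  have "continuous_on {0..T} (\<lambda>t. (1 + t) powr x)"
    by (intro continuous_intros) auto
  thus ?thesis by (intro continuous_on_scaleR assms)
qed

lemma continuous_nl:
  assumes z: "continuous_on {0..T} z"
  shows "continuous_on {0..T} (\<lambda>t. nl t (z t))"
proof -
  have sub: "{0..T} \<subseteq> {0..}" by auto
  have arg: "continuous_on {0..T} (\<lambda>t. mul (\<lambda>\<xi>. of_real (W 0 \<xi> / W t \<xi>)) ((1 + t) powr (- a) *\<^sub>R z t))"
  proof (rule continuous_on_mul[where C = 1])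
    show "AE \<xi> in lborel. continuous_on {0..T} (\<lambda>t. complex_of_real (W 0 \<xi> / W t \<xi>))"
      by (intro AE_I2 continuous_on_of_real continuous_on_divide continuous_on_const
          continuous_on_subset[OF continuous_W sub]) auto
    show "bounded_symbol (\<lambda>\<xi>. complex_of_real (W 0 \<xi> / W t \<xi>)) 1" if "t \<in> {0..T}" for t
      by (rule sol_shift(2)) (use that in simp)
  qed (intro continuous_scaled z)
  have "continuous_on UNIV (nl 0)"
    by (simp add: continuous_on_eq_continuous_at isCont_nl_0)
  from continuous_on_compose2[OF this arg] have "continuous_on {0..T} (\<lambda>t. nl 0 (mul (\<lambda>\<xi>. of_real (W 0 \<xi> / W t \<xi>)) ((1 + t) powr (- a) *\<^sub>R z t)))"
    by simp
  thus ?thesis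
  proof (rule continuous_on_eq)
    fix t assume "t \<in> {0..T}"
    hence "t \<ge> 0" by simp
    from sol_shift(1)[OF this, of "z t"]
    show "nl 0 (mul (\<lambda>\<xi>. of_real (W 0 \<xi> / W t \<xi>)) ((1 + t) powr (- a) *\<^sub>R z t)) = nl t (z t)"
      by (simp only: nl_def)
  qed
qed

text \<open>Clamping the elapsed time at 0 extends the integrand by \<open>K1 0 = 0\<close> beyond
  \<tau> = t. It becomes continuous on the whole square, and the integral can run over the fixed
  interval up to T.\<close>

definition G :: "real \<Rightarrow> real \<Rightarrow> (real^'n) l2 \<Rightarrow> (real^'n) l2" where
  "G t \<tau> f = mul (\<lambda>\<xi>. of_real (W t \<xi>) * K1 (max 0 (t - \<tau>)) \<xi>) (fourier_l2 f)"

lemma G_symbol: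
  assumes "0 \<le> t"
  obtains E where "bounded_symbol (\<lambda>\<xi>. of_real (W t \<xi>) * K1 (max 0 (t - \<tau>)) \<xi>) E"
proof -
  obtain E where "\<And>s t'. s \<in> {0..max t (t - \<tau>)} \<Longrightarrow> t' \<in> {0..max t (t - \<tau>)} \<Longrightarrow> bounded_symbol (\<lambda>\<xi>. of_real (W t' \<xi>) * K1 s \<xi>) E"
  proof -
    show thesis by (rule W_K1_uniform_symbol[of "max t (t - \<tau>)", OF that])
  qed
  thus ?thesis using assms by (intro that[of E]) auto
qed

lemma G_diff: "0 \<le> t \<Longrightarrow> G t \<tau> (f - g) = G t \<tau> f - G t \<tau> g"
proof -
  assume "0 \<le> t"
  then obtain E where E: "bounded_symbol (\<lambda>\<xi>. of_real (W t \<xi>) * K1 (max 0 (t - \<tau>)) \<xi>) E"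
    by (rule G_symbol)
  show ?thesis by (simp only: G_def fop_diff[of "-1", simplified] mul_diff[OF E])
qed

lemma G_future: "t \<le> \<tau> \<Longrightarrow> G t \<tau> f = 0"
  by (simp add: G_def mul_def abs_l2_zero)

lemma continuous_G:
  assumes z: "continuous_on {0..T} z"
  shows "continuous_on ({0..T} \<times> {0..T}) (\<lambda>(t, \<tau>). G t \<tau> (nl \<tau> (z \<tau>)))"
proof -
  have sub: "{0..T} \<subseteq> {0..}" by auto
  obtain E where E: "\<And>s t. s \<in> {0..T} \<Longrightarrow> t \<in> {0..T} \<Longrightarrow> bounded_symbol (\<lambda>\<xi>. of_real (W t \<xi>) * K1 s \<xi>) E"
  proof -
    show thesis by (rule W_K1_uniform_symbol[of T, OF that])
  qed
  have "continuous_on ({0..T} \<times> {0..T}) (\<lambda>x. mul (\<lambda>\<xi>. of_real (W (fst x) \<xi>) * K1 (max 0 (fst x - snd x)) \<xi>) (fourier_l2 (nl (snd x) (z (snd x)))))"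
  proof (rule continuous_on_mul)
    show "bounded_symbol (\<lambda>\<xi>. of_real (W (fst x) \<xi>) * K1 (max 0 (fst x - snd x)) \<xi>) E" if "x \<in> {0..T} \<times> {0..T}" for x
      using that by (intro E) auto
    show "AE \<xi> in lborel. continuous_on ({0..T} \<times> {0..T}) (\<lambda>x. of_real (W (fst x) \<xi>) * K1 (max 0 (fst x - snd x)) \<xi>)"
    proof (intro AE_I2 continuous_on_mult continuous_on_of_real)
      fix \<xi> :: "real^'n"
      show "continuous_on ({0..T} \<times> {0..T}) (\<lambda>x. W (fst x) \<xi>)"
        by (rule continuous_on_compose2[OF continuous_W[of \<xi>] continuous_on_fst[OF continuous_on_id]]) auto
      show "continuous_on ({0..T} \<times> {0..T}) (\<lambda>x. K1 (max 0 (fst x - snd x)) \<xi>)"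
        by (rule continuous_on_compose2[OF continuous_K1[of UNIV \<xi>]]) (auto intro!: continuous_intros)
    qed
    have "continuous_on ({0..T} \<times> {0..T}) (\<lambda>x. nl (snd x) (z (snd x)))"
      by (rule continuous_on_compose2[OF continuous_nl[OF z] continuous_on_snd[OF continuous_on_id]]) auto
    thus "continuous_on ({0..T} \<times> {0..T}) (\<lambda>x. fourier_l2 (nl (snd x) (z (snd x))))"
      by (rule bounded_linear.continuous_on[OF bounded_linear_fop, rotated]) simp
  qed
  thus ?thesis by (simp add: G_def case_prod_unfold)
qed

lemma continuous_G_snd:
  assumes "continuous_on {0..T} z" "t \<in> {0..T}"
  shows "continuous_on {0..T} (\<lambda>\<tau>. G t \<tau> (nl \<tau> (z \<tau>)))"
proof -
  have "continuous_on {0..T} (Pair t)" by (intro continuous_on_Pair continuous_on_const continuous_on_id)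
  from continuous_on_compose2[OF continuous_G[OF assms(1)] this] show ?thesis
    using assms(2) by (auto simp: image_subset_iff)
qed

lemma integral_G_restrict:
  assumes "continuous_on {0..T} z" "t \<in> {0..T}"
  shows "integral {0..T} (\<lambda>\<tau>. G t \<tau> (nl \<tau> (z \<tau>))) = integral {0..t} (\<lambda>\<tau>. G t \<tau> (nl \<tau> (z \<tau>)))"
proof -
  have "integral {0..t} (\<lambda>\<tau>. G t \<tau> (nl \<tau> (z \<tau>))) + integral {t..T} (\<lambda>\<tau>. G t \<tau> (nl \<tau> (z \<tau>)))
      = integral {0..T} (\<lambda>\<tau>. G t \<tau> (nl \<tau> (z \<tau>)))"
    by (rule Henstock_Kurzweil_Integration.integral_combine) (use assms(2) integrable_continuous_real[OF continuous_G_snd[OF assms]] in auto)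
  moreover have "integral {t..T} (\<lambda>\<tau>. G t \<tau> (nl \<tau> (z \<tau>))) = integral {t..T} (\<lambda>\<tau>. 0)"
    by (rule integral_cong) (simp add: G_future)
  ultimately show ?thesis by simp
qed

text \<open>The first term serves forcing from before t / 2, the other two serve recent forcing, for
  which 1 + \<tau> is comparable to 1 + t. The exponents are such that each term integrates to order
  (1 + t)^\<gamma>.\<close>

definition bound :: "real \<Rightarrow> real \<Rightarrow> real" where
  "bound t \<tau> = (1 + \<tau>) powr (\<gamma> - 1) + (1 + t) powr (a + \<gamma> - 1) * (1 + (t - \<tau>)) powr (- a)
    + (1 + t) powr (\<theta> + \<gamma> - 1) * (1 + (t - \<tau>)) powr (- \<theta>)"

lemma bound_integral:
  assumes t: "t \<ge> 0"
  shows "bound t integrable_on {0..t}" "integral {0..t} (bound t) \<le> (1 / \<gamma> + 1 / (1 - a) + 1 / (1 - \<theta>)) * (1 + t) powr \<gamma>"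
proof -
  define I where "I = ((1 + t) powr \<gamma> - 1) / \<gamma> + (1 + t) powr (a + \<gamma> - 1) * (((1 + t) powr (1 - a) - 1) / (1 - a))
     + (1 + t) powr (\<theta> + \<gamma> - 1) * (((1 + t) powr (1 - \<theta>) - 1) / (1 - \<theta>))"
  have "(bound t has_integral I) {0..t}"
    unfolding bound_def[abs_def] I_def
    by (intro has_integral_add has_integral_mult_right has_integral_powr_shift has_integral_powr_reflect
        \<gamma>_pos a_less_1 \<theta>_less_1 t)
  thus "bound t integrable_on {0..t}" by (rule has_integral_integrable)
  have "integral {0..t} (bound t) = I" by (rule integral_unique) fact
  also have "I \<le> (1 + t) powr \<gamma> / \<gamma> + (1 + t) powr (a + \<gamma> - 1) * ((1 + t) powr (1 - a) / (1 - a))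
     + (1 + t) powr (\<theta> + \<gamma> - 1) * ((1 + t) powr (1 - \<theta>) / (1 - \<theta>))"
    unfolding I_def using \<gamma>_pos a_less_1 \<theta>_less_1
    by (intro add_mono mult_left_mono divide_right_mono) auto
  also have "\<dots> = (1 / \<gamma> + 1 / (1 - a) + 1 / (1 - \<theta>)) * (1 + t) powr \<gamma>"
  proof -
    have "(1 + t) powr (x + \<gamma> - 1) * ((1 + t) powr (1 - x) / (1 - x)) = 1 / (1 - x) * (1 + t) powr \<gamma>" for x
      unfolding times_divide_eq_right powr_add[symmetric] by simp
    from this[of a] this[of \<theta>] show ?thesis by (simp only: distrib_right) simp
  qed
  finally show "integral {0..t} (bound t) \<le> (1 / \<gamma> + 1 / (1 - a) + 1 / (1 - \<theta>)) * (1 + t) powr \<gamma>" .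
qed

text \<open>The absolute value of the exponent lets the estimate be applied without knowing whether
  the exponent is positive.\<close>

lemma powr_half_bound:
  fixes t \<tau> x :: real
  assumes "0 \<le> \<tau>" "\<tau> \<le> t" "t \<le> 2 * \<tau>"
  shows "(1 + \<tau>) powr x \<le> 2 powr \<bar>x\<bar> * (1 + t) powr x"
proof (cases "x \<ge> 0")
  case True
  have "1 * (1 + \<tau>) powr x \<le> 2 powr \<bar>x\<bar> * (1 + t) powr x"
    using True assms by (intro mult_mono powr_mono2 ge_one_powr_ge_zero) auto
  thus ?thesis by simp
next
  case False
  have "(1 + \<tau>) powr x \<le> ((1 + t) / 2) powr x"
    using False assms by (intro powr_mono2') auto
  also have "\<dots> = 2 powr \<bar>x\<bar> * (1 + t) powr x"
    using False by (simp add: powr_divide powr_minus_divide)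
  finally show ?thesis .
qed

text \<open>Combines the two kernel estimates with the sizes of the forcing in L^m and L^2, the cut
  being at \<tau> = t / 2. The factor (1 + t)^a is the one in the definition of the weighted
  unknown.\<close>

lemma G_bound:
  obtains C where "C > 0"
    "\<And>t \<tau> z z' M d. 0 \<le> \<tau> \<Longrightarrow> \<tau> \<le> t \<Longrightarrow> M > 0 \<Longrightarrow> d > 0 \<Longrightarrow> norm z \<le> M \<Longrightarrow> norm z' \<le> M \<Longrightarrow> norm (z - z') \<le> d \<Longrightarrow>
      (1 + t) powr a * norm (G t \<tau> (nl \<tau> z - nl \<tau> z')) \<le> C * (M powr (p - 1) * d) * bound t \<tau>"
proof -
  obtain K where K: "K > 0"
    "\<And>t z z' M d. t \<ge> 0 \<Longrightarrow> M > 0 \<Longrightarrow> d > 0 \<Longrightarrow> norm z \<le> M \<Longrightarrow> norm z' \<le> M \<Longrightarrow> norm (z - z') \<le> d \<Longrightarrow>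
      Lm_bound m (K * (1 + t) powr (- (\<delta> / \<mu>)) * (M powr (p - 1) * d)) (rep_l2 (nl t z - nl t z'))"
    "\<And>t z z' M d. t \<ge> 0 \<Longrightarrow> M > 0 \<Longrightarrow> d > 0 \<Longrightarrow> norm z \<le> M \<Longrightarrow> norm z' \<le> M \<Longrightarrow> norm (z - z') \<le> d \<Longrightarrow>
      norm (nl t z - nl t z') \<le> K * (1 + t) powr (- ((\<delta> + \<kappa>) / \<mu>)) * (M powr (p - 1) * d)"
  proof -
    show thesis by (rule nl_bounds[OF that])
  qed
  obtain C where C: "C > 0"
    "\<And>s t B (f :: (real^'n) l2). 0 \<le> s \<Longrightarrow> s \<le> t \<Longrightarrow> t \<le> 2 * s \<Longrightarrow> B > 0 \<Longrightarrow> Lm_bound m B (rep_l2 f) \<Longrightarrow>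
      norm (mul (\<lambda>\<xi>. of_real (W t \<xi>) * K1 s \<xi>) (fourier_l2 f)) \<le> C * (1 + t) powr (- a) * (B + norm f)"
    "\<And>s t B (f :: (real^'n) l2). 0 \<le> s \<Longrightarrow> s \<le> t \<Longrightarrow> B > 0 \<Longrightarrow> Lm_bound m B (rep_l2 f) \<Longrightarrow>
      norm (mul (\<lambda>\<xi>. of_real (W t \<xi>) * K1 s \<xi>) (fourier_l2 f))
        \<le> C * ((1 + s) powr (- a) * (B + norm f) + (1 + t) powr (\<sigma> / \<mu>) * (1 + s) powr (- \<theta>) * norm f)"
  proof -
    show thesis by (rule duhamel_kernel_bounds[OF that])
  qed
  define x where "x = \<gamma> - 1 - \<kappa> / \<mu>"
  define C' where "C' = 2 * C * K * (1 + 2 powr \<bar>\<gamma> - 1\<bar> + 2 powr \<bar>x\<bar>)"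
  have e1: "- (\<delta> / \<mu>) = \<gamma> - 1" and e2: "- ((\<delta> + \<kappa>) / \<mu>) = x"
    by (simp_all add: \<gamma>_def x_def add_divide_distrib)
  show ?thesis
  proof (rule that[of C'])
    show "C' > 0" using C K by (simp add: C'_def add_pos_pos)
    fix t \<tau> M d :: real and z z' :: "(real^'n) l2"
    assume \<tau>: "0 \<le> \<tau>" "\<tau> \<le> t" and M: "M > 0" and d: "d > 0" and z: "norm z \<le> M" "norm z' \<le> M" "norm (z - z') \<le> d"
    define Q where "Q = M powr (p - 1) * d"
    have Q: "Q > 0" using M d by (simp add: Q_def)
    define f where "f = nl \<tau> z - nl \<tau> z'"
    define s where "s = t - \<tau>"
    have s: "0 \<le> s" "s \<le> t" and t: "0 \<le> t" using \<tau> by (auto simp: s_def)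
    define B where "B = K * (1 + \<tau>) powr (\<gamma> - 1) * Q"
    have B: "B > 0" using K Q \<tau> by (simp add: B_def)
    have Lm: "Lm_bound m B (rep_l2 f)"
      using K(2)[OF \<tau>(1) M d z] unfolding e1 by (simp add: B_def f_def Q_def)
    have f: "norm f \<le> K * (1 + \<tau>) powr x * Q"
      using K(3)[OF \<tau>(1) M d z] unfolding e2 by (simp add: f_def Q_def)
    \<comment> \<open>The L^2 size of the forcing is no larger than its L^m size, so wherever both
      occur they are merged into B.\<close>
    have "(1 + \<tau>) powr x \<le> (1 + \<tau>) powr (\<gamma> - 1)"
      using \<tau> \<kappa>_nonneg \<mu>_pos by (intro powr_mono) (auto simp: x_def)
    hence "K * (1 + \<tau>) powr x * Q \<le> B"
      unfolding B_def using K Q by (intro mult_right_mono mult_left_mono) auto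
    hence fB: "B + norm f \<le> 2 * B" using f by simp
    have G: "G t \<tau> f = mul (\<lambda>\<xi>. of_real (W t \<xi>) * K1 s \<xi>) (fourier_l2 f)"
      using s by (simp add: G_def s_def)
    have pa: "(1 + t) powr a * (1 + t) powr (- a) = 1"
      unfolding powr_add[symmetric] using t by simp
    have "(1 + t) powr a * norm (G t \<tau> f) \<le> C' * Q * bound t \<tau>"
    \<comment> \<open>The true case is \<tau> <= t / 2: the kernel decays like (1 + t)^(-a), which
      cancels the weight and leaves the forcing alone.\<close>
    proof (cases "t \<le> 2 * s")
      case True
      have "(1 + t) powr a * norm (G t \<tau> f) \<le> (1 + t) powr a * (C * (1 + t) powr (- a) * (2 * B))"
        unfolding G using C fB by (intro mult_left_mono order_trans[OF C(2)[OF s True B Lm]]) auto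
      also have "\<dots> = ((1 + t) powr a * (1 + t) powr (- a)) * (C * (2 * B))" by simp
      also have "\<dots> = (2 * C * K * 1) * Q * (1 + \<tau>) powr (\<gamma> - 1)" unfolding pa by (simp add: B_def)
      also have "\<dots> \<le> C' * Q * bound t \<tau>"
        unfolding C'_def bound_def using C K Q by (intro mult_mono mult_left_mono) auto
      finally show ?thesis .
    next
      case False
      hence t\<tau>: "t \<le> 2 * \<tau>" by (simp add: s_def)
      define c1 where "c1 = 2 * C * K * 2 powr \<bar>\<gamma> - 1\<bar>"
      define c2 where "c2 = C * K * 2 powr \<bar>x\<bar>"
      have c: "0 \<le> c1" "c1 \<le> C'" "0 \<le> c2" "c2 \<le> C'"
        using C K by (auto simp: c1_def c2_def C'_def intro!: mult_mono)
      have B2: "B \<le> K * (2 powr \<bar>\<gamma> - 1\<bar> * (1 + t) powr (\<gamma> - 1)) * Q"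
        unfolding B_def using K Q by (intro mult_right_mono mult_left_mono powr_half_bound \<tau> t\<tau>) auto
      have f2: "norm f \<le> K * (2 powr \<bar>x\<bar> * (1 + t) powr x) * Q"
        using K Q by (intro order_trans[OF f] mult_right_mono mult_left_mono powr_half_bound \<tau> t\<tau>) auto
      have "(1 + t) powr a * norm (G t \<tau> f) \<le> (1 + t) powr a * (C * ((1 + s) powr (- a) * (2 * (K * (2 powr \<bar>\<gamma> - 1\<bar> * (1 + t) powr (\<gamma> - 1)) * Q))
          + (1 + t) powr (\<sigma> / \<mu>) * (1 + s) powr (- \<theta>) * (K * (2 powr \<bar>x\<bar> * (1 + t) powr x) * Q)))"
        unfolding G using C fB B2 f2
        by (intro mult_left_mono order_trans[OF C(3)[OF s B Lm]] add_mono) auto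
      also have "\<dots> = c1 * Q * (((1 + t) powr a * (1 + t) powr (\<gamma> - 1)) * (1 + s) powr (- a))
          + c2 * Q * (((1 + t) powr a * (1 + t) powr (\<sigma> / \<mu>) * (1 + t) powr x) * (1 + s) powr (- \<theta>))"
        by (simp add: c1_def c2_def algebra_simps)
      also have "(1 + t) powr a * (1 + t) powr (\<gamma> - 1) = (1 + t) powr (a + \<gamma> - 1)"
        by (simp add: powr_add[symmetric] add_diff_eq)
      also have "(1 + t) powr a * (1 + t) powr (\<sigma> / \<mu>) * (1 + t) powr x = (1 + t) powr (\<theta> + \<gamma> - 1)"
      proof -
        \<comment> \<open>The extra L^2 decay \<kappa>/\<mu> of the forcing offsets the \<kappa>
          contained in a; what remains of a + \<sigma>/\<mu> is \<theta>.\<close>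
        have "a + \<sigma> / \<mu> + x = \<theta> + \<gamma> - 1"
          by (simp add: a_def \<theta>_def x_def diff_divide_distrib)
        thus ?thesis by (simp add: powr_add[symmetric])
      qed
      also have "c1 * Q * ((1 + t) powr (a + \<gamma> - 1) * (1 + s) powr (- a)) + c2 * Q * ((1 + t) powr (\<theta> + \<gamma> - 1) * (1 + s) powr (- \<theta>))
        \<le> C' * Q * ((1 + t) powr (a + \<gamma> - 1) * (1 + s) powr (- a)) + C' * Q * ((1 + t) powr (\<theta> + \<gamma> - 1) * (1 + s) powr (- \<theta>))"
        using Q c by (intro add_mono mult_right_mono) auto
      also have "\<dots> \<le> C' * Q * bound t \<tau>"
        using Q c by (simp add: bound_def s_def distrib_left)
      finally show ?thesis .
    qed
    thus "(1 + t) powr a * norm (G t \<tau> (nl \<tau> z - nl \<tau> z')) \<le> C' * (M powr (p - 1) * d) * bound t \<tau>"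
      by (simp add: f_def Q_def)
  qed
qed

section \<open>Contraction and fixed point\<close>

definition duh :: "real \<Rightarrow> (real \<Rightarrow> (real^'n) l2) \<Rightarrow> real \<Rightarrow> (real^'n) l2" where
  "duh T z t = (1 + t) powr a *\<^sub>R integral {0..T} (\<lambda>\<tau>. G t \<tau> (nl \<tau> (z \<tau>)))"

lemma continuous_duh: "continuous_on {0..T} z \<Longrightarrow> continuous_on {0..T} (duh T z)"
  unfolding duh_def
  by (rule continuous_scaled, rule integral_continuous_on_param[of "{0..T}" 0 T, simplified]) (rule continuous_G)

lemma duh_0: "t \<ge> 0 \<Longrightarrow> duh T (\<lambda>_. 0) t = 0"
  using G_diff[of t _ 0 0] by (simp add: duh_def nl_0)

text \<open>The bound of \<open>G_bound\<close> is integrated over {0..t}. The constant is chosen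
  before T, so T enters only through (1 + T)^\<gamma>.\<close>

lemma duh_contraction:
  obtains C where "C > 0"
    "\<And>T t z z' M d. continuous_on {0..T} z \<Longrightarrow> continuous_on {0..T} z' \<Longrightarrow> M > 0 \<Longrightarrow> d > 0 \<Longrightarrow> t \<in> {0..T} \<Longrightarrow>
      (\<forall>\<tau>\<in>{0..T}. norm (z \<tau>) \<le> M \<and> norm (z' \<tau>) \<le> M \<and> norm (z \<tau> - z' \<tau>) \<le> d) \<Longrightarrow>
      norm (duh T z t - duh T z' t) \<le> C * (1 + T) powr \<gamma> * M powr (p - 1) * d"
proof -
  obtain C where C: "C > 0"
    "\<And>t \<tau> z z' M d. 0 \<le> \<tau> \<Longrightarrow> \<tau> \<le> t \<Longrightarrow> M > 0 \<Longrightarrow> d > 0 \<Longrightarrow> norm z \<le> M \<Longrightarrow> norm z' \<le> M \<Longrightarrow> norm (z - z') \<le> d \<Longrightarrow>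
      (1 + t) powr a * norm (G t \<tau> (nl \<tau> z - nl \<tau> z')) \<le> C * (M powr (p - 1) * d) * bound t \<tau>"
  proof -
    show thesis by (rule G_bound[OF that])
  qed
  define k where "k = 1 / \<gamma> + 1 / (1 - a) + 1 / (1 - \<theta>)"
  have k: "k > 0" using \<gamma>_pos a_less_1 \<theta>_less_1 by (simp add: k_def add_pos_pos)
  show ?thesis
  proof (rule that[of "C * k"])
    show "C * k > 0" using C k by simp
    fix T t M d :: real and z z' :: "real \<Rightarrow> (real^'n) l2"
    assume z: "continuous_on {0..T} z" and z': "continuous_on {0..T} z'" and M: "M > 0" and d: "d > 0" and t: "t \<in> {0..T}"
      and b: "\<forall>\<tau>\<in>{0..T}. norm (z \<tau>) \<le> M \<and> norm (z' \<tau>) \<le> M \<and> norm (z \<tau> - z' \<tau>) \<le> d"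
    have t0: "t \<ge> 0" using t by simp
    define Q where "Q = M powr (p - 1) * d"
    have Q: "Q > 0" using M d by (simp add: Q_def)
    have sub: "{0..t} \<subseteq> {0..T}" using t by auto
    have int: "(\<lambda>\<tau>. G t \<tau> (nl \<tau> (y \<tau>))) integrable_on {0..t}" if "continuous_on {0..T} y" for y
      using that t sub by (intro integrable_continuous_real continuous_on_subset[OF continuous_G_snd])
    have "duh T z t - duh T z' t = (1 + t) powr a *\<^sub>R (integral {0..t} (\<lambda>\<tau>. G t \<tau> (nl \<tau> (z \<tau>))) - integral {0..t} (\<lambda>\<tau>. G t \<tau> (nl \<tau> (z' \<tau>))))"
      by (simp add: duh_def integral_G_restrict[OF z t] integral_G_restrict[OF z' t] scaleR_diff_right)
    also have "integral {0..t} (\<lambda>\<tau>. G t \<tau> (nl \<tau> (z \<tau>))) - integral {0..t} (\<lambda>\<tau>. G t \<tau> (nl \<tau> (z' \<tau>)))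
        = integral {0..t} (\<lambda>\<tau>. G t \<tau> (nl \<tau> (z \<tau>)) - G t \<tau> (nl \<tau> (z' \<tau>)))"
      by (rule integral_diff[symmetric]) (rule int z z')+
    also have "(1 + t) powr a *\<^sub>R \<dots> = integral {0..t} (\<lambda>\<tau>. (1 + t) powr a *\<^sub>R (G t \<tau> (nl \<tau> (z \<tau>)) - G t \<tau> (nl \<tau> (z' \<tau>))))"
      by simp
    finally have eq: "duh T z t - duh T z' t = integral {0..t} (\<lambda>\<tau>. (1 + t) powr a *\<^sub>R (G t \<tau> (nl \<tau> (z \<tau>)) - G t \<tau> (nl \<tau> (z' \<tau>))))" .
    have "norm (duh T z t - duh T z' t) \<le> integral {0..t} (\<lambda>\<tau>. C * Q * bound t \<tau>)"
      unfolding eq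
    proof (rule integral_norm_bound_integral)
      show "(\<lambda>\<tau>. (1 + t) powr a *\<^sub>R (G t \<tau> (nl \<tau> (z \<tau>)) - G t \<tau> (nl \<tau> (z' \<tau>)))) integrable_on {0..t}"
        by (intro integrable_cmul integrable_diff int z z')
      show "(\<lambda>\<tau>. C * Q * bound t \<tau>) integrable_on {0..t}"
        using integrable_cmul[OF bound_integral(1)[OF t0], of "C * Q"] by simp
      fix \<tau> assume \<tau>: "\<tau> \<in> {0..t}"
      have "norm (z \<tau>) \<le> M" "norm (z' \<tau>) \<le> M" "norm (z \<tau> - z' \<tau>) \<le> d" using b sub \<tau> by auto
      thus "norm ((1 + t) powr a *\<^sub>R (G t \<tau> (nl \<tau> (z \<tau>)) - G t \<tau> (nl \<tau> (z' \<tau>)))) \<le> C * Q * bound t \<tau>"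
        using C(2)[of \<tau> t M d "z \<tau>" "z' \<tau>"] \<tau> M d by (simp add: G_diff[OF t0, symmetric] Q_def)
    qed
    also have "\<dots> = C * Q * integral {0..t} (bound t)" by simp
    also have "\<dots> \<le> C * Q * (k * (1 + t) powr \<gamma>)"
      unfolding k_def using C Q by (intro mult_left_mono bound_integral t0) auto
    also have "\<dots> \<le> C * Q * (k * (1 + T) powr \<gamma>)"
      using C Q k t \<gamma>_pos by (intro mult_left_mono powr_mono2) auto
    finally show "norm (duh T z t - duh T z' t) \<le> C * k * (1 + T) powr \<gamma> * M powr (p - 1) * d"
      by (simp add: Q_def mult_ac)
  qed
qed

text \<open>Banach's theorem on a closed ball. Functions on {0..T} are modelled by bounded
  continuous functions on the line, a complete metric space, with time clamped to the
  interval.\<close>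

lemma fixed_point:
  obtains C L where "C > 0" "L > 0"
    "\<And>\<epsilon> T. \<epsilon> > 0 \<Longrightarrow> T \<ge> 0 \<Longrightarrow> C * (1 + T) powr \<gamma> * (2 * L * \<epsilon>) powr (p - 1) \<le> 1 / 2 \<Longrightarrow>
      \<exists>z. continuous_on {0..T} z \<and> (\<forall>t\<in>{0..T}. z t = \<epsilon> *\<^sub>R ((1 + t) powr a *\<^sub>R lin t) + duh T z t)"
proof -
  obtain C where C: "C > 0"
    "\<And>T t z z' M d. continuous_on {0..T} z \<Longrightarrow> continuous_on {0..T} z' \<Longrightarrow> M > 0 \<Longrightarrow> d > 0 \<Longrightarrow> t \<in> {0..T} \<Longrightarrow>
      (\<forall>\<tau>\<in>{0..T}. norm (z \<tau>) \<le> M \<and> norm (z' \<tau>) \<le> M \<and> norm (z \<tau> - z' \<tau>) \<le> d) \<Longrightarrow>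
      norm (duh T z t - duh T z' t) \<le> C * (1 + T) powr \<gamma> * M powr (p - 1) * d"
  proof -
    show thesis by (rule duh_contraction[OF that])
  qed
  obtain L where L: "L > 0" "\<And>t. t \<ge> 0 \<Longrightarrow> norm (lin t) \<le> L * (1 + t) powr (- a)"
  proof -
    show thesis by (rule lin_bound[OF that])
  qed
  show ?thesis
  proof (rule that[OF C(1) L(1)])
    fix \<epsilon> T :: real assume \<epsilon>: "\<epsilon> > 0" and T: "T \<ge> 0" and small: "C * (1 + T) powr \<gamma> * (2 * L * \<epsilon>) powr (p - 1) \<le> 1 / 2"
    \<comment> \<open>Twice the size of the linear part, so that the integral term may use the other
      half.\<close>
    define M where "M = 2 * L * \<epsilon>"
    have M: "M > 0" using L \<epsilon> by (simp add: M_def)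
    \<comment> \<open>The continuous retraction of the line onto {0..T}; composing with it extends
      the image of a function beyond the interval without increasing its norm.\<close>
    define c where "c t = max 0 (min T t)" for t :: real
    have cT: "c t \<in> {0..T}" for t using T by (auto simp: c_def)
    have ct: "c t = t" if "t \<in> {0..T}" for t using that by (auto simp: c_def)
    have cc: "continuous_on UNIV c" unfolding c_def by (intro continuous_intros)
    define P where "P z t = \<epsilon> *\<^sub>R ((1 + t) powr a *\<^sub>R lin t) + duh T z t" for z t
    have contP: "continuous_on {0..T} (P z)" if "continuous_on {0..T} z" for z
      unfolding P_def by (intro continuous_intros continuous_scaled continuous_lin continuous_duh that)
    have lin: "norm (\<epsilon> *\<^sub>R ((1 + t) powr a *\<^sub>R lin t)) \<le> M / 2" if "t \<in> {0..T}" for t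
    proof -
      have t: "t \<ge> 0" using that by simp
      have "norm (\<epsilon> *\<^sub>R ((1 + t) powr a *\<^sub>R lin t)) \<le> \<epsilon> * ((1 + t) powr a * (L * (1 + t) powr (- a)))"
        using \<epsilon> L(2)[OF t] by (simp add: mult_left_mono)
      also have "(1 + t) powr a * (L * (1 + t) powr (- a)) = L"
      proof -
        have "(1 + t) powr a * (1 + t) powr (- a) = 1" unfolding powr_add[symmetric] using t by simp
        thus ?thesis by (metis mult.left_commute mult.right_neutral)
      qed
      finally show ?thesis by (simp add: M_def mult.commute)
    qed
    have contr: "norm (duh T z t - duh T z' t) \<le> d / 2"
      if "continuous_on {0..T} z" "continuous_on {0..T} z'" "d > 0" "t \<in> {0..T}"
        "\<forall>\<tau>\<in>{0..T}. norm (z \<tau>) \<le> M \<and> norm (z' \<tau>) \<le> M \<and> norm (z \<tau> - z' \<tau>) \<le> d" for z z' d t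
    proof -
      have "norm (duh T z t - duh T z' t) \<le> C * (1 + T) powr \<gamma> * M powr (p - 1) * d"
        by (rule C(2)[OF that(1,2) M that(3,4,5)])
      also have "\<dots> \<le> 1 / 2 * d"
        using small that(3) unfolding M_def by (intro mult_right_mono) auto
      finally show ?thesis by simp
    qed
    have normP: "norm (P z t) \<le> M" if "continuous_on {0..T} z" "t \<in> {0..T}" "\<forall>\<tau>\<in>{0..T}. norm (z \<tau>) \<le> M" for z t
    proof -
      \<comment> \<open>Invariance of the ball is the contraction estimate against the zero
        function, with d = M, as the integral term vanishes there.\<close>
      have "norm (duh T z t - duh T (\<lambda>_. 0) t) \<le> M / 2"
        using that M by (intro contr) auto
      hence "norm (duh T z t) \<le> M / 2" using that(2) by (simp add: duh_0)
      thus ?thesis unfolding P_def using lin[OF that(2)] norm_triangle_ineq[of "\<epsilon> *\<^sub>R ((1 + t) powr a *\<^sub>R lin t)" "duh T z t"] by linarith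
    qed
    define S where "S = cball (0 :: real \<Rightarrow>\<^sub>C (real^'n) l2) M"
    define \<Phi> where "\<Phi> z = Bcontfun (\<lambda>t. P (apply_bcontfun z) (c t))" for z :: "real \<Rightarrow>\<^sub>C (real^'n) l2"
    have S: "norm (apply_bcontfun z t) \<le> M" if "z \<in> S" for z t
      using that norm_bounded[of z t] by (simp add: S_def)
    have app: "apply_bcontfun (\<Phi> z) = (\<lambda>t. P (apply_bcontfun z) (c t))" if "z \<in> S" for z
    proof -
      have "(\<lambda>t. P (apply_bcontfun z) (c t)) \<in> bcontfun"
      proof (rule bcontfun_normI)
        show "continuous_on UNIV (\<lambda>t. P (apply_bcontfun z) (c t))"
          by (rule continuous_on_compose2[OF contP cc]) (use cT in auto)
        show "norm (P (apply_bcontfun z) (c t)) \<le> M" for t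
          using S[OF that] by (intro normP cT) auto
      qed
      thus ?thesis by (simp add: \<Phi>_def Bcontfun_inverse)
    qed
    have "\<exists>!z. z \<in> S \<and> \<Phi> z = z"
    proof (rule Banach_fix[OF complete_eq_closed[THEN iffD2], where c = "1/2"])
      show "closed S" unfolding S_def by simp
      show "S \<noteq> {}" using M by (auto simp: S_def)
      show "\<Phi> ` S \<subseteq> S"
      proof (rule image_subsetI)
        fix z assume z: "z \<in> S"
        have "norm (\<Phi> z) \<le> M"
          by (rule norm_bound) (use S[OF z] in \<open>auto simp: app[OF z] intro!: normP cT\<close>)
        thus "\<Phi> z \<in> S" by (simp add: S_def)
      qed
      fix z z' assume z: "z \<in> S" "z' \<in> S"
      show "dist (\<Phi> z) (\<Phi> z') \<le> 1 / 2 * dist z z'"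
      proof (cases "z = z'")
        case False
        show ?thesis
        proof (rule dist_bound)
          fix t
          have "norm (apply_bcontfun z \<tau> - apply_bcontfun z' \<tau>) \<le> dist z z'" for \<tau>
            using dist_bounded[of z \<tau> z'] by (simp add: dist_norm)
          hence "norm (duh T (apply_bcontfun z) (c t) - duh T (apply_bcontfun z') (c t)) \<le> dist z z' / 2"
            using S[OF z(1)] S[OF z(2)] False by (intro contr cT) auto
          thus "dist (apply_bcontfun (\<Phi> z) t) (apply_bcontfun (\<Phi> z') t) \<le> 1 / 2 * dist z z'"
            by (simp add: app z P_def dist_norm)
        qed
      qed simp
    qed simp_all
    then obtain z where z: "z \<in> S" "\<Phi> z = z" by blast
    show "\<exists>z. continuous_on {0..T} z \<and> (\<forall>t\<in>{0..T}. z t = \<epsilon> *\<^sub>R ((1 + t) powr a *\<^sub>R lin t) + duh T z t)"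
    proof (intro exI conjI ballI)
      show "continuous_on {0..T} (apply_bcontfun z)" by simp
      fix t assume t: "t \<in> {0..T}"
      have "apply_bcontfun z t = apply_bcontfun (\<Phi> z) t" by (simp add: z)
      also have "\<dots> = P (apply_bcontfun z) t" by (simp add: app z(1) ct[OF t])
      finally show "apply_bcontfun z t = \<epsilon> *\<^sub>R ((1 + t) powr a *\<^sub>R lin t) + duh T (apply_bcontfun z) t"
        by (simp add: P_def)
    qed
  qed
qed

end

section \<open>From \<open>L\<^sup>2\<close> classes back to functions\<close>

lemma Lp_space_2_cong_AE:
  assumes "f \<in> borel_measurable lborel" "g \<in> Lp_space 2" "AE x in lborel. f x = g x"
  shows "f \<in> Lp_space 2"
proof -
  have "(\<integral>\<^sup>+x. ennreal ((cmod (f x))\<^sup>2) \<partial>lborel) = (\<integral>\<^sup>+x. ennreal ((cmod (g x))\<^sup>2) \<partial>lborel)"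
    by (rule nn_integral_cong_AE) (use assms(3) in \<open>eventually_elim, simp\<close>)
  thus ?thesis using assms(1,2) by (simp add: Lp_space_2_iff_nn)
qed

lemma conv_kernel_l2:
  fixes f :: "real^'n \<Rightarrow> complex"
  assumes k: "bounded_symbol k C" and f: "f \<in> Lp_space 2"
  shows "conv_kernel k f \<in> Lp_space 2"
    and "abs_l2 (conv_kernel k f) = inv_fourier_l2 (mul k (fourier_l2 (abs_l2 f)))"
proof -
  have kF: "(\<lambda>\<xi>. k \<xi> * fourier f \<xi>) \<in> Lp_space 2"
    using Lp_space_2_mult[OF fourier_in_Lp[OF f]] k by (auto simp: bounded_symbol_def)
  show "conv_kernel k f \<in> Lp_space 2"
    unfolding conv_kernel_def by (rule inv_fourier_in_Lp[OF kF])
  show "abs_l2 (conv_kernel k f) = inv_fourier_l2 (mul k (fourier_l2 (abs_l2 f)))"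
    unfolding conv_kernel_def abs_inv_fourier[OF kF] abs_fourier[OF f, symmetric]
      mul_abs_l2[OF k fourier_in_Lp[OF f]] ..
qed

lemma abs_l2_sum:
  assumes "finite D" "\<And>i. i \<in> D \<Longrightarrow> f i \<in> Lp_space 2"
  shows "(\<lambda>x. \<Sum>i\<in>D. f i x) \<in> Lp_space 2 \<and> abs_l2 (\<lambda>x. \<Sum>i\<in>D. f i x) = (\<Sum>i\<in>D. abs_l2 (f i))"
  using assms
proof (induction D rule: finite_induct)
  case empty
  show ?case by (simp add: abs_l2_zero Lp_space_2_zero)
next
  case (insert i D)
  thus ?case by (auto simp: abs_l2_add intro: Lp_space_2_add)
qed

text \<open>Riemann sums commute with passing to classes, and \<open>Lp_norm 2\<close> of a
  representative is the norm of its class. The defining gauge conditions therefore coincide term by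
  term.\<close>

lemma L2_has_integral_l2:
  fixes v :: "real \<Rightarrow> 'a::euclidean_space \<Rightarrow> complex"
  assumes I: "(V has_integral w) {a..b}"
    and v: "\<And>\<tau>. \<tau> \<in> {a..b} \<Longrightarrow> v \<tau> \<in> Lp_space 2" "\<And>\<tau>. \<tau> \<in> {a..b} \<Longrightarrow> abs_l2 (v \<tau>) = V \<tau>"
  shows "L2_has_integral v (rep_l2 w) a b"
proof -
  have eq: "Lp_norm 2 (\<lambda>x. (\<Sum>(\<tau>, k)\<in>\<D>. of_real (measure lborel k) * v \<tau> x) - rep_l2 w x)
      = norm ((\<Sum>(\<tau>, k)\<in>\<D>. measure lborel k *\<^sub>R V \<tau>) - w)" if "\<D> tagged_division_of {a..b}" for \<D>
  proof -
    note div = tagged_division_ofD[OF that]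
    have \<D>: "fst i \<in> {a..b}" if "i \<in> \<D>" for i
      using div(2)[of "fst i" "snd i"] div(3)[of "fst i" "snd i"] that by (simp add: subset_iff)
    have fin: "finite \<D>" by (rule div(1))
    define f where "f i x = measure lborel (snd i) *\<^sub>R v (fst i) x" for i :: "real \<times> real set" and x
    have f: "f i \<in> Lp_space 2" "abs_l2 (f i) = measure lborel (snd i) *\<^sub>R V (fst i)" if "i \<in> \<D>" for i
      unfolding f_def[abs_def]
      by (rule Lp_space_2_scaleR[OF v(1)[OF \<D>[OF that]]], simp only: abs_l2_scaleR[OF v(1)[OF \<D>[OF that]]] v(2)[OF \<D>[OF that]])
    have sum: "(\<lambda>x. \<Sum>i\<in>\<D>. f i x) \<in> Lp_space 2" "abs_l2 (\<lambda>x. \<Sum>i\<in>\<D>. f i x) = (\<Sum>i\<in>\<D>. abs_l2 (f i))"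
      using abs_l2_sum[OF fin, of f] f(1) by auto
    have "Lp_norm 2 (\<lambda>x. (\<Sum>(\<tau>, k)\<in>\<D>. of_real (measure lborel k) * v \<tau> x) - rep_l2 w x) = Lp_norm 2 (\<lambda>x. (\<Sum>i\<in>\<D>. f i x) - rep_l2 w x)"
      by (simp add: f_def case_prod_unfold scaleR_conv_of_real)
    also have "\<dots> = norm (abs_l2 (\<lambda>x. (\<Sum>i\<in>\<D>. f i x) - rep_l2 w x))"
      by (rule norm_abs_l2[symmetric]) (intro Lp_space_2_diff sum(1) l2_fun_in)
    also have "abs_l2 (\<lambda>x. (\<Sum>i\<in>\<D>. f i x) - rep_l2 w x) = (\<Sum>i\<in>\<D>. abs_l2 (f i)) - w"
      by (simp add: abs_l2_diff[OF sum(1) l2_fun_in] sum(2))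
    also have "(\<Sum>i\<in>\<D>. abs_l2 (f i)) = (\<Sum>(\<tau>, k)\<in>\<D>. measure lborel k *\<^sub>R V \<tau>)"
      by (simp add: f(2) case_prod_unfold)
    finally show ?thesis .
  qed
  show ?thesis
    unfolding L2_has_integral_def
  proof (intro conjI allI impI ballI v(1) l2_fun_in)
    fix e :: real assume e: "e > 0"
    from I have "\<forall>e>0. \<exists>g. gauge g \<and> (\<forall>\<D>. \<D> tagged_division_of {a..b} \<and> g fine \<D> \<longrightarrow>
        norm ((\<Sum>(\<tau>, k)\<in>\<D>. measure lborel k *\<^sub>R V \<tau>) - w) < e)"
      by (simp only: has_integral_real)
    from this[rule_format, OF e] obtain g where g: "gauge g \<and> (\<forall>\<D>. \<D> tagged_division_of {a..b} \<and> g fine \<D> \<longrightarrow>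
        norm ((\<Sum>(\<tau>, k)\<in>\<D>. measure lborel k *\<^sub>R V \<tau>) - w) < e)"
      by (rule exE)
    show "\<exists>g. gauge g \<and> (\<forall>\<D>. \<D> tagged_division_of {a..b} \<and> g fine \<D> \<longrightarrow>
           Lp_norm 2 (\<lambda>x. (\<Sum>(\<tau>, k)\<in>\<D>. of_real (measure lborel k) * v \<tau> x) - rep_l2 w x) < e)"
    proof (intro exI[of _ g] conjI allI impI conjunct1[OF g])
      fix \<D> assume \<D>: "\<D> tagged_division_of {a..b} \<and> g fine \<D>"
      show "Lp_norm 2 (\<lambda>x. (\<Sum>(\<tau>, k)\<in>\<D>. of_real (measure lborel k) * v \<tau> x) - rep_l2 w x) < e"
        unfolding eq[OF conjunct1[OF \<D>]] by (rule conjunct2[OF g, rule_format, OF \<D>])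
    qed
  qed
qed

section \<open>The fixed point as a solution of Duhamel's formula\<close>

context semilinear
begin

text \<open>Describes H^\<sigma> on the Fourier side: y is the class of the Bessel weighted
  transform, and its norm is the Sobolev norm.\<close>

lemma bessel_l2:
  fixes f :: "real^'n \<Rightarrow> complex"
  assumes f: "f \<in> Lp_space 2" and y: "fourier_l2 (abs_l2 f) = mul (\<lambda>\<xi>. of_real (1 / bw \<xi>)) y"
  shows "bessel_weight \<sigma> f \<in> Lp_space 2" "H_norm \<sigma> f = norm y"
proof -
  have [measurable]: "fourier f \<in> borel_measurable lborel" by (rule Lp_space_measurable[OF fourier_in_Lp[OF f]])
  have bf: "bessel_weight \<sigma> f = (\<lambda>\<xi>. of_real (bw \<xi>) * fourier f \<xi>)"
    by (simp add: bessel_weight_def bw_def)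
  have meas: "bessel_weight \<sigma> f \<in> borel_measurable lborel" unfolding bf by measurable
  have "AE \<xi> in lborel. rep_l2 (abs_l2 (fourier f)) \<xi> = fourier f \<xi>"
    by (rule rep_abs_l2[OF fourier_in_Lp[OF f]])
  moreover have "AE \<xi> in lborel. rep_l2 (mul (\<lambda>\<xi>. of_real (1 / bw \<xi>)) y) \<xi> = of_real (1 / bw \<xi>) * rep_l2 y \<xi>"
    by (rule rep_mul[OF bounded_symbol_inverse_bw])
  ultimately have ae: "AE \<xi> in lborel. bessel_weight \<sigma> f \<xi> = rep_l2 y \<xi>"
    unfolding abs_fourier[OF f] y
  proof eventually_elim
    case (elim \<xi>)
    have "bessel_weight \<sigma> f \<xi> = of_real (bw \<xi>) * (of_real (1 / bw \<xi>) * rep_l2 y \<xi>)"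
      unfolding bf using elim by simp
    also have "\<dots> = rep_l2 y \<xi>" using bw_pos(2)[of \<xi>] by simp
    finally show ?case .
  qed
  show b: "bessel_weight \<sigma> f \<in> Lp_space 2"
    by (rule Lp_space_2_cong_AE[OF meas l2_fun_in ae])
  have "abs_l2 (bessel_weight \<sigma> f) = y"
    using abs_l2_eqI[OF b l2_fun_in ae] by simp
  thus "H_norm \<sigma> f = norm y"
    unfolding H_norm_def norm_abs_l2[OF b, symmetric] by simp
qed

lemma fourier_sol: "fourier_l2 (sol t z) = mul (\<lambda>\<xi>. of_real (1 / W t \<xi>)) ((1 + t) powr (- a) *\<^sub>R z)"
  by (simp add: sol_def)

lemma bw_W_bound:
  assumes t: "t \<ge> 0"
  shows "bounded_symbol (\<lambda>\<xi> :: real^'n. of_real (bw \<xi> / W t \<xi>)) (2 powr (\<sigma> / 2))"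
proof -
  have "bw \<xi> \<le> 2 powr (\<sigma> / 2) * W t \<xi>" for \<xi> :: "real^'n"
  proof -
    have "1 * norm \<xi> \<le> \<rho> t * norm \<xi>" by (rule mult_right_mono[OF \<rho>_ge_1[OF t]]) simp
    hence le: "norm \<xi> powr \<sigma> \<le> (\<rho> t * norm \<xi>) powr \<sigma>" using \<sigma>_pos by (intro powr_mono2) auto
    \<comment> \<open>1 + |\<xi>|^2 <= 2 r^2, while r^\<sigma> is bounded by W since \<rho> t >= 1.
      The comparison constant is therefore uniform in time.\<close>
    define r where "r = max 1 (norm \<xi>)"
    have r: "r \<ge> 1" by (simp add: r_def)
    have "1\<^sup>2 \<le> r\<^sup>2" "(norm \<xi>)\<^sup>2 \<le> r\<^sup>2" by (rule power_mono; simp add: r_def)+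
    hence "bw \<xi> \<le> (2 * r\<^sup>2) powr (\<sigma> / 2)"
      unfolding bw_def using \<sigma>_pos by (intro powr_mono2) auto
    also have "\<dots> = 2 powr (\<sigma> / 2) * r powr \<sigma>"
    proof -
      have "(r\<^sup>2) powr (\<sigma> / 2) = r powr \<sigma>"
        using powr_powr[of r 2 "\<sigma> / 2"] r by simp
      thus ?thesis by (simp add: powr_mult)
    qed
    also have "r powr \<sigma> \<le> W t \<xi>"
    proof (cases "norm \<xi> \<le> 1")
      case False thus ?thesis using le by (simp add: r_def wt_def max_def)
    qed (simp add: r_def wt_def max_def)
    finally show ?thesis by simp
  qed
  hence "cmod (of_real (bw \<xi> / W t \<xi>)) \<le> 2 powr (\<sigma> / 2)" for \<xi> :: "real^'n"
    using bw_pos(1)[of \<xi>] by (simp add: norm_divide abs_of_pos pos_divide_le_eq)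
  thus ?thesis by (simp add: bounded_symbol_def)
qed

text \<open>\<open>Y t\<close> is the Bessel weighted transform of the solution. The Sobolev norm of
  a difference of solutions is the L^2 norm of the difference of \<open>Y\<close>, so strong
  continuity of the symbols gives the claim.\<close>

lemma H_continuous_sol:
  assumes z: "continuous_on {0..T} z"
  shows "H_continuous_on {0..<T} \<sigma> (\<lambda>t. rep_l2 (sol t (z t)))"
proof -
  define Y where "Y t = mul (\<lambda>\<xi>. of_real (bw \<xi> / W t \<xi>)) ((1 + t) powr (- a) *\<^sub>R z t)" for t
  have sub: "{0..T} \<subseteq> {0..}" by auto
  have Y: "continuous_on {0..T} Y"
    unfolding Y_def
  proof (rule continuous_on_mul)
    show "bounded_symbol (\<lambda>\<xi>. of_real (bw \<xi> / W t \<xi>)) (2 powr (\<sigma> / 2))" if "t \<in> {0..T}" for t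
      using that by (intro bw_W_bound) auto
    show "AE \<xi> in lborel. continuous_on {0..T} (\<lambda>t. complex_of_real (bw \<xi> / W t \<xi>))"
      by (intro AE_I2 continuous_on_of_real continuous_on_divide continuous_on_const
          continuous_on_subset[OF continuous_W sub]) auto
  qed (intro continuous_scaled z)
  have F: "fourier_l2 (sol t (z t)) = mul (\<lambda>\<xi>. of_real (1 / bw \<xi>)) (Y t)" if "t \<ge> 0" for t
  proof -
    have "(\<lambda>\<xi>. complex_of_real (1 / bw \<xi>) * of_real (bw \<xi> / W t \<xi>)) = (\<lambda>\<xi>. of_real (1 / W t \<xi>))"
      unfolding of_real_mult[symmetric] using bw_pos(2) by (simp add: fun_eq_iff)
    thus ?thesis
      by (simp only: fourier_sol Y_def mul_mul[OF bounded_symbol_inverse_bw bw_W_bound[OF that]])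
  qed
  show ?thesis
    unfolding H_continuous_on_def
  proof (intro conjI ballI)
    fix t assume "t \<in> {0..<T}"
    hence t: "t \<ge> 0" by simp
    show "rep_l2 (sol t (z t)) \<in> H_space \<sigma>"
      unfolding H_space_def using bessel_l2(1)[OF l2_fun_in, of "sol t (z t)" "Y t"] F[OF t] by simp
  next
    fix t assume t: "t \<in> {0..<T}"
    have "(Y \<longlongrightarrow> Y t) (at t within {0..<T})"
      using continuous_on_subset[OF Y, of "{0..<T}"] t by (auto simp: continuous_on_def subset_iff)
    hence "((\<lambda>s. norm (Y s - Y t)) \<longlongrightarrow> 0) (at t within {0..<T})"
      by (intro tendsto_norm_zero LIM_zero)
    moreover have "\<forall>\<^sub>F s in at t within {0..<T}. norm (Y s - Y t) = H_norm \<sigma> (\<lambda>x. rep_l2 (sol s (z s)) x - rep_l2 (sol t (z t)) x)"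
      unfolding eventually_at_filter
    proof (intro always_eventually allI impI)
      fix s assume s: "s \<in> {0..<T}"
      have "fourier_l2 (abs_l2 (\<lambda>x. rep_l2 (sol s (z s)) x - rep_l2 (sol t (z t)) x)) = mul (\<lambda>\<xi>. of_real (1 / bw \<xi>)) (Y s - Y t)"
        using s t by (simp add: abs_l2_diff F fop_diff mul_diff[OF bounded_symbol_inverse_bw, simplified])
      thus "norm (Y s - Y t) = H_norm \<sigma> (\<lambda>x. rep_l2 (sol s (z s)) x - rep_l2 (sol t (z t)) x)"
        by (intro bessel_l2(2)[symmetric] Lp_space_2_diff l2_fun_in)
    qed
    ultimately show "((\<lambda>s. H_norm \<sigma> (\<lambda>x. rep_l2 (sol s (z s)) x - rep_l2 (sol t (z t)) x)) \<longlongrightarrow> 0) (at t within {0..<T})"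
      by (rule Lim_transform_eventually)
  qed
qed

lemma unweight: "complex_of_real (1 / W t \<xi>) * (of_real (W t \<xi>) * k) = k"
  by (simp add: mult.assoc[symmetric] del: of_real_divide flip: of_real_mult)

lemma unweight_lin:
  assumes t: "t \<ge> 0"
  shows "mul (\<lambda>\<xi>. of_real (1 / W t \<xi>)) (lin t)
    = mul (K0 t) (fourier_l2 (abs_l2 u0)) + mul (K1 t) (fourier_l2 (abs_l2 u1))"
proof -
  obtain C where C: "\<And>s t. 0 \<le> s \<Longrightarrow> 0 \<le> t \<Longrightarrow>
    bounded_symbol (\<lambda>\<xi>. of_real (W t \<xi>) * K1 s \<xi>) (s + C * (1 + t) powr (\<sigma> / \<mu>) * (1 + s) powr (- \<theta>))"
  proof -
    show thesis by (rule W_K1_symbol[OF that])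
  qed
  have e0: "mul (\<lambda>\<xi>. of_real (1 / W t \<xi>)) (mul (K0b t) z0) = mul (K0 t) (fourier_l2 (abs_l2 u0))"
    by (simp only: fourier_u0 mul_mul[OF bounded_symbol_inverse_wt K0b_symbol[OF t]]
        mul_mul[OF K0_symbol[OF t] bounded_symbol_inverse_bw] K0b_def mult.assoc unweight)
  have e1: "mul (\<lambda>\<xi>. of_real (1 / W t \<xi>)) (mul (\<lambda>\<xi>. of_real (W t \<xi>) * K1 t \<xi>) (fourier_l2 (abs_l2 u1)))
      = mul (K1 t) (fourier_l2 (abs_l2 u1))"
    by (simp only: mul_mul[OF bounded_symbol_inverse_wt C[OF t t]] unweight)
  show ?thesis
    by (simp only: lin_def mul_add[OF bounded_symbol_inverse_wt] e0 e1)
qed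

lemma unweight_G:
  assumes "\<tau> \<in> {0..t}"
  shows "mul (\<lambda>\<xi>. of_real (1 / W t \<xi>)) (G t \<tau> f) = mul (K1 (t - \<tau>)) (fourier_l2 f)"
proof -
  have t: "t \<ge> 0" "max 0 (t - \<tau>) = t - \<tau>" using assms by auto
  obtain E where E: "bounded_symbol (\<lambda>\<xi>. of_real (W t \<xi>) * K1 (max 0 (t - \<tau>)) \<xi>) E"
    using t(1) by (rule G_symbol)
  show ?thesis
    by (simp only: G_def mul_mul[OF bounded_symbol_inverse_wt E] unweight) (simp only: t(2))
qed

text \<open>Removing the weight and inverting the Fourier transform is a bounded linear operation,
  hence commutes with the integral in time. It turns each \<open>G t \<tau>\<close> into convolution
  with \<open>K1\<close> at time t - \<tau>.\<close>

lemma duhamel_solution_sol: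
  assumes z: "continuous_on {0..T} z"
    and eq: "\<forall>t\<in>{0..T}. z t = \<epsilon> *\<^sub>R ((1 + t) powr a *\<^sub>R lin t) + duh T z t"
  shows "duhamel_solution \<sigma> \<sigma>1 \<sigma>2 p u0 u1 \<epsilon> T (\<lambda>t. rep_l2 (sol t (z t)))"
  unfolding duhamel_solution_def
proof (intro conjI ballI)
  show "H_continuous_on {0..<T} \<sigma> (\<lambda>t. rep_l2 (sol t (z t)))"
    by (rule H_continuous_sol[OF z])
  show "abs_power p (rep_l2 (sol t (z t))) \<in> Lp_space 2" if "t \<in> {0..<T}" for t
    using that by (intro nl_in_Lp) auto
  fix t assume "t \<in> {0..<T}"
  hence t: "t \<in> {0..T}" and t0: "t \<ge> 0" by auto
  define h where "h v = inv_fourier_l2 (mul (\<lambda>\<xi>. of_real (1 / W t \<xi>)) v)" for v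
  have h: "bounded_linear h"
    unfolding h_def
    using bounded_linear_compose[OF bounded_linear_fop[OF abs_one] bounded_linear_mul[OF bounded_symbol_inverse_wt]]
    by (simp add: o_def)
  define J where "J = integral {0..t} (\<lambda>\<tau>. G t \<tau> (nl \<tau> (z \<tau>)))"
  define w where "w = rep_l2 (h J)"
  have "continuous_on {0..t} (\<lambda>\<tau>. G t \<tau> (nl \<tau> (z \<tau>)))"
    by (rule continuous_on_subset[OF continuous_G_snd[OF z t]]) (use t in auto)
  hence "((\<lambda>\<tau>. G t \<tau> (nl \<tau> (z \<tau>))) has_integral J) {0..t}"
    unfolding J_def by (intro integrable_integral integrable_continuous_real)
  hence int: "((h \<circ> (\<lambda>\<tau>. G t \<tau> (nl \<tau> (z \<tau>)))) has_integral h J) {0..t}"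
    by (rule has_integral_linear[OF _ h])
  have L2: "L2_has_integral (\<lambda>\<tau>. conv_kernel (K1 (t - \<tau>)) (abs_power p (rep_l2 (sol \<tau> (z \<tau>))))) w 0 t"
    unfolding w_def
  proof (rule L2_has_integral_l2[OF int])
    fix \<tau> assume \<tau>: "\<tau> \<in> {0..t}"
    hence s: "0 \<le> t - \<tau>" "0 \<le> \<tau>" by auto
    show "conv_kernel (K1 (t - \<tau>)) (abs_power p (rep_l2 (sol \<tau> (z \<tau>)))) \<in> Lp_space 2"
      by (rule conv_kernel_l2(1)[OF K1_symbol[OF s(1)] nl_in_Lp[OF s(2)]])
    show "abs_l2 (conv_kernel (K1 (t - \<tau>)) (abs_power p (rep_l2 (sol \<tau> (z \<tau>))))) = (h \<circ> (\<lambda>\<tau>. G t \<tau> (nl \<tau> (z \<tau>)))) \<tau>"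
      unfolding conv_kernel_l2(2)[OF K1_symbol[OF s(1)] nl_in_Lp[OF s(2)]]
      by (simp only: o_def h_def unweight_G[OF \<tau>] nl_def)
  qed
  have pa: "(1 + t) powr (- a) * (1 + t) powr a = 1"
    unfolding powr_add[symmetric] using t0 by simp
  have "(1 + t) powr (- a) *\<^sub>R z t = \<epsilon> *\<^sub>R lin t + J"
  proof -
    have "z t = \<epsilon> *\<^sub>R ((1 + t) powr a *\<^sub>R lin t) + (1 + t) powr a *\<^sub>R J"
      using eq t by (simp add: duh_def integral_G_restrict[OF z t] J_def)
    hence "(1 + t) powr (- a) *\<^sub>R z t = \<epsilon> *\<^sub>R (((1 + t) powr (- a) * (1 + t) powr a) *\<^sub>R lin t) + ((1 + t) powr (- a) * (1 + t) powr a) *\<^sub>R J"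
      by (simp add: scaleR_add_right mult_ac)
    thus ?thesis by (simp add: pa)
  qed
  hence "sol t (z t) = h (\<epsilon> *\<^sub>R lin t + J)" by (simp add: sol_def h_def)
  also have "\<dots> = \<epsilon> *\<^sub>R h (lin t) + h J"
    by (simp add: linear_add[OF bounded_linear.linear[OF h]] linear_scale[OF bounded_linear.linear[OF h]])
  also have "h (lin t) = abs_l2 (conv_kernel (K0 t) u0) + abs_l2 (conv_kernel (K1 t) u1)"
    unfolding conv_kernel_l2(2)[OF K0_symbol[OF t0] u0_2] conv_kernel_l2(2)[OF K1_symbol[OF t0] u1_2]
    by (simp only: h_def unweight_lin[OF t0] fop_add[OF abs_one])
  finally have "sol t (z t) = \<epsilon> *\<^sub>R (abs_l2 (conv_kernel (K0 t) u0) + abs_l2 (conv_kernel (K1 t) u1)) + h J" .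
  note E = this
  have "AE x in lborel. rep_l2 (sol t (z t)) x = of_real \<epsilon> * conv_kernel (K0 t) u0 x + of_real \<epsilon> * conv_kernel (K1 t) u1 x + w x"
    using rep_l2_add[of "\<epsilon> *\<^sub>R (abs_l2 (conv_kernel (K0 t) u0) + abs_l2 (conv_kernel (K1 t) u1))" "h J"]
      rep_l2_scaleR[of \<epsilon> "abs_l2 (conv_kernel (K0 t) u0) + abs_l2 (conv_kernel (K1 t) u1)"]
      rep_l2_add[of "abs_l2 (conv_kernel (K0 t) u0)" "abs_l2 (conv_kernel (K1 t) u1)"]
      rep_abs_l2[OF conv_kernel_l2(1)[OF K0_symbol[OF t0] u0_2]] rep_abs_l2[OF conv_kernel_l2(1)[OF K1_symbol[OF t0] u1_2]]
  proof eventually_elim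
    case (elim x)
    thus ?case by (simp add: E w_def scaleR_conv_of_real distrib_left)
  qed
  with L2 show "\<exists>w. L2_has_integral (\<lambda>\<tau>. conv_kernel (K1 (t - \<tau>)) (abs_power p (rep_l2 (sol \<tau> (z \<tau>))))) w 0 t \<and>
      (AE x in lborel. rep_l2 (sol t (z t)) x = of_real \<epsilon> * conv_kernel (K0 t) u0 x + of_real \<epsilon> * conv_kernel (K1 t) u1 x + w x)"
    by blast
qed

section \<open>The lifespan bound\<close>

lemma \<gamma>_eq: "\<gamma> = 1 - real CARD('n) / (2 * m * (\<sigma> - \<sigma>1)) * (p - 1) + p * \<sigma>1 / (\<sigma> - \<sigma>1)"
proof -
  define s where "s = \<sigma> - \<sigma>1"
  have "s > 0" using \<mu>_pos by (simp add: s_def \<mu>_def)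
  moreover have "\<mu> = 2 * s" by (simp add: s_def \<mu>_def)
  ultimately show ?thesis
    using m by (simp add: \<gamma>_def \<delta>_def n_def s_def[symmetric] field_simps)
qed

lemma lifespan_bound:
  "\<exists>\<epsilon>0>0. \<exists>C>0. \<forall>\<epsilon>\<in>{0<..\<epsilon>0}. ereal (\<epsilon> powr (- (p - 1) / \<gamma>)) \<le> ereal C * lifespan \<sigma> \<sigma>1 \<sigma>2 p u0 u1 \<epsilon>"
proof -
  obtain C L where C: "C > 0" and L: "L > 0" and fp:
    "\<And>\<epsilon> T. \<epsilon> > 0 \<Longrightarrow> T \<ge> 0 \<Longrightarrow> C * (1 + T) powr \<gamma> * (2 * L * \<epsilon>) powr (p - 1) \<le> 1 / 2 \<Longrightarrow>
      \<exists>z. continuous_on {0..T} z \<and> (\<forall>t\<in>{0..T}. z t = \<epsilon> *\<^sub>R ((1 + t) powr a *\<^sub>R lin t) + duh T z t)"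
  proof -
    show thesis by (rule fixed_point[OF that])
  qed
  define X where "X = 2 * C * (2 * L) powr (p - 1)"
  have X: "X > 0" using C L by (simp add: X_def)
  \<comment> \<open>With 1 + T = c \<epsilon>^(-(p-1)/\<gamma>) the smallness condition of
    \<open>fixed_point\<close> holds with equality.\<close>
  define c where "c = X powr (- 1 / \<gamma>)"
  have c: "c > 0" using X by (simp add: c_def)
  have c\<gamma>: "c powr \<gamma> = 1 / X"
    unfolding c_def powr_powr using X \<gamma>_pos by (simp add: powr_minus_divide)
  \<comment> \<open>Ensures c e >= 2 for \<epsilon> <= \<epsilon>0, so subtracting 1 below costs at
    most half; hence T > 0 and the final constant 2 / c.\<close>
  define \<epsilon>0 where "\<epsilon>0 = (c / 2) powr (\<gamma> / (p - 1))"
  have p0: "p - 1 > 0" using p by simp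
  show ?thesis
  proof (intro exI conjI ballI)
    show "\<epsilon>0 > 0" using c by (simp add: \<epsilon>0_def)
    show "2 / c > 0" using c by simp
    fix \<epsilon> assume "\<epsilon> \<in> {0<..\<epsilon>0}"
    hence \<epsilon>: "\<epsilon> > 0" "\<epsilon> \<le> \<epsilon>0" by auto
    define e where "e = \<epsilon> powr (- (p - 1) / \<gamma>)"
    have "\<epsilon> powr ((p - 1) / \<gamma>) \<le> \<epsilon>0 powr ((p - 1) / \<gamma>)"
      using \<epsilon> p0 \<gamma>_pos by (intro powr_mono2) auto
    also have "\<dots> = c / 2" using c p0 \<gamma>_pos by (simp add: \<epsilon>0_def powr_powr)
    finally have "\<epsilon> powr ((p - 1) / \<gamma>) * e \<le> c / 2 * e"
      by (rule mult_right_mono) (simp add: e_def)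
    moreover have "\<epsilon> powr ((p - 1) / \<gamma>) * e = 1"
      using \<epsilon> unfolding e_def powr_add[symmetric] by (simp flip: add_divide_distrib)
    ultimately have "1 \<le> c / 2 * e" by simp
    define T where "T = c * e - 1"
    have T: "c / 2 * e \<le> T" "T > 0" using \<open>1 \<le> c / 2 * e\<close> by (auto simp: T_def)
    have "(1 + T) powr \<gamma> = c powr \<gamma> * e powr \<gamma>" by (simp add: T_def powr_mult)
    also have "e powr \<gamma> = \<epsilon> powr (- (p - 1))" using \<gamma>_pos by (simp add: e_def powr_powr)
    finally have "C * (1 + T) powr \<gamma> * (2 * L * \<epsilon>) powr (p - 1)
       = C * (2 * L) powr (p - 1) * (1 / X) * (\<epsilon> powr (- (p - 1)) * \<epsilon> powr (p - 1))"
      unfolding c\<gamma> powr_mult by simp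
    also have "\<epsilon> powr (- (p - 1)) * \<epsilon> powr (p - 1) = 1" unfolding powr_add[symmetric] using \<epsilon> by simp
    also have "C * (2 * L) powr (p - 1) * (1 / X) * 1 = 1 / 2" using C L by (simp add: X_def)
    finally have "C * (1 + T) powr \<gamma> * (2 * L * \<epsilon>) powr (p - 1) \<le> 1 / 2" by simp
    from fp[OF \<epsilon>(1) less_imp_le[OF T(2)] this] obtain z where
      "continuous_on {0..T} z" "\<forall>t\<in>{0..T}. z t = \<epsilon> *\<^sub>R ((1 + t) powr a *\<^sub>R lin t) + duh T z t" by blast
    hence "duhamel_solution \<sigma> \<sigma>1 \<sigma>2 p u0 u1 \<epsilon> T (\<lambda>t. rep_l2 (sol t (z t)))"
      by (rule duhamel_solution_sol)
    hence "ereal T \<le> lifespan \<sigma> \<sigma>1 \<sigma>2 p u0 u1 \<epsilon>"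
      unfolding lifespan_def using T(2) by (intro Sup_upper) auto
    hence "ereal (2 / c) * ereal T \<le> ereal (2 / c) * lifespan \<sigma> \<sigma>1 \<sigma>2 p u0 u1 \<epsilon>"
      using c by (intro ereal_mult_left_mono) auto
    moreover have "e \<le> 2 / c * T" using T(1) c by (simp add: field_simps)
    hence "ereal e \<le> ereal (2 / c) * ereal T" by simp
    ultimately show "ereal (\<epsilon> powr (- (p - 1) / \<gamma>)) \<le> ereal (2 / c) * lifespan \<sigma> \<sigma>1 \<sigma>2 p u0 u1 \<epsilon>"
      unfolding e_def by (rule order_trans[rotated])
  qed
qed

end

theorem proposition3p1:
  fixes \<sigma> \<sigma>1 \<sigma>2 m p n \<gamma> :: real
    and u0 u1 :: "(real ^ 'n) \<Rightarrow> complex"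
  defines "n \<equiv> real CARD('n)"
    and "\<gamma> \<equiv> 1 - n / (2 * m * (\<sigma> - \<sigma>1)) * (p - 1) + p * \<sigma>1 / (\<sigma> - \<sigma>1)"
  assumes "\<sigma> \<ge> 1" and "0 \<le> \<sigma>1" and "\<sigma>1 < \<sigma> / 2" and "\<sigma> / 2 < \<sigma>2" and "\<sigma>2 \<le> \<sigma>"
    and "\<sigma>1 = 0 \<Longrightarrow> 1 < m \<and> m \<le> 2"
    and "\<sigma>1 > 0 \<Longrightarrow> 1 < m \<and> m < 2 * n / (n + 4 * \<sigma>1)"
    and "p > 1"
    and "(n \<le> 2 * \<sigma> \<and> 2 / m < p) \<or>
         (2 * \<sigma> < n \<and> (m = 2 \<or> n < 4 * \<sigma> / (2 - m)) \<and> 2 / m < p \<and> p \<le> n / (n - 2 * \<sigma>))"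
    and "p < 1 + 2 * m * \<sigma> / (n - 2 * m * \<sigma>1)"
    and "(u0, u1) \<in> data_space \<sigma> m"
  shows "\<exists>\<epsilon>0>0. \<exists>C>0. \<forall>\<epsilon>\<in>{0<..\<epsilon>0}.
           ereal (\<epsilon> powr (- (p - 1) / \<gamma>)) \<le> ereal C * lifespan \<sigma> \<sigma>1 \<sigma>2 p u0 u1 \<epsilon>"
proof -
  have m: "1 < m" "m \<le> 2"
  proof -
    \<comment> \<open>For \<sigma>1 > 0 the bound m <= 2 is implied by the stronger condition on
      m.\<close>
    have "2 * n / (n + 4 * \<sigma>1) \<le> 2" using assms(4) by (simp add: n_def divide_le_eq)
    thus "1 < m" "m \<le> 2" using assms(4,8,9) by (cases "\<sigma>1 = 0"; force)+
  qed
  interpret S: semilinear \<sigma> \<sigma>1 \<sigma>2 m p u0 u1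
    by unfold_locales (use assms m in \<open>auto simp: n_def\<close>)
  show ?thesis
    using S.lifespan_bound unfolding S.\<gamma>_eq assms(1,2) .
qed

end
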